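(* Let $n\geq 2$ and let $r=f/g$ with $f,g\in\mathbb{Z}[X_1,\ldots,X_n]$ coprime, $r$ non-constant and non-composite (over $\mathbb{Q}$), and $d=\deg(r)=\max(\deg f,\deg g)\geq 2$. If $p$ is a prime with $$p>\mathcal{H}=d^{3d^2-3}\Big(\binom{n+d}{n}2^d\Big)^{d^2-1}\binom{d^2-1}{\lfloor (d^2-1)/2\rfloor}\max(H(f),H(g))^{d^2-1},$$ then $\overline{f}^p$ and $\overline{g}^p$ are coprime and $\overline{r}^p=\overline{f}^p/\overline{g}^p$ is non-composite (over $\mathbb{F}_p$).
   Context: $H(h)$ is the maximum absolute value of the coefficients of $h\in\mathbb{Z}[X_1,\ldots,X_n]$, and $\overline{h}^p\in\mathbb{F}_p[X_1,\ldots,X_n]$ its reduction modulo $p$. A rational function $r$ over a field $\mathbb{L}$ is composite over $\mathbb{L}$ if $r=u(h)$ with $h\in\mathbb{L}(X_1,\ldots,X_n)$, $u\in\mathbb{L}(t)$, $\deg u\geq 2$; otherwise non-composite. *)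

theory Defs
  imports
    "HOL-Library.Poly_Mapping"
    "HOL-Computational_Algebra.Polynomial"
    "HOL-Computational_Algebra.Fraction_Field"
    "Berlekamp_Zassenhaus.Finite_Field"
begin

(* Polynomials in the variables X_0, X_1, ...: finitely supported coefficient functions on
   finitely supported exponent vectors; multiplication is convolution. *)
type_synonym 'a mpoly = "(nat \<Rightarrow>\<^sub>0 nat) \<Rightarrow>\<^sub>0 'a"

(* R[X_1, ..., X_n], the variables being numbered 0, ..., n - 1. *)
definition mpolys :: "nat \<Rightarrow> 'a::zero mpoly set" where
  "mpolys n = {f. \<forall>m\<in>Poly_Mapping.keys f. Poly_Mapping.keys m \<subseteq> {..<n}}"

(* Total degree; the zero polynomial gets degree 0. *)
definition total_degree :: "'a::zero mpoly \<Rightarrow> nat" where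
  "total_degree f =
     Max (insert 0 ((\<lambda>m. \<Sum>i\<in>Poly_Mapping.keys m. Poly_Mapping.lookup m i) ` Poly_Mapping.keys f))"

definition height :: "int mpoly \<Rightarrow> nat" where
  "height f = Max (insert 0 ((\<lambda>m. nat \<bar>Poly_Mapping.lookup f m\<bar>) ` Poly_Mapping.keys f))"

(* The image of an integer polynomial over another ring: the inclusion for 'a = rat, reduction
   modulo p for 'a = 'p mod_ring with CARD('p) = p. *)
definition of_int_mpoly :: "int mpoly \<Rightarrow> 'a::comm_ring_1 mpoly" where
  "of_int_mpoly f = Poly_Mapping.map of_int f"

(* The library constant coprime needs a division operation, which polynomial mappings do not
   have; this is its defining formula. Over a domain a divisor of a nonzero element of mpolys n
   lies in mpolys n together with its cofactor, and the units are the constant ones, so for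
   polynomials that are not both zero this is coprimality in R[X_1, ..., X_n] for every n whose
   variables suffice to write them. *)
definition mpoly_coprime :: "'a::idom mpoly \<Rightarrow> 'a mpoly \<Rightarrow> bool" where
  "mpoly_coprime f g \<longleftrightarrow> (\<forall>c. c dvd f \<longrightarrow> c dvd g \<longrightarrow> c dvd 1)"

(* L(X_1, ..., X_n) inside the fraction field of the ring of all polynomials. *)
definition ratfuns :: "nat \<Rightarrow> 'a::field mpoly fract set" where
  "ratfuns n = {Fract a b | a b. a \<in> mpolys n \<and> b \<in> mpolys n \<and> b \<noteq> 0}"

definition const_ratfun :: "'a::field \<Rightarrow> 'a mpoly fract" where
  "const_ratfun c = Fract (Poly_Mapping.single 0 c) 1"

definition subst_ratfun :: "'a::field poly \<Rightarrow> 'a mpoly fract \<Rightarrow> 'a mpoly fract" where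
  "subst_ratfun a h = poly (map_poly const_ratfun a) h"

(* r = u(h) with u = a / b in L(t) in lowest terms, so that deg u = max (deg a) (deg b). The
   condition that b(h) is nonzero says that u(h) is defined; it matters only for constant h. *)
definition composite :: "nat \<Rightarrow> 'a::field mpoly fract \<Rightarrow> bool" where
  "composite n r \<longleftrightarrow>
     (\<exists>h\<in>ratfuns n. \<exists>a b :: 'a poly.
        b \<noteq> 0 \<and> coprime a b \<and> max (degree a) (degree b) \<ge> 2 \<and>
        subst_ratfun b h \<noteq> 0 \<and> r = subst_ratfun a h / subst_ratfun b h)"

end

theory Submission
  imports Defs "Jordan_Normal_Form.Determinant" "HOL-Computational_Algebra.Formal_Power_Series"
    "HOL-Computational_Algebra.Polynomial_FPS" "HOL-Computational_Algebra.Polynomial_Factorial"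
begin

text \<open>Let \<open>j\<close> be a variable on which \<open>f / g\<close> depends. Restrict \<open>f\<close> and \<open>g\<close> to the plane
  \<open>X\<^sub>i = U\<^sub>i + V\<^sub>i x\<close> (\<open>i \<noteq> j\<close>), \<open>X\<^sub>j = y\<close> with indeterminate \<open>U\<^sub>i\<close> and \<open>V\<^sub>i\<close>, and put
  \<open>F = S f - T g\<close> with further indeterminates \<open>S\<close> and \<open>T\<close>. The condition that \<open>(A dx + B dy) / F\<close>
  is closed is a linear system in the coefficients of \<open>A\<close> and \<open>B\<close>. With \<open>A\<close>, \<open>B\<close> and \<open>x A + y B\<close>
  restricted to total degree less than \<open>d\<close> it has \<open>d\<^sup>2 - 1\<close> unknowns.

  If \<open>f\<close> and \<open>g\<close> have a common factor or \<open>f / g = u(h\<^sub>1 / h\<^sub>2)\<close> is composite, then \<open>F\<close> factors, and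
  logarithmic derivatives of the factors, respectively \<open>d(h\<^sub>2 / h\<^sub>1)\<close>, give a nonzero solution in
  every characteristic exceeding \<open>d\<close>. Over \<open>\<rat>\<close> the converse is true even after \<open>S\<close> and \<open>T\<close> are
  specialized to \<open>g(U)\<close> and \<open>f(U)\<close>: by the argument of Lueroth's theorem, \<open>f / g\<close> being non-composite
  makes \<open>f(Z) g(X) - f(X) g(Z)\<close> irreducible, and a closed form with an irreducible denominator that
  is a simple pole of degree \<open>d\<close> is zero by the degree bounds. So some maximal minor of the system is
  nonzero over \<open>\<int>\<close>. By the Leibniz formula its coefficients are at most the product of the row sums,
  hence less than \<open>p\<close>, and it remains nonzero modulo \<open>p\<close>.\<close>

subsection \<open>Evaluation of multivariate polynomials\<close>

text \<open>A rational point makes the closed-form criterion work over the ground field itself, with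
  no algebraic closure. Specializing S, T to g(U), f(U) puts the point x = 0, y = U_j on F = 0, and
  F is smooth there because the derivative of f / g in X_j is nonzero. So the curve is parametrized
  by a power series y(x), and vanishing on this series replaces components and function fields. The
  residue of a closed form along F = 0 is constant on the series, hence equal to B / F_y at the
  point. As no nonzero polynomial of degree less than d vanishes on the curve, A and B are this
  constant times F_x and F_y; Euler's relation and the bound on x A + y B then make it zero. The
  latter bound costs d + 1 of the d (d + 1) coefficients of A and B, whence d^2 - 1.

  During reduction S and T stay variables: a coefficient of F is then linear in those of f and g,
  whereas the specialized F would square their height. A row sum is at most 2 (3 d - 4) 2^d binom(n
  + d, n) H with H the larger height, and 2 (3 d - 4) <= d^3.\<close>

abbreviation mconst :: "'a::zero \<Rightarrow> 'a mpoly" where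
  "mconst c \<equiv> Poly_Mapping.single 0 c"

definition mvar :: "nat \<Rightarrow> 'a::zero_neq_one mpoly" where
  "mvar i = Poly_Mapping.single (Poly_Mapping.single i 1) 1"

definition mon :: "(nat \<Rightarrow> 'b::comm_monoid_mult) \<Rightarrow> (nat \<Rightarrow>\<^sub>0 nat) \<Rightarrow> 'b" where
  "mon \<rho> m = (\<Prod>i\<in>Poly_Mapping.keys m. \<rho> i ^ Poly_Mapping.lookup m i)"

text \<open>The coefficient map and the images of the variables are separate arguments, so that
  reduction modulo p, evaluation at points, substitutions and power series parametrizations are all
  instances.\<close>

definition mev :: "('a::zero \<Rightarrow> 'b::comm_semiring_1) \<Rightarrow> (nat \<Rightarrow> 'b) \<Rightarrow> 'a mpoly \<Rightarrow> 'b" where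
  "mev \<iota> \<rho> f = (\<Sum>m\<in>Poly_Mapping.keys f. \<iota> (Poly_Mapping.lookup f m) * mon \<rho> m)"

text \<open>Indexed by an arbitrary set of variables, because later layouts split the variables by
  parity and not by an initial segment.\<close>

definition MP :: "nat set \<Rightarrow> 'a::zero mpoly set" where
  "MP S = {f. \<forall>m\<in>Poly_Mapping.keys f. Poly_Mapping.keys m \<subseteq> S}"

lemma mpolys_eq_MP: "mpolys n = MP {..<n}"
  by (simp add: mpolys_def MP_def)

lemma mon_superset:
  assumes "finite S" "Poly_Mapping.keys m \<subseteq> S"
  shows "mon \<rho> m = (\<Prod>i\<in>S. \<rho> i ^ Poly_Mapping.lookup m i)"
  unfolding mon_def by (rule prod.mono_neutral_left) (use assms in \<open>auto simp: in_keys_iff\<close>)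

lemma mon_add: "mon \<rho> (m + m') = mon \<rho> m * mon \<rho> m'"
proof -
  let ?S = "Poly_Mapping.keys m \<union> Poly_Mapping.keys m'"
  have "mon \<rho> (m + m') = (\<Prod>i\<in>?S. \<rho> i ^ Poly_Mapping.lookup (m + m') i)"
    by (rule mon_superset) (use keys_add[of m m'] in auto)
  also have "\<dots> = mon \<rho> m * mon \<rho> m'"
    by (simp add: mon_superset[of ?S m] mon_superset[of ?S m'] lookup_add power_add prod.distrib)
  finally show ?thesis .
qed

lemma mon_0 [simp]: "mon \<rho> 0 = 1"
  by (simp add: mon_def)

lemma mon_single: "mon \<rho> (Poly_Mapping.single i k) = \<rho> i ^ k"
  by (cases "k = 0") (simp_all add: mon_def)

lemma mev_superset:
  assumes "finite S" "Poly_Mapping.keys f \<subseteq> S" "\<iota> 0 = 0"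
  shows "mev \<iota> \<rho> f = (\<Sum>m\<in>S. \<iota> (Poly_Mapping.lookup f m) * mon \<rho> m)"
  unfolding mev_def by (rule sum.mono_neutral_left) (use assms in \<open>auto simp: in_keys_iff\<close>)

lemma mev_0 [simp]: "mev \<iota> \<rho> 0 = 0"
  by (simp add: mev_def)

lemma mev_single: "\<iota> 0 = 0 \<Longrightarrow> mev \<iota> \<rho> (Poly_Mapping.single m c) = \<iota> c * mon \<rho> m"
  by (cases "c = 0") (simp_all add: mev_def)

lemma mev_add:
  fixes \<iota> :: "'a::comm_ring_1 \<Rightarrow> 'b::comm_ring_1"
  assumes "comm_ring_hom \<iota>"
  shows "mev \<iota> \<rho> (f + g) = mev \<iota> \<rho> f + mev \<iota> \<rho> g"
proof -
  interpret comm_ring_hom \<iota> by fact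
  let ?S = "Poly_Mapping.keys f \<union> Poly_Mapping.keys g"
  have "mev \<iota> \<rho> (f + g) = (\<Sum>m\<in>?S. \<iota> (Poly_Mapping.lookup (f + g) m) * mon \<rho> m)"
    by (rule mev_superset) (use keys_add[of f g] in \<open>auto simp: hom_zero\<close>)
  also have "\<dots> = mev \<iota> \<rho> f + mev \<iota> \<rho> g"
    by (simp add: mev_superset[of ?S f] mev_superset[of ?S g] lookup_add hom_distribs
        distrib_right sum.distrib)
  finally show ?thesis .
qed

lemma mpoly_sum_monomials:
  "(\<Sum>m\<in>Poly_Mapping.keys f. Poly_Mapping.single m (Poly_Mapping.lookup f m)) = f"
  by (rule poly_mapping_eqI)
    (auto simp: lookup_sum lookup_single when_def in_keys_iff if_distrib sum.delta' cong: if_cong)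

lemma mev_sum:
  fixes \<iota> :: "'a::comm_ring_1 \<Rightarrow> 'b::comm_ring_1"
  assumes "comm_ring_hom \<iota>"
  shows "mev \<iota> \<rho> (sum F I) = (\<Sum>i\<in>I. mev \<iota> \<rho> (F i))"
  by (induction I rule: infinite_finite_induct) (simp_all add: mev_add[OF assms])

lemma mpoly_mult_monomials:
  fixes f g :: "'a::comm_ring_1 mpoly"
  shows "f * g = (\<Sum>m\<in>Poly_Mapping.keys f. \<Sum>m'\<in>Poly_Mapping.keys g.
    Poly_Mapping.single (m + m') (Poly_Mapping.lookup f m * Poly_Mapping.lookup g m'))"
proof -
  have "f * g = (\<Sum>m\<in>Poly_Mapping.keys f. Poly_Mapping.single m (Poly_Mapping.lookup f m)) *
     (\<Sum>m\<in>Poly_Mapping.keys g. Poly_Mapping.single m (Poly_Mapping.lookup g m))"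
    by (simp only: mpoly_sum_monomials)
  then show ?thesis by (simp add: sum_product mult_single)
qed

lemma mev_mult:
  fixes \<iota> :: "'a::comm_ring_1 \<Rightarrow> 'b::comm_ring_1"
  assumes "comm_ring_hom \<iota>"
  shows "mev \<iota> \<rho> (f * g) = mev \<iota> \<rho> f * mev \<iota> \<rho> g"
proof -
  interpret comm_ring_hom \<iota> by fact
  show ?thesis
    unfolding mpoly_mult_monomials[of f g]
    by (simp add: mev_sum[OF assms] mev_single hom_zero hom_mult mon_add)
       (simp add: mev_def sum_product mult_ac)
qed

lemma mev_hom:
  fixes \<iota> :: "'a::comm_ring_1 \<Rightarrow> 'b::comm_ring_1"
  assumes "comm_ring_hom \<iota>"
  shows "comm_ring_hom (mev \<iota> \<rho>)"
proof -
  interpret comm_ring_hom \<iota> by fact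
  have "mev \<iota> \<rho> 1 = 1"
    using mev_single[of \<iota> \<rho> 0 1] by (simp add: hom_zero)
  then show ?thesis
    by unfold_locales (simp_all add: mev_add[OF assms] mev_mult[OF assms])
qed

lemma mev_mconst:
  fixes \<iota> :: "'a::comm_ring_1 \<Rightarrow> 'b::comm_ring_1"
  assumes "comm_ring_hom \<iota>"
  shows "mev \<iota> \<rho> (mconst c) = \<iota> c"
proof -
  interpret comm_ring_hom \<iota> by fact
  show ?thesis by (simp add: mev_single hom_zero)
qed

lemma mev_mvar:
  fixes \<iota> :: "'a::comm_ring_1 \<Rightarrow> 'b::comm_ring_1"
  assumes "comm_ring_hom \<iota>"
  shows "mev \<iota> \<rho> (mvar i) = \<rho> i"
proof -
  interpret comm_ring_hom \<iota> by fact
  show ?thesis by (simp add: mvar_def mev_single hom_zero mon_single)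
qed

lemma mconst_hom: "comm_ring_hom (mconst :: 'a::comm_ring_1 \<Rightarrow> 'a mpoly)"
  by unfold_locales (simp_all add: single_add mult_single)

lemma mon_mvar: "mon mvar m = (Poly_Mapping.single m 1 :: 'a::comm_ring_1 mpoly)"
proof -
  have pw: "(mvar i :: 'a mpoly) ^ k = Poly_Mapping.single (Poly_Mapping.single i k) 1" for i k
    by (induction k) (simp_all add: mvar_def mult_single single_add[symmetric])
  have *: "(\<Prod>i\<in>S. Poly_Mapping.single (h i) 1) = (Poly_Mapping.single (sum h S) 1 :: 'a mpoly)"
    for h :: "nat \<Rightarrow> nat \<Rightarrow>\<^sub>0 nat" and S
    by (induction S rule: infinite_finite_induct) (simp_all add: mult_single)
  have "(\<Sum>i\<in>Poly_Mapping.keys m. Poly_Mapping.single i (Poly_Mapping.lookup m i)) = m"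
    by (rule poly_mapping_eqI)
     (auto simp: lookup_sum lookup_single when_def in_keys_iff if_distrib sum.delta' cong: if_cong)
  then show ?thesis unfolding mon_def pw * by (simp only:)
qed

lemma mev_id: "mev mconst mvar f = (f :: 'a::comm_ring_1 mpoly)"
  by (simp add: mev_def mon_mvar mult_single mpoly_sum_monomials)

lemma hom_mev:
  fixes \<iota> :: "'a::comm_ring_1 \<Rightarrow> 'b::comm_ring_1" and h :: "'b \<Rightarrow> 'c::comm_ring_1"
  assumes "comm_ring_hom h"
  shows "h (mev \<iota> \<rho> f) = mev (\<lambda>c. h (\<iota> c)) (\<lambda>i. h (\<rho> i)) f"
proof -
  interpret comm_ring_hom h by fact
  show ?thesis by (simp add: mev_def mon_def hom_distribs hom_prod)
qed

lemma mev_cong: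
  assumes "f \<in> MP S" "\<And>i. i \<in> S \<Longrightarrow> \<rho> i = \<rho>' i" "\<And>c. \<iota> c = \<iota>' c"
  shows "mev \<iota> \<rho> f = mev \<iota>' \<rho>' f"
proof -
  have "\<rho> i ^ k = \<rho>' i ^ k" if "m \<in> Poly_Mapping.keys f" "i \<in> Poly_Mapping.keys m" for m i k
  proof -
    have "i \<in> S" using assms(1) that unfolding MP_def by auto
    then show ?thesis using assms(2) by simp
  qed
  then show ?thesis
    unfolding mev_def mon_def
    by (intro sum.cong refl arg_cong2[of _ _ _ _ "(*)"] prod.cong assms(3))
qed

lemma MP_UNIV [simp]: "f \<in> MP UNIV"
  by (simp add: MP_def)

lemma MP_0 [simp]: "0 \<in> MP S"
  by (simp add: MP_def)

lemma MP_mconst [simp]: "mconst c \<in> MP S"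
  by (simp add: MP_def)

lemma MP_1 [simp]: "1 \<in> MP S"
  by (simp add: MP_def)

lemma MP_mvar [simp]: "i \<in> S \<Longrightarrow> mvar i \<in> MP S"
  by (simp add: MP_def mvar_def)

lemma MP_add [simp]: "f \<in> MP S \<Longrightarrow> g \<in> MP S \<Longrightarrow> f + g \<in> MP S"
  using keys_add[of f g] by (auto simp: MP_def)

lemma MP_uminus [simp]: "f \<in> MP S \<Longrightarrow> - f \<in> MP S"
  for f :: "'a::ring_1 mpoly"
  by (auto simp: MP_def in_keys_iff)

lemma MP_diff [simp]: "f \<in> MP S \<Longrightarrow> g \<in> MP S \<Longrightarrow> f - g \<in> MP S"
  for f :: "'a::ring_1 mpoly"
  using MP_add[of f S "- g"] by simp

lemma MP_mult [simp]: "f \<in> MP S \<Longrightarrow> g \<in> MP S \<Longrightarrow> f * g \<in> MP S"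
  for f :: "'a::comm_ring_1 mpoly"
  unfolding MP_def
proof (safe)
  fix m i assume a: "\<forall>m\<in>Poly_Mapping.keys f. Poly_Mapping.keys m \<subseteq> S" "\<forall>m\<in>Poly_Mapping.keys g. Poly_Mapping.keys m \<subseteq> S"
   "m \<in> Poly_Mapping.keys (f * g)" "i \<in> Poly_Mapping.keys m"
  from a(3) keys_mult[of f g] obtain x y where "m = x + y" "x \<in> Poly_Mapping.keys f" "y \<in> Poly_Mapping.keys g" by blast
  with a keys_add[of x y] show "i \<in> S" by blast
qed

lemma MP_power [simp]: "f \<in> MP S \<Longrightarrow> f ^ k \<in> MP S"
  for f :: "'a::comm_ring_1 mpoly"
  by (induction k) auto

lemma MP_sum: "(\<And>i. i \<in> I \<Longrightarrow> F i \<in> MP S) \<Longrightarrow> sum F I \<in> MP S"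
  for F :: "_ \<Rightarrow> 'a::comm_ring_1 mpoly"
  by (induction I rule: infinite_finite_induct) auto

lemma MP_prod: "(\<And>i. i \<in> I \<Longrightarrow> F i \<in> MP S) \<Longrightarrow> prod F I \<in> MP S"
  for F :: "_ \<Rightarrow> 'a::comm_ring_1 mpoly"
  by (induction I rule: infinite_finite_induct) auto

lemma MP_mono: "f \<in> MP S \<Longrightarrow> S \<subseteq> T \<Longrightarrow> f \<in> MP T"
  by (auto simp: MP_def)

lemma MP_Int: "f \<in> MP S \<Longrightarrow> f \<in> MP T \<Longrightarrow> f \<in> MP (S \<inter> T)"
  by (auto simp: MP_def)

lemma MP_finite: "\<exists>S. finite S \<and> f \<in> MP S"
  by (rule exI[of _ "\<Union>(Poly_Mapping.keys ` Poly_Mapping.keys f)"]) (auto simp: MP_def)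

lemma MP_mev:
  fixes f :: "'a::comm_ring_1 mpoly" and \<iota> :: "'a \<Rightarrow> 'b::comm_ring_1 mpoly"
  assumes "f \<in> MP S" "\<And>i. i \<in> S \<Longrightarrow> \<rho> i \<in> MP T" "\<And>c. \<iota> c \<in> MP T"
  shows "mev \<iota> \<rho> f \<in> MP T"
  unfolding mev_def mon_def using assms
  by (intro MP_sum MP_mult MP_prod MP_power) (auto simp: MP_def[of S])

text \<open>By \<open>mev_id\<close> every polynomial is a sum of products of constants and
  variables; membership in \<open>MP S\<close> is carried along with \<open>P\<close> so that only
  variables of S are met.\<close>

lemma MP_induct [consumes 1, case_names const var add mult]:
  fixes f :: "'a::comm_ring_1 mpoly"
  assumes "f \<in> MP S"
    and const: "\<And>c. P (mconst c)" and var: "\<And>i. i \<in> S \<Longrightarrow> P (mvar i)"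
    and add: "\<And>f g. f \<in> MP S \<Longrightarrow> g \<in> MP S \<Longrightarrow> P f \<Longrightarrow> P g \<Longrightarrow> P (f + g)"
    and mult: "\<And>f g. f \<in> MP S \<Longrightarrow> g \<in> MP S \<Longrightarrow> P f \<Longrightarrow> P g \<Longrightarrow> P (f * g)"
  shows "P f"
proof -
  let ?Q = "\<lambda>f. f \<in> MP S \<and> P f"
  have c: "?Q (mconst c)" for c using const by simp
  have zo: "?Q 0" "?Q 1" using c[of 0] c[of 1] by simp_all
  have s: "?Q (sum F I)" if "\<And>i. i \<in> I \<Longrightarrow> ?Q (F i)" for F :: "(nat \<Rightarrow>\<^sub>0 nat) \<Rightarrow> 'a mpoly" and I
    using that by (induction I rule: infinite_finite_induct) (use zo add in auto)
  have p: "?Q (prod F I)" if "\<And>i. i \<in> I \<Longrightarrow> ?Q (F i)" for F :: "nat \<Rightarrow> 'a mpoly" and I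
    using that by (induction I rule: infinite_finite_induct) (use zo mult in auto)
  have pw: "?Q (f ^ k)" if "?Q f" for f k
    using that by (induction k) (use zo mult in auto)
  have "?Q (mev mconst mvar f)"
    unfolding mev_def mon_def
  proof (intro s)
    fix m assume m: "m \<in> Poly_Mapping.keys f"
    have "?Q (\<Prod>i\<in>Poly_Mapping.keys m. mvar i ^ Poly_Mapping.lookup m i)"
    proof (intro p pw)
      fix i assume "i \<in> Poly_Mapping.keys m"
      then have "i \<in> S" using m assms(1) unfolding MP_def by auto
      then show "?Q (mvar i)" using var by simp
    qed
    then show "?Q (mconst (Poly_Mapping.lookup f m) * (\<Prod>i\<in>Poly_Mapping.keys m. mvar i ^ Poly_Mapping.lookup m i))"
      using c mult by auto
  qed
  then show ?thesis by (simp add: mev_id)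
qed

text \<open>Both sides respect sums and products, so constants and variables decide. Identities
  between composed substitutions are reduced to this throughout.\<close>

lemma hom_eq_on_MP:
  fixes f :: "'a::comm_ring_1 mpoly" and h k :: "'a mpoly \<Rightarrow> 'b::comm_ring_1"
  assumes "f \<in> MP S" "comm_ring_hom h" "comm_ring_hom k"
    and "\<And>c. h (mconst c) = k (mconst c)" "\<And>i. i \<in> S \<Longrightarrow> h (mvar i) = k (mvar i)"
  shows "h f = k f"
proof -
  interpret h: comm_ring_hom h by fact
  interpret k: comm_ring_hom k by fact
  show ?thesis using assms(1)
    by (induction rule: MP_induct) (use assms(4,5) in \<open>auto simp: h.hom_add h.hom_mult k.hom_add k.hom_mult\<close>)
qed

lemma comm_ring_hom_comp:
  assumes "comm_ring_hom f" "comm_ring_hom g"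
  shows "comm_ring_hom (\<lambda>x. f (g x))"
proof -
  interpret f: comm_ring_hom f by fact
  interpret g: comm_ring_hom g by fact
  show ?thesis by unfold_locales (simp_all add: f.hom_add g.hom_add f.hom_mult g.hom_mult)
qed

lemma comm_ring_hom_id: "comm_ring_hom (\<lambda>x::'a::comm_ring_1. x)"
  by unfold_locales simp_all

lemma pCons_hom: "comm_ring_hom (\<lambda>c::'a::comm_ring_1. [:c:])"
  by unfold_locales (simp_all add: one_pCons)

lemma poly_eval_hom: "comm_ring_hom (\<lambda>p::'a::comm_ring_1 poly. poly p x)"
  by unfold_locales simp_all

lemma map_poly_hom: "comm_ring_hom h \<Longrightarrow> comm_ring_hom (map_poly h)"
proof -
  assume "comm_ring_hom h"
  then interpret map_poly_comm_ring_hom h by (simp add: map_poly_comm_ring_hom_def)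
  show ?thesis by unfold_locales
qed

text \<open>The passage to polynomials in X_t over the ring in the other variables. The coefficients
  keep the same type; that they do not involve X_t is \<open>coeff_slice_MP\<close>, and setting the
  outer variable to X_t undoes the passage.\<close>

definition slice :: "nat \<Rightarrow> 'a::comm_ring_1 mpoly \<Rightarrow> 'a mpoly poly" where
  "slice t = mev (\<lambda>c. [:mconst c:]) (\<lambda>i. if i = t then [:0, 1:] else [:mvar i:])"

lemma slice_hom: "comm_ring_hom (slice t :: 'a::comm_ring_1 mpoly \<Rightarrow> _)"
  unfolding slice_def by (rule mev_hom[OF comm_ring_hom_comp[OF pCons_hom mconst_hom]])

lemma slice_mconst [simp]: "slice t (mconst c) = [:mconst c:]"
  unfolding slice_def by (rule mev_mconst[OF comm_ring_hom_comp[OF pCons_hom mconst_hom]])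

lemma slice_mvar: "slice t (mvar i) = (if i = t then [:0, 1:] else [:mvar i:])"
  unfolding slice_def by (rule mev_mvar[OF comm_ring_hom_comp[OF pCons_hom mconst_hom]])

lemma poly_slice: "poly (slice t f) (mvar t) = f"
proof -
  have "poly (slice t f) (mvar t) = (\<lambda>x. x) f"
    by (rule hom_eq_on_MP[OF MP_UNIV comm_ring_hom_comp[OF poly_eval_hom slice_hom] comm_ring_hom_id])
      (simp_all add: slice_mvar)
  then show ?thesis .
qed

lemma slice_inj: "slice t f = slice t g \<longleftrightarrow> f = g"
  by (metis poly_slice)

lemma slice_free:
  assumes "f \<in> MP S" "t \<notin> S"
  shows "slice t f = [:f:]"
  by (rule hom_eq_on_MP[OF assms(1) slice_hom pCons_hom]) (use assms(2) in \<open>auto simp: slice_mvar\<close>)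

lemma coeff_slice_MP:
  assumes "f \<in> MP S"
  shows "coeff (slice t f) k \<in> MP (S - {t})"
proof -
  have "\<forall>k. coeff (slice t f) k \<in> MP (S - {t})"
    using assms
  proof (induction rule: MP_induct)
    case (const c)
    then show ?case by (auto simp: coeff_pCons split: nat.splits)
  next
    case (var i)
    then show ?case by (auto simp: slice_mvar coeff_pCons split: nat.splits)
  next
    case (add f g)
    interpret comm_ring_hom "slice t :: 'a mpoly \<Rightarrow> _" by (rule slice_hom)
    from add show ?case by (auto simp: hom_add)
  next
    case (mult f g)
    interpret comm_ring_hom "slice t :: 'a mpoly \<Rightarrow> _" by (rule slice_hom)
    from mult show ?case by (auto simp: hom_mult coeff_mult intro!: MP_sum)
  qed
  then show ?thesis by blast
qed

lemma degree_slice_0_iff: 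
  "degree (slice t f) = 0 \<longleftrightarrow> f \<in> MP (- {t})" for f :: "'a::comm_ring_1 mpoly"
proof
  assume "degree (slice t f) = 0"
  then obtain c where c: "slice t f = [:c:]" by (metis degree_eq_zeroE)
  then have "f = c" using poly_slice[of t f] by simp
  moreover have "c \<in> MP (UNIV - {t})" using coeff_slice_MP[OF MP_UNIV, of t f 0] c by simp
  ultimately show "f \<in> MP (- {t})" by (simp add: Compl_eq_Diff_UNIV)
next
  assume "f \<in> MP (- {t})"
  then show "degree (slice t f) = 0" by (simp add: slice_free)
qed

lemma MP_iff_free: "f \<in> MP S \<longleftrightarrow> (\<forall>t. t \<notin> S \<longrightarrow> f \<in> MP (- {t}))"
  unfolding MP_def by blast

text \<open>Over a domain the degrees in a variable t outside S add up, so a factor has degree 0 in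
  t as well.\<close>

lemma MP_factor:
  fixes f g :: "'a::idom mpoly"
  assumes "f * g \<in> MP S" "f * g \<noteq> 0"
  shows "f \<in> MP S"
proof (subst MP_iff_free, intro allI impI)
  fix t assume "t \<notin> S"
  interpret comm_ring_hom "slice t :: 'a mpoly \<Rightarrow> _" by (rule slice_hom)
  have "degree (slice t (f * g)) = 0"
    using slice_free[OF assms(1) \<open>t \<notin> S\<close>] by simp
  moreover have "slice t f \<noteq> 0" "slice t g \<noteq> 0"
    using assms(2) slice_inj[of t f 0] slice_inj[of t g 0] by (auto simp: hom_zero)
  ultimately have "degree (slice t f) = 0"
    by (simp add: hom_mult degree_mult_eq)
  then show "f \<in> MP (- {t})"
    by (rule degree_slice_0_iff[THEN iffD1])
qed

subsection \<open>Degrees and unique factorization\<close>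

lemma mvar_neq_0 [simp]: "mvar i \<noteq> (0 :: 'a::zero_neq_one mpoly)"
proof
  assume "mvar i = (0 :: 'a mpoly)"
  then have "Poly_Mapping.lookup (mvar i :: 'a mpoly) (Poly_Mapping.single i 1) = 0" by simp
  then show False by (simp add: mvar_def)
qed

text \<open>Multiplies each variable of S by a new outer variable: the coefficient of its k-th power
  is the component of f that is homogeneous of degree k in the variables of S. The degree is the
  joint degree in S, for \<open>S = UNIV\<close> the total degree.\<close>

definition tpol :: "nat set \<Rightarrow> 'a::comm_ring_1 mpoly \<Rightarrow> 'a mpoly poly" where
  "tpol S = mev (\<lambda>c. [:mconst c:]) (\<lambda>i. if i \<in> S then [:0, mvar i:] else [:mvar i:])"

definition sdeg :: "nat set \<Rightarrow> 'a::comm_ring_1 mpoly \<Rightarrow> nat" where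
  "sdeg S f = degree (tpol S f)"

abbreviation tdeg :: "'a::comm_ring_1 mpoly \<Rightarrow> nat" where
  "tdeg \<equiv> sdeg UNIV"

definition mdeg :: "nat set \<Rightarrow> (nat \<Rightarrow>\<^sub>0 nat) \<Rightarrow> nat" where
  "mdeg S m = (\<Sum>i\<in>Poly_Mapping.keys m \<inter> S. Poly_Mapping.lookup m i)"

lemma tpol_hom: "comm_ring_hom (tpol S :: 'a::comm_ring_1 mpoly \<Rightarrow> _)"
  unfolding tpol_def by (rule mev_hom[OF comm_ring_hom_comp[OF pCons_hom mconst_hom]])

lemma tpol_mconst [simp]: "tpol S (mconst c) = [:mconst c:]"
  unfolding tpol_def by (rule mev_mconst[OF comm_ring_hom_comp[OF pCons_hom mconst_hom]])

lemma tpol_mvar: "tpol S (mvar i) = (if i \<in> S then [:0, mvar i:] else [:mvar i:])"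
  unfolding tpol_def by (rule mev_mvar[OF comm_ring_hom_comp[OF pCons_hom mconst_hom]])

lemma poly_tpol_1: "poly (tpol S f) 1 = f"
proof -
  have "poly (tpol S f) 1 = (\<lambda>x. x) f"
    by (rule hom_eq_on_MP[OF MP_UNIV comm_ring_hom_comp[OF poly_eval_hom tpol_hom] comm_ring_hom_id])
      (simp_all add: tpol_mvar)
  then show ?thesis .
qed

lemma tpol_free:
  assumes "f \<in> MP (- S)"
  shows "tpol S f = [:f:]"
  by (rule hom_eq_on_MP[OF assms tpol_hom pCons_hom]) (auto simp: tpol_mvar)

lemma poly_tpol_0: "poly (tpol S f) 0 \<in> MP (- S)"
proof -
  have "poly (tpol S f) 0 = mev mconst (\<lambda>i. if i \<in> S then 0 else mvar i) f"
    by (rule hom_eq_on_MP[OF MP_UNIV comm_ring_hom_comp[OF poly_eval_hom tpol_hom]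
        mev_hom[OF mconst_hom]])
      (simp_all add: mev_mconst[OF mconst_hom] mev_mvar[OF mconst_hom] tpol_mvar)
  also have "\<dots> \<in> MP (- S)" by (rule MP_mev[OF MP_UNIV]) auto
  finally show ?thesis .
qed

lemma tpol_eq_0_iff [simp]: "tpol S f = 0 \<longleftrightarrow> f = 0"
proof -
  interpret comm_ring_hom "tpol S :: 'a mpoly \<Rightarrow> _" by (rule tpol_hom)
  show ?thesis by (metis poly_tpol_1 hom_zero poly_0)
qed

lemma sdeg_mult: "f \<noteq> 0 \<Longrightarrow> g \<noteq> 0 \<Longrightarrow> sdeg S (f * g) = sdeg S f + sdeg S g"
  for f g :: "'a::idom mpoly"
proof -
  interpret comm_ring_hom "tpol S :: 'a mpoly \<Rightarrow> _" by (rule tpol_hom)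
  show "f \<noteq> 0 \<Longrightarrow> g \<noteq> 0 \<Longrightarrow> sdeg S (f * g) = sdeg S f + sdeg S g"
    by (simp add: sdeg_def hom_mult degree_mult_eq)
qed

lemma sdeg_0_iff: "sdeg S f = 0 \<longleftrightarrow> f \<in> MP (- S)"
proof
  assume "sdeg S f = 0"
  then obtain c where c: "tpol S f = [:c:]" unfolding sdeg_def by (metis degree_eq_zeroE)
  then have "f = poly (tpol S f) 0" using poly_tpol_1[of S f] by simp
  then show "f \<in> MP (- S)" using poly_tpol_0[of S f] by simp
qed (auto simp: sdeg_def tpol_free)

lemma MP_empty: "MP {} = range (mconst :: 'a::comm_ring_1 \<Rightarrow> _)"
proof (intro equalityI subsetI)
  fix f :: "'a mpoly" assume f: "f \<in> MP {}"
  have "f = mev mconst mvar f" by (simp add: mev_id)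
  also have "\<dots> = mev mconst (\<lambda>i. mconst 0) f" by (rule mev_cong[OF f]) auto
  also have "\<dots> = mconst (mev (\<lambda>c. c) (\<lambda>i. 0) f)" by (rule hom_mev[OF mconst_hom, symmetric])
  finally show "f \<in> range mconst" by (metis rangeI)
qed auto

lemma tdeg_0_iff: "tdeg f = 0 \<longleftrightarrow> f \<in> range mconst"
  by (simp add: sdeg_0_iff MP_empty)

lemma coeff_mult_sum_bound:
  fixes p q :: "'a::comm_ring_1 poly"
  assumes "degree p \<le> a" "degree q \<le> b"
  shows "coeff (p * q) (a + b) = coeff p a * coeff q b"
proof -
  have "coeff (p * q) (a + b) = (\<Sum>i\<le>a + b. coeff p i * coeff q (a + b - i))" by (rule coeff_mult)
  also have "\<dots> = (\<Sum>i\<le>a + b. if i = a then coeff p a * coeff q b else 0)"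
  proof (intro sum.cong refl)
    fix i assume "i \<in> {..a + b}"
    show "coeff p i * coeff q (a + b - i) = (if i = a then coeff p a * coeff q b else 0)"
    proof (cases "i = a")
      case False
      then have "coeff p i = 0 \<or> coeff q (a + b - i) = 0"
        using assms \<open>i \<in> _\<close> by (cases "i < a") (auto intro!: coeff_eq_0)
      then show ?thesis using False by auto
    qed simp
  qed
  finally show ?thesis by simp
qed

lemma mon_tpol:
  "mon (\<lambda>i. if i \<in> S then [:0, mvar i:] else [:mvar i:]) m =
     monom (Poly_Mapping.single m 1 :: 'a::comm_ring_1 mpoly) (mdeg S m)"
proof -
  have x: "[:0, a:] ^ k = monom (a ^ k) k" for a :: "'a mpoly" and k
    by (induction k) (simp_all add: monom_Suc smult_monom)
  have y: "[:a:] ^ k = monom (a ^ k) 0" for a :: "'a mpoly" and k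
    by (induction k) (simp_all add: monom_0)
  have *: "(\<Prod>i\<in>I. monom (F i) (h i)) = monom (prod F I) (sum h I)" 
    for F :: "nat \<Rightarrow> 'a mpoly" and h and I :: "nat set"
    by (induction I rule: infinite_finite_induct) (simp_all add: mult_monom)
  have "mon (\<lambda>i. if i \<in> S then [:0, mvar i:] else [:mvar i:]) m =
     (\<Prod>i\<in>Poly_Mapping.keys m. monom (mvar i ^ Poly_Mapping.lookup m i :: 'a mpoly)
       (if i \<in> S then Poly_Mapping.lookup m i else 0))"
    unfolding mon_def by (intro prod.cong refl) (simp add: x y)
  also have "\<dots> = monom (mon mvar m) (mdeg S m)"
    unfolding * mon_def mdeg_def by (simp add: sum.inter_restrict)
  finally show ?thesis by (simp add: mon_mvar)
qed

lemma tpol_altdef: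
  "tpol S f = (\<Sum>m\<in>Poly_Mapping.keys f. monom (Poly_Mapping.single m (Poly_Mapping.lookup f m)) (mdeg S m))"
  unfolding tpol_def mev_def by (intro sum.cong refl) (simp add: mon_tpol smult_monom mult_single)

lemma coeff_tpol:
  "coeff (tpol S f) k = (\<Sum>m\<in>{m \<in> Poly_Mapping.keys f. mdeg S m = k}. Poly_Mapping.single m (Poly_Mapping.lookup f m))"
  unfolding tpol_altdef coeff_sum coeff_monom by (rule sum.inter_filter[symmetric]) simp

lemma lookup_coeff_tpol:
  "Poly_Mapping.lookup (coeff (tpol S f) k) m = (if mdeg S m = k then Poly_Mapping.lookup f m else 0)"
  unfolding coeff_tpol lookup_sum lookup_single when_def
  by (auto simp: in_keys_iff if_distrib sum.delta cong: if_cong)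

lemma sdeg_le_iff: "sdeg S f \<le> d \<longleftrightarrow> (\<forall>m\<in>Poly_Mapping.keys f. mdeg S m \<le> d)"
proof
  assume d: "sdeg S f \<le> d"
  show "\<forall>m\<in>Poly_Mapping.keys f. mdeg S m \<le> d"
  proof (rule ballI, rule ccontr)
    fix m assume m: "m \<in> Poly_Mapping.keys f" "\<not> mdeg S m \<le> d"
    then have "coeff (tpol S f) (mdeg S m) = 0" using d by (intro coeff_eq_0) (simp add: sdeg_def)
    then have "Poly_Mapping.lookup f m = 0" using lookup_coeff_tpol[of S f "mdeg S m" m] by simp
    with m show False by (simp add: in_keys_iff)
  qed
next
  assume "\<forall>m\<in>Poly_Mapping.keys f. mdeg S m \<le> d"
  then show "sdeg S f \<le> d"
    unfolding sdeg_def tpol_altdef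
    by (intro degree_sum_le) (auto intro: order.trans[OF degree_monom_le])
qed

lemma hom_sum_monomials:
  fixes H :: "'a::comm_ring_1 mpoly \<Rightarrow> 'b::comm_ring_1"
  assumes "comm_ring_hom H"
  shows "H f = (\<Sum>m\<in>Poly_Mapping.keys f. H (mconst (Poly_Mapping.lookup f m)) * mon (\<lambda>i. H (mvar i)) m)"
proof -
  have "H f = mev (\<lambda>c. H (mconst c)) (\<lambda>i. H (mvar i)) f"
    using hom_mev[OF assms, of mconst mvar f] by (simp only: mev_id)
  then show ?thesis unfolding mev_def .
qed

lemma degree_mon_le:
  assumes "\<And>i. i \<in> Poly_Mapping.keys m \<Longrightarrow> degree (\<rho> i) \<le> (if i \<in> S then 1 else 0)"
  shows "degree (mon \<rho> m :: 'b::comm_ring_1 poly) \<le> mdeg S m"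
    and "coeff (mon \<rho> m) (mdeg S m) = mon (\<lambda>i. coeff (\<rho> i) (if i \<in> S then 1 else 0)) m"
proof -
  let ?e = "\<lambda>i. if i \<in> S then Poly_Mapping.lookup m i else 0"
  have pw: "degree (p ^ k) \<le> e * k \<and> coeff (p ^ k) (e * k) = coeff p e ^ k" 
    if "degree p \<le> e" for p :: "'b poly" and e k
  proof (induction k)
    case (Suc k)
    have "degree (p * p ^ k) \<le> e + e * k"
      using Suc that degree_mult_le[of p "p ^ k"] by linarith
    moreover have "coeff (p * p ^ k) (e + e * k) = coeff p e * coeff (p ^ k) (e * k)"
      using Suc that by (intro coeff_mult_sum_bound) auto
    ultimately show ?case using Suc by simp
  qed simp
  have "degree (\<Prod>i\<in>I. \<rho> i ^ Poly_Mapping.lookup m i) \<le> sum ?e I \<and>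
      coeff (\<Prod>i\<in>I. \<rho> i ^ Poly_Mapping.lookup m i) (sum ?e I) =
      (\<Prod>i\<in>I. coeff (\<rho> i) (if i \<in> S then 1 else 0) ^ Poly_Mapping.lookup m i)" if "I \<subseteq> Poly_Mapping.keys m" for I
  proof -
    have "finite I" using that by (rule finite_subset) simp
    then show ?thesis using that
    proof (induction I rule: finite_induct)
      case (insert i I)
      let ?p = "\<rho> i ^ Poly_Mapping.lookup m i" and ?q = "\<Prod>i\<in>I. \<rho> i ^ Poly_Mapping.lookup m i"
      have p: "degree ?p \<le> ?e i" "coeff ?p (?e i) = coeff (\<rho> i) (if i \<in> S then 1 else 0) ^ Poly_Mapping.lookup m i"
        using pw[of "\<rho> i" "if i \<in> S then 1 else 0" "Poly_Mapping.lookup m i"] assms[of i] insert.prems by (auto split: if_splits)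
      have q: "degree ?q \<le> sum ?e I" "coeff ?q (sum ?e I) = (\<Prod>i\<in>I. coeff (\<rho> i) (if i \<in> S then 1 else 0) ^ Poly_Mapping.lookup m i)"
        using insert by auto
      have "degree (?p * ?q) \<le> ?e i + sum ?e I"
        using p(1) q(1) degree_mult_le[of ?p ?q] by linarith
      moreover have "coeff (?p * ?q) (?e i + sum ?e I) = coeff ?p (?e i) * coeff ?q (sum ?e I)"
        using p(1) q(1) by (rule coeff_mult_sum_bound)
      ultimately show ?case using insert.hyps p(2) q(2) by simp
    qed simp
  qed
  from this[of "Poly_Mapping.keys m"]
  show "degree (mon \<rho> m) \<le> mdeg S m"
    "coeff (mon \<rho> m) (mdeg S m) = mon (\<lambda>i. coeff (\<rho> i) (if i \<in> S then 1 else 0)) m"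
    by (simp_all add: mon_def mdeg_def sum.inter_restrict)
qed

text \<open>Substitutions into polynomials in one variable under which the variables of S become at
  most linear and the others constant. Restriction to the plane and specialization at points,
  followed by \<open>tpol\<close>, are of this kind.\<close>

context
  fixes H :: "'a::comm_ring_1 mpoly \<Rightarrow> 'b::comm_ring_1 poly" and T S :: "nat set" and f :: "'a mpoly"
  assumes H: "comm_ring_hom H" and f: "f \<in> MP T"
    and c: "\<And>c. degree (H (mconst c)) = 0"
    and v: "\<And>i. i \<in> T \<Longrightarrow> degree (H (mvar i)) \<le> (if i \<in> S then 1 else 0)"
begin

lemma degree_var:
  assumes "m \<in> Poly_Mapping.keys f" "i \<in> Poly_Mapping.keys m"
  shows "degree (H (mvar i)) \<le> (if i \<in> S then 1 else 0)"
proof (rule v)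
  show "i \<in> T" using f assms unfolding MP_def by auto
qed

lemma hom_degree_le: "degree (H f) \<le> sdeg S f"
proof -
  have "degree (H (mconst (Poly_Mapping.lookup f m)) * mon (\<lambda>i. H (mvar i)) m) \<le> sdeg S f"
    if m: "m \<in> Poly_Mapping.keys f" for m
  proof -
    have "degree (mon (\<lambda>i. H (mvar i)) m) \<le> mdeg S m"
      by (rule degree_mon_le(1)) (rule degree_var[OF m])
    also have "\<dots> \<le> sdeg S f" using sdeg_le_iff[of S f "sdeg S f"] m by blast
    finally show ?thesis
      using degree_mult_le[of "H (mconst (Poly_Mapping.lookup f m))" "mon (\<lambda>i. H (mvar i)) m"] c by (metis add_0 order.trans)
  qed
  then show ?thesis unfolding hom_sum_monomials[OF H, of f] by (intro degree_sum_le) auto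
qed

text \<open>Terms of lower degree in S do not reach d, and in a term of degree d each variable
  contributes only its top coefficient. This computes leading forms of restricted
  polynomials.\<close>

lemma hom_top_coeff:
  assumes d: "sdeg S f \<le> d"
  shows "coeff (H f) d = mev (\<lambda>c. coeff (H (mconst c)) 0) (\<lambda>i. coeff (H (mvar i)) (if i \<in> S then 1 else 0))
     (coeff (tpol S f) d)"
proof -
  let ?\<iota> = "\<lambda>c. coeff (H (mconst c)) 0"
  let ?\<rho> = "\<lambda>i. coeff (H (mvar i)) (if i \<in> S then 1 else 0)"
  have i0: "?\<iota> 0 = 0"
  proof -
    interpret comm_ring_hom H by (rule H)
    show ?thesis by (simp add: hom_zero)
  qed
  have t: "coeff (H (mconst (Poly_Mapping.lookup f m)) * mon (\<lambda>i. H (mvar i)) m) d =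
      ?\<iota> (Poly_Mapping.lookup (coeff (tpol S f) d) m) * mon ?\<rho> m"
    if m: "m \<in> Poly_Mapping.keys f" for m
  proof -
    have le: "mdeg S m \<le> d" using sdeg_le_iff[of S f d] d m by blast
    have dm: "degree (mon (\<lambda>i. H (mvar i)) m) \<le> mdeg S m" "coeff (mon (\<lambda>i. H (mvar i)) m) (mdeg S m) = mon ?\<rho> m"
      by (rule degree_mon_le, rule degree_var[OF m], assumption)+
    obtain a where a: "H (mconst (Poly_Mapping.lookup f m)) = [:a:]" using c by (metis degree_eq_zeroE)
    show ?thesis
    proof (cases "mdeg S m = d")
      case True
      then show ?thesis using dm a by (simp add: lookup_coeff_tpol)
    next
      case False
      then have "coeff (mon (\<lambda>i. H (mvar i)) m) d = 0" using le dm(1) by (intro coeff_eq_0) simp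
      then show ?thesis using False a i0 by (simp add: lookup_coeff_tpol)
    qed
  qed
  have "coeff (H f) d = (\<Sum>m\<in>Poly_Mapping.keys f. ?\<iota> (Poly_Mapping.lookup (coeff (tpol S f) d) m) * mon ?\<rho> m)"
    unfolding hom_sum_monomials[OF H, of f] coeff_sum using t by (intro sum.cong refl)
  also have "\<dots> = mev ?\<iota> ?\<rho> (coeff (tpol S f) d)"
    by (rule mev_superset[symmetric]) (use i0 in \<open>auto simp: in_keys_iff lookup_coeff_tpol split: if_splits\<close>)
  finally show ?thesis .
qed

end

section \<open>Unique factorization by Gauss's lemma\<close>

lemma mconst_dvd_1: "c \<noteq> 0 \<Longrightarrow> mconst c dvd 1" for c :: "'a::field"
proof -
  assume "c \<noteq> 0"
  then have "1 = mconst c * mconst (inverse c)" by (simp add: mult_single)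
  then show ?thesis by (rule dvdI)
qed

lemma dvd_1_iff_tdeg: "f dvd 1 \<longleftrightarrow> f \<noteq> 0 \<and> tdeg f = 0" for f :: "'a::field mpoly"
proof
  assume "f dvd 1"
  then obtain g where g: "1 = f * g" by (auto elim: dvdE)
  then have "f \<noteq> 0" "g \<noteq> 0" by auto
  moreover have "tdeg (1::'a mpoly) = 0" using tdeg_0_iff[of "1::'a mpoly"] single_one by (metis rangeI)
  ultimately show "f \<noteq> 0 \<and> tdeg f = 0" using sdeg_mult[of f g] g by simp
next
  assume a: "f \<noteq> 0 \<and> tdeg f = 0"
  then obtain c where "f = mconst c" using tdeg_0_iff[of f] by auto
  with a have "c \<noteq> 0" by auto
  then show "f dvd 1" unfolding \<open>f = mconst c\<close> by (rule mconst_dvd_1)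
qed

text \<open>Primality tested only against polynomials in S. The relative form permits induction on
  the set of variables: the result for S feeds the step to one more variable.\<close>

definition rprime :: "nat set \<Rightarrow> 'a::idom mpoly \<Rightarrow> bool" where
  "rprime S p \<longleftrightarrow> p \<in> MP S \<and> p \<noteq> 0 \<and> \<not> p dvd 1 \<and>
     (\<forall>a\<in>MP S. \<forall>b\<in>MP S. p dvd a * b \<longrightarrow> p dvd a \<or> p dvd b)"

text \<open>A nonunit that is not irreducible splits into two nonunits, both of smaller total degree
  because the units are the nonzero constants.\<close>

lemma irreducible_factorization:
  fixes f :: "'a::field mpoly"
  assumes "f \<noteq> 0"
  shows "\<exists>u ps. u dvd 1 \<and> (\<forall>p\<in>set ps. irreducible p) \<and> f = u * prod_list ps"
  using assms
proof (induction "tdeg f" arbitrary: f rule: less_induct)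
  case less
  show ?case
  proof (cases "f dvd 1 \<or> irreducible f")
    case True
    then show ?thesis
    proof
      assume "f dvd 1"
      then show ?thesis by (intro exI[of _ f] exI[of _ "[]"]) simp
    next
      assume "irreducible f"
      then show ?thesis by (intro exI[of _ 1] exI[of _ "[f]"]) simp
    qed
  next
    case False
    then obtain a b where ab: "f = a * b" "\<not> a dvd 1" "\<not> b dvd 1"
      using less.prems unfolding irreducible_def by blast
    then have nz: "a \<noteq> 0" "b \<noteq> 0" using less.prems by auto
    with ab have "tdeg a < tdeg f" "tdeg b < tdeg f"
      by (auto simp: sdeg_mult dvd_1_iff_tdeg)
    with less.hyps nz obtain u ps v qs where
      "u dvd 1" "\<forall>p\<in>set ps. irreducible p" "a = u * prod_list ps"
      "v dvd 1" "\<forall>p\<in>set qs. irreducible p" "b = v * prod_list qs" by metis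
    moreover from this have "u * v dvd 1" by (metis mult_dvd_mono mult_1_left)
    ultimately show ?thesis
      by (intro exI[of _ "u * v"] exI[of _ "ps @ qs"]) (auto simp: ab(1) mult_ac)
  qed
qed

lemma dvd_iff_slice:
  fixes p a :: "'a::idom mpoly"
  assumes "p \<in> MP (- {t})"
  shows "p dvd a \<longleftrightarrow> (\<forall>k. p dvd coeff (slice t a) k)"
proof -
  interpret comm_ring_hom "slice t :: 'a mpoly \<Rightarrow> _" by (rule slice_hom)
  have s: "slice t p = [:p:]" using assms by (rule slice_free) simp
  have "p dvd a \<longleftrightarrow> [:p:] dvd slice t a"
  proof
    assume "p dvd a" then show "[:p:] dvd slice t a"
      using s by (metis hom_mult dvd_def)
  next
    assume "[:p:] dvd slice t a"
    then obtain q where "slice t a = [:p:] * q" by (auto elim: dvdE)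
    then have "poly (slice t a) (mvar t) = p * poly q (mvar t)" by simp
    then show "p dvd a" by (simp add: poly_slice)
  qed
  then show ?thesis by (simp add: const_poly_dvd_iff)
qed

text \<open>Gauss's lemma: of two polynomials in t not divisible by p take the first coefficients,
  of index i and j, not divisible by p. In the coefficient of index i + j of the product every other
  term is divisible by p.\<close>

lemma rprime_insert:
  fixes p :: "'a::idom mpoly"
  assumes p: "rprime S p" and t: "t \<notin> S"
  shows "rprime (insert t S) p"
proof -
  interpret comm_ring_hom "slice t :: 'a mpoly \<Rightarrow> _" by (rule slice_hom)
  have pS: "p \<in> MP S" using p by (simp add: rprime_def)
  have pt: "p \<in> MP (- {t})" using MP_mono[OF pS] t by auto
  have "p dvd a \<or> p dvd b" if ab: "a \<in> MP (insert t S)" "b \<in> MP (insert t S)" "p dvd a * b" for a b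
  proof (rule ccontr)
    assume "\<not> ?thesis"
    then have ex: "\<exists>k. \<not> p dvd coeff (slice t a) k" "\<exists>k. \<not> p dvd coeff (slice t b) k"
      using dvd_iff_slice[OF pt, of a] dvd_iff_slice[OF pt, of b] by auto
    define i where "i = (LEAST k. \<not> p dvd coeff (slice t a) k)"
    define j where "j = (LEAST k. \<not> p dvd coeff (slice t b) k)"
    have i: "\<not> p dvd coeff (slice t a) i" "\<And>k. k < i \<Longrightarrow> p dvd coeff (slice t a) k"
      unfolding i_def using LeastI_ex[OF ex(1)] not_less_Least by blast+
    have j: "\<not> p dvd coeff (slice t b) j" "\<And>k. k < j \<Longrightarrow> p dvd coeff (slice t b) k"
      unfolding j_def using LeastI_ex[OF ex(2)] not_less_Least by blast+
    let ?g = "\<lambda>k. coeff (slice t a) k * coeff (slice t b) (i + j - k)"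
    have "p dvd coeff (slice t (a * b)) (i + j)"
      using ab(3) dvd_iff_slice[OF pt, of "a * b"] by blast
    then have "p dvd (\<Sum>k\<le>i + j. ?g k)" by (simp add: hom_mult coeff_mult)
    moreover have "(\<Sum>k\<le>i + j. ?g k) = ?g i + (\<Sum>k\<in>{..i + j} - {i}. ?g k)"
      by (rule sum.remove) auto
    moreover have "p dvd (\<Sum>k\<in>{..i + j} - {i}. ?g k)"
    proof (rule dvd_sum)
      fix k assume "k \<in> {..i + j} - {i}"
      then have "k < i \<or> i + j - k < j" by auto
      then show "p dvd ?g k" using i(2) j(2) by (auto intro: dvd_mult dvd_mult2)
    qed
    ultimately have "p dvd ?g i" by (simp only: dvd_add_left_iff)
    then have "p dvd coeff (slice t a) i * coeff (slice t b) j" by simp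
    moreover have "coeff (slice t a) i \<in> MP S" "coeff (slice t b) j \<in> MP S"
      using coeff_slice_MP[OF ab(1), of t i] coeff_slice_MP[OF ab(2), of t j]
      unfolding Diff_insert_absorb[OF t] by simp_all
    ultimately show False using p i(1) j(1) unfolding rprime_def by blast
  qed
  then show ?thesis using p MP_mono[OF pS, of "insert t S"] by (auto simp: rprime_def)
qed

text \<open>Since the primes in a factorization of \<open>a\<close> distribute over \<open>m\<close> and \<open>w\<close>, a factor \<open>a\<close> common to
  both sides of \<open>a f = m w\<close> can be cancelled.\<close>

lemma cancel_primes:
  fixes f m w u :: "'a::field mpoly"
  assumes "\<forall>p\<in>set ps. rprime S p" "u dvd 1" "u * prod_list ps * f = m * w"
    and "m \<in> MP S" "w \<in> MP S"
  shows "\<exists>b c m2 w2. u * prod_list ps = b * c \<and> m = b * m2 \<and> w = c * w2 \<and> f = m2 * w2"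
  using assms
proof (induction ps arbitrary: m w)
  case Nil
  then have "u * f = m * w" "u dvd m" by (auto intro: dvd_trans[of u 1 m])
  then obtain m2 where "m = u * m2" by (auto elim: dvdE)
  moreover from this \<open>u * f = m * w\<close> have "f = m2 * w" using Nil.prems(2) by auto
  ultimately show ?case by (intro exI[of _ u] exI[of _ 1] exI[of _ m2] exI[of _ w]) auto
next
  case (Cons p ps)
  have p: "rprime S p" "p \<noteq> 0" using Cons.prems(1) by (auto simp: rprime_def)
  have eq: "p * (u * prod_list ps * f) = m * w" using Cons.prems(3) by (simp add: mult_ac)
  then have "p dvd m * w" by (metis dvd_triv_left)
  then consider "p dvd m" | "p dvd w" using p Cons.prems by (auto simp: rprime_def)
  then show ?case
  proof cases
    case 1
    then obtain m' where m': "m = p * m'" by (auto elim: dvdE)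
    have "u * prod_list ps * f = m' * w" using eq p(2) by (simp add: m' mult.assoc)
    moreover have "m' \<in> MP S"
    proof (cases "m' = 0")
      case False
      then show ?thesis using MP_factor[of m' p S] Cons.prems(4) m' p(2) by (simp add: mult_ac)
    qed simp
    ultimately obtain b c m2 w2 where "u * prod_list ps = b * c" "m' = b * m2" "w = c * w2" "f = m2 * w2"
      using Cons.IH[of m' w] Cons.prems by auto
    then show ?thesis
      by (intro exI[of _ "p * b"] exI[of _ c] exI[of _ m2] exI[of _ w2]) (auto simp: m' mult_ac)
  next
    case 2
    then obtain w' where w': "w = p * w'" by (auto elim: dvdE)
    have "p * (u * prod_list ps * f) = p * (m * w')" using eq w' by (simp add: mult_ac)
    then have "u * prod_list ps * f = m * w'" using p(2) by simp
    moreover have "w' \<in> MP S"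
    proof (cases "w' = 0")
      case False
      then show ?thesis using MP_factor[of w' p S] Cons.prems(5) w' p(2) by (simp add: mult_ac)
    qed simp
    ultimately obtain b c m2 w2 where "u * prod_list ps = b * c" "m = b * m2" "w' = c * w2" "f = m2 * w2"
      using Cons.IH[of m w'] Cons.prems by auto
    then show ?thesis
      by (intro exI[of _ b] exI[of _ "p * c"] exI[of _ m2] exI[of _ w2]) (auto simp: w' mult_ac)
  qed
qed

text \<open>One step of pseudo-division: multiplying q by the leading coefficient of m cancels the
  top term without fractions.\<close>

lemma slice_degree_reduce:
  fixes q m :: "'a::idom mpoly"
  assumes "m \<noteq> 0" "q \<noteq> 0" "degree (slice t m) \<le> degree (slice t q)"
  defines "r \<equiv> lead_coeff (slice t m) * q -
      lead_coeff (slice t q) * mvar t ^ (degree (slice t q) - degree (slice t m)) * m"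
  shows "r = 0 \<or> degree (slice t r) < degree (slice t q)"
proof -
  interpret comm_ring_hom "slice t :: 'a mpoly \<Rightarrow> _" by (rule slice_hom)
  let ?M = "slice t m" and ?Q = "slice t q"
  have nz: "?M \<noteq> 0" "?Q \<noteq> 0" using assms(1,2) slice_inj[of t m 0] slice_inj[of t q 0] by (auto simp: hom_zero)
  have lc: "slice t (coeff (slice t x) k) = [:coeff (slice t x) k:]" for x :: "'a mpoly" and k
    by (rule slice_free[OF coeff_slice_MP[OF MP_UNIV]]) simp
  have pw: "slice t (mvar t ^ k :: 'a mpoly) = monom 1 k" for k
    by (simp add: hom_power slice_mvar monom_altdef)
  let ?k = "degree ?Q - degree ?M"
  have r: "slice t r = smult (lead_coeff ?M) ?Q - smult (lead_coeff ?Q) (monom 1 ?k * ?M)"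
    unfolding r_def by (simp add: hom_minus hom_mult lc pw)
  have "degree (slice t r) \<le> degree ?Q"
    unfolding r by (intro degree_diff_le order.trans[OF degree_smult_le])
      (use nz assms(3) in \<open>auto simp: degree_mult_eq degree_monom_eq\<close>)
  moreover have "coeff (slice t r) (degree ?Q) = 0"
  proof -
    have "coeff (monom 1 ?k * ?M) (degree ?Q) = lead_coeff ?M"
      using assms(3) by (simp add: coeff_monom_mult)
    then show ?thesis unfolding r by simp
  qed
  ultimately have "slice t r = 0 \<or> degree (slice t r) < degree ?Q"
    using leading_coeff_0_iff[of "slice t r"] by (cases "degree (slice t r) = degree ?Q") auto
  then show ?thesis using slice_inj[of t r 0] by (simp add: hom_zero)
qed

text \<open>Euclidean division in t over the fraction field of the ring in the other variables, with
  the denominator \<open>a\<close> cleared.\<close>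

lemma slice_pseudo_division:
  fixes q m :: "'a::idom mpoly"
  assumes "m \<noteq> 0" "m \<in> MP S'" "q \<in> MP S'"
  shows "\<exists>a w r. a \<in> MP (S' - {t}) \<and> a \<noteq> 0 \<and> w \<in> MP S' \<and> r \<in> MP S' \<and> a * q = m * w + r \<and>
     (r = 0 \<or> degree (slice t r) < degree (slice t m))"
  using assms(3)
proof (induction "degree (slice t q)" arbitrary: q rule: less_induct)
  case less
  interpret comm_ring_hom "slice t :: 'a mpoly \<Rightarrow> _" by (rule slice_hom)
  show ?case
  proof (cases "q = 0 \<or> degree (slice t q) < degree (slice t m)")
    case True
    then show ?thesis using less.prems by (intro exI[of _ 1] exI[of _ 0] exI[of _ q]) auto
  next
    case False
    let ?k = "degree (slice t q) - degree (slice t m)"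
    define lm where "lm = lead_coeff (slice t m)"
    define cq where "cq = lead_coeff (slice t q) * mvar t ^ ?k"
    define q' where "q' = lm * q - cq * m"
    have red: "q' = 0 \<or> degree (slice t q') < degree (slice t q)"
      unfolding q'_def lm_def cq_def by (rule slice_degree_reduce) (use assms(1) False in auto)
    have lm: "lm \<in> MP (S' - {t})" "lm \<noteq> 0"
      using coeff_slice_MP[OF assms(2)] assms(1) slice_inj[of t m 0]
      by (auto simp: lm_def hom_zero)
    have lmS: "lm \<in> MP S'" using MP_mono[OF lm(1)] by auto
    have cq: "cq \<in> MP S'"
    proof (cases "t \<in> S'")
      case True
      then show ?thesis
        using MP_mono[OF coeff_slice_MP[OF less.prems, of t], of S'] by (auto simp: cq_def intro!: MP_mult MP_power)
    next
      case f: False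
      have "degree (slice t q) = 0" by (simp add: slice_free[OF less.prems f])
      then show ?thesis
        using MP_mono[OF coeff_slice_MP[OF less.prems, of t], of S'] by (auto simp: cq_def)
    qed
    have q': "q' \<in> MP S'" unfolding q'_def using lmS cq less.prems assms(2) by simp
    have "\<exists>a w r. a \<in> MP (S' - {t}) \<and> a \<noteq> 0 \<and> w \<in> MP S' \<and> r \<in> MP S' \<and> a * q' = m * w + r \<and>
     (r = 0 \<or> degree (slice t r) < degree (slice t m))"
      using red
    proof
      assume "q' = 0"
      then show ?thesis by (intro exI[of _ 1] exI[of _ 0] exI[of _ 0]) simp
    qed (use less.hyps q' in blast)
    then obtain a w r where a: "a \<in> MP (S' - {t})" "a \<noteq> 0" "w \<in> MP S'" "r \<in> MP S'" "a * q' = m * w + r"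
     "r = 0 \<or> degree (slice t r) < degree (slice t m)" by blast
    have "a \<in> MP S'" using MP_mono[OF a(1)] by auto
    then have "a * lm * q = m * (w + a * cq) + r" "a * lm \<in> MP (S' - {t})" "a * lm \<noteq> 0" "w + a * cq \<in> MP S'"
      using a lm cq by (auto simp: q'_def algebra_simps)
    then show ?thesis using a(4,6) by blast
  qed
qed

context
  fixes S :: "nat set" and t :: nat and f :: "'a::field mpoly"
  assumes S: "\<And>f :: 'a mpoly. f \<in> MP S \<Longrightarrow> irreducible f \<Longrightarrow> rprime S f" and t: "t \<notin> S"
    and f: "f \<in> MP (insert t S)" "irreducible f" "f \<notin> MP S"
begin

text \<open>The primes of e are free of t and remain prime when t is adjoined, so they distribute
  over m and w and can be removed; the part b taken from m is again free of t.\<close>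

lemma gauss_cancel:
  fixes e x m w :: "'a mpoly"
  assumes e: "e \<in> MP S" "e \<noteq> 0" and eq: "e * x = m * w"
    and m: "m \<in> MP (insert t S)" and w: "w \<in> MP (insert t S)"
  shows "\<exists>b c m2 w2. b \<in> MP S \<and> b \<noteq> 0 \<and> m = b * m2 \<and> w = c * w2 \<and> x = m2 * w2"
proof -
  obtain u ps where ups: "u dvd 1" "\<forall>p\<in>set ps. irreducible p" "e = u * prod_list ps"
    using irreducible_factorization[OF e(2)] by blast
  have "rprime (insert t S) p" if p: "p \<in> set ps" for p
  proof -
    have "p dvd e" using p unfolding ups(3) by (simp add: dvd_mult prod_list_dvd)
    then obtain e' where "e = p * e'" by (auto elim: dvdE)
    then have "p \<in> MP S" using MP_factor[of p e' S] e by simp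
    then show ?thesis using S p ups(2) t by (auto intro: rprime_insert)
  qed
  then obtain b c m2 w2 where "e = b * c" "m = b * m2" "w = c * w2" "x = m2 * w2"
    using cancel_primes[of ps "insert t S" u x m w] ups eq m w by auto
  moreover from this have "b \<in> MP S" "b \<noteq> 0" using MP_factor[of b c S] e by auto
  ultimately show ?thesis by blast
qed

text \<open>After cancelling e, f splits as \<open>b * f2\<close> with b free of t. Irreducibility
  makes b a unit, since a unit f2 would leave f free of t.\<close>

lemma gauss_dvd:
  fixes e h :: "'a mpoly"
  assumes e: "e \<in> MP S" "e \<noteq> 0" and "f dvd e * h" and h: "h \<in> MP (insert t S)"
  shows "f dvd h"
proof (cases "h = 0")
  case False
  obtain k where k: "e * h = f * k" using assms by (auto elim: dvdE)
  have "e \<in> MP (insert t S)" using MP_mono[OF e(1)] by auto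
  then have "f * k \<in> MP (insert t S)" unfolding k[symmetric] using h by simp
  moreover have "f * k \<noteq> 0" unfolding k[symmetric] using False e(2) by simp
  ultimately have "k \<in> MP (insert t S)"
    using MP_factor[of k f "insert t S"] by (simp add: mult.commute)
  then obtain b c f2 k2 where b: "b \<in> MP S" "f = b * f2" "k = c * k2" "h = f2 * k2"
    using gauss_cancel[OF e k f(1)] by blast
  from b(2) f(2) have "b dvd 1 \<or> f2 dvd 1" by (auto dest: irreducibleD)
  then show ?thesis
  proof
    assume "b dvd 1"
    then have "f dvd f2" unfolding b(2) by (metis dvd_refl mult_dvd_mono mult_1_left)
    then show ?thesis unfolding b(4) by simp
  next
    assume "f2 dvd 1"
    then have "f2 \<in> MP S" unfolding dvd_1_iff_tdeg tdeg_0_iff by auto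
    then have "f \<in> MP S" using b by simp
    with f(3) show ?thesis by simp
  qed
qed simp

text \<open>The argument of a principal ideal domain over the fraction field in the variables S: a
  generator m of the colon ideal of h modulo f divides f up to factors free of t, so up to such
  factors it is a unit or an associate of f.\<close>

lemma gauss_prime:
  fixes g h :: "'a mpoly"
  assumes g: "g \<in> MP (insert t S)" and h: "h \<in> MP (insert t S)" and fgh: "f dvd g * h"
  shows "f dvd g \<or> f dvd h"
proof -
  \<comment> \<open>The colon ideal of h modulo f, with the denominators c free of t.\<close>
  define J where "J = {q \<in> MP (insert t S). \<exists>c\<in>MP S. c \<noteq> 0 \<and> f dvd c * q * h}"
  have fJ: "f \<in> J" and gJ: "g \<in> J" unfolding J_def using f g fgh by (auto intro!: bexI[of _ 1])
  have f0: "f \<noteq> 0" using f(2) by auto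
  define dg where "dg q = degree (slice t q)" for q :: "'a mpoly"
  obtain m where m: "m \<in> J" "m \<noteq> 0" "\<And>q. q \<in> J \<Longrightarrow> q \<noteq> 0 \<Longrightarrow> dg m \<le> dg q"
    using ex_has_least_nat[of "\<lambda>q. q \<in> J \<and> q \<noteq> 0" f dg] fJ f0 by blast
  have mS: "m \<in> MP (insert t S)" using m(1) by (simp add: J_def)
  have div: "\<exists>a w. a \<in> MP S \<and> a \<noteq> 0 \<and> w \<in> MP (insert t S) \<and> a * q = m * w" if q: "q \<in> J" for q
  proof -
    have qS: "q \<in> MP (insert t S)" using q by (simp add: J_def)
    from slice_pseudo_division[OF m(2) mS qS, of t] t obtain a w r where
      a: "a \<in> MP S" "a \<noteq> 0" "w \<in> MP (insert t S)" "r \<in> MP (insert t S)" "a * q = m * w + r"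
      "r = 0 \<or> dg r < dg m" by (auto simp: dg_def)
    obtain c1 c2 where c: "c1 \<in> MP S" "c1 \<noteq> 0" "f dvd c1 * q * h" "c2 \<in> MP S" "c2 \<noteq> 0" "f dvd c2 * m * h"
      using q m(1) by (auto simp: J_def)
    have "c1 * c2 * r * h = (a * c2) * (c1 * q * h) - (w * c1) * (c2 * m * h)"
    proof -
      have "r = a * q - m * w" using a(5) by (simp add: algebra_simps)
      then show ?thesis by (simp only:) (simp add: algebra_simps)
    qed
    then have "f dvd c1 * c2 * r * h" using c by (simp add: dvd_diff dvd_mult)
    then have "r \<in> J" unfolding J_def using a(4) c by (auto intro!: bexI[of _ "c1 * c2"])
    then have "r = 0" using m(3)[of r] a(6) by fastforce
    then show ?thesis using a by auto
  qed
  obtain a w where a: "a \<in> MP S" "a \<noteq> 0" "w \<in> MP (insert t S)" "a * f = m * w" using div[OF fJ] by blast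
  obtain a' w' where a': "a' \<in> MP S" "a' \<noteq> 0" "a' * g = m * w'" using div[OF gJ] by blast
  obtain b c m2 w2 where b: "b \<in> MP S" "b \<noteq> 0" "m = b * m2" "w = c * w2" "f = m2 * w2"
    using gauss_cancel[OF a(1,2,4) mS a(3)] by blast
  \<comment> \<open>If m2 is a unit, m is free of t up to a unit and f divides a t-free multiple of
    h. If w2 is a unit, f divides m and hence a t-free multiple of g.\<close>
  from b(5) f(2) have "m2 dvd 1 \<or> w2 dvd 1" by (auto dest: irreducibleD)
  then show ?thesis
  proof
    assume u: "m2 dvd 1"
    obtain c where c: "c \<in> MP S" "c \<noteq> 0" "f dvd c * m * h" using m(1) by (auto simp: J_def)
    from u obtain v where v: "m2 * v = 1" by (auto elim: dvdE)
    have "f dvd v * (c * m * h)" using c(3) by (rule dvd_mult)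
    moreover have "v * (c * m * h) = c * b * h * (m2 * v)" by (simp add: b(3))
    ultimately have "f dvd c * b * h" by (simp add: v)
    moreover have "c * b \<in> MP S" "c * b \<noteq> 0" using b c by auto
    ultimately show ?thesis using gauss_dvd[of "c * b" h] h by blast
  next
    assume "w2 dvd 1"
    then have "f dvd m2" unfolding b(5) by (metis dvd_refl mult_dvd_mono mult.right_neutral)
    then have "f dvd a' * g" unfolding a'(3) b(3) by simp
    then show ?thesis using gauss_dvd[OF a'(1,2)] g by blast
  qed
qed

end

lemma irreducible_rprime:
  fixes f :: "'a::field mpoly"
  assumes "finite S" "f \<in> MP S" "irreducible f"
  shows "rprime S f"
  using assms
proof (induction S arbitrary: f rule: finite_induct)
  case empty
  obtain c where c: "f = mconst c" using empty(1) unfolding MP_empty by blast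
  have "f = 0 \<or> f dvd 1" using mconst_dvd_1[of c] unfolding c by fastforce
  then show ?case using empty(2) unfolding irreducible_def by blast
next
  case (insert t S)
  show ?case
  proof (cases "f \<in> MP S")
    case True
    then show ?thesis using insert.IH insert.prems insert.hyps rprime_insert by blast
  next
    case False
    have "f dvd g \<or> f dvd h" if "g \<in> MP (insert t S)" "h \<in> MP (insert t S)" "f dvd g * h" for g h
      using gauss_prime[OF insert.IH insert.hyps(2) insert.prems False that] .
    then show ?thesis using insert.prems by (auto simp: rprime_def irreducible_def)
  qed
qed

text \<open>The polynomials concerned use finitely many variables, so primality relative to finite S
  is enough.\<close>

theorem irreducible_imp_prime_elem_mpoly:
  fixes f :: "'a::field mpoly"
  assumes "irreducible f"
  shows "prime_elem f"
proof (rule prime_elemI)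
  show "f \<noteq> 0" "\<not> f dvd 1" using assms by (auto simp: irreducible_def)
  fix a b assume ab: "f dvd a * b"
  obtain A B C where fin: "finite A" "finite B" "finite C" and m: "f \<in> MP A" "a \<in> MP B" "b \<in> MP C"
    using MP_finite by metis
  let ?S = "A \<union> B \<union> C"
  have "f \<in> MP ?S" "a \<in> MP ?S" "b \<in> MP ?S" using m by (auto elim: MP_mono)
  then show "f dvd a \<or> f dvd b"
    using irreducible_rprime[of ?S f] fin assms ab by (auto simp: rprime_def)
qed

lemma prime_elem_mvar: "prime_elem (mvar i :: 'a::field mpoly)"
proof (rule irreducible_imp_prime_elem_mpoly)
  let ?x = "mvar i :: 'a mpoly"
  have nz: "?x \<noteq> 0" by (rule mvar_neq_0)
  then have d: "tdeg ?x = 1" by (simp add: sdeg_def tpol_mvar)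
  show "irreducible ?x"
  proof (rule irreducibleI)
    show "\<not> ?x dvd 1" by (simp add: dvd_1_iff_tdeg d)
    fix a b assume ab: "?x = a * b"
    then have "a \<noteq> 0" "b \<noteq> 0" using nz by auto
    then show "a dvd 1 \<or> b dvd 1" using ab d sdeg_mult[of a b] by (auto simp: dvd_1_iff_tdeg)
  qed (rule nz)
qed

lemma prime_factor_exists_mpoly:
  fixes f :: "'a::field mpoly"
  assumes "f \<noteq> 0" "\<not> f dvd 1"
  shows "\<exists>p. prime_elem p \<and> p dvd f"
proof -
  obtain u ps where u: "u dvd 1" "\<forall>p\<in>set ps. irreducible p" "f = u * prod_list ps"
    using irreducible_factorization[OF assms(1)] by blast
  then have "ps \<noteq> []" using assms(2) by auto
  then obtain p qs where "ps = p # qs" by (cases ps) auto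
  then have "irreducible p" "p dvd f" using u by auto
  then show ?thesis using irreducible_imp_prime_elem_mpoly by blast
qed

text \<open>Prime factors are peeled off f: each divides \<open>g * h\<close> but not g, hence
  h.\<close>

lemma coprime_dvd_mult_mpoly:
  fixes f g h :: "'a::field mpoly"
  assumes "mpoly_coprime f g" "f dvd g * h" "f \<noteq> 0"
  shows "f dvd h"
  using assms
proof (induction "tdeg f" arbitrary: f h rule: less_induct)
  case less
  show ?case
  proof (cases "f dvd 1")
    case True
    then show ?thesis by (rule dvd_trans) simp
  next
    case False
    then obtain p where p: "prime_elem p" "p dvd f" using prime_factor_exists_mpoly less.prems by blast
    then obtain f' where f': "f = p * f'" by (auto elim: dvdE)
    have p0: "p \<noteq> 0" "\<not> p dvd 1" using p by (auto simp: prime_elem_def)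
    have "\<not> p dvd g" using less.prems(1) p p0 by (auto simp: mpoly_coprime_def)
    moreover have "p dvd g * h" using p(2) less.prems(2) by (rule dvd_trans)
    ultimately have "p dvd h" using p(1) by (auto simp: prime_elem_dvd_mult_iff)
    then obtain h' where h': "h = p * h'" by (auto elim: dvdE)
    have "tdeg f' < tdeg f" using less.prems(3) p0 unfolding f' by (subst sdeg_mult) (auto simp: dvd_1_iff_tdeg)
    moreover have "mpoly_coprime f' g" using less.prems(1) unfolding mpoly_coprime_def f' by auto
    moreover have "f' dvd g * h'"
    proof -
      have "g * (p * h') = p * (g * h')" by (rule mult.left_commute)
      then show ?thesis using less.prems(2) p0(1) unfolding f' h' by (simp only: dvd_times_left_cancel_iff simp_thms)
    qed
    ultimately have "f' dvd h'" using less.hyps[of f' h'] less.prems(3) f' by (metis mult_zero_right)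
    then show ?thesis by (simp add: f' h')
  qed
qed

subsection \<open>Partial derivatives and power series roots\<close>

definition pd :: "nat \<Rightarrow> 'a::idom mpoly \<Rightarrow> 'a mpoly" where
  "pd i f = poly (pderiv (slice i f)) (mvar i)"

lemma pd_add: "pd i (f + g) = pd i f + pd i g"
proof -
  interpret comm_ring_hom "slice i :: 'a mpoly \<Rightarrow> _" by (rule slice_hom)
  show ?thesis by (simp add: pd_def hom_add pderiv_add)
qed

lemma pd_mult: "pd i (f * g) = f * pd i g + g * pd i f"
proof -
  interpret comm_ring_hom "slice i :: 'a mpoly \<Rightarrow> _" by (rule slice_hom)
  show ?thesis by (simp add: pd_def hom_mult pderiv_mult poly_slice)
qed

lemma pd_mconst [simp]: "pd i (mconst c) = 0"
  by (simp add: pd_def pderiv_pCons)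

lemma pd_free: "f \<in> MP S \<Longrightarrow> i \<notin> S \<Longrightarrow> pd i f = 0"
  by (simp add: pd_def slice_free pderiv_pCons)

lemma pd_mvar: "pd i (mvar j) = (if i = j then 1 else 0)"
  by (auto simp: pd_def slice_mvar pderiv_pCons)

lemma pd_0 [simp]: "pd i 0 = 0" and pd_1 [simp]: "pd i 1 = 0"
  using pd_mconst[of i 0] pd_mconst[of i 1] by simp_all

lemma pd_uminus: "pd i (- f) = - pd i f"
  using pd_add[of i f "- f"] by (simp add: eq_neg_iff_add_eq_0 add.commute)

lemma pd_diff: "pd i (f - g) = pd i f - pd i g"
  using pd_add[of i f "- g"] by (simp add: pd_uminus)

lemma pd_sum: "pd i (sum F I) = (\<Sum>k\<in>I. pd i (F k))"
  by (induction I rule: infinite_finite_induct) (simp_all add: pd_add)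

lemma pd_MP: 
  assumes "f \<in> MP S"
  shows "pd i f \<in> MP S"
  using assms by (induction rule: MP_induct) (auto simp: pd_add pd_mult pd_mvar)

text \<open>The leading coefficient in X_i, in degree k > 0, survives in the derivative as k times
  itself, and k is nonzero in the coefficient ring up to this degree.\<close>

lemma pd_eq_0_imp_free:
  fixes f :: "'a::idom mpoly"
  assumes "pd i f = 0" and ch: "\<And>k. 0 < k \<Longrightarrow> k \<le> degree (slice i f) \<Longrightarrow> (of_nat k :: 'a) \<noteq> 0"
  shows "f \<in> MP (- {i})"
proof -
  interpret comm_ring_hom "slice i :: 'a mpoly \<Rightarrow> _" by (rule slice_hom)
  let ?q = "pderiv (slice i f)"
  have q: "coeff ?q k \<in> MP (- {i})" for k
    using coeff_slice_MP[OF MP_UNIV, of i f "Suc k"] single_of_nat[where 'b = "nat \<Rightarrow>\<^sub>0 nat"]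
    by (simp add: coeff_pderiv Compl_eq_Diff_UNIV) 
      (metis MP_mconst MP_mult MP_add MP_mult of_nat_Suc single_of_nat)
  \<comment> \<open>The coefficients of \<open>?q\<close> do not involve X_i, so evaluating at X_i
    and slicing again returns \<open>?q\<close>.\<close>
  have "slice i (poly ?q (mvar i)) = ?q"
  proof -
    have "poly ?q (mvar i) = (\<Sum>k\<le>degree ?q. coeff ?q k * mvar i ^ k)" by (rule poly_altdef)
    then have "slice i (poly ?q (mvar i)) = (\<Sum>k\<le>degree ?q. [:coeff ?q k:] * [:0, 1:] ^ k)"
      by (simp add: hom_sum hom_mult hom_power slice_mvar slice_free[OF q])
    also have "\<dots> = ?q" by (simp add: poly_as_sum_of_monoms[symmetric] monom_altdef) (simp add: poly_as_sum_of_monoms flip: monom_altdef)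
    finally show ?thesis .
  qed
  then have q0: "?q = 0" using assms(1) unfolding pd_def by (simp add: hom_zero)
  have "degree (slice i f) = 0"
  proof (rule ccontr)
    assume d: "degree (slice i f) \<noteq> 0"
    then obtain k where k: "degree (slice i f) = Suc k" by (cases "degree (slice i f)") auto
    have "coeff ?q k = 0" using q0 by simp
    then have "of_nat (Suc k) * lead_coeff (slice i f) = 0" by (simp add: coeff_pderiv k)
    then have "(of_nat (Suc k) :: 'a mpoly) = 0" using d by (auto simp del: of_nat_Suc)
    then have "mconst (of_nat (Suc k) :: 'a) = 0" by (simp only: single_of_nat)
    then have "(of_nat (Suc k) :: 'a) = 0" by (metis lookup_single_eq lookup_zero)
    then show False using ch[of "Suc k"] k by simp
  qed
  then show ?thesis by (rule degree_slice_0_iff[THEN iffD1])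
qed

text \<open>The chain rule for a derivation \<open>D\<close> of the target ring that kills the image of the
  coefficients.\<close>

lemma chain_rule:
  fixes f :: "'a::idom mpoly" and D :: "'b::comm_ring_1 \<Rightarrow> 'b"
  assumes h: "comm_ring_hom h" and f: "f \<in> MP S" and S: "finite S"
    and D_add: "\<And>x y. D (x + y) = D x + D y" and D_mult: "\<And>x y. D (x * y) = x * D y + D x * y"
    and D_const: "\<And>c. D (h (mconst c)) = 0"
  shows "D (h f) = (\<Sum>i\<in>S. h (pd i f) * D (h (mvar i)))"
  using f
proof (induction rule: MP_induct)
  interpret comm_ring_hom h by fact
  {
    case (const c)
    then show ?case by (simp add: D_const hom_zero)
  next
    case (var i)
    have "(\<Sum>k\<in>S. h (pd k (mvar i)) * D (h (mvar k))) = (\<Sum>k\<in>S. if k = i then D (h (mvar i)) else 0)"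
      by (rule sum.cong) (auto simp: pd_mvar hom_zero hom_one)
    then show ?case using var S by simp
  next
    case (add f g)
    then show ?case by (simp add: hom_add pd_add D_add distrib_right sum.distrib)
  next
    case (mult f g)
    then show ?case
      by (simp add: hom_add hom_mult pd_mult D_mult algebra_simps sum.distrib sum_distrib_left)
  }
qed

lemma chain_rule_fps:
  fixes f :: "'a::idom mpoly" and h :: "'a mpoly \<Rightarrow> 'b::idom fps"
  assumes "comm_ring_hom h" "f \<in> MP S" "finite S" "\<And>c. fps_deriv (h (mconst c)) = 0"
  shows "fps_deriv (h f) = (\<Sum>i\<in>S. h (pd i f) * fps_deriv (h (mvar i)))"
  by (rule chain_rule[OF assms(1,2,3)]) (simp_all add: assms(4))

section \<open>Hensel lifting for power series\<close>

lemma poly_diff_dvd: "(x - y) dvd (poly p x - poly p y)" for x y :: "'a::comm_ring_1"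
proof (induction p)
  case (pCons a p)
  have "poly (pCons a p) x - poly (pCons a p) y = x * (poly p x - poly p y) + (x - y) * poly p y"
    by (simp add: algebra_simps)
  then show ?case using pCons by (metis dvd_add dvd_mult dvd_triv_left)
qed simp

lemma poly_taylor_dvd: "\<exists>r. poly p (x + e) = poly p x + e * poly (pderiv p) x + e\<^sup>2 * r"
  for x e :: "'a::idom"
proof (induction p)
  case 0
  show ?case by (intro exI[of _ 0]) simp
next
  case (pCons a p)
  then obtain r where r: "poly p (x + e) = poly p x + e * poly (pderiv p) x + e\<^sup>2 * r" by blast
  show ?case
    by (intro exI[of _ "poly (pderiv p) x + (x + e) * r"])
      (simp only: r poly_pCons pderiv_pCons poly_add, simp add: power2_eq_square algebra_simps)
qed

lemma fps_X_power_dvd_iff: "fps_X ^ k dvd f \<longleftrightarrow> (\<forall>i<k. fps_nth f i = 0)" for f :: "'a::comm_ring_1 fps"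
proof
  assume "fps_X ^ k dvd f"
  then show "\<forall>i<k. fps_nth f i = 0" by (auto simp: fps_X_power_mult_nth elim!: dvdE)
next
  assume "\<forall>i<k. fps_nth f i = 0"
  then have "f = fps_X ^ k * Abs_fps (\<lambda>i. fps_nth f (i + k))"
    by (intro fps_ext) (auto simp: fps_X_power_mult_nth)
  then show "fps_X ^ k dvd f" by (rule dvdI)
qed

text \<open>Newton iteration one coefficient at a time: the derivative at each approximation has the
  same nonzero constant term, so the next coefficient solves a linear equation.\<close>

lemma fps_hensel:
  fixes p :: "'f::field fps poly"
  assumes "fps_nth (poly p (fps_const y0)) 0 = 0" "fps_nth (poly (pderiv p) (fps_const y0)) 0 \<noteq> 0"
  shows "\<exists>y. fps_nth y 0 = y0 \<and> poly p y = 0"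
proof -
  have cong0: "fps_nth (poly q y) 0 = fps_nth (poly q (fps_const y0)) 0" if "fps_nth y 0 = y0" for q y
  proof -
    have "fps_X ^ 1 dvd y - fps_const y0" unfolding fps_X_power_dvd_iff using that by simp
    then have "fps_X ^ 1 dvd poly q y - poly q (fps_const y0)" using poly_diff_dvd dvd_trans by blast
    then show ?thesis unfolding fps_X_power_dvd_iff by simp
  qed
  define P where "P k y \<longleftrightarrow> fps_nth y 0 = y0 \<and> fps_X ^ Suc k dvd poly p y" for k y
  define Q where "Q k y z \<longleftrightarrow> fps_X ^ Suc k dvd z - y" for k :: nat and y z :: "'f fps"
  have "P 0 (fps_const y0)" unfolding P_def fps_X_power_dvd_iff using assms(1) by simp
  moreover have "\<exists>z. P (Suc k) z \<and> Q k y z" if "P k y" for k y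
  proof -
    define c where "c = fps_nth (poly (pderiv p) (fps_const y0)) 0"
    \<comment> \<open>The correction of order k + 1 changes coefficient k + 1 of the value by
      \<open>a * c\<close> and no lower one; its square has order 2 k + 2.\<close>
    define a where "a = - fps_nth (poly p y) (Suc k) / c"
    define e where "e = fps_const a * fps_X ^ Suc k"
    obtain r where r: "poly p (y + e) = poly p y + e * poly (pderiv p) y + e\<^sup>2 * r"
      using poly_taylor_dvd by blast
    have c: "fps_nth (poly (pderiv p) y) 0 = c" "c \<noteq> 0"
      using that cong0[of y "pderiv p"] assms(2) unfolding P_def c_def by blast+
    have e2: "e\<^sup>2 * r = fps_X ^ (Suc k + Suc k) * (fps_const a ^ 2 * r)"
      by (simp add: e_def power_mult_distrib power_add power2_eq_square mult_ac)
    have e1: "e * poly (pderiv p) y = fps_X ^ Suc k * (fps_const a * poly (pderiv p) y)"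
      by (simp add: e_def mult_ac)
    have "fps_nth (poly p (y + e)) i = 0" if "i < Suc (Suc k)" for i
    proof -
      have 2: "fps_nth (e\<^sup>2 * r) i = 0" unfolding e2 fps_X_power_mult_nth using that by simp
      have 1: "fps_nth (e * poly (pderiv p) y) i = (if i = Suc k then a * c else 0)"
        unfolding e1 fps_X_power_mult_nth using that c by (auto simp: less_Suc_eq)
      show ?thesis using 1 2 \<open>P k y\<close> c that unfolding r P_def fps_X_power_dvd_iff
        by (auto simp: a_def less_Suc_eq)
    qed
    then have "fps_X ^ Suc (Suc k) dvd poly p (y + e)" unfolding fps_X_power_dvd_iff by blast
    moreover have "fps_nth (y + e) 0 = y0" using that by (simp add: P_def e_def)
    moreover have "Q k y (y + e)" by (simp add: Q_def e_def)
    ultimately show ?thesis unfolding P_def by blast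
  qed
  ultimately obtain F where F: "\<And>k. P k (F k)" "\<And>k. Q k (F k) (F (Suc k))"
    using dependent_nat_choice[of P Q] by metis
  have mono: "fps_X ^ Suc k dvd F (k + m) - F k" for k m
  proof (induction m)
    case (Suc m)
    have "fps_X ^ Suc k dvd F (Suc (k + m)) - F (k + m)"
      using F(2)[of "k + m"] unfolding Q_def fps_X_power_dvd_iff by auto
    with Suc have "fps_X ^ Suc k dvd (F (Suc (k + m)) - F (k + m)) + (F (k + m) - F k)" by (rule dvd_add[rotated])
    then show ?case by simp
  qed simp
  \<comment> \<open>Coefficient k no longer changes from \<open>F k\<close> on.\<close>
  define y where "y = Abs_fps (\<lambda>k. fps_nth (F k) k)"
  have yF: "fps_X ^ Suc k dvd y - F k" for k
    unfolding fps_X_power_dvd_iff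
  proof (intro allI impI)
    fix i assume "i < Suc k"
    then have "fps_nth (F (i + (k - i)) - F i) i = 0" using mono[of i "k - i"] unfolding fps_X_power_dvd_iff by blast
    then show "fps_nth (y - F k) i = 0" using \<open>i < Suc k\<close> by (simp add: y_def)
  qed
  have "fps_nth (poly p y) k = 0" for k
  proof -
    have "fps_X ^ Suc k dvd (poly p y - poly p (F k)) + poly p (F k)"
      using yF[of k] F(1)[of k] poly_diff_dvd dvd_trans unfolding P_def by (blast intro: dvd_add)
    then show ?thesis unfolding fps_X_power_dvd_iff by simp
  qed
  then have "poly p y = 0" by (intro fps_ext) simp
  moreover have "fps_nth y 0 = y0" using F(1)[of 0] by (simp add: y_def P_def)
  ultimately show ?thesis by blast
qed

subsection \<open>The curve of constant ratio\<close>

text \<open>Power series over the fraction field are differentiated below, and a series with zero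
  derivative is constant only in characteristic 0.\<close>

instance fract :: ("{idom, ring_char_0}") ring_char_0
proof
  show "inj (of_nat :: nat \<Rightarrow> 'a fract)"
  proof (rule injI)
    fix m k assume "(of_nat m :: 'a fract) = of_nat k"
    moreover have "(of_nat k :: 'a fract) = to_fract (of_nat k)" for k
      by (induction k) simp_all
    ultimately show "m = k" by simp
  qed
qed

lemma to_fract_ring_hom: "comm_ring_hom (to_fract :: 'a::idom \<Rightarrow> 'a fract)"
  by unfold_locales simp_all

lemma fps_const_hom: "comm_ring_hom (fps_const :: 'a::comm_ring_1 \<Rightarrow> 'a fps)"
  by unfold_locales simp_all

lemma fps_nth_0_hom: "comm_ring_hom (\<lambda>f :: 'a::comm_ring_1 fps. fps_nth f 0)"
  by unfold_locales simp_all

lemma fps_of_poly_hom: "comm_ring_hom (fps_of_poly :: 'a::comm_ring_1 poly \<Rightarrow> 'a fps)"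
  by unfold_locales (simp_all add: fps_of_poly_add fps_of_poly_mult)

lemma map_poly_pCons_0: "h 0 = 0 \<Longrightarrow> map_poly h (pCons c p) = pCons (h c) (map_poly h p)"
  by (intro poly_eqI) (simp add: coeff_map_poly coeff_pCons split: nat.splits)

text \<open>Specialize all variables but t so that some coefficient in t survives, then avoid
  finitely many roots.\<close>

lemma mev_point_exists:
  fixes q :: "'k::field_char_0 mpoly"
  assumes "finite S" "q \<in> MP S" "q \<noteq> 0"
  shows "\<exists>\<theta>. mev (\<lambda>c. c) \<theta> q \<noteq> 0"
  using assms
proof (induction S arbitrary: q rule: finite_induct)
  case empty
  then obtain c where "q = mconst c" unfolding MP_empty by blast
  with empty show ?case by (auto simp: mev_mconst[OF comm_ring_hom_id])
next
  case (insert t S)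
  have "slice t q \<noteq> 0" using insert.prems(2) poly_slice[of t q] by auto
  then obtain k where k: "coeff (slice t q) k \<noteq> 0" by (metis leading_coeff_0_iff)
  have "coeff (slice t q) k \<in> MP S"
    using coeff_slice_MP[OF insert.prems(1), of t k] unfolding Diff_insert_absorb[OF insert.hyps(2)] .
  with insert.IH k obtain \<theta> where \<theta>: "mev (\<lambda>c. c) \<theta> (coeff (slice t q) k) \<noteq> 0" by blast
  let ?e = "\<lambda>\<theta>. mev (\<lambda>c::'k. c) \<theta>"
  let ?p = "map_poly (?e \<theta>) (slice t q)"
  interpret e: comm_ring_hom "?e \<theta>" by (rule mev_hom[OF comm_ring_hom_id])
  have "coeff ?p k \<noteq> 0" using \<theta> by (simp add: coeff_map_poly)
  then have "?p \<noteq> 0" by (metis coeff_0)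
  then have "finite {x. poly ?p x = 0}" by (rule poly_roots_finite)
  then obtain x where x: "poly ?p x \<noteq> 0" using ex_new_if_finite[OF infinite_UNIV_char_0] by blast
  have "?e (\<theta>(t := x)) q = poly (map_poly (?e \<theta>) (slice t q)) x"
    by (rule hom_eq_on_MP[OF MP_UNIV mev_hom[OF comm_ring_hom_id]
        comm_ring_hom_comp[OF comm_ring_hom_comp[OF poly_eval_hom map_poly_hom[OF mev_hom[OF comm_ring_hom_id]]] slice_hom]])
      (simp_all add: slice_mvar mev_mconst[OF comm_ring_hom_id] mev_mvar[OF comm_ring_hom_id] map_poly_pCons_0 e.hom_one)
  with x show ?case by metis
qed

text \<open>A / B has zero derivative by the quotient rule, so in characteristic 0 it is the
  quotient of the constant terms.\<close>

lemma fps_ratio_const: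
  fixes A B :: "'a::{field, ring_char_0} fps"
  assumes AB: "fps_deriv A * B = A * fps_deriv B" and nz: "fps_nth B 0 \<noteq> 0"
  shows "A * fps_const (fps_nth B 0) = fps_const (fps_nth A 0) * B"
proof -
  define u where "u = A * inverse B"
  have iB: "inverse B * B = 1" using nz by (rule inverse_mult_eq_1)
  then have uB: "u * B = A" by (simp add: u_def mult.assoc)
  have du: "fps_deriv u * B + u * fps_deriv B = fps_deriv A"
    using arg_cong[OF uB, of fps_deriv] by (simp add: add.commute del: fps_deriv_eq_iff)
  have "fps_deriv u * B * B + u * B * fps_deriv B = fps_deriv A * B"
    by (simp add: algebra_simps flip: du)
  then have "fps_deriv u * (B * B) = 0" using AB uB by (simp add: mult.assoc)
  moreover have "B * B \<noteq> 0" using nz by auto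
  ultimately have "fps_deriv u = 0" by simp
  then have u: "u = fps_const (fps_nth u 0)" by simp
  have "fps_nth u 0 * fps_nth B 0 = fps_nth A 0" using arg_cong[OF uB, of "\<lambda>h. fps_nth h 0"] by simp
  then have u0: "fps_const (fps_nth u 0) * fps_const (fps_nth B 0) = fps_const (fps_nth A 0)"
    by (simp only: fps_const_mult)
  have "A * fps_const (fps_nth B 0) = (fps_const (fps_nth u 0) * fps_const (fps_nth B 0)) * B"
    unfolding uB[symmetric] by (subst u) (simp add: mult_ac)
  then show ?thesis unfolding u0 .
qed

text \<open>\<open>wj\<close> is g^2 times the derivative of f / g in X_j. That it is nonzero is the
  smoothness which allows Z_j to be solved as a power series.\<close>

locale leaf_setup =
  fixes n j :: nat and f g :: "'k::field_char_0 mpoly"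
  assumes j: "j < n" and f: "f \<in> MP {..<n}" and g: "g \<in> MP {..<n}"
    and wj: "g * pd j f - f * pd j g \<noteq> 0"
begin

text \<open>b^2 times the derivative of a / b in X_i.\<close>

definition w :: "nat \<Rightarrow> 'k mpoly \<Rightarrow> 'k mpoly \<Rightarrow> 'k mpoly" where
  "w i a b = b * pd i a - a * pd i b"

text \<open>The variables are laid out as follows: \<open>2 i\<close> with \<open>i < n\<close> is the coordinate \<open>X\<^sub>i\<close> of a
  generic point, \<open>2 (n + i)\<close> the coordinate \<open>V\<^sub>i\<close> of a generic direction, \<open>2 i + 1\<close> the coordinate
  \<open>Z\<^sub>i\<close> of a moving point, and \<open>2 n + 1\<close> the parameter \<open>s\<close> of a curve. All other even
  variables are constants.\<close>

definition zj :: nat where "zj = 2 * j + 1"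

definition xs :: "'k mpoly \<Rightarrow> 'k mpoly" where
  "xs = mev mconst (\<lambda>i. mvar (2 * i))"

definition zs :: "'k mpoly \<Rightarrow> 'k mpoly" where
  "zs = mev mconst (\<lambda>i. mvar (2 * i + 1))"

text \<open>The numerator of the difference of the values of a / b at Z and at X, as in the proof of
  Lueroth's theorem.\<close>

definition Phi :: "'k mpoly \<Rightarrow> 'k mpoly \<Rightarrow> 'k mpoly" where
  "Phi a b = zs a * xs b - xs a * zs b"

abbreviation cst :: "'k mpoly \<Rightarrow> 'k mpoly fract fps" where
  "cst q \<equiv> fps_const (to_fract q)"

text \<open>The curve as a power series in s: Z_i = X_i + V_i s for i other than j, and Z_j = y. The
  coefficients lie in a fraction field in which X and V are constants.\<close>

definition ev0 :: "'k mpoly fract fps \<Rightarrow> 'k mpoly \<Rightarrow> 'k mpoly fract fps" where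
  "ev0 y = mev (\<lambda>c. cst (mconst c))
     (\<lambda>v. if even v then cst (mvar v) else if v = 2 * n + 1 then fps_X
          else if v = zj then y else cst (mvar (v - 1)) + cst (mvar (2 * n + (v - 1))) * fps_X)"

text \<open>Moves Z onto X; for polynomials without s this is the value at the base point s = 0 of
  the curve.\<close>

definition diag :: "'k mpoly \<Rightarrow> 'k mpoly" where
  "diag = mev mconst (\<lambda>v. if even v then mvar v else mvar (v - 1))"

definition Xv :: "nat set" where "Xv = {v. even v \<and> v < 2 * n}"
definition Zv :: "nat set" where "Zv = {v. odd v \<and> v < 2 * n}"

text \<open>The variables that are independent along the curve: all but \<open>Z\<^sub>j\<close> and the \<open>V\<^sub>i\<close>
  with \<open>i \<noteq> j\<close>. The curve does not involve \<open>V\<^sub>j\<close>.\<close>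

definition Tv :: "nat set" where
  "Tv = {v. even v \<and> (v < 2 * n \<or> 4 * n \<le> v \<or> v = 2 * (n + j))} \<union> {v. odd v \<and> v \<le> 2 * n + 1 \<and> v \<noteq> zj}"

lemma zj_facts [simp]: "odd zj" "zj < 2 * n" "zj \<noteq> 2 * n + 1" "zj \<noteq> Suc (2 * n)" "zj - 1 = 2 * j" "zj - Suc 0 = 2 * j"
  using j by (auto simp: zj_def)

lemma cst_hom: "comm_ring_hom (\<lambda>c. cst (mconst c))"
  by (rule comm_ring_hom_comp[OF fps_const_hom comm_ring_hom_comp[OF to_fract_ring_hom mconst_hom]])

lemma cst_hom': "comm_ring_hom cst"
  by (rule comm_ring_hom_comp[OF fps_const_hom to_fract_ring_hom])

lemma ev0_hom: "comm_ring_hom (ev0 y)"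
  unfolding ev0_def by (rule mev_hom[OF cst_hom])

lemma xs_hom: "comm_ring_hom xs" and zs_hom: "comm_ring_hom zs" and diag_hom: "comm_ring_hom diag"
  unfolding xs_def zs_def diag_def by (rule mev_hom[OF mconst_hom])+

lemma xs_simps [simp]: "xs (mconst c) = mconst c" "xs (mvar i) = mvar (2 * i)"
  and zs_simps [simp]: "zs (mconst c) = mconst c" "zs (mvar i) = mvar (2 * i + 1)"
  and diag_simps [simp]: "diag (mconst c) = mconst c" "diag (mvar v) = (if even v then mvar v else mvar (v - 1))"
  unfolding xs_def zs_def diag_def by (simp_all add: mev_mconst[OF mconst_hom] mev_mvar[OF mconst_hom])

lemma ev0_mconst [simp]: "ev0 y (mconst c) = cst (mconst c)"
  unfolding ev0_def by (rule mev_mconst[OF cst_hom])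

lemma ev0_mvar: "ev0 y (mvar v) = (if even v then cst (mvar v) else if v = 2 * n + 1 then fps_X
          else if v = zj then y else cst (mvar (v - 1)) + cst (mvar (2 * n + (v - 1))) * fps_X)"
  unfolding ev0_def by (rule mev_mvar[OF cst_hom])

lemma xs_MP: "xs a \<in> MP Xv" if "a \<in> MP {..<n}"
  unfolding xs_def by (rule MP_mev[OF that]) (auto simp: Xv_def)

lemma zs_MP: "zs a \<in> MP Zv" if "a \<in> MP {..<n}"
  unfolding zs_def by (rule MP_mev[OF that]) (auto simp: Zv_def)

lemma Phi_MP: "a \<in> MP {..<n} \<Longrightarrow> b \<in> MP {..<n} \<Longrightarrow> Phi a b \<in> MP (Xv \<union> Zv)"
  unfolding Phi_def by (intro MP_diff MP_mult) (auto intro: MP_mono[OF xs_MP] MP_mono[OF zs_MP])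

lemma ev0_even: "q \<in> MP {v. even v} \<Longrightarrow> ev0 y q = cst q"
  by (rule hom_eq_on_MP[OF _ ev0_hom cst_hom']) (auto simp: ev0_mvar)

lemma ev0_xs: "ev0 y (xs a) = cst (xs a)"
  by (rule ev0_even) (auto simp: xs_def intro: MP_mev[of a UNIV])

lemma diag_xs [simp]: "diag (xs a) = xs a" and diag_zs [simp]: "diag (zs a) = xs a"
proof -
  show "diag (xs a) = xs a"
    by (rule hom_eq_on_MP[OF MP_UNIV comm_ring_hom_comp[OF diag_hom xs_hom] xs_hom]) auto
  show "diag (zs a) = xs a"
    by (rule hom_eq_on_MP[OF MP_UNIV comm_ring_hom_comp[OF diag_hom zs_hom] xs_hom]) auto
qed

lemma unshift: "mev mconst (\<lambda>v. mvar (v div 2)) (xs a) = a" "mev mconst (\<lambda>v. mvar (v div 2)) (zs a) = a"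
proof -
  have "mev mconst (\<lambda>v. mvar (v div 2)) (xs a) = (\<lambda>x. x) a"
    by (rule hom_eq_on_MP[OF MP_UNIV comm_ring_hom_comp[OF mev_hom[OF mconst_hom] xs_hom] comm_ring_hom_id])
      (simp_all add: mev_mconst[OF mconst_hom] mev_mvar[OF mconst_hom])
  then show "mev mconst (\<lambda>v. mvar (v div 2)) (xs a) = a" .
  have "mev mconst (\<lambda>v. mvar (v div 2)) (zs a) = (\<lambda>x. x) a"
    by (rule hom_eq_on_MP[OF MP_UNIV comm_ring_hom_comp[OF mev_hom[OF mconst_hom] zs_hom] comm_ring_hom_id])
      (simp_all add: mev_mconst[OF mconst_hom] mev_mvar[OF mconst_hom])
  then show "mev mconst (\<lambda>v. mvar (v div 2)) (zs a) = a" .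
qed

lemma xs_eq_0_iff [simp]: "xs a = 0 \<longleftrightarrow> a = 0" and zs_eq_0_iff [simp]: "zs a = 0 \<longleftrightarrow> a = 0"
proof -
  show "xs a = 0 \<longleftrightarrow> a = 0" using unshift(1)[of a] by (auto simp: xs_def)
  show "zs a = 0 \<longleftrightarrow> a = 0" using unshift(2)[of a] by (auto simp: zs_def)
qed

lemma ev0_nth_0:
  assumes "q \<in> MP ({v. even v} \<union> Zv)" "fps_nth y 0 = to_fract (mvar (2 * j))"
  shows "fps_nth (ev0 y q) 0 = to_fract (diag q)"
  by (rule hom_eq_on_MP[OF assms(1) comm_ring_hom_comp[OF fps_nth_0_hom ev0_hom]
        comm_ring_hom_comp[OF to_fract_ring_hom diag_hom]])
    (auto simp: ev0_mvar assms(2) Zv_def elim!: oddE)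

lemma ev0_zj [simp]: "ev0 y (mvar zj) = y"
  by (simp add: ev0_mvar)

text \<open>The coefficients of the slice do not involve Z_j, so the series y' used for them is
  arbitrary.\<close>

lemma ev0_slice: "ev0 y q = poly (map_poly (ev0 y') (slice zj q)) y"
proof -
  interpret e: comm_ring_hom "ev0 y'" by (rule ev0_hom)
  show ?thesis
  by (rule hom_eq_on_MP[OF MP_UNIV ev0_hom comm_ring_hom_comp[OF comm_ring_hom_comp[OF poly_eval_hom
      map_poly_hom[OF ev0_hom]] slice_hom]])
    (auto simp: slice_mvar ev0_mvar map_poly_pCons_0 e.hom_zero e.hom_one)
qed

lemma pd_xs: "pd (2 * i) (xs a) = xs (pd i a)" and pd_zs: "pd (2 * i + 1) (zs a) = zs (pd i a)"
proof -
  obtain S where S: "finite S" "a \<in> MP S" using MP_finite by blast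
  have "pd (2 * i) (xs a) = (\<Sum>k\<in>insert i S. xs (pd k a) * pd (2 * i) (xs (mvar k)))"
    by (rule chain_rule[OF xs_hom MP_mono[OF S(2)]]) (auto simp: S pd_add pd_mult)
  also have "\<dots> = (\<Sum>k\<in>insert i S. if k = i then xs (pd k a) else 0)"
    by (intro sum.cong refl) (auto simp: pd_mvar)
  finally show "pd (2 * i) (xs a) = xs (pd i a)" using S by simp
  have "pd (2 * i + 1) (zs a) = (\<Sum>k\<in>insert i S. zs (pd k a) * pd (2 * i + 1) (zs (mvar k)))"
    by (rule chain_rule[OF zs_hom MP_mono[OF S(2)]]) (auto simp: S pd_add pd_mult)
  also have "\<dots> = (\<Sum>k\<in>insert i S. if k = i then zs (pd k a) else 0)"
    by (intro sum.cong refl) (auto simp: pd_mvar)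
  finally show "pd (2 * i + 1) (zs a) = zs (pd i a)" using S by simp
qed

lemma pd_xs_odd: "odd v \<Longrightarrow> pd v (xs a) = 0" and pd_zs_even: "even v \<Longrightarrow> pd v (zs a) = 0"
proof -
  have "xs a \<in> MP {v. even v}" "zs a \<in> MP {v. odd v}"
    unfolding xs_def zs_def by (rule MP_mev[OF MP_UNIV]; simp)+
  then show "odd v \<Longrightarrow> pd v (xs a) = 0" "even v \<Longrightarrow> pd v (zs a) = 0"
    by (auto intro: pd_free)
qed

lemma diag_Phi: "diag (Phi a b) = 0"
proof -
  interpret comm_ring_hom diag by (rule diag_hom)
  show ?thesis by (simp add: Phi_def hom_minus hom_mult)
qed

lemma pd_zj_Phi: "pd zj (Phi a b) = zs (pd j a) * xs b - xs a * zs (pd j b)"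
  by (simp add: Phi_def pd_diff pd_mult pd_zs[of j, folded zj_def] pd_xs_odd)

lemma diag_pd_Phi: "diag (pd zj (Phi a b)) = xs (w j a b)"
proof -
  interpret comm_ring_hom diag by (rule diag_hom)
  interpret x: comm_ring_hom xs by (rule xs_hom)
  show ?thesis unfolding pd_zj_Phi by (simp add: hom_minus hom_mult w_def x.hom_minus x.hom_mult mult.commute)
qed

text \<open>Hensel's lemma at s = 0: there Z = X, so Phi vanishes, and its derivative in Z_j is
  \<open>w j f g\<close>, nonzero by \<open>wj\<close>.\<close>

lemma curve_exists: "\<exists>y. fps_nth y 0 = to_fract (mvar (2 * j)) \<and> ev0 y (Phi f g) = 0"
proof -
  let ?y0 = "to_fract (mvar (2 * j)) :: 'k mpoly fract"
  let ?p = "map_poly (ev0 0) (slice zj (Phi f g))"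
  have sub: "MP (Xv \<union> Zv) \<subseteq> MP ({v. even v} \<union> Zv)" by (auto intro: MP_mono simp: Xv_def)
  have Pm: "Phi f g \<in> MP ({v. even v} \<union> Zv)" using Phi_MP[OF f g] sub by blast
  have e: "ev0 y q = poly (map_poly (ev0 0) (slice zj q)) y" for y q by (rule ev0_slice)
  interpret i: comm_ring_hom "ev0 0" by (rule ev0_hom)
  have "idom_hom (ev0 0)" by unfold_locales (simp_all add: i.hom_add i.hom_mult)
  then have pd: "pderiv ?p = map_poly (ev0 0) (pderiv (slice zj (Phi f g)))"
    by (rule idom_hom.map_poly_pderiv[symmetric])
  have pde: "poly (pderiv ?p) y = ev0 y (pd zj (Phi f g))" for y
  proof -
    interpret s: comm_ring_hom "slice zj :: 'k mpoly \<Rightarrow> _" by (rule slice_hom)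
    have "ev0 y (poly Q (mvar zj)) = poly (map_poly (ev0 0) Q) y" if "\<And>k. coeff Q k \<in> MP (- {zj})" for Q
    proof -
      have c: "ev0 y a = ev0 0 a" if "a \<in> MP (- {zj})" for a
        by (rule hom_eq_on_MP[OF that ev0_hom ev0_hom]) (auto simp: ev0_mvar)
      interpret e: comm_ring_hom "ev0 y" by (rule ev0_hom)
      show ?thesis using that
      proof (induction Q)
        case 0
        then show ?case by (simp add: e.hom_zero)
      next
        case (pCons a Q)
        have "coeff Q k \<in> MP (- {zj})" for k using pCons.prems[of "Suc k"] by simp
        moreover have "ev0 y a = ev0 0 a" using pCons.prems[of 0] by (intro c) simp
        ultimately show ?case using pCons.IH by (simp add: e.hom_add e.hom_mult map_poly_pCons_0 i.hom_zero)
      qed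
    qed
    moreover have "coeff (pderiv (slice zj (Phi f g))) k \<in> MP (- {zj})" for k
    proof -
      have "of_nat (Suc k) \<in> (MP (- {zj}) :: 'k mpoly set)" by (metis MP_mconst single_of_nat)
      moreover have "coeff (slice zj (Phi f g)) (Suc k) \<in> MP (- {zj})"
        using coeff_slice_MP[OF MP_UNIV] by (simp add: Compl_eq_Diff_UNIV)
      ultimately show ?thesis unfolding coeff_pderiv by (rule MP_mult)
    qed
    ultimately show ?thesis unfolding pd pd_def by simp
  qed
  have "fps_nth (poly ?p (fps_const ?y0)) 0 = 0"
    unfolding e[symmetric] using diag_Phi by (subst ev0_nth_0[OF Pm]) simp_all
  moreover have "pd zj (Phi f g) \<in> MP ({v. even v} \<union> Zv)" using Pm by (rule pd_MP)
  then have "fps_nth (poly (pderiv ?p) (fps_const ?y0)) 0 \<noteq> 0"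
    unfolding pde using diag_pd_Phi wj by (subst ev0_nth_0) (simp_all add: w_def)
  ultimately obtain y where "fps_nth y 0 = ?y0 \<and> poly ?p y = 0" using fps_hensel by blast
  then show ?thesis unfolding e[symmetric] by blast
qed

definition yy :: "'k mpoly fract fps" where
  "yy = (SOME y. fps_nth y 0 = to_fract (mvar (2 * j)) \<and> ev0 y (Phi f g) = 0)"

definition ev :: "'k mpoly \<Rightarrow> 'k mpoly fract fps" where "ev = ev0 yy"

lemma yy: "fps_nth yy 0 = to_fract (mvar (2 * j))" "ev (Phi f g) = 0"
  using someI_ex[OF curve_exists] unfolding ev_def yy_def by blast+

sublocale ev: comm_ring_hom ev
  unfolding ev_def by (rule ev0_hom)

sublocale xs: comm_ring_hom xs by (rule xs_hom)
sublocale zs: comm_ring_hom zs by (rule zs_hom)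
sublocale diag: comm_ring_hom diag by (rule diag_hom)

lemma ev_xs: "ev (xs a) = cst (xs a)"
  unfolding ev_def by (rule ev0_xs)

lemma ev_nth_0: "q \<in> MP ({v. even v} \<union> Zv) \<Longrightarrow> fps_nth (ev q) 0 = to_fract (diag q)"
  unfolding ev_def by (rule ev0_nth_0[OF _ yy(1)])

lemma ev_zs_nth_0: "a \<in> MP {..<n} \<Longrightarrow> fps_nth (ev (zs a)) 0 = to_fract (xs a)"
  by (subst ev_nth_0) (auto intro: MP_mono[OF zs_MP])

lemma ev_zs_neq_0: "a \<in> MP {..<n} \<Longrightarrow> a \<noteq> 0 \<Longrightarrow> ev (zs a) \<noteq> 0"
  using ev_zs_nth_0[of a] by auto

lemma w_MP: "a \<in> MP {..<n} \<Longrightarrow> b \<in> MP {..<n} \<Longrightarrow> w i a b \<in> MP {..<n}"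
  unfolding w_def by (intro MP_diff MP_mult pd_MP)

text \<open>The name refers to the level sets of f / g: along the curve a / b keeps the value that
  it has at X.\<close>

definition leaf :: "'k mpoly \<Rightarrow> 'k mpoly \<Rightarrow> bool" where
  "leaf a b \<longleftrightarrow> a \<in> MP {..<n} \<and> b \<in> MP {..<n} \<and> ev (zs a) * cst (xs b) = cst (xs a) * ev (zs b)"

lemma leaf_iff: "leaf a b \<longleftrightarrow> a \<in> MP {..<n} \<and> b \<in> MP {..<n} \<and> ev (Phi a b) = 0"
  unfolding leaf_def Phi_def by (simp add: ev.hom_minus ev.hom_mult ev_xs)

lemma g_neq_0: "g \<noteq> 0" using wj by auto

text \<open>Along the curve the derivative of a / b is a combination of its partial derivatives. As
  these are proportional to those of f / g, it is a multiple of the derivative of f / g, which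
  vanishes because f / g is constant there.\<close>

lemma dep_imp_leaf:
  assumes a: "a \<in> MP {..<n}" and b: "b \<in> MP {..<n}" "b \<noteq> 0"
    and dep: "\<And>i. i < n \<Longrightarrow> w i a b * w j f g = w j a b * w i f g"
  shows "leaf a b"
proof -
  let ?c = "\<lambda>i. fps_deriv (ev (zs (mvar i)))"
  have d: "fps_deriv (ev (zs q)) = (\<Sum>i<n. ev (zs (pd i q)) * ?c i)" if "q \<in> MP {..<n}" for q
    by (rule chain_rule_fps[where h = "\<lambda>q. ev (zs q)", OF comm_ring_hom_comp[OF ev.comm_ring_hom_axioms zs_hom] that])
      (simp_all add: ev_def)
  have wd: "fps_deriv (ev (zs p)) * ev (zs q) - ev (zs p) * fps_deriv (ev (zs q)) =
      (\<Sum>i<n. ev (zs (w i p q)) * ?c i)" if "p \<in> MP {..<n}" "q \<in> MP {..<n}" for p q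
    unfolding d[OF that(1)] d[OF that(2)] w_def
    by (simp add: ev.hom_minus ev.hom_mult zs.hom_minus zs.hom_mult sum_distrib_left sum_distrib_right
        flip: sum_subtractf) (intro sum.cong refl, simp add: algebra_simps)
  define F G where "F = ev (zs f)" and "G = ev (zs g)"
  have FG: "F * cst (xs g) = cst (xs f) * G"
    using yy(2) by (simp add: F_def G_def Phi_def ev.hom_minus ev.hom_mult ev_xs)
  have cg: "cst (xs g) \<noteq> 0" using g_neq_0 by simp
  have "fps_deriv F * cst (xs g) = cst (xs f) * fps_deriv G"
    using arg_cong[OF FG, of fps_deriv] by (simp del: fps_deriv_eq_iff)
  then have "cst (xs g) * (fps_deriv F * G - F * fps_deriv G) = cst (xs f) * fps_deriv G * G - (F * cst (xs g)) * fps_deriv G"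
    by (simp add: algebra_simps)
  also have "\<dots> = 0" unfolding FG by (simp add: algebra_simps)
  finally have "fps_deriv F * G - F * fps_deriv G = 0" using cg by simp
  then have w0: "(\<Sum>i<n. ev (zs (w i f g)) * ?c i) = 0" using wd[OF f g] by (simp add: F_def G_def)
  define A B where "A = ev (zs a)" and "B = ev (zs b)"
  have "(fps_deriv A * B - A * fps_deriv B) * ev (zs (w j f g)) = (\<Sum>i<n. ev (zs (w i a b * w j f g)) * ?c i)"
    unfolding A_def B_def wd[OF a b(1)] sum_distrib_right
    by (intro sum.cong refl) (simp add: ev.hom_mult zs.hom_mult mult_ac)
  also have "\<dots> = (\<Sum>i<n. ev (zs (w j a b * w i f g)) * ?c i)"
    by (intro sum.cong refl) (simp add: dep)
  also have "\<dots> = ev (zs (w j a b)) * (\<Sum>i<n. ev (zs (w i f g)) * ?c i)"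
    unfolding sum_distrib_left by (intro sum.cong refl) (simp add: ev.hom_mult zs.hom_mult mult_ac)
  also have "\<dots> = 0" unfolding w0 by simp
  finally have "(fps_deriv A * B - A * fps_deriv B) * ev (zs (w j f g)) = 0" .
  moreover have "ev (zs (w j f g)) \<noteq> 0" using wj f g by (intro ev_zs_neq_0 w_MP) (simp_all add: w_def)
  ultimately have AB: "fps_deriv A * B = A * fps_deriv B" by simp
  have B0: "fps_nth B 0 = to_fract (xs b)" "fps_nth A 0 = to_fract (xs a)"
    unfolding A_def B_def using a b by (simp_all add: ev_zs_nth_0)
  then have "A * cst (xs b) = cst (xs a) * B" using fps_ratio_const[OF AB] b by simp
  then show ?thesis unfolding leaf_def A_def B_def using a b by simp
qed

end

section \<open>Degrees of differences, products and derivatives\<close>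

lemma sdeg_diff_le: "sdeg S (a - b) \<le> max (sdeg S a) (sdeg S b)"
  and sdeg_mult_le: "sdeg S (a * b) \<le> sdeg S a + sdeg S b"
proof -
  interpret comm_ring_hom "tpol S :: 'a mpoly \<Rightarrow> _" by (rule tpol_hom)
  show "sdeg S (a - b) \<le> max (sdeg S a) (sdeg S b)"
    by (simp add: sdeg_def hom_minus degree_diff_le_max)
  show "sdeg S (a * b) \<le> sdeg S a + sdeg S b"
    by (simp add: sdeg_def hom_mult degree_mult_le)
qed

lemma tpol_0 [simp]: "tpol S 0 = 0"
  using tpol_eq_0_iff by blast

text \<open>Differentiating by a variable of S lowers the degree in S by one, which the factor
  \<open>[:0, 1:]\<close> restores.\<close>

lemma map_poly_pd_tpol:
  fixes q :: "'a::idom mpoly"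
  shows "map_poly (pd v) (tpol S q) = tpol S (pd v q) * (if v \<in> S then [:0, 1:] else 1)"
proof -
  obtain T where T: "finite T" "q \<in> MP T" using MP_finite by blast
  let ?D = "map_poly (pd v) :: 'a mpoly poly \<Rightarrow> _"
  have Dc: "coeff (?D p) k = pd v (coeff p k)" for p k by (simp add: coeff_map_poly)
  have "?D (tpol S q) = (\<Sum>u\<in>insert v T. tpol S (pd u q) * ?D (tpol S (mvar u)))"
  proof (rule chain_rule[OF tpol_hom])
    show "?D (x + y) = ?D x + ?D y" for x y by (rule poly_eqI) (simp add: Dc pd_add)
    show "?D (x * y) = x * ?D y + ?D x * y" for x y
      by (rule poly_eqI, simp add: Dc coeff_mult pd_sum pd_mult sum.distrib, intro sum.cong refl mult.commute)
    show "?D (tpol S (mconst c)) = 0" for c by (rule poly_eqI) (simp add: Dc coeff_pCons split: nat.splits)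
  qed (use T in \<open>auto elim: MP_mono\<close>)
  also have "\<dots> = (\<Sum>u\<in>insert v T. if u = v then tpol S (pd v q) * (if v \<in> S then [:0, 1:] else 1) else 0)"
  proof (intro sum.cong refl)
    fix u assume "u \<in> insert v T"
    have "?D (tpol S (mvar u)) = (if u = v then if v \<in> S then [:0, 1:] else 1 else 0)"
      by (rule poly_eqI) (auto simp: Dc tpol_mvar coeff_pCons pd_mvar split: nat.splits)
    then show "tpol S (pd u q) * ?D (tpol S (mvar u)) =
        (if u = v then tpol S (pd v q) * (if v \<in> S then [:0, 1:] else 1) else 0)" by simp
  qed
  also have "\<dots> = tpol S (pd v q) * (if v \<in> S then [:0, 1:] else 1)" using T by simp
  finally show ?thesis .
qed

lemma sdeg_pd_le:
  fixes q :: "'a::idom mpoly"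
  shows "sdeg S (pd v q) \<le> sdeg S q"
proof (cases "pd v q = 0")
  case False
  have "sdeg S (pd v q) \<le> degree (tpol S (pd v q) * (if v \<in> S then [:0, 1:] else 1))"
    unfolding sdeg_def using False by (subst degree_mult_eq) auto
  also have "\<dots> \<le> sdeg S q"
    unfolding map_poly_pd_tpol[symmetric] sdeg_def by (rule degree_map_poly_le)
  finally show ?thesis .
qed (simp add: sdeg_def)

lemma sdeg_pd_less:
  fixes q :: "'a::idom mpoly"
  assumes "v \<in> S" "sdeg S q \<le> d" "0 < d"
  shows "sdeg S (pd v q) < d"
proof (cases "pd v q = 0")
  case False
  have "sdeg S (pd v q) + 1 = degree (tpol S (pd v q) * [:0, 1:])"
    unfolding sdeg_def using False by (subst degree_mult_eq) auto
  also have "\<dots> \<le> sdeg S q"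
    using map_poly_pd_tpol[of v S q] assms(1) unfolding sdeg_def by (metis degree_map_poly_le)
  finally show ?thesis using assms(2) by simp
qed (use assms in \<open>simp add: sdeg_def\<close>)

section \<open>The ideal of the curve and its generator\<close>

context leaf_setup
begin

text \<open>On the variables \<open>Tv\<close> the parametrization is invertible: it is polynomial
  in s, and V_i is recovered as (Z_i - X_i) / s.\<close>

lemma curve_elim:
  assumes R: "R \<in> MP Tv" and "ev R = 0"
  shows "R = 0"
proof -
  \<comment> \<open>The parametrization before passing to power series and fractions.\<close>
  define th :: "'k mpoly \<Rightarrow> 'k mpoly poly" where
    "th = mev (\<lambda>c. [:mconst c:]) (\<lambda>v. if even v then [:mvar v:] else if v = 2 * n + 1 then [:0, 1:]
       else [:mvar (v - 1), mvar (2 * n + (v - 1)):])"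
  have ch: "comm_ring_hom (\<lambda>c::'k. [:mconst c:])" by (rule comm_ring_hom_comp[OF pCons_hom mconst_hom])
  have th: "comm_ring_hom th" unfolding th_def by (rule mev_hom[OF ch])
  have thc: "th (mconst c) = [:mconst c:]" for c unfolding th_def by (rule mev_mconst[OF ch])
  have thv: "th (mvar v) = (if even v then [:mvar v:] else if v = 2 * n + 1 then [:0, 1:]
       else [:mvar (v - 1), mvar (2 * n + (v - 1)):])" for v
    unfolding th_def by (rule mev_mvar[OF ch])
  have "ev R = fps_of_poly (map_poly to_fract (th R))"
  proof (rule hom_eq_on_MP[OF R ev.comm_ring_hom_axioms comm_ring_hom_comp[OF comm_ring_hom_comp[OF
        fps_of_poly_hom map_poly_hom[OF to_fract_ring_hom]] th]])
    fix v assume v: "v \<in> Tv"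
    show "ev (mvar v) = fps_of_poly (map_poly to_fract (th (mvar v)))"
    proof (cases "even v")
      case True
      then show ?thesis by (simp add: ev_def ev0_mvar thv map_poly_pCons_0 fps_of_poly_const)
    next
      case False
      then have "v \<noteq> zj" using v by (auto simp: Tv_def)
      with False show ?thesis
        by (auto simp: ev_def ev0_mvar thv map_poly_pCons_0 fps_of_poly_pCons fps_of_poly_const mult.commute)
    qed
  qed (simp add: ev_def thc map_poly_pCons_0 fps_of_poly_const)
  then have "map_poly to_fract (th R) = 0" using assms(2) by simp
  then have thR: "th R = 0" by (simp add: map_poly_eq_0_iff)
  \<comment> \<open>The inverse parametrization: V_i, of index 2 (n + i), goes to (Z_i - X_i) / s
    for i other than j.\<close>
  define ps :: "'k mpoly \<Rightarrow> 'k mpoly fract" where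
    "ps = mev (\<lambda>c. to_fract (mconst c)) (\<lambda>v. if even v \<and> 2 * n \<le> v \<and> v < 4 * n \<and> v \<noteq> 2 * (n + j)
       then (to_fract (mvar (v - 2 * n + 1)) - to_fract (mvar (v - 2 * n))) / to_fract (mvar (2 * n + 1))
       else to_fract (mvar v))"
  have ch: "comm_ring_hom (\<lambda>c::'k. to_fract (mconst c))" by (rule comm_ring_hom_comp[OF to_fract_ring_hom mconst_hom])
  have ps: "comm_ring_hom ps" unfolding ps_def by (rule mev_hom[OF ch])
  interpret ps: comm_ring_hom ps by (rule ps)
  have psc: "ps (mconst c) = to_fract (mconst c)" for c unfolding ps_def by (rule mev_mconst[OF ch])
  have psv: "ps (mvar v) = (if even v \<and> 2 * n \<le> v \<and> v < 4 * n \<and> v \<noteq> 2 * (n + j)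
       then (to_fract (mvar (v - 2 * n + 1)) - to_fract (mvar (v - 2 * n))) / to_fract (mvar (2 * n + 1))
       else to_fract (mvar v))" for v
    unfolding ps_def by (rule mev_mvar[OF ch])
  have "poly (map_poly ps (th R)) (to_fract (mvar (2 * n + 1))) = to_fract R"
  proof (rule hom_eq_on_MP[OF R comm_ring_hom_comp[OF comm_ring_hom_comp[OF poly_eval_hom map_poly_hom[OF ps]] th] to_fract_ring_hom])
    fix v assume v: "v \<in> Tv"
    show "poly (map_poly ps (th (mvar v))) (to_fract (mvar (2 * n + 1))) = to_fract (mvar v)"
    proof (cases "even v \<or> v = 2 * n + 1")
      case True
      then show ?thesis using v by (auto simp: thv psv Tv_def map_poly_pCons_0 ps.hom_one)
    next
      case False
      then obtain i where i: "v = 2 * i + 1" by (auto elim: oddE)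
      then have "i < n" using v False by (auto simp: Tv_def)
      moreover have "i \<noteq> j" using v i by (auto simp: Tv_def zj_def)
      ultimately show ?thesis using False by (simp add: i thv psv map_poly_pCons_0)
    qed
  qed (simp add: thc map_poly_pCons_0 psc)
  then show ?thesis unfolding thR by simp
qed

lemma Phi_neq_0: "Phi f g \<noteq> 0"
  using diag_pd_Phi[of f g] wj by (auto simp: w_def diag.hom_zero)

text \<open>Power series over a field form a domain, so one prime factor of Phi already vanishes on
  the curve.\<close>

lemma G_exists: "\<exists>G. prime_elem G \<and> G dvd Phi f g \<and> ev G = 0"
proof -
  obtain u ps where u: "u dvd 1" "\<forall>p\<in>set ps. irreducible p" "Phi f g = u * prod_list ps"
    using irreducible_factorization[OF Phi_neq_0] by blast
  obtain c where c: "u = mconst c" "u \<noteq> 0" using u(1) unfolding dvd_1_iff_tdeg tdeg_0_iff by blast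
  have "ev u \<noteq> 0" using c by (simp add: ev_def)
  then have "ev (prod_list ps) = 0" using yy(2) unfolding u(3) by (simp add: ev.hom_mult)
  then have "\<exists>p\<in>set ps. ev p = 0"
    by (induction ps) (auto simp: ev.hom_mult ev.hom_one)
  then obtain p where p: "p \<in> set ps" "ev p = 0" by blast
  then have "p dvd Phi f g" unfolding u(3) by (simp add: dvd_mult prod_list_dvd)
  then show ?thesis using p u(2) irreducible_imp_prime_elem_mpoly by blast
qed

definition G :: "'k mpoly" where "G = (SOME G. prime_elem G \<and> G dvd Phi f g \<and> ev G = 0)"

lemma G: "prime_elem G" "G dvd Phi f g" "ev G = 0"
  using someI_ex[OF G_exists] unfolding G_def by blast+

lemma G_neq_0: "G \<noteq> 0" using G(1) by auto

definition Tz :: "nat set" where "Tz = insert zj Tv"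

lemma XZ_subset: "Xv \<union> Zv \<subseteq> Tz" "Xv \<subseteq> Tv"
  by (auto simp: Xv_def Zv_def Tz_def Tv_def)

lemma G_MP: "G \<in> MP (Xv \<union> Zv)"
proof -
  obtain K where "Phi f g = G * K" using G(2) by (auto elim: dvdE)
  then show ?thesis using MP_factor[of G K] Phi_MP[OF f g] Phi_neq_0 by simp
qed

lemma G_not_dvd_Tv: "q \<in> MP Tv \<Longrightarrow> q \<noteq> 0 \<Longrightarrow> \<not> G dvd q"
proof
  assume q: "q \<in> MP Tv" "q \<noteq> 0" "G dvd q"
  then obtain k where "q = G * k" by (auto elim: dvdE)
  then have "G \<in> MP Tv" using MP_factor[of G k Tv] q by simp
  then show False using curve_elim G(3) G_neq_0 by blast
qed

text \<open>Otherwise an element m of least degree in Z_j in the ideal of G and q divides both up to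
  factors free of Z_j. As m vanishes on the curve, it involves Z_j by \<open>curve_elim\<close>;
  this and the primality of G contradict the assumption.\<close>

lemma curve_dvd:
  assumes q: "q \<in> MP Tz" and q0: "ev q = 0"
  shows "G dvd q"
proof (rule ccontr)
  assume nd: "\<not> G dvd q"
  define J where "J = {m. \<exists>a\<in>MP Tz. \<exists>b\<in>MP Tz. m = a * G + b * q}"
  have GT: "G \<in> MP Tz" using MP_mono[OF G_MP XZ_subset(1)] .
  have JG: "G \<in> J" unfolding J_def by (rule CollectI, rule bexI[of _ 1], rule bexI[of _ 0]) auto
  have Jq: "q \<in> J" unfolding J_def by (rule CollectI, rule bexI[of _ 0], rule bexI[of _ 1]) auto
  define dg where "dg m = degree (slice zj m)" for m :: "'k mpoly"
  obtain m where m: "m \<in> J" "m \<noteq> 0" "\<And>m'. m' \<in> J \<Longrightarrow> m' \<noteq> 0 \<Longrightarrow> dg m \<le> dg m'"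
    using ex_has_least_nat[of "\<lambda>m. m \<in> J \<and> m \<noteq> 0" G dg] JG G_neq_0 by blast
  obtain a0 b0 where ab0: "a0 \<in> MP Tz" "b0 \<in> MP Tz" "m = a0 * G + b0 * q" using m(1) by (auto simp: J_def)
  have mT: "m \<in> MP Tz" using ab0 GT q by simp
  have ev_m: "ev m = 0" unfolding ab0(3) by (simp add: ev.hom_add ev.hom_mult G q0)
  have m_Tv: "m \<notin> MP Tv" using curve_elim[of m] ev_m m(2) by blast
  have TzTv: "Tz - {zj} = Tv" by (auto simp: Tz_def Tv_def)
  have div: "\<exists>a x. a \<in> MP Tv \<and> a \<noteq> 0 \<and> a * p = m * x" if p: "p \<in> J" for p
  proof -
    obtain a1 b1 where ab1: "a1 \<in> MP Tz" "b1 \<in> MP Tz" "p = a1 * G + b1 * q" using p by (auto simp: J_def)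
    have pT: "p \<in> MP Tz" using ab1 GT q by simp
    from slice_pseudo_division[OF m(2) mT pT, of zj] obtain a x r where
      a: "a \<in> MP Tv" "a \<noteq> 0" "x \<in> MP Tz" "r \<in> MP Tz" "a * p = m * x + r" "r = 0 \<or> dg r < dg m"
      unfolding TzTv dg_def by blast
    have aT: "a \<in> MP Tz" using a(1) by (rule MP_mono) (auto simp: Tz_def)
    have "r = a * p - m * x" using a(5) by simp
    then have "r = (a * a1 - x * a0) * G + (a * b1 - x * b0) * q"
      unfolding ab0(3) ab1(3) by (simp add: algebra_simps)
    moreover have "a * a1 - x * a0 \<in> MP Tz" "a * b1 - x * b0 \<in> MP Tz" using aT a(3) ab0 ab1 by simp_all
    ultimately have "r \<in> J" unfolding J_def by blast
    then have "r = 0" using m(3)[of r] a(6) by fastforce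
    then show ?thesis using a by auto
  qed
  obtain a x where a: "a \<in> MP Tv" "a \<noteq> 0" "a * q = m * x" using div[OF Jq] by blast
  obtain a' x' where a': "a' \<in> MP Tv" "a' \<noteq> 0" "a' * G = m * x'" using div[OF JG] by blast
  have "G dvd m * x'" unfolding a'(3)[symmetric] by simp
  then consider "G dvd m" | "G dvd x'" using G(1) by (auto simp: prime_elem_dvd_mult_iff)
  then show False
  proof cases
    case 1
    then have "G dvd a * q" unfolding a(3) by simp
    then show False using nd G(1) G_not_dvd_Tv[OF a(1,2)] by (auto simp: prime_elem_dvd_mult_iff)
  next
    case 2
    then obtain y where y: "x' = G * y" by (auto elim: dvdE)
    then have "a' * G = (m * y) * G" using a'(3) by (simp add: mult_ac)
    then have "a' = m * y" using G_neq_0 by simp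
    then have "m \<in> MP Tv" using MP_factor[of m y Tv] a' by simp
    then show False using m_Tv by blast
  qed
qed

text \<open>The vector field \<open>w j f g\<close> d/dX_i - \<open>w i f g\<close> d/dX_j, which is
  tangent to the level sets of f / g in X.\<close>

definition delta :: "nat \<Rightarrow> 'k mpoly \<Rightarrow> 'k mpoly" where
  "delta i q = xs (w j f g) * pd (2 * i) q - xs (w i f g) * pd (2 * j) q"

lemma delta_mult: "delta i (p * q) = p * delta i q + q * delta i p"
  by (simp add: delta_def pd_mult algebra_simps)

text \<open>The derivation kills (f / g)(X) and everything in Z, hence also Phi / g(X); the identity
  is the quotient rule.\<close>

lemma delta_Phi: "xs g * delta i (Phi f g) = delta i (xs g) * Phi f g"
proof -
  have p: "pd (2 * k) (Phi f g) = zs f * xs (pd k g) - xs (pd k f) * zs g" for k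
    unfolding Phi_def pd_diff pd_mult pd_xs by (simp add: pd_zs_even mult.commute)
  define a b fi gi fj gj F H where "a = xs f" and "b = xs g" and "fi = xs (pd i f)" and "gi = xs (pd i g)"
    and "fj = xs (pd j f)" and "gj = xs (pd j g)" and "F = zs f" and "H = zs g"
  have "b * ((b * fj - a * gj) * (F * gi - fi * H) - (b * fi - a * gi) * (F * gj - fj * H)) =
    ((b * fj - a * gj) * gi - (b * fi - a * gi) * gj) * (F * b - a * H)"
    by (simp add: algebra_simps)
  then show ?thesis
    unfolding delta_def p unfolding Phi_def w_def pd_xs xs.hom_minus xs.hom_mult
    by (simp only: a_def b_def fi_def gi_def fj_def gj_def F_def H_def)
qed

text \<open>G is a simple factor of Phi: a double one would make the derivative of Phi in Z_j vanish
  on the curve, while at the base point it is \<open>w j f g\<close>. Since \<open>delta\<close>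
  maps Phi to a multiple of Phi up to g(X), G divides its own derivative.\<close>

lemma G_dvd_delta: "G dvd delta i G"
proof -
  obtain K where K: "Phi f g = G * K" using G(2) by (auto elim: dvdE)
  have nK: "\<not> G dvd K"
  proof
    assume "G dvd K"
    then obtain K' where "K = G * K'" by (auto elim: dvdE)
    then have "Phi f g = G * (G * K')" using K by simp
    then have "ev (pd zj (Phi f g)) = 0" by (simp add: pd_mult ev.hom_add ev.hom_mult G(3))
    moreover have "pd zj (Phi f g) \<in> MP ({v. even v} \<union> Zv)"
      by (rule pd_MP, rule MP_mono[OF Phi_MP[OF f g]]) (auto simp: Xv_def)
    ultimately have "diag (pd zj (Phi f g)) = 0" using ev_nth_0 by fastforce
    then show False using wj by (simp add: diag_pd_Phi w_def)
  qed
  have "xs g * (G * delta i K + K * delta i G) = delta i (xs g) * (G * K)"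
    using delta_Phi[of i] unfolding K delta_mult .
  then have "xs g * (K * delta i G) = delta i (xs g) * (G * K) - xs g * (G * delta i K)"
    by (simp add: distrib_left eq_diff_eq add.commute)
  also have "\<dots> = G * (delta i (xs g) * K - xs g * delta i K)" by (simp add: algebra_simps)
  finally have "xs g * (K * delta i G) = \<dots>" .
  then have "G dvd xs g * (K * delta i G)" by simp
  moreover have "\<not> G dvd xs g" using G_not_dvd_Tv[of "xs g"] MP_mono[OF xs_MP[OF g] XZ_subset(2)] g_neq_0 by simp
  ultimately show ?thesis using nK G(1) by (auto simp: prime_elem_dvd_mult_iff)
qed

text \<open>\<open>delta\<close> does not raise the degree in Z, so the cofactor has degree 0 in
  Z.\<close>

lemma delta_G: "\<exists>l\<in>MP Xv. delta i G = G * l" if i: "i < n"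
proof (cases "delta i G = 0")
  case False
  obtain l where l: "delta i G = G * l" using G_dvd_delta by (auto elim: dvdE)
  then have nz: "l \<noteq> 0" using False by auto
  have w0: "sdeg Zv (xs (w k f g)) = 0" for k
    unfolding sdeg_0_iff using xs_MP[OF w_MP[OF f g]] by (rule MP_mono) (auto simp: Xv_def Zv_def)
  have "sdeg Zv (xs (w k f g) * pd (2 * m) G) \<le> sdeg Zv G" for k m
    using sdeg_mult_le[of Zv "xs (w k f g)" "pd (2 * m) G"] sdeg_pd_le[of Zv "2 * m" G] w0[of k]
    by (simp add: Zv_def)
  then have "sdeg Zv (delta i G) \<le> sdeg Zv G"
    unfolding delta_def using sdeg_diff_le by (meson max.bounded_iff order.trans max.boundedI)
  then have "sdeg Zv l = 0" unfolding l using sdeg_mult[OF G_neq_0 nz, of Zv] by simp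
  then have "l \<in> MP (- Zv)" by (simp add: sdeg_0_iff)
  moreover have wM: "xs (w k f g) \<in> MP (Xv \<union> Zv)" for k
    by (rule MP_mono[OF xs_MP[OF w_MP[OF f g]]]) simp
  have "delta i G \<in> MP (Xv \<union> Zv)"
    unfolding delta_def by (intro MP_diff MP_mult pd_MP wM G_MP)
  then have "l \<in> MP (Xv \<union> Zv)" using MP_factor[of l G] False l by (simp add: mult.commute)
  ultimately have "l \<in> MP Xv" using MP_Int[of l "- Zv" "Xv \<union> Zv"] by (auto elim: MP_mono)
  then show ?thesis using l by blast
qed (auto intro!: bexI[of _ 0])

section \<open>Specialization at points\<close>

abbreviation pv :: "(nat \<Rightarrow> 'k) \<Rightarrow> 'k mpoly \<Rightarrow> 'k" where
  "pv \<theta> \<equiv> mev (\<lambda>c. c) \<theta>"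

text \<open>\<open>pt\<close> replaces Z by the point \<theta> and keeps X, \<open>px\<close>
  replaces X and keeps Z; both rename the remaining coordinates back to the variables of f and
  g.\<close>

definition pt :: "(nat \<Rightarrow> 'k) \<Rightarrow> 'k mpoly \<Rightarrow> 'k mpoly" where
  "pt \<theta> = mev mconst (\<lambda>v. if even v then mvar (v div 2) else mconst (\<theta> (v div 2)))"

definition px :: "(nat \<Rightarrow> 'k) \<Rightarrow> 'k mpoly \<Rightarrow> 'k mpoly" where
  "px \<theta> = mev mconst (\<lambda>v. if even v then mconst (\<theta> (v div 2)) else mvar (v div 2))"

lemma pv_hom: "comm_ring_hom (pv \<theta>)" by (rule mev_hom[OF comm_ring_hom_id])

lemma pv_simps [simp]: "pv \<theta> (mconst c) = c" "pv \<theta> (mvar i) = \<theta> i"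
  by (simp_all add: mev_mconst[OF comm_ring_hom_id] mev_mvar[OF comm_ring_hom_id])

lemma pt_hom: "comm_ring_hom (pt \<theta>)" and px_hom: "comm_ring_hom (px \<theta>)"
  unfolding pt_def px_def by (rule mev_hom[OF mconst_hom])+

lemma pt_simps [simp]: "pt \<theta> (mconst c) = mconst c"
    "pt \<theta> (mvar v) = (if even v then mvar (v div 2) else mconst (\<theta> (v div 2)))"
  and px_simps [simp]: "px \<theta> (mconst c) = mconst c"
    "px \<theta> (mvar v) = (if even v then mconst (\<theta> (v div 2)) else mvar (v div 2))"
  unfolding pt_def px_def by (simp_all add: mev_mconst[OF mconst_hom] mev_mvar[OF mconst_hom])

lemma pv_pt: "pv \<tau> (pt \<theta> q) = pv (\<lambda>v. if even v then \<tau> (v div 2) else \<theta> (v div 2)) q"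
  by (rule hom_eq_on_MP[OF MP_UNIV comm_ring_hom_comp[OF pv_hom pt_hom] pv_hom]) auto

lemma pv_px: "pv \<theta> (px \<tau> q) = pv (\<lambda>v. if even v then \<tau> (v div 2) else \<theta> (v div 2)) q"
  by (rule hom_eq_on_MP[OF MP_UNIV comm_ring_hom_comp[OF pv_hom px_hom] pv_hom]) auto

lemma px_xs [simp]: "px \<theta> (xs a) = mconst (pv \<theta> a)" and px_zs [simp]: "px \<theta> (zs a) = a"
  and pt_xs [simp]: "pt \<theta> (xs a) = a"
proof -
  show "px \<theta> (xs a) = mconst (pv \<theta> a)"
    by (rule hom_eq_on_MP[OF MP_UNIV comm_ring_hom_comp[OF px_hom xs_hom] comm_ring_hom_comp[OF mconst_hom pv_hom]]) auto
  have "px \<theta> (zs a) = (\<lambda>x. x) a"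
    by (rule hom_eq_on_MP[OF MP_UNIV comm_ring_hom_comp[OF px_hom zs_hom] comm_ring_hom_id]) auto
  then show "px \<theta> (zs a) = a" .
  have "pt \<theta> (xs a) = (\<lambda>x. x) a"
    by (rule hom_eq_on_MP[OF MP_UNIV comm_ring_hom_comp[OF pt_hom xs_hom] comm_ring_hom_id]) auto
  then show "pt \<theta> (xs a) = a" .
qed

lemma px_Phi: "px \<theta> (Phi a b) = a * mconst (pv \<theta> b) - mconst (pv \<theta> a) * b"
proof -
  interpret comm_ring_hom "px \<theta>" by (rule px_hom)
  show ?thesis by (simp add: Phi_def hom_minus hom_mult)
qed

lemma pt_MP: "pt \<theta> q \<in> MP {..<n}" and px_MP: "px \<theta> q \<in> MP {..<n}" if "q \<in> MP (Xv \<union> Zv)"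
  unfolding pt_def px_def by (rule MP_mev[OF that]; auto simp: Xv_def Zv_def)+

lemma pd_pt: "pd i (pt \<theta> q) = pt \<theta> (pd (2 * i) q)"
proof -
  obtain S where S: "finite S" "q \<in> MP S" using MP_finite by blast
  have "pd i (pt \<theta> q) = (\<Sum>v\<in>insert (2 * i) S. pt \<theta> (pd v q) * pd i (pt \<theta> (mvar v)))"
    by (rule chain_rule[OF pt_hom MP_mono[OF S(2)]]) (auto simp: S pd_add pd_mult)
  also have "\<dots> = (\<Sum>v\<in>insert (2 * i) S. if v = 2 * i then pt \<theta> (pd v q) else 0)"
    by (intro sum.cong refl) (auto simp: pd_mvar elim: evenE)
  finally show ?thesis using S by simp
qed

lemma tdeg_pt: "q \<in> MP (Xv \<union> Zv) \<Longrightarrow> tdeg (pt \<theta> q) \<le> sdeg Xv q"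
  and tdeg_px: "q \<in> MP (Xv \<union> Zv) \<Longrightarrow> tdeg (px \<theta> q) \<le> sdeg Zv q"
proof -
  assume q: "q \<in> MP (Xv \<union> Zv)"
  show "tdeg (pt \<theta> q) \<le> sdeg Xv q"
    unfolding sdeg_def[of UNIV]
    by (rule hom_degree_le[OF comm_ring_hom_comp[OF tpol_hom pt_hom] q]) (auto simp: tpol_mvar Xv_def Zv_def)
  show "tdeg (px \<theta> q) \<le> sdeg Zv q"
    unfolding sdeg_def[of UNIV]
    by (rule hom_degree_le[OF comm_ring_hom_comp[OF tpol_hom px_hom] q]) (auto simp: tpol_mvar Xv_def Zv_def)
qed

text \<open>By \<open>delta_G\<close> the logarithmic derivative of G under \<open>delta\<close>
  does not depend on Z. So two specializations of Z have the same one, and their quotient is killed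
  by \<open>delta\<close>.\<close>

lemma G_pair_leaf:
  assumes "pt \<theta>' G \<noteq> 0"
  shows "leaf (pt \<theta> G) (pt \<theta>' G)"
proof (rule dep_imp_leaf[OF pt_MP[OF G_MP] pt_MP[OF G_MP] assms])
  fix i assume i: "i < n"
  obtain l where l: "l \<in> MP Xv" "delta i G = G * l" using delta_G[OF i] by blast
  let ?l = "mev mconst (\<lambda>v. mvar (v div 2)) l"
  have pl: "pt \<theta> l = ?l" for \<theta> unfolding pt_def by (rule mev_cong[OF l(1)]) (auto simp: Xv_def)
  have e: "w j f g * pd i (pt \<theta> G) - w i f g * pd j (pt \<theta> G) = pt \<theta> G * ?l" for \<theta>
  proof -
    interpret comm_ring_hom "pt \<theta>" by (rule pt_hom)
    show ?thesis using arg_cong[OF l(2), of "pt \<theta>"] unfolding delta_def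
      by (simp add: hom_minus hom_mult pd_pt pl)
  qed
  let ?a = "pt \<theta> G" and ?b = "pt \<theta>' G"
  have "w i ?a ?b * w j f g - w j ?a ?b * w i f g =
     ?b * (w j f g * pd i ?a - w i f g * pd j ?a) - ?a * (w j f g * pd i ?b - w i f g * pd j ?b)"
    unfolding w_def[of _ ?a ?b] by (simp add: algebra_simps)
  also have "\<dots> = 0" unfolding e by (simp add: mult_ac)
  finally show "w i ?a ?b * w j f g = w j ?a ?b * w i f g" by simp
qed

definition nonprop :: "'k mpoly \<Rightarrow> 'k mpoly \<Rightarrow> bool" where
  "nonprop a b \<longleftrightarrow> b \<noteq> 0 \<and> (\<forall>c. a \<noteq> mconst c * b)"

lemma pv_exists: "q \<noteq> 0 \<Longrightarrow> \<exists>\<theta>. pv \<theta> q \<noteq> 0"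
  using mev_point_exists MP_finite by blast

text \<open>For c the value of a / b at one point, a - c b is a nonzero polynomial, so it is nonzero
  at another.\<close>

lemma nonprop_points:
  assumes "nonprop a b"
  shows "\<exists>\<theta> \<theta>'. pv \<theta> a * pv \<theta>' b \<noteq> pv \<theta>' a * pv \<theta> b"
proof -
  obtain \<theta>' where t: "pv \<theta>' b \<noteq> 0" using pv_exists assms by (auto simp: nonprop_def)
  define c where "c = pv \<theta>' a / pv \<theta>' b"
  have "a - mconst c * b \<noteq> 0" using assms by (auto simp: nonprop_def)
  then obtain \<theta> where t2: "pv \<theta> (a - mconst c * b) \<noteq> 0" using pv_exists by blast
  interpret comm_ring_hom "pv \<theta>" by (rule pv_hom)
  have "pv \<theta> a - c * pv \<theta> b \<noteq> 0" using t2 by (simp add: hom_minus hom_mult)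
  then show ?thesis using t by (intro exI[of _ \<theta>] exI[of _ \<theta>']) (auto simp: c_def field_simps)
qed

text \<open>G vanishes on the diagonal, so its specialization at Z = \<tau> vanishes at X = \<tau>,
  where another specialization does not.\<close>

lemma G_nonprop_pair: "\<exists>\<theta> \<theta>'. nonprop (pt \<theta> G) (pt \<theta>' G)"
proof -
  obtain \<xi> where "pv \<xi> G \<noteq> 0" using pv_exists[OF G_neq_0] by blast
  define \<theta>' \<tau>1 where "\<theta>' i = \<xi> (2 * i + 1)" and "\<tau>1 i = \<xi> (2 * i)" for i
  have "(\<lambda>v. if even v then \<tau>1 (v div 2) else \<theta>' (v div 2)) = \<xi>"
    by (auto simp: \<theta>'_def \<tau>1_def fun_eq_iff)
  then have E1: "pv \<tau>1 (pt \<theta>' G) \<noteq> 0" using \<open>pv \<xi> G \<noteq> 0\<close> by (simp add: pv_pt)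
  then have "pt \<theta>' G \<noteq> 0" "px \<tau>1 G \<noteq> 0"
    using pv_px[of \<theta>' \<tau>1 G] pv_pt[of \<tau>1 \<theta>' G] by auto
  \<comment> \<open>\<tau> avoids the zeros of G(\<tau>1, Z) and of G(X, \<theta>').\<close>
  then obtain \<tau> where \<tau>: "pv \<tau> (px \<tau>1 G * pt \<theta>' G) \<noteq> 0" using pv_exists[of "px \<tau>1 G * pt \<theta>' G"] by auto
  interpret comm_ring_hom "pv \<tau>" by (rule pv_hom)
  interpret t1: comm_ring_hom "pv \<tau>1" by (rule pv_hom)
  have \<tau>': "pv \<tau>1 (pt \<tau> G) \<noteq> 0" "pv \<tau> (pt \<theta>' G) \<noteq> 0"
    using \<tau> by (auto simp: hom_mult pv_px pv_pt)
  have "diag G = 0"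
  proof -
    have "G \<in> MP ({v. even v} \<union> Zv)" using G_MP by (rule MP_mono) (auto simp: Xv_def)
    then show ?thesis using ev_nth_0[of G] G(3) by simp
  qed
  have "pv \<tau> (pt \<tau> G) = pv (\<lambda>v. \<tau> (v div 2)) (diag G)"
    by (rule hom_eq_on_MP[OF MP_UNIV comm_ring_hom_comp[OF pv_hom pt_hom] comm_ring_hom_comp[OF pv_hom diag_hom]])
      (auto elim!: oddE)
  then have z: "pv \<tau> (pt \<tau> G) = 0" using \<open>diag G = 0\<close> by simp
  have "nonprop (pt \<tau> G) (pt \<theta>' G)"
    unfolding nonprop_def
  proof (intro conjI allI)
    show "pt \<theta>' G \<noteq> 0" by fact
    fix c
    show "pt \<tau> G \<noteq> mconst c * pt \<theta>' G"
    proof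
      assume c: "pt \<tau> G = mconst c * pt \<theta>' G"
      have "c = 0" using z \<tau>'(2) unfolding c by (simp add: hom_mult)
      then show False using \<tau>'(1) unfolding c by (simp add: t1.hom_zero)
    qed
  qed
  then show ?thesis by blast
qed

definition pdeg :: "'k mpoly \<Rightarrow> 'k mpoly \<Rightarrow> nat" where
  "pdeg a b = max (tdeg a) (tdeg b)"

lemma sdeg_Phi:
  assumes "a \<in> MP {..<n}" "b \<in> MP {..<n}"
  shows "sdeg Xv (Phi a b) \<le> pdeg a b" "sdeg Zv (Phi a b) \<le> pdeg a b"
proof -
  have x: "sdeg Xv (xs q) \<le> tdeg q" for q
    unfolding sdeg_def[of Xv]
    by (rule hom_degree_le[OF comm_ring_hom_comp[OF tpol_hom xs_hom] MP_UNIV]) (simp_all add: tpol_mvar)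
  have z: "sdeg Zv (zs q) \<le> tdeg q" for q
    unfolding sdeg_def[of Zv]
    by (rule hom_degree_le[OF comm_ring_hom_comp[OF tpol_hom zs_hom] MP_UNIV]) (simp_all add: tpol_mvar)
  have y: "sdeg Zv (xs q) = 0" "sdeg Xv (zs q) = 0" if "q \<in> MP {..<n}" for q
  proof -
    show "sdeg Zv (xs q) = 0" unfolding sdeg_0_iff by (rule MP_mono[OF xs_MP[OF that]]) (auto simp: Xv_def Zv_def)
    show "sdeg Xv (zs q) = 0" unfolding sdeg_0_iff by (rule MP_mono[OF zs_MP[OF that]]) (auto simp: Xv_def Zv_def)
  qed
  have m: "sdeg S (p * q) \<le> c" if "sdeg S p + sdeg S q \<le> c" for S and p q :: "'k mpoly" and c
    using sdeg_mult_le[of S p q] that by linarith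
  have "sdeg Xv (zs a * xs b) \<le> tdeg b" "sdeg Xv (xs a * zs b) \<le> tdeg a"
    "sdeg Zv (zs a * xs b) \<le> tdeg a" "sdeg Zv (xs a * zs b) \<le> tdeg b"
    by (rule m; use x[of a] x[of b] z[of a] z[of b] y[OF assms(1)] y[OF assms(2)] in linarith)+
  then show "sdeg Xv (Phi a b) \<le> pdeg a b" "sdeg Zv (Phi a b) \<le> pdeg a b"
    unfolding Phi_def pdeg_def using sdeg_diff_le by (meson max.bounded_iff order.trans max.coboundedI1 max.coboundedI2 max.boundedI)+
qed

end

subsection \<open>Lueroth generators\<close>

lemma mconst_eq_iff [simp]: "mconst x = mconst y \<longleftrightarrow> x = y"
  by (metis lookup_single_eq)

lemma degree_le_1_form:
  assumes "degree p \<le> 1"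
  shows "\<exists>a b. p = [:a, b:]"
proof (intro exI poly_eqI)
  fix k show "coeff p k = coeff [:coeff p 0, coeff p 1:] k"
    using assms by (auto simp: coeff_pCons coeff_eq_0 split: nat.splits)
qed

lemma const_ratfun_hom: "comm_ring_hom (const_ratfun :: 'a::field \<Rightarrow> _)"
proof -
  have "const_ratfun = (\<lambda>c::'a. to_fract (mconst c))"
    by (simp add: const_ratfun_def to_fract_def fun_eq_iff)
  then show ?thesis using comm_ring_hom_comp[OF to_fract_ring_hom mconst_hom] by metis
qed

lemma const_ratfun_altdef: "const_ratfun c = to_fract (mconst c)"
  by (simp add: const_ratfun_def to_fract_def)

lemma subst_ratfun_hom: "comm_ring_hom (\<lambda>a. subst_ratfun a h)"
  unfolding subst_ratfun_def by (rule comm_ring_hom_comp[OF poly_eval_hom map_poly_hom[OF const_ratfun_hom]])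

lemma subst_ratfun_const: "subst_ratfun [:c:] h = const_ratfun c"
  and subst_ratfun_linear: "subst_ratfun [:c, e:] h = const_ratfun c + h * const_ratfun e"
proof -
  interpret comm_ring_hom "const_ratfun :: 'a \<Rightarrow> _" by (rule const_ratfun_hom)
  show "subst_ratfun [:c:] h = const_ratfun c" "subst_ratfun [:c, e:] h = const_ratfun c + h * const_ratfun e"
    by (simp_all add: subst_ratfun_def map_poly_pCons_0 hom_zero)
qed

text \<open>The field generated by h over the constants.\<close>

definition QH :: "'a::field mpoly fract \<Rightarrow> 'a mpoly fract set" where
  "QH h = {subst_ratfun A h / subst_ratfun B h | A B. subst_ratfun B h \<noteq> 0}"

lemma QH_mult: "x \<in> QH h \<Longrightarrow> y \<in> QH h \<Longrightarrow> x * y \<in> QH h"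
  and QH_diff: "x \<in> QH h \<Longrightarrow> y \<in> QH h \<Longrightarrow> x - y \<in> QH h"
  and QH_divide: "x \<in> QH h \<Longrightarrow> y \<in> QH h \<Longrightarrow> x / y \<in> QH h"
  and QH_const: "const_ratfun c \<in> QH h" and QH_self: "h \<in> QH h"
proof -
  interpret comm_ring_hom "\<lambda>a. subst_ratfun a h" by (rule subst_ratfun_hom)
  interpret c: comm_ring_hom "const_ratfun :: 'a \<Rightarrow> _" by (rule const_ratfun_hom)
  {
    assume "x \<in> QH h" "y \<in> QH h"
    then obtain A B C D where x: "x = subst_ratfun A h / subst_ratfun B h" "subst_ratfun B h \<noteq> 0"
      and y: "y = subst_ratfun C h / subst_ratfun D h" "subst_ratfun D h \<noteq> 0" unfolding QH_def by blast
    show "x * y \<in> QH h"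
      unfolding QH_def using x y by (intro CollectI exI[of _ "A * C"] exI[of _ "B * D"]) (simp add: hom_mult)
    have "x - y = subst_ratfun (A * D - C * B) h / subst_ratfun (B * D) h"
      unfolding x(1) y(1) diff_frac_eq[OF x(2) y(2)] by (simp add: hom_mult hom_minus)
    moreover have "subst_ratfun (B * D) h \<noteq> 0" using x(2) y(2) by (simp add: hom_mult)
    ultimately show "x - y \<in> QH h" unfolding QH_def by blast
    show "x / y \<in> QH h"
    proof (cases "subst_ratfun C h = 0")
      case True
      then show ?thesis unfolding QH_def using y
        by (intro CollectI exI[of _ 0] exI[of _ 1]) (simp add: hom_zero hom_one)
    next
      case False
      have "x / y = subst_ratfun (A * D) h / subst_ratfun (B * C) h"
        unfolding x(1) y(1) divide_divide_times_eq by (simp add: hom_mult)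
      moreover have "subst_ratfun (B * C) h \<noteq> 0" using x(2) False by (simp add: hom_mult)
      ultimately show ?thesis unfolding QH_def by blast
    qed
  }
  show "const_ratfun c \<in> QH h" unfolding QH_def
    by (intro CollectI exI[of _ "[:c:]"] exI[of _ 1]) (simp add: subst_ratfun_const hom_one)
  show "h \<in> QH h" unfolding QH_def
    by (intro CollectI exI[of _ "[:0, 1:]"] exI[of _ 1]) (simp add: subst_ratfun_linear hom_one c.hom_zero c.hom_one)
qed

context leaf_setup
begin

text \<open>A Lueroth generator: a nonconstant ratio of least degree among those constant on the
  leaf. The degree is that of the pair, so minimality also enforces coprimality.\<close>

definition minimal_pair :: "'k mpoly \<Rightarrow> 'k mpoly \<Rightarrow> bool" where
  "minimal_pair a b \<longleftrightarrow> leaf a b \<and> nonprop a b \<and>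
     (\<forall>a' b'. leaf a' b' \<and> nonprop a' b' \<longrightarrow> pdeg a b \<le> pdeg a' b')"

lemma nonprop_nz: "nonprop a b \<Longrightarrow> a \<noteq> 0 \<and> b \<noteq> 0"
proof -
  assume a: "nonprop a b"
  then have "a \<noteq> mconst 0 * b" unfolding nonprop_def by blast
  with a show ?thesis by (simp add: nonprop_def)
qed

lemma nonprop_fg: "nonprop f g"
  unfolding nonprop_def
proof (intro conjI allI notI)
  fix c assume "f = mconst c * g"
  then have "g * pd j f - f * pd j g = 0" by (simp add: pd_mult algebra_simps)
  then show False using wj by simp
qed (use g_neq_0 in simp)

lemma leaf_fg: "leaf f g"
  unfolding leaf_iff using f g yy(2) by simp

lemma minimal_pair_coprime:
  assumes m: "minimal_pair a b" and c: "c dvd a" "c dvd b"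
  shows "c dvd 1"
proof -
  obtain a' b' where ab: "a = c * a'" "b = c * b'" using c unfolding dvd_def by blast
  have nz: "a \<noteq> 0" "b \<noteq> 0" using m nonprop_nz by (auto simp: minimal_pair_def)
  then have nz': "a' \<noteq> 0" "b' \<noteq> 0" "c \<noteq> 0" by (auto simp: ab)
  have abM: "a \<in> MP {..<n}" "b \<in> MP {..<n}" using m by (auto simp: minimal_pair_def leaf_def)
  have M: "a' \<in> MP {..<n}" "b' \<in> MP {..<n}" "c \<in> MP {..<n}"
    using MP_factor[of a' c "{..<n}"] MP_factor[of b' c "{..<n}"] MP_factor[of c a' "{..<n}"] abM nz
    by (simp_all add: ab mult.commute)
  have "Phi a b = zs c * xs c * Phi a' b'"
    unfolding Phi_def ab by (simp add: xs.hom_mult zs.hom_mult algebra_simps)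
  then have "ev (zs c) * ev (xs c) * ev (Phi a' b') = 0"
    using m by (simp add: minimal_pair_def leaf_iff ev.hom_mult)
  then have "leaf a' b'" unfolding leaf_iff using M ev_zs_neq_0[OF M(3) nz'(3)] nz' by (simp add: ev_xs)
  moreover have "nonprop a' b'"
    unfolding nonprop_def
  proof (intro conjI allI)
    fix k show "a' \<noteq> mconst k * b'"
    proof
      assume "a' = mconst k * b'"
      then have "a = mconst k * b" by (simp add: ab mult_ac)
      then show False using m by (auto simp: minimal_pair_def nonprop_def)
    qed
  qed fact
  ultimately have "pdeg a b \<le> pdeg a' b'" using m by (auto simp: minimal_pair_def)
  then have "tdeg c = 0" unfolding pdeg_def ab sdeg_mult[OF nz'(3,1)] sdeg_mult[OF nz'(3,2)] by linarith
  then show ?thesis using nz' by (simp add: dvd_1_iff_tdeg)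
qed

text \<open>The specializations of G at points Z include a nonproportional leaf pair, so the degree
  of G in X is at least that of (a, b), and the cofactor K of G in \<open>Phi a b\<close> is free of
  X. Specializing X at two points shows that K divides two independent combinations of a and b,
  hence both, so it is a unit.\<close>

lemma minimal_pair_Phi:
  assumes m: "minimal_pair a b"
  shows "Phi a b dvd G" "G dvd Phi a b"
proof -
  have M: "a \<in> MP {..<n}" "b \<in> MP {..<n}" and l: "leaf a b" and np: "nonprop a b"
    using m by (auto simp: minimal_pair_def leaf_def)
  show dv: "G dvd Phi a b"
    by (rule curve_dvd[OF MP_mono[OF Phi_MP[OF M] XZ_subset(1)]]) (use l in \<open>simp add: leaf_iff\<close>)
  then obtain K where K: "Phi a b = G * K" by (auto elim: dvdE)
  obtain \<theta> \<theta>' where det: "pv \<theta> a * pv \<theta>' b \<noteq> pv \<theta>' a * pv \<theta> b" using nonprop_points[OF np] by blast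
  have Phi0: "Phi a b \<noteq> 0"
  proof
    assume "Phi a b = 0"
    then have e: "a * mconst (pv \<theta> b) - mconst (pv \<theta> a) * b = 0" for \<theta>
      using px_Phi[of \<theta> a b] comm_ring_hom.axioms(1)[OF px_hom[of \<theta>]] by (simp add: px_def)
    interpret comm_ring_hom "pv \<theta>'" by (rule pv_hom)
    have "pv \<theta>' (a * mconst (pv \<theta> b) - mconst (pv \<theta> a) * b) = 0" unfolding e by simp
    then show False using det by (simp add: hom_minus hom_mult)
  qed
  have nzK: "K \<noteq> 0" using Phi0 K by auto
  have KM: "K \<in> MP (Xv \<union> Zv)" using MP_factor[of K G] Phi_MP[OF M] Phi0 K by (simp add: mult.commute)
  obtain \<alpha> \<beta> where np2: "nonprop (pt \<alpha> G) (pt \<beta> G)" using G_nonprop_pair by blast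
  then have "leaf (pt \<alpha> G) (pt \<beta> G)" using G_pair_leaf nonprop_nz by blast
  then have "pdeg a b \<le> pdeg (pt \<alpha> G) (pt \<beta> G)" using np2 m by (auto simp: minimal_pair_def)
  also have "\<dots> \<le> sdeg Xv G" unfolding pdeg_def using tdeg_pt[OF G_MP] by simp
  finally have "sdeg Xv (Phi a b) \<le> sdeg Xv G" using sdeg_Phi(1)[OF M] by linarith
  then have "sdeg Xv K = 0" unfolding K sdeg_mult[OF G_neq_0 nzK] by simp
  then have "K \<in> MP (- Xv \<inter> (Xv \<union> Zv))" using MP_Int[OF _ KM] by (simp add: sdeg_0_iff)
  then have KZ: "K \<in> MP Zv" by (rule MP_mono) auto
  define K' where "K' = mev mconst (\<lambda>v. mvar (v div 2)) K"
  have K': "px \<tau> K = K'" for \<tau> unfolding px_def K'_def by (rule mev_cong[OF KZ]) (auto simp: Zv_def)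
  have zK: "zs K' = K"
  proof -
    have "zs (px \<theta> K) = (\<lambda>x. x) K"
      by (rule hom_eq_on_MP[OF KZ comm_ring_hom_comp[OF zs_hom px_hom] comm_ring_hom_id])
        (auto simp: Zv_def elim!: oddE)
    then show ?thesis by (simp add: K')
  qed
  have dK: "K' dvd a * mconst (pv \<tau> b) - mconst (pv \<tau> a) * b" for \<tau>
  proof -
    interpret comm_ring_hom "px \<tau>" by (rule px_hom)
    have "px \<tau> (Phi a b) = px \<tau> G * K'" unfolding K by (simp add: hom_mult K')
    then show ?thesis unfolding px_Phi by simp
  qed
  \<comment> \<open>The determinant of the combinations of a and b obtained at \<theta> and
    \<theta>'; Cramer's rule gives back multiples of a and b.\<close>
  define D where "D = pv \<theta> a * pv \<theta>' b - pv \<theta>' a * pv \<theta> b"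
  have D: "D \<noteq> 0" using det by (simp add: D_def)
  have uD: "mconst (inverse D) * mconst D = (1 :: 'k mpoly)" using D by (simp add: mult_single)
  let ?r = "\<lambda>\<tau>. a * mconst (pv \<tau> b) - mconst (pv \<tau> a) * b"
  have cm: "mconst (x * y) = mconst x * mconst y" "mconst (x - y) = mconst x - mconst y" for x y :: 'k
    by (simp_all add: mult_single single_diff)
  have "mconst (pv \<theta> a) * ?r \<theta>' - mconst (pv \<theta>' a) * ?r \<theta> = mconst D * a"
    unfolding D_def cm by (simp add: algebra_simps)
  then have "K' dvd mconst D * a" using dK by (metis dvd_diff dvd_mult)
  then have "K' dvd mconst (inverse D) * (mconst D * a)" by (rule dvd_mult)
  then have Ka: "K' dvd a" unfolding mult.assoc[symmetric] uD by simp
  have "mconst (pv \<theta> b) * ?r \<theta>' - mconst (pv \<theta>' b) * ?r \<theta> = mconst D * b"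
    unfolding D_def cm by (simp add: algebra_simps)
  then have "K' dvd mconst D * b" using dK by (metis dvd_diff dvd_mult)
  then have "K' dvd mconst (inverse D) * (mconst D * b)" by (rule dvd_mult)
  then have Kb: "K' dvd b" unfolding mult.assoc[symmetric] uD by simp
  have "K' dvd 1" by (rule minimal_pair_coprime[OF m Ka Kb])
  then obtain L where "K' * L = 1" by (auto elim: dvdE)
  then have "K * zs L = 1" using zs.hom_mult[of K' L] by (simp add: zK zs.hom_one)
  then have "G = Phi a b * zs L" unfolding K by (simp add: mult.assoc)
  then show "Phi a b dvd G" by simp
qed

text \<open>\<open>Phi h1 h2\<close> divides \<open>Phi a b\<close>, and specializing X in the
  quotient at two points gives a leaf pair of smaller degree. Its ratio times a rational function of
  h1 / h2 is a Moebius transform of a / b.\<close>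

lemma leaf_in_QH:
  assumes m: "minimal_pair h1 h2" and l: "leaf a b" "b \<noteq> 0"
  shows "to_fract a / to_fract b \<in> QH (to_fract h1 / to_fract h2)"
  using l
proof (induction "pdeg a b" arbitrary: a b rule: less_induct)
  case less
  let ?Q = "QH (to_fract h1 / to_fract h2)"
  have hM: "h1 \<in> MP {..<n}" "h2 \<in> MP {..<n}" and hl: "leaf h1 h2" and hnp: "nonprop h1 h2"
    using m by (auto simp: minimal_pair_def leaf_def)
  have M: "a \<in> MP {..<n}" "b \<in> MP {..<n}" using less.prems by (auto simp: leaf_def)
  show ?case
  proof (cases "nonprop a b")
    case False
    then obtain c where "a = mconst c * b" using less.prems by (auto simp: nonprop_def)
    then have "to_fract a / to_fract b = const_ratfun c" using less.prems by (simp add: const_ratfun_altdef)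
    then show ?thesis using QH_const by metis
  next
    case True
    obtain \<theta> \<theta>' where det: "pv \<theta> a * pv \<theta>' b \<noteq> pv \<theta>' a * pv \<theta> b" using nonprop_points[OF True] by blast
    have "G dvd Phi a b"
      by (rule curve_dvd[OF MP_mono[OF Phi_MP[OF M] XZ_subset(1)]]) (use less.prems in \<open>simp add: leaf_iff\<close>)
    then have "Phi h1 h2 dvd Phi a b" using minimal_pair_Phi[OF m] dvd_trans by blast
    then obtain E where E: "Phi a b = Phi h1 h2 * E" by (auto elim: dvdE)
    define r where "r \<tau> = a * mconst (pv \<tau> b) - mconst (pv \<tau> a) * b" for \<tau>
    define hr where "hr \<tau> = h1 * mconst (pv \<tau> h2) - mconst (pv \<tau> h1) * h2" for \<tau>
    have rE: "r \<tau> = hr \<tau> * px \<tau> E" for \<tau>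
    proof -
      interpret comm_ring_hom "px \<tau>" by (rule px_hom)
      show ?thesis using arg_cong[OF E, of "px \<tau>"] unfolding r_def hr_def px_Phi[symmetric] by (simp add: hom_mult)
    qed
    have r0: "r \<tau> \<noteq> 0" if "\<tau> = \<theta> \<or> \<tau> = \<theta>'" for \<tau>
    proof
      assume "r \<tau> = 0"
      then have e: "pv \<sigma> (r \<tau>) = 0" for \<sigma> by simp
      have "pv \<sigma> a * pv \<tau> b - pv \<tau> a * pv \<sigma> b = 0" for \<sigma>
      proof -
        interpret comm_ring_hom "pv \<sigma>" by (rule pv_hom)
        show ?thesis using e[of \<sigma>] by (simp add: r_def hom_minus hom_mult)
      qed
      from this[of \<theta>] this[of \<theta>'] that det show False by auto
    qed
    have nz: "hr \<theta> \<noteq> 0" "hr \<theta>' \<noteq> 0" "px \<theta> E \<noteq> 0" "px \<theta>' E \<noteq> 0"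
      using r0[of \<theta>] r0[of \<theta>'] rE by auto
    have Phi0: "Phi a b \<noteq> 0" using r0[of \<theta>] px_Phi[of \<theta> a b] unfolding r_def[symmetric] by (auto simp: px_def)
    have E0: "E \<noteq> 0" "Phi h1 h2 \<noteq> 0" using Phi0 E by auto
    have EM: "E \<in> MP (Xv \<union> Zv)" using MP_factor[of E "Phi h1 h2"] Phi_MP[OF M] Phi0 E by (simp add: mult.commute)
    have rM: "r \<tau> \<in> MP {..<n}" "hr \<tau> \<in> MP {..<n}" for \<tau> using M hM by (simp_all add: r_def hr_def)
    have rl: "ev (zs (p * mconst u - mconst v * q)) * cst (xs (p * mconst u' - mconst v' * q)) =
       cst (xs (p * mconst u - mconst v * q)) * ev (zs (p * mconst u' - mconst v' * q))"
      if "leaf p q" for p q u v u' v'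
    proof -
      have pq: "ev (zs p) * cst (xs q) = cst (xs p) * ev (zs q)" using that by (simp add: leaf_def)
      interpret c: comm_ring_hom cst by (rule cst_hom')
      define A B C D where "A = ev (zs p)" and "B = ev (zs q)" and "C = cst (xs p)" and "D = cst (xs q)"
      define x y x' y' where "x = cst (mconst u)" and "y = cst (mconst v)" and "x' = cst (mconst u')" and "y' = cst (mconst v')"
      have "(A * x - y * B) * (C * x' - y' * D) - (C * x - y * D) * (A * x' - y' * B) = (x * y' - y * x') * (C * B - A * D)"
        by (simp add: algebra_simps)
      also have "\<dots> = 0" using pq by (simp add: A_def B_def C_def D_def)
      finally have "(A * x - y * B) * (C * x' - y' * D) = (C * x - y * D) * (A * x' - y' * B)" by simp
      moreover have "ev (mconst u) = cst (mconst u)" for u by (simp add: ev_def)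
      ultimately show ?thesis
        unfolding A_def B_def C_def D_def x_def y_def x'_def y'_def
        by (simp only: zs.hom_minus zs.hom_mult xs.hom_minus xs.hom_mult ev.hom_minus ev.hom_mult
            zs_simps xs_simps c.hom_minus c.hom_mult)
    qed
    have l1: "ev (zs (r \<theta>)) * cst (xs (r \<theta>')) = cst (xs (r \<theta>)) * ev (zs (r \<theta>'))"
      unfolding r_def by (rule rl[OF less.prems(1)])
    have l2: "ev (zs (hr \<theta>)) * cst (xs (hr \<theta>')) = cst (xs (hr \<theta>)) * ev (zs (hr \<theta>'))"
      unfolding hr_def by (rule rl[OF hl])
    let ?e = "px \<theta> E" and ?e' = "px \<theta>' E"
    have "leaf ?e ?e'"
      unfolding leaf_def
    proof (intro conjI)
      interpret c: comm_ring_hom cst by (rule cst_hom')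
      have "(ev (zs (hr \<theta>)) * cst (xs (hr \<theta>'))) * (ev (zs ?e) * cst (xs ?e')) =
        (ev (zs (hr \<theta>)) * cst (xs (hr \<theta>'))) * (cst (xs ?e) * ev (zs ?e'))"
        using l1 unfolding rE zs.hom_mult xs.hom_mult ev.hom_mult c.hom_mult
        by (subst (2) l2) (simp only: mult_ac)
      moreover have "ev (zs (hr \<theta>)) * cst (xs (hr \<theta>')) \<noteq> 0" using nz ev_zs_neq_0[OF rM(2)] by simp
      ultimately show "ev (zs ?e) * cst (xs ?e') = cst (xs ?e) * ev (zs ?e')" by simp
    qed (use px_MP[OF EM] in auto)
    moreover have "pdeg ?e ?e' < pdeg a b"
    proof -
      \<comment> \<open>Otherwise \<open>Phi h1 h2\<close> would be free of Z and could not vanish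
        on the curve.\<close>
      have "sdeg Zv (Phi h1 h2) \<noteq> 0"
      proof
        assume "sdeg Zv (Phi h1 h2) = 0"
        then have "Phi h1 h2 \<in> MP (- Zv)" by (simp add: sdeg_0_iff)
        then have "Phi h1 h2 \<in> MP (- Zv \<inter> (Xv \<union> Zv))" using Phi_MP[OF hM] by (rule MP_Int)
        then have "Phi h1 h2 \<in> MP Tv" by (rule MP_mono) (use XZ_subset in auto)
        then show False using curve_elim[of "Phi h1 h2"] hl E0 by (simp add: leaf_iff)
      qed
      then have "sdeg Zv E < sdeg Zv (Phi a b)" unfolding E sdeg_mult[OF E0(2,1)] by simp
      moreover have "pdeg ?e ?e' \<le> sdeg Zv E" unfolding pdeg_def using tdeg_px[OF EM] by simp
      ultimately show ?thesis using sdeg_Phi(2)[OF M] by linarith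
    qed
    ultimately have eQ: "to_fract ?e / to_fract ?e' \<in> ?Q" using less.hyps[of ?e ?e'] nz by simp
    have cQ: "const_ratfun c \<in> ?Q" for c by (rule QH_const)
    define \<eta> where "\<eta> = to_fract h1 / to_fract h2"
    have h20: "to_fract h2 \<noteq> 0" using nonprop_nz[OF hnp] by simp
    have hrQ: "to_fract (hr \<tau>) / to_fract h2 \<in> ?Q" for \<tau>
    proof -
      have "to_fract (hr \<tau>) / to_fract h2 = \<eta> * const_ratfun (pv \<tau> h2) - const_ratfun (pv \<tau> h1)"
        using h20 by (simp add: hr_def \<eta>_def const_ratfun_altdef field_simps)
      also have "\<dots> \<in> ?Q" unfolding \<eta>_def by (intro QH_diff QH_mult QH_self cQ)
      finally show ?thesis .
    qed
    \<comment> \<open>The Moebius transform of a / b with its zero at the value at \<theta> and its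
      pole at the value at \<theta>'. By \<open>rE\<close> it is built from h1 / h2 and the smaller
      pair; \<open>W2\<close> inverts it.\<close>
    define W where "W = to_fract (r \<theta>) / to_fract (r \<theta>')"
    have "W = (to_fract (hr \<theta>) / to_fract h2) / (to_fract (hr \<theta>') / to_fract h2) * (to_fract ?e / to_fract ?e')"
      unfolding W_def rE using h20 nz by (simp add: field_simps)
    also have "\<dots> \<in> ?Q" by (intro QH_mult QH_divide hrQ eQ)
    finally have WQ: "W \<in> ?Q" .
    define A B A' B' where "A = const_ratfun (pv \<theta> a)" and "B = const_ratfun (pv \<theta> b)"
      and "A' = const_ratfun (pv \<theta>' a)" and "B' = const_ratfun (pv \<theta>' b)"
    let ?a = "to_fract a" and ?b = "to_fract b"
    have b0: "?b \<noteq> 0" using less.prems by simp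
    have W1: "W * (?a * B' - A' * ?b) = ?a * B - A * ?b"
    proof -
      have tr: "?a * const_ratfun (pv \<tau> b) - const_ratfun (pv \<tau> a) * ?b = to_fract (r \<tau>)" for \<tau>
        by (simp add: r_def const_ratfun_altdef)
      show ?thesis unfolding A_def B_def A'_def B'_def tr W_def using r0[of \<theta>'] by simp
    qed
    have W2: "?a * (W * B' - B) = ?b * (W * A' - A)" using W1 by (simp add: algebra_simps)
    have "W * B' - B \<noteq> 0"
    proof
      assume z: "W * B' - B = 0"
      then have "W * A' - A = 0" using W2 b0 by simp
      then have "A = W * A'" "B = W * B'" using z by simp_all
      then have "A * B' = A' * B" by simp
      then have "mconst (pv \<theta> a) * mconst (pv \<theta>' b) = mconst (pv \<theta>' a) * mconst (pv \<theta> b)"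
        unfolding A_def B_def A'_def B'_def const_ratfun_altdef by (simp flip: to_fract_mult)
      then show False using det by (simp add: mult_single)
    qed
    then have "?a / ?b = (W * A' - A) / (W * B' - B)" using W2 b0 by (simp add: field_simps)
    also have "\<dots> \<in> ?Q" unfolding A_def B_def A'_def B'_def by (intro QH_divide QH_diff QH_mult WQ cQ)
    finally show ?thesis .
  qed
qed

text \<open>A minimal pair of smaller degree would give f / g = A(h) / B(h) with h = h1 / h2. If A
  and B had degree at most 1, f and g would divide linear combinations of h1 and h2, which have
  smaller degree; so this would be a proper composition.\<close>

theorem noncomposite_minimal:
  assumes cop: "mpoly_coprime f g" and nc: "\<not> composite n (to_fract f / to_fract g)"
  shows "minimal_pair f g"
proof (rule ccontr)
  assume nm: "\<not> minimal_pair f g"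
  define P where "P ab \<longleftrightarrow> leaf (fst ab) (snd ab) \<and> nonprop (fst ab) (snd ab)" for ab
  have "P (f, g)" using leaf_fg nonprop_fg by (simp add: P_def)
  then obtain ab where ab: "P ab" "\<And>ab'. P ab' \<Longrightarrow> pdeg (fst ab) (snd ab) \<le> pdeg (fst ab') (snd ab')"
    using ex_has_least_nat[of P "(f, g)" "\<lambda>ab. pdeg (fst ab) (snd ab)"] by blast
  define h1 h2 where "h1 = fst ab" and "h2 = snd ab"
  have m: "minimal_pair h1 h2" unfolding minimal_pair_def h1_def h2_def using ab by (force simp: P_def)
  have lt: "pdeg h1 h2 < pdeg f g"
  proof -
    obtain a' b' where "leaf a' b'" "nonprop a' b'" "pdeg a' b' < pdeg f g"
      using nm leaf_fg nonprop_fg by (auto simp: minimal_pair_def not_le)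
    then show ?thesis using m unfolding minimal_pair_def by (meson le_less_trans)
  qed
  have hM: "h1 \<in> MP {..<n}" "h2 \<in> MP {..<n}" and hnp: "nonprop h1 h2"
    using m by (auto simp: minimal_pair_def leaf_def)
  define \<eta> where "\<eta> = to_fract h1 / to_fract h2"
  interpret s: comm_ring_hom "\<lambda>a. subst_ratfun a \<eta>" by (rule subst_ratfun_hom)
  \<comment> \<open>Among all representations one with a denominator of least degree is taken; this
    makes A and B coprime.\<close>
  define R where "R AB \<longleftrightarrow> subst_ratfun (snd AB) \<eta> \<noteq> 0 \<and>
     to_fract f / to_fract g = subst_ratfun (fst AB) \<eta> / subst_ratfun (snd AB) \<eta>" for AB
  have "to_fract f / to_fract g \<in> QH \<eta>" unfolding \<eta>_def by (rule leaf_in_QH[OF m leaf_fg g_neq_0])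
  then obtain A0 B0 where "R (A0, B0)" unfolding QH_def R_def by auto
  then obtain AB where AB: "R AB" "\<And>AB'. R AB' \<Longrightarrow> degree (snd AB) \<le> degree (snd AB')"
    using ex_has_least_nat[of R "(A0, B0)" "\<lambda>AB. degree (snd AB)"] by blast
  obtain A B where [simp]: "AB = (A, B)" by (cases AB)
  have B0: "subst_ratfun B \<eta> \<noteq> 0" and r: "to_fract f / to_fract g = subst_ratfun A \<eta> / subst_ratfun B \<eta>"
    using AB(1) by (simp_all add: R_def)
  have Bnz: "B \<noteq> 0" using B0 by (auto simp: s.hom_zero)
  have cAB: "coprime A B"
  proof (rule coprimeI)
    fix c assume c: "c dvd A" "c dvd B"
    then obtain A' B' where AB': "A = c * A'" "B = c * B'" unfolding dvd_def by blast
    have "R (A', B')" using B0 r by (simp add: R_def AB' s.hom_mult)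
    then have "degree B \<le> degree B'" using AB(2)[of "(A', B')"] by simp
    moreover have "degree B = degree c + degree B'" using Bnz unfolding AB' by (intro degree_mult_eq) auto
    ultimately have "degree c = 0" by simp
    then show "is_unit c" using Bnz AB' by (auto simp: is_unit_iff_degree)
  qed
  have deg: "max (degree A) (degree B) \<ge> 2"
  proof (rule ccontr)
    assume "\<not> ?thesis"
    then have "degree A \<le> 1" "degree B \<le> 1" by auto
    then obtain a0 a1 b0 b1 where A: "A = [:a0, a1:]" and B: "B = [:b0, b1:]"
      using degree_le_1_form by blast
    define P Q where "P = mconst a0 * h2 + mconst a1 * h1" and "Q = mconst b0 * h2 + mconst b1 * h1"
    have h20: "to_fract h2 \<noteq> 0" using nonprop_nz[OF hnp] by simp
    have sA: "subst_ratfun A \<eta> = to_fract P / to_fract h2" "subst_ratfun B \<eta> = to_fract Q / to_fract h2"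
      using h20 by (simp_all add: A B subst_ratfun_linear P_def Q_def \<eta>_def const_ratfun_altdef field_simps)
    have Q0: "Q \<noteq> 0" using B0 sA by auto
    have fg0: "f \<noteq> 0" "g \<noteq> 0" using nonprop_nz[OF nonprop_fg] by auto
    have "to_fract (f * Q) = to_fract (g * P)" using r h20 Q0 fg0 unfolding sA by (simp add: field_simps)
    then have eq: "f * Q = g * P" by (simp only: to_fract_eq_iff)
    have P0: "P \<noteq> 0" using eq Q0 fg0 by auto
    have "f dvd g * P" "g dvd f * Q" using eq by (metis dvd_triv_left)+
    then have "f dvd P" "g dvd Q" using cop coprime_dvd_mult_mpoly[of f g P] coprime_dvd_mult_mpoly[of g f Q] fg0
      by (auto simp: mpoly_coprime_def)
    then obtain f' g' where "P = f * f'" "Q = g * g'" unfolding dvd_def by blast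
    then have "tdeg f \<le> tdeg P" "tdeg g \<le> tdeg Q"
      using P0 Q0 sdeg_mult[of f f' UNIV] sdeg_mult[of g g' UNIV] by auto
    moreover have "tdeg (mconst x * h2 + mconst y * h1) \<le> pdeg h1 h2" for x y
    proof -
      interpret t: comm_ring_hom "tpol UNIV :: 'k mpoly \<Rightarrow> _" by (rule tpol_hom)
      show ?thesis unfolding sdeg_def pdeg_def t.hom_add t.hom_mult tpol_mconst
        by (rule degree_add_le) (auto simp: le_max_iff_disj intro: order.trans[OF degree_smult_le])
    qed
    ultimately have "pdeg f g \<le> pdeg h1 h2" unfolding P_def Q_def pdeg_def[of f g] by (meson max.boundedI order.trans)
    then show False using lt by simp
  qed
  have "\<eta> \<in> ratfuns n"
    unfolding ratfuns_def mpolys_eq_MP \<eta>_def Fract_conv_to_fract using hM nonprop_nz[OF hnp] by blast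
  then have "composite n (to_fract f / to_fract g)"
    unfolding composite_def using Bnz cAB deg B0 r by blast
  then show False using nc by simp
qed

end

subsection \<open>Closed forms in characteristic zero\<close>

lemma pd_commute: "pd i (pd k q) = pd k (pd i q)"
  using MP_UNIV[of q]
  by (induction rule: MP_induct) (simp_all add: pd_add pd_mult pd_mvar algebra_simps)

lemma prime_elem_power_dvd_cancel:
  fixes p :: "'a::idom"
  assumes p: "prime_elem p" and n: "\<not> p dvd F" and d: "p ^ m dvd F * W"
  shows "p ^ m dvd W"
  using d
proof (induction m arbitrary: W)
  case (Suc m)
  then have "p dvd F * W" by (meson dvd_trans dvd_power zero_less_Suc)
  then have "p dvd W" using p n by (auto simp: prime_elem_dvd_mult_iff)
  then obtain W' where W': "W = p * W'" unfolding dvd_def by blast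
  have "p * p ^ m dvd p * (F * W')" using Suc.prems by (simp add: W' mult_ac)
  then have "p ^ m dvd F * W'" using p unfolding dvd_mult_cancel_left prime_elem_def by blast
  then have "p ^ m dvd W'" by (rule Suc.IH)
  then show ?case unfolding W' power_Suc by (rule mult_dvd_mono[OF dvd_refl])
qed simp

text \<open>Euler's identity for all homogeneous components at once: the left side multiplies the
  component of degree k by k.\<close>

lemma euler_tpol:
  fixes q :: "'a::idom mpoly"
  assumes "finite S"
  shows "[:0, 1:] * pderiv (tpol S q) = tpol S (\<Sum>v\<in>S. mvar v * pd v q)"
proof -
  interpret comm_ring_hom "tpol S :: 'a mpoly \<Rightarrow> _" by (rule tpol_hom)
  obtain T where T: "finite T" "q \<in> MP T" using MP_finite by blast
  have "pderiv (tpol S q) = (\<Sum>u\<in>T \<union> S. tpol S (pd u q) * pderiv (tpol S (mvar u)))"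
    by (rule chain_rule[OF tpol_hom])
      (use T assms in \<open>auto simp: pderiv_add pderiv_mult pderiv_pCons elim: MP_mono\<close>)
  also have "\<dots> = (\<Sum>u\<in>S. tpol S (pd u q) * [:mvar u:])"
    by (rule sum.mono_neutral_cong_right) (use T assms in \<open>auto simp: tpol_mvar pderiv_pCons\<close>)
  finally have e: "pderiv (tpol S q) = (\<Sum>u\<in>S. tpol S (pd u q) * [:mvar u:])" .
  have "[:0, 1:] * pderiv (tpol S q) = (\<Sum>u\<in>S. [:0, mvar u:] * tpol S (pd u q))"
    unfolding e sum_distrib_left by (intro sum.cong refl) simp
  also have "\<dots> = tpol S (\<Sum>v\<in>S. mvar v * pd v q)"
    by (simp add: hom_sum hom_mult tpol_mvar)
  finally show ?thesis .
qed

context leaf_setup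
begin

definition s :: nat where "s = 2 * n + 1"

text \<open>Restriction of Z to the plane Z_i = X_i + V_i s with Z_j free. Afterwards s and Z_j are
  the plane coordinates and the even variables are constants.\<close>

definition eta :: "'k mpoly \<Rightarrow> 'k mpoly" where
  "eta = mev mconst (\<lambda>v. if odd v \<and> v < 2 * n \<and> v \<noteq> zj
     then mvar (v - 1) + mvar (2 * n + (v - 1)) * mvar s else mvar v)"

definition Cv :: "nat set" where "Cv = {v. even v} \<union> {s, zj}"

lemma s_facts [simp]: "odd s" "s \<noteq> zj" "zj \<noteq> s" "\<not> s < 2 * n"
proof -
  show "s \<noteq> zj" using zj_facts(2) unfolding s_def by linarith
  then show "zj \<noteq> s" by simp
qed (simp_all add: s_def)

lemma even_parts:
  assumes "odd v"
  shows "v - 1 \<noteq> s" "v - 1 \<noteq> zj" "2 * n + (v - 1) \<noteq> s" "2 * n + (v - 1) \<noteq> zj"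
    "s \<noteq> v - 1" "zj \<noteq> v - 1" "s \<noteq> 2 * n + (v - 1)" "zj \<noteq> 2 * n + (v - 1)"
proof -
  have e: "even (v - 1)" "even (2 * n + (v - 1))" using assms by simp_all
  have "x \<noteq> y \<and> y \<noteq> x" if "even x" "odd y" for x y :: nat using that by auto
  from this[OF e(1) s_facts(1)] this[OF e(1) zj_facts(1)] this[OF e(2) s_facts(1)] this[OF e(2) zj_facts(1)]
  show "v - 1 \<noteq> s" "v - 1 \<noteq> zj" "2 * n + (v - 1) \<noteq> s" "2 * n + (v - 1) \<noteq> zj"
    "s \<noteq> v - 1" "zj \<noteq> v - 1" "s \<noteq> 2 * n + (v - 1)" "zj \<noteq> 2 * n + (v - 1)" by blast+
qed

lemma eta_hom: "comm_ring_hom eta"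
  unfolding eta_def by (rule mev_hom[OF mconst_hom])

sublocale eta: comm_ring_hom eta by (rule eta_hom)

lemma eta_mconst [simp]: "eta (mconst c) = mconst c"
  unfolding eta_def by (rule mev_mconst[OF mconst_hom])

lemma eta_mvar: "eta (mvar v) = (if odd v \<and> v < 2 * n \<and> v \<noteq> zj
     then mvar (v - 1) + mvar (2 * n + (v - 1)) * mvar s else mvar v)"
  unfolding eta_def by (rule mev_mvar[OF mconst_hom])

lemma ev_mvar: "ev (mvar v) = (if even v then cst (mvar v) else if v = s then fps_X
          else if v = zj then yy else cst (mvar (v - 1)) + cst (mvar (2 * n + (v - 1))) * fps_X)"
  unfolding ev_def ev0_mvar s_def by simp

lemma ev_mconst [simp]: "ev (mconst c) = cst (mconst c)"
  unfolding ev_def by (rule ev0_mconst)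

lemma ev_eta: "q \<in> MP ({v. even v} \<union> {v. odd v \<and> v \<le> s}) \<Longrightarrow> ev (eta q) = ev q"
  by (rule hom_eq_on_MP[OF _ comm_ring_hom_comp[OF ev.comm_ring_hom_axioms eta_hom] ev.comm_ring_hom_axioms])
    (auto simp: eta_mvar ev_mvar ev.hom_add ev.hom_mult)

lemma eta_id:
  assumes "q \<in> MP Cv"
  shows "eta q = q"
proof -
  have "eta q = (\<lambda>x. x) q"
    by (rule hom_eq_on_MP[OF assms eta_hom comm_ring_hom_id]) (auto simp: eta_mvar Cv_def)
  then show ?thesis .
qed

lemma ev_even: "q \<in> MP {v. even v} \<Longrightarrow> ev q = cst q"
  unfolding ev_def by (rule ev0_even)

text \<open>On the plane V_i s = Z_i - X_i, so a power of s trades the V_i with i other than j for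
  variables of \<open>Tz\<close>. This makes \<open>curve_dvd\<close> applicable to polynomials on
  the plane.\<close>

lemma eta_lift:
  assumes "p \<in> MP Cv"
  shows "\<exists>M q. q \<in> MP Tz \<and> eta q = mvar s ^ M * p"
  using assms
proof (induction rule: MP_induct)
  case (const c)
  show ?case by (intro exI[of _ 0] exI[of _ "mconst c"]) simp
next
  case (var v)
  show ?case
  proof (cases "v \<in> Tz")
    case True
    then have "eta (mvar v) = mvar v" using var by (intro eta_id) simp
    then show ?thesis using True by (intro exI[of _ 0] exI[of _ "mvar v"]) simp
  next
    case False
    then have v: "even v" "2 * n \<le> v" "v < 4 * n" "v \<noteq> 2 * (n + j)"
      using var by (auto simp: Tz_def Tv_def Cv_def s_def)
    from v(1) obtain k where k: "v = 2 * k" by (rule evenE)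
    define i where "i = k - n"
    have "n \<le> k" "k < 2 * n" "k \<noteq> n + j" using v(2-4) unfolding k by simp_all
    then have i: "v = 2 * (n + i)" "i < n" "i \<noteq> j" unfolding k i_def by auto
    let ?q = "mvar (2 * i + 1) - mvar (2 * i) :: 'k mpoly"
    have z: "2 * i + 1 \<noteq> zj" using i by (simp add: zj_def)
    have "2 * i + 1 \<in> Tz" "2 * i \<in> Tz" using i z by (auto simp: Tz_def Tv_def)
    then have "?q \<in> MP Tz" by simp
    moreover have "eta ?q = mvar s ^ 1 * mvar v"
      using i z by (simp add: eta.hom_minus eta_mvar mult.commute)
    ultimately show ?thesis by blast
  qed
next
  case (add p q)
  then obtain M p' N q' where "p' \<in> MP Tz" "eta p' = mvar s ^ M * p" "q' \<in> MP Tz" "eta q' = mvar s ^ N * q" by blast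
  moreover have "eta (mvar s) = mvar s" "s \<in> Tz" by (simp_all add: eta_mvar) (simp add: Tz_def Tv_def s_def)
  ultimately show ?case
    by (intro exI[of _ "M + N"] exI[of _ "mvar s ^ N * p' + mvar s ^ M * q'"])
      (simp add: eta.hom_add eta.hom_mult eta.hom_power power_add algebra_simps)
next
  case (mult p q)
  then obtain M p' N q' where "p' \<in> MP Tz" "eta p' = mvar s ^ M * p" "q' \<in> MP Tz" "eta q' = mvar s ^ N * q" by blast
  then show ?case
    by (intro exI[of _ "M + N"] exI[of _ "p' * q'"]) (simp add: eta.hom_mult power_add mult_ac)
qed

definition F :: "'k mpoly" where "F = eta (Phi f g)"

text \<open>The value at the base point s = 0, Z_j = X_j of the plane.\<close>

definition z0 :: "'k mpoly \<Rightarrow> 'k mpoly" where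
  "z0 = mev mconst (\<lambda>v. if even v then mvar v else if v = s then 0 else mvar (v - 1))"

lemma z0_hom: "comm_ring_hom z0"
  unfolding z0_def by (rule mev_hom[OF mconst_hom])

sublocale z0: comm_ring_hom z0 by (rule z0_hom)

lemma z0_simps [simp]: "z0 (mconst c) = mconst c"
  "z0 (mvar v) = (if even v then mvar v else if v = s then 0 else mvar (v - 1))"
  unfolding z0_def by (simp_all add: mev_mconst[OF mconst_hom] mev_mvar[OF mconst_hom])

lemma z0_eta: "q \<in> MP (Xv \<union> Zv) \<Longrightarrow> z0 (eta q) = diag q"
  by (rule hom_eq_on_MP[OF _ comm_ring_hom_comp[OF z0_hom eta_hom] diag_hom])
    (auto simp: eta_mvar z0.hom_add z0.hom_mult Xv_def Zv_def s_def)

lemma z0_MP: "z0 q \<in> MP {v. even v}" if "q \<in> MP Cv"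
  unfolding z0_def by (rule MP_mev[OF that]) (auto simp: Cv_def)

lemma ev_nth_0': "q \<in> MP Cv \<Longrightarrow> fps_nth (ev q) 0 = to_fract (z0 q)"
  by (rule hom_eq_on_MP[OF _ comm_ring_hom_comp[OF fps_nth_0_hom ev.comm_ring_hom_axioms]
        comm_ring_hom_comp[OF to_fract_ring_hom z0_hom]])
    (auto simp: ev_mvar yy(1) Cv_def)

lemma eta_MP: "eta q \<in> MP Cv" if "q \<in> MP (Xv \<union> Zv)"
  unfolding eta_def
  by (rule MP_mev[OF that]) (auto simp: Cv_def Xv_def Zv_def intro!: MP_add MP_mult)

lemma F_MP: "F \<in> MP Cv"
  unfolding F_def by (rule eta_MP[OF Phi_MP[OF f g]])

lemma ev_F: "ev F = 0"
  unfolding F_def using ev_eta[of "Phi f g"] yy(2) MP_mono[OF Phi_MP[OF f g]]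
  by (auto simp: Xv_def Zv_def s_def subset_iff)

lemma pd_zj_eta: "pd zj (eta q) = eta (pd zj q)"
proof -
  obtain S where S: "finite S" "q \<in> MP S" using MP_finite by blast
  have "pd zj (eta q) = (\<Sum>v\<in>insert zj S. eta (pd v q) * pd zj (eta (mvar v)))"
    by (rule chain_rule[OF eta_hom MP_mono[OF S(2)]]) (auto simp: S pd_add pd_mult)
  also have "\<dots> = (\<Sum>v\<in>insert zj S. if v = zj then eta (pd v q) else 0)"
  proof (intro sum.cong refl)
    fix v
    have "pd zj (eta (mvar v)) = (if v = zj then 1 else 0)"
    proof (cases "odd v \<and> v < 2 * n \<and> v \<noteq> zj")
      case True
      then have "zj \<noteq> v - 1" "zj \<noteq> 2 * n + (v - 1)" "zj \<noteq> s" using even_parts by auto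
      then show ?thesis using True by (simp add: eta_mvar pd_add pd_mult pd_mvar)
    next
      case False
      then show ?thesis by (auto simp: eta_mvar pd_mvar)
    qed
    then show "eta (pd v q) * pd zj (eta (mvar v)) = (if v = zj then eta (pd v q) else 0)" by simp
  qed
  finally show ?thesis using S by simp
qed

lemma z0_pd_F: "z0 (pd zj F) = xs (w j f g)"
  unfolding F_def pd_zj_eta using z0_eta[OF pd_MP[OF Phi_MP[OF f g]]] diag_pd_Phi by simp

text \<open>The derivative of F in Z_j would be divisible by s as well, but at the base point it is
  \<open>w j f g\<close>.\<close>

lemma mvar_s_not_dvd_F: "\<not> mvar s dvd F"
proof
  assume "mvar s dvd F"
  then obtain H where "F = mvar s * H" by (auto elim: dvdE)
  then have "pd zj F = mvar s * pd zj H" by (simp add: pd_mult pd_mvar)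
  then have "z0 (pd zj F) = 0" by (simp add: z0.hom_mult)
  then show False using wj by (simp add: z0_pd_F w_def)
qed

lemma tpol_zs: "tpol Zv (zs a) = map_poly zs (tpol UNIV a)" if "a \<in> MP {..<n}"
  by (rule hom_eq_on_MP[OF that comm_ring_hom_comp[OF tpol_hom zs_hom]
     comm_ring_hom_comp[OF map_poly_hom[OF zs_hom] tpol_hom]])
    (auto simp: tpol_mvar map_poly_pCons_0 zs.hom_zero Zv_def)

text \<open>Otherwise the components p, q of f, g in degree d = \<open>pdeg f g\<close> satisfy p(Z)
  g(X) = f(X) q(Z). Two points X with different values of f / g force p = q = 0, although one of f,
  g has degree d.\<close>

lemma top_Phi_neq_0: "coeff (tpol Zv (Phi f g)) (pdeg f g) \<noteq> 0"
proof
  let ?d = "pdeg f g"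
  define p q where "p = coeff (tpol UNIV f) ?d" and "q = coeff (tpol UNIV g) ?d"
  interpret t: comm_ring_hom "tpol Zv :: 'k mpoly \<Rightarrow> _" by (rule tpol_hom)
  have fx: "tpol Zv (xs a) = [:xs a:]" if "a \<in> MP {..<n}" for a
    by (rule tpol_free) (use xs_MP[OF that] in \<open>auto intro: MP_mono simp: Xv_def Zv_def\<close>)
  assume "coeff (tpol Zv (Phi f g)) ?d = 0"
  then have e: "zs p * xs g = xs f * zs q"
    unfolding Phi_def t.hom_minus t.hom_mult fx[OF f] fx[OF g] tpol_zs[OF f] tpol_zs[OF g]
    by (simp add: p_def q_def coeff_map_poly zs.hom_zero mult.commute)
  have e2: "p * mconst (pv \<theta> g) = mconst (pv \<theta> f) * q" for \<theta>
  proof -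
    interpret comm_ring_hom "px \<theta>" by (rule px_hom)
    show ?thesis using arg_cong[OF e, of "px \<theta>"] by (simp add: hom_mult)
  qed
  obtain \<theta> \<theta>' where det: "pv \<theta> f * pv \<theta>' g \<noteq> pv \<theta>' f * pv \<theta> g" using nonprop_points[OF nonprop_fg] by blast
  define A B A' B' where "A = mconst (pv \<theta> f)" and "B = mconst (pv \<theta> g)" and "A' = mconst (pv \<theta>' f)" and "B' = mconst (pv \<theta>' g)"
  have e3: "p * B = A * q" "p * B' = A' * q" using e2 by (simp_all add: A_def B_def A'_def B'_def)
  have D: "A * B' - A' * B \<noteq> 0" using det unfolding A_def B_def A'_def B'_def by (simp add: mult_single)
  have "(A * B' - A' * B) * q = (A * q) * B' - (A' * q) * B" by (simp add: algebra_simps)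
  also have "\<dots> = 0" unfolding e3[symmetric] by (simp add: mult_ac)
  finally have q0: "q = 0" using D by simp
  have "(A * B' - A' * B) * p = A * (p * B') - A' * (p * B)" by (simp add: algebra_simps)
  also have "\<dots> = 0" unfolding e3 by (simp add: mult_ac)
  finally have p0: "p = 0" using D by simp
  have "f \<noteq> 0" "g \<noteq> 0" using nonprop_nz[OF nonprop_fg] by auto
  then have "lead_coeff (tpol UNIV f) \<noteq> 0" "lead_coeff (tpol UNIV g) \<noteq> 0" by simp_all
  then show False using p0 q0 unfolding p_def q_def pdeg_def sdeg_def by (metis max_def)
qed

text \<open>The top form of F on the plane is that of Phi at Z_i = V_i s with Z_j kept. Setting s =
  1 and renaming V_i to Z_i recovers it, so a generic plane loses no degree.\<close>

lemma top_F_neq_0: "coeff (tpol {s, zj} F) (pdeg f g) \<noteq> 0"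
proof -
  let ?d = "pdeg f g" and ?H = "\<lambda>q. tpol {s, zj} (eta q)"
  define t where "t = coeff (tpol Zv (Phi f g)) ?d"
  have H: "comm_ring_hom ?H" by (rule comm_ring_hom_comp[OF tpol_hom eta_hom])
  interpret tp: comm_ring_hom "tpol {s, zj} :: 'k mpoly \<Rightarrow> _" by (rule tpol_hom)
  have ne: "v - 1 \<noteq> s" "v - 1 \<noteq> zj" "2 * n + (v - 1) \<noteq> s" "2 * n + (v - 1) \<noteq> zj" if "odd v" for v
    using even_parts[OF that] by blast+
  have Hv: "?H (mvar v) = (if even v then [:mvar v:] else if v \<noteq> zj then [:mvar (v - 1), mvar (2 * n + (v - 1)) * mvar s:] else [:0, mvar zj:])"
    if "v \<in> Xv \<union> Zv" for v
    using that ne[of v] by (auto simp: eta_mvar tp.hom_add tp.hom_mult tpol_mvar Xv_def Zv_def)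
  have "coeff (?H (Phi f g)) ?d = mev (\<lambda>c. coeff (?H (mconst c)) 0)
      (\<lambda>v. coeff (?H (mvar v)) (if v \<in> Zv then 1 else 0)) t"
    unfolding t_def
    by (rule hom_top_coeff[OF H Phi_MP[OF f g]]) 
      (use sdeg_Phi(2)[OF f g] in \<open>auto simp: Hv Xv_def Zv_def\<close>)
  also have "(\<lambda>c. coeff (?H (mconst c)) 0) = mconst" by (simp add: fun_eq_iff)
  finally have e: "coeff (tpol {s, zj} F) ?d = mev mconst (\<lambda>v. coeff (?H (mvar v)) (if v \<in> Zv then 1 else 0)) t"
    by (simp add: F_def)
  have tM: "t \<in> MP (Xv \<union> Zv)"
  proof -
    have "Poly_Mapping.keys t \<subseteq> Poly_Mapping.keys (Phi f g)"
      unfolding t_def by (auto simp: in_keys_iff lookup_coeff_tpol split: if_splits)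
    then show ?thesis using Phi_MP[OF f g] unfolding MP_def by blast
  qed
  \<comment> \<open>V_i has index 2 (n + i), and Z_i has index 2 i + 1.\<close>
  let ?R = "mev mconst (\<lambda>v. if v = s then 1 else if even v \<and> 2 * n \<le> v then mvar (v - 2 * n + 1) else mvar v) :: 'k mpoly \<Rightarrow> 'k mpoly"
  have R: "comm_ring_hom ?R" by (rule mev_hom[OF mconst_hom])
  interpret R: comm_ring_hom ?R by (rule R)
  have Rv: "?R (mvar v) = (if v = s then 1 else if even v \<and> 2 * n \<le> v then mvar (v - 2 * n + 1) else mvar v)" for v
    by (rule mev_mvar[OF mconst_hom])
  have "?R (mev mconst (\<lambda>v. coeff (?H (mvar v)) (if v \<in> Zv then 1 else 0)) t) = (\<lambda>x. x) t"
  proof (rule hom_eq_on_MP[OF tM comm_ring_hom_comp[OF R mev_hom[OF mconst_hom]] comm_ring_hom_id])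
    fix v assume v: "v \<in> Xv \<union> Zv"
    have "mev mconst (\<lambda>v. coeff (?H (mvar v)) (if v \<in> Zv then 1 else 0)) (mvar v) =
       (if even v then mvar v else if v \<noteq> zj then mvar (2 * n + (v - 1)) * mvar s else mvar zj :: 'k mpoly)"
      unfolding mev_mvar[OF mconst_hom] Hv[OF v] using v by (auto simp: Xv_def Zv_def)
    moreover have "even v \<Longrightarrow> v < 2 * n" "odd v \<Longrightarrow> v < 2 * n" "odd v \<Longrightarrow> v \<ge> 1" using v by (auto simp: Xv_def Zv_def odd_pos Suc_leI)
    moreover have "v \<noteq> s" using v by (auto simp: Xv_def Zv_def s_def)
    ultimately show "?R (mev mconst (\<lambda>v. coeff (?H (mvar v)) (if v \<in> Zv then 1 else 0)) (mvar v)) = mvar v"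
      using ne(3)[of v] by (auto simp: R.hom_mult Rv)
  qed (simp add: mev_mconst[OF mconst_hom])
  then show ?thesis unfolding e using top_Phi_neq_0 R.hom_zero by (metis t_def)
qed

text \<open>A lift of q vanishes on the curve, so it is divisible by G and, by minimality, by
  \<open>Phi f g\<close>. The power of s brought in by the lift cancels because s is prime and does
  not divide F; so F, of degree at least \<open>pdeg f g\<close>, divides q.\<close>

lemma curve_small_zero:
  assumes m: "minimal_pair f g" and q: "q \<in> MP Cv" "ev q = 0" "sdeg {s, zj} q < pdeg f g"
  shows "q = 0"
proof (rule ccontr)
  assume q0: "q \<noteq> 0"
  obtain M p where p: "p \<in> MP Tz" "eta p = mvar s ^ M * q" using eta_lift[OF q(1)] by blast
  have "Tz \<subseteq> {v. even v} \<union> {v. odd v \<and> v \<le> s}" 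
  proof -
    have "zj \<le> 2 * n + 1" using zj_facts(2) by linarith
    then show ?thesis by (auto simp: Tz_def Tv_def s_def)
  qed
  then have "ev p = ev (eta p)" using ev_eta MP_mono[OF p(1)] by simp
  also have "\<dots> = 0" by (simp add: p(2) ev.hom_mult q(2))
  finally have "G dvd p" by (rule curve_dvd[OF p(1)])
  then have "Phi f g dvd p" by (rule dvd_trans[OF minimal_pair_Phi(1)[OF m]])
  then obtain E where "p = Phi f g * E" by (auto elim: dvdE)
  then have E: "mvar s ^ M * q = F * eta E" using p(2) by (simp add: F_def eta.hom_mult)
  have "mvar s ^ M dvd F * eta E" unfolding E[symmetric] by simp
  then have "mvar s ^ M dvd eta E" by (rule prime_elem_power_dvd_cancel[OF prime_elem_mvar mvar_s_not_dvd_F])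
  then obtain W where "eta E = mvar s ^ M * W" by (auto elim: dvdE)
  then have "mvar s ^ M * q = mvar s ^ M * (F * W)" using E by (simp add: mult_ac)
  then have qF: "q = F * W" by simp
  then have "F \<noteq> 0" "W \<noteq> 0" using q0 by auto
  then have "sdeg {s, zj} F \<le> sdeg {s, zj} q" unfolding qF by (simp add: sdeg_mult)
  moreover have "pdeg f g \<le> sdeg {s, zj} F" unfolding sdeg_def by (rule le_degree[OF top_F_neq_0])
  ultimately show False using q(3) by simp
qed

lemma ev_deriv:
  assumes "q \<in> MP Cv"
  shows "fps_deriv (ev q) = ev (pd s q) + ev (pd zj q) * fps_deriv yy"
proof -
  obtain T where T: "finite T" "q \<in> MP T" using MP_finite by blast
  let ?S = "(T \<inter> Cv) \<union> {s, zj}"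
  have "q \<in> MP ?S" using MP_Int[OF T(2) assms] by (rule MP_mono) auto
  then have "fps_deriv (ev q) = (\<Sum>i\<in>?S. ev (pd i q) * fps_deriv (ev (mvar i)))"
    by (intro chain_rule_fps[OF ev.comm_ring_hom_axioms]) (use T in auto)
  also have "\<dots> = (\<Sum>i\<in>{s, zj}. ev (pd i q) * fps_deriv (ev (mvar i)))"
    by (rule sum.mono_neutral_right) (use T in \<open>auto simp: Cv_def ev_mvar\<close>)
  finally show ?thesis by (simp add: ev_mvar)
qed

text \<open>The residue b / Fy has zero derivative along the curve, so it equals its value NB / N at
  the base point. \<open>curve_small_zero\<close> turns the resulting relations on the curve into
  the identities \<open>NA\<close> and \<open>NBe\<close>.\<close>

theorem closed_form_zero:
  assumes m: "minimal_pair f g" and A: "A \<in> MP Cv" and B: "B \<in> MP Cv"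
    and degA: "sdeg {s, zj} A < pdeg f g" and degB: "sdeg {s, zj} B < pdeg f g"
    and degAB: "sdeg {s, zj} (mvar s * A + mvar zj * B) < pdeg f g"
    and closed: "F * (pd zj A - pd s B) = pd zj F * A - pd s F * B"
  shows "A = 0 \<and> B = 0"
proof -
  let ?d = "pdeg f g" and ?S = "{s, zj}"
  define N NB where "N = z0 (pd zj F)" and "NB = z0 B"
  have N0: "N \<noteq> 0" unfolding N_def z0_pd_F using wj by (simp add: w_def)
  have NM: "N \<in> MP {v. even v}" "NB \<in> MP {v. even v}" unfolding N_def NB_def using z0_MP pd_MP F_MP B by auto
  have "{v. even v} \<subseteq> Cv" by (auto simp: Cv_def)
  then have NC: "N \<in> MP Cv" "NB \<in> MP Cv" using MP_mono NM by blast+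
  have d0: "0 < ?d" using degA by simp
  have sF: "sdeg ?S F \<le> ?d"
  proof -
    have "sdeg ?S F \<le> sdeg Zv (Phi f g)"
      unfolding F_def sdeg_def[of ?S]
    proof (rule hom_degree_le[OF comm_ring_hom_comp[OF tpol_hom eta_hom] Phi_MP[OF f g]])
      fix v assume v: "v \<in> Xv \<union> Zv"
      interpret tp: comm_ring_hom "tpol ?S :: 'k mpoly \<Rightarrow> _" by (rule tpol_hom)
      have "odd v \<Longrightarrow> v - 1 \<noteq> s" "odd v \<Longrightarrow> v - 1 \<noteq> zj" "odd v \<Longrightarrow> 2 * n + (v - 1) \<noteq> s" "odd v \<Longrightarrow> 2 * n + (v - 1) \<noteq> zj"
        using even_parts by blast+
      then show "degree (tpol ?S (eta (mvar v))) \<le> (if v \<in> Zv then 1 else 0)"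
        using v by (auto simp: eta_mvar tp.hom_add tp.hom_mult tpol_mvar Xv_def Zv_def)
    qed simp
    then show ?thesis using sdeg_Phi(2)[OF f g] by simp
  qed
  define a b Fy Fx y' where "a = ev A" and "b = ev B" and "Fy = ev (pd zj F)" and "Fx = ev (pd s F)" and "y' = fps_deriv yy"
  define Ay Bx By Fyy Fxy where "Ay = ev (pd zj A)" and "Bx = ev (pd s B)" and "By = ev (pd zj B)"
    and "Fyy = ev (pd zj (pd zj F))" and "Fxy = ev (pd s (pd zj F))"
  \<comment> \<open>\<open>1\<close> is implicit differentiation of F = 0 along the curve,
    \<open>2\<close> the closedness equation restricted to the curve, and \<open>3\<close> its
    derivative in y, likewise restricted.\<close>
  have 1: "Fx + Fy * y' = 0" using ev_deriv[OF F_MP] unfolding ev_F Fx_def Fy_def y'_def by simp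
  have 2: "Fy * a = Fx * b"
    using arg_cong[OF closed, of ev] by (simp add: ev.hom_mult ev.hom_minus ev_F Fy_def Fx_def a_def b_def)
  have "Fy * (Ay - Bx) = (Fyy * a + Fy * Ay) - (Fxy * b + Fx * By)"
    using arg_cong[OF closed, of "\<lambda>q. ev (pd zj q)"]
    by (simp add: pd_mult pd_diff pd_commute[of zj s] ev.hom_mult ev.hom_minus ev.hom_add ev_F Fy_def Fx_def a_def b_def
        Ay_def Bx_def By_def Fyy_def Fxy_def mult_ac add_ac)
  then have 3: "Fy * Bx - Fx * By = Fxy * b - Fyy * a"
    by (simp add: algebra_simps)
  have 4: "fps_deriv Fy = Fxy + Fyy * y'" unfolding Fy_def Fxy_def Fyy_def y'_def by (rule ev_deriv[OF pd_MP[OF F_MP]])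
  have 5: "fps_deriv b = Bx + By * y'" unfolding b_def Bx_def By_def y'_def by (rule ev_deriv[OF B])
  have Fy0: "fps_nth Fy 0 = to_fract N" unfolding Fy_def N_def by (rule ev_nth_0'[OF pd_MP[OF F_MP]])
  have b0: "fps_nth b 0 = to_fract NB" unfolding b_def NB_def by (rule ev_nth_0'[OF B])
  have Fy_nz: "Fy \<noteq> 0" using Fy0 N0 by auto
  have Fyy': "Fy * y' = - Fx" using 1 by (simp add: eq_neg_iff_add_eq_0 add.commute)
  have "Fy * (fps_deriv b * Fy - b * fps_deriv Fy) =
      Fy * (Fy * Bx + By * (Fy * y') - b * Fxy) - b * Fyy * (Fy * y')"
    unfolding 4 5 by (simp add: algebra_simps)
  also have "\<dots> = Fy * ((Fy * Bx - Fx * By) - b * Fxy) + b * Fyy * Fx"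
    unfolding Fyy' by (simp add: algebra_simps)
  also have "\<dots> = Fyy * (Fx * b - Fy * a)" unfolding 3 by (simp add: algebra_simps)
  also have "\<dots> = 0" using 2 by simp
  finally have "fps_deriv b * Fy = b * fps_deriv Fy" using Fy_nz by simp
  then have bN: "b * cst N = cst NB * Fy" using fps_ratio_const[of b Fy] Fy0 b0 N0 by simp
  have "Fy * (a * cst N) = (Fy * a) * cst N" by (simp add: mult_ac)
  also have "\<dots> = Fx * (b * cst N)" unfolding 2 by (simp add: mult_ac)
  also have "\<dots> = Fy * (cst NB * Fx)" unfolding bN by (simp add: mult_ac)
  finally have aN: "a * cst N = cst NB * Fx" using Fy_nz by simp
  have sdN: "sdeg ?S (P * p) \<le> sdeg ?S p" if "P \<in> MP {v. even v}" for P p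
  proof -
    have "sdeg ?S P = 0" unfolding sdeg_0_iff using that by (rule MP_mono) auto
    then show ?thesis using sdeg_mult_le[of ?S P p] by simp
  qed
  have small: "N * P - NB * pd v F = 0" if "P \<in> MP Cv" "sdeg ?S P < ?d" "v \<in> ?S"
    "ev P * cst N = cst NB * ev (pd v F)" for P v
  proof (rule curve_small_zero[OF m])
    show "N * P - NB * pd v F \<in> MP Cv" using NC that(1) pd_MP[OF F_MP] by simp
    show "ev (N * P - NB * pd v F) = 0"
      using that(4) NM by (simp add: ev.hom_minus ev.hom_mult ev_even mult.commute)
    have "sdeg ?S (pd v F) < ?d" by (rule sdeg_pd_less[OF that(3) sF d0])
    then show "sdeg ?S (N * P - NB * pd v F) < ?d"
      using sdeg_diff_le[of ?S "N * P" "NB * pd v F"] sdN[OF NM(1), of P] sdN[OF NM(2), of "pd v F"] that(2) by linarith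
  qed
  have NA: "N * A = NB * pd s F" using small[OF A degA, of s] aN by (simp add: a_def Fx_def)
  have NBe: "N * B = NB * pd zj F" using small[OF B degB, of zj] bN by (simp add: b_def Fy_def)
  interpret tp: comm_ring_hom "tpol ?S :: 'k mpoly \<Rightarrow> _" by (rule tpol_hom)
  \<comment> \<open>By Euler's relation N (x A + y B) is NB times a polynomial whose component of
    degree d is d times that of F. The left side has degree below d, so NB = 0.\<close>
  have "N * (mvar s * A + mvar zj * B) = NB * (\<Sum>v\<in>?S. mvar v * pd v F)"
  proof -
    have "N * (mvar s * A + mvar zj * B) = mvar s * (N * A) + mvar zj * (N * B)" by (simp add: algebra_simps)
    then show ?thesis unfolding NA NBe by (simp add: algebra_simps)
  qed
  moreover have finite_S: "finite ?S" by simp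
  ultimately have "tpol ?S N * tpol ?S (mvar s * A + mvar zj * B) = tpol ?S NB * ([:0, 1:] * pderiv (tpol ?S F))"
    unfolding euler_tpol[of ?S F, OF finite_S] tp.hom_mult[symmetric] by (simp only:)
  moreover have "tpol ?S N = [:N:]" "tpol ?S NB = [:NB:]"
    by (rule tpol_free, rule MP_mono[OF NM(1)], auto, rule tpol_free, rule MP_mono[OF NM(2)], auto)
  ultimately have "smult N (tpol ?S (mvar s * A + mvar zj * B)) = smult NB (pCons 0 (pderiv (tpol ?S F)))" by simp
  then have "N * coeff (tpol ?S (mvar s * A + mvar zj * B)) ?d = NB * coeff (pCons 0 (pderiv (tpol ?S F))) ?d"
    unfolding coeff_smult[symmetric] by (rule arg_cong)
  moreover have "coeff (tpol ?S (mvar s * A + mvar zj * B)) ?d = 0"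
    using degAB by (intro coeff_eq_0) (simp add: sdeg_def)
  moreover have "coeff (pCons 0 (pderiv (tpol ?S F))) ?d = of_nat ?d * coeff (tpol ?S F) ?d"
    using d0 by (cases ?d) (simp_all add: coeff_pderiv)
  ultimately have "NB * (of_nat ?d * coeff (tpol ?S F) ?d) = 0" by simp
  then have "NB = 0" using top_F_neq_0 d0 by simp
  then show ?thesis using NA NBe N0 by simp
qed

end

subsection \<open>Restriction to a generic plane\<close>

definition dx :: "'c::idom poly poly \<Rightarrow> 'c poly poly" where "dx = map_poly pderiv"

abbreviation dy :: "'c::idom poly poly \<Rightarrow> 'c poly poly" where "dy \<equiv> pderiv"

text \<open>The outer variable is y and the inner one x, so this is the coefficient of x^a
  y^b.\<close>

abbreviation cf :: "'c::zero poly poly \<Rightarrow> nat \<Rightarrow> nat \<Rightarrow> 'c" where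
  "cf q a b \<equiv> coeff (coeff q b) a"

abbreviation cc :: "'c::comm_ring_1 \<Rightarrow> 'c poly poly" where "cc c \<equiv> [:[:c:]:]"
abbreviation vx :: "'c::comm_ring_1 poly poly" where "vx \<equiv> [:[:0, 1:]:]"
abbreviation vy :: "'c::comm_ring_1 poly poly" where "vy \<equiv> [:0, 1:]"

text \<open>Degree strictly below d, so that zero needs no exception; degree at most d is
  \<open>bdl (Suc d)\<close>.\<close>

definition bdl :: "nat \<Rightarrow> 'c::zero poly poly \<Rightarrow> bool" where
  "bdl d q \<longleftrightarrow> (\<forall>a b. d \<le> a + b \<longrightarrow> cf q a b = 0)"

text \<open>The equation d((A dx + B dy) / F) = 0 multiplied by F^2.\<close>

definition closedf :: "'c::idom poly poly \<Rightarrow> 'c poly poly \<Rightarrow> 'c poly poly \<Rightarrow> bool" where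
  "closedf F A B \<longleftrightarrow> F * (dy A - dx B) = dy F * A - dx F * B"

lemma cc_hom: "comm_ring_hom (cc :: 'c::comm_ring_1 \<Rightarrow> _)"
  by (rule comm_ring_hom_comp[OF pCons_hom pCons_hom])

lemma cf_eqI: "(\<And>a b. cf p a b = cf q a b) \<Longrightarrow> p = q"
  by (intro poly_eqI)

lemma coeff_dx: "coeff (dx q) b = pderiv (coeff q b)"
  by (simp add: dx_def coeff_map_poly)

lemma dx_add: "dx (p + q) = dx p + dx q"
  by (rule poly_eqI) (simp add: coeff_dx pderiv_add)

lemma dx_diff: "dx (p - q) = dx p - dx q"
  by (rule poly_eqI) (simp add: coeff_dx pderiv_diff)

lemma pderiv_sum': "pderiv (sum F I) = (\<Sum>i\<in>I. pderiv (F i))" for F :: "_ \<Rightarrow> 'c::idom poly"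
  by (induction I rule: infinite_finite_induct) (simp_all add: pderiv_add)

lemma dx_mult: "dx (p * q) = p * dx q + dx p * q"
  by (rule poly_eqI)
    (simp add: coeff_dx coeff_mult pderiv_sum' pderiv_mult sum.distrib, intro sum.cong refl mult.commute)

lemma dx_cc [simp]: "dx (cc c) = 0" and dx_vx [simp]: "dx vx = 1" and dx_vy [simp]: "dx vy = 0"
  by (rule poly_eqI, simp add: coeff_dx coeff_pCons pderiv_pCons one_pCons split: nat.splits)+

lemma dy_cc [simp]: "dy (cc c) = 0" and dy_vx [simp]: "dy vx = 0" and dy_vy [simp]: "dy vy = 1"
  by (simp_all add: pderiv_pCons)

lemma dy_mult: "dy (p * q) = p * dy q + dy p * q"
  by (simp add: pderiv_mult mult.commute)

lemma bdl_mono: "bdl d q \<Longrightarrow> d \<le> d' \<Longrightarrow> bdl d' q"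
  by (auto simp: bdl_def)

lemma bdl_0 [simp]: "bdl d 0"
  by (simp add: bdl_def)

lemma bdl_add: "bdl d p \<Longrightarrow> bdl d q \<Longrightarrow> bdl d (p + q)"
  by (auto simp: bdl_def)

lemma bdl_diff: "bdl d p \<Longrightarrow> bdl d q \<Longrightarrow> bdl d (p - q)" for p :: "'c::comm_ring_1 poly poly"
  by (auto simp: bdl_def)

lemma bdl_sum: "(\<And>i. i \<in> I \<Longrightarrow> bdl d (F i)) \<Longrightarrow> bdl d (sum F I)" for F :: "_ \<Rightarrow> 'c::comm_ring_1 poly poly"
  by (induction I rule: infinite_finite_induct) (auto intro: bdl_add)

lemma cf_mult: "cf (p * q) a b = (\<Sum>j\<le>b. \<Sum>i\<le>a. cf p i j * cf q (a - i) (b - j))"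
  for p :: "'c::comm_ring_1 poly poly"
  by (simp add: coeff_mult coeff_sum)

lemma bdl_mult:
  fixes p q :: "'c::comm_ring_1 poly poly"
  assumes p: "bdl (Suc k) p" and q: "bdl l q"
  shows "bdl (k + l) (p * q)"
  unfolding bdl_def
proof (intro allI impI)
  fix a b assume ab: "k + l \<le> a + b"
  have "cf p i j * cf q (a - i) (b - j) = 0" if "i \<le> a" "j \<le> b" for i j
  proof (cases "Suc k \<le> i + j")
    case False
    then have "l \<le> (a - i) + (b - j)" using ab that by linarith
    then show ?thesis using q by (simp add: bdl_def)
  qed (use p in \<open>simp add: bdl_def\<close>)
  then show "cf (p * q) a b = 0" unfolding cf_mult by simp
qed

lemma bdl_cc: "bdl 1 (cc c)" and bdl_vx: "bdl 2 (vx :: 'c::comm_ring_1 poly poly)" and bdl_vy: "bdl 2 (vy :: 'c poly poly)"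
  by (auto simp: bdl_def coeff_pCons one_pCons split: nat.splits)

lemma bdl_power: "bdl (Suc k) p \<Longrightarrow> bdl (Suc (m * k)) (p ^ m)" for p :: "'c::comm_ring_1 poly poly"
proof (induction m)
  case 0
  then show ?case by (auto simp: bdl_def one_pCons coeff_pCons split: nat.splits)
next
  case (Suc m)
  then have "bdl (k + Suc (m * k)) (p * p ^ m)" by (intro bdl_mult) auto
  then show ?case by simp
qed

lemma bdl_dx: "bdl (Suc k) q \<Longrightarrow> bdl k (dx q)" and bdl_dy: "bdl (Suc k) q \<Longrightarrow> bdl k (dy q)"
proof -
  assume q: "bdl (Suc k) q"
  show "bdl k (dx q)" using q by (simp add: bdl_def coeff_dx coeff_pderiv)
  have "coeff (of_nat m * c) a = of_nat m * coeff c a" for m a and c :: "'a poly"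
    by (induction m) (simp_all add: algebra_simps)
  then have "cf (dy q) a b = of_nat (Suc b) * cf q a (Suc b)" for a b
    by (simp only: coeff_pderiv)
  then show "bdl k (dy q)" using q by (simp add: bdl_def)
qed

lemma cf_dy: "cf (dy q) a b = of_nat (Suc b) * cf q a (Suc b)"
proof -
  have "coeff (of_nat m * c) a = of_nat m * coeff c a" for m a and c :: "'a poly"
    by (induction m) (simp_all add: algebra_simps)
  then show ?thesis by (simp only: coeff_pderiv)
qed

lemma cf_dx: "cf (dx q) a b = of_nat (Suc a) * cf q (Suc a) b"
  by (simp add: coeff_dx coeff_pderiv)

lemma cf_euler: "cf (vx * dx q + vy * dy q) a b = of_nat (a + b) * cf q a b"
proof -
  have "cf (vx * dx q) a b = of_nat a * cf q a b"
    by (cases a) (simp_all add: coeff_pCons cf_dx)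
  moreover have "cf (vy * dy q) a b = of_nat b * cf q a b"
    by (cases b) (simp_all add: coeff_pCons cf_dy del: of_nat_Suc)
  ultimately show ?thesis by (simp add: algebra_simps)
qed

text \<open>The Euler operator multiplies the component of degree k by k, so subtracting k times q
  removes the top degree.\<close>

lemma bdl_euler:
  assumes "bdl (Suc k) q"
  shows "bdl k (vx * dx q + vy * dy q - cc (of_nat k) * q)"
  unfolding bdl_def
proof (intro allI impI)
  fix a b assume ab: "k \<le> a + b"
  have "cf (cc (of_nat k) * q) a b = of_nat k * cf q a b" by simp
  then have "cf (vx * dx q + vy * dy q - cc (of_nat k) * q) a b = (of_nat (a + b) - of_nat k) * cf q a b"
    by (simp only: coeff_diff cf_euler left_diff_distrib)
  then show "cf (vx * dx q + vy * dy q - cc (of_nat k) * q) a b = 0"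
    using ab assms by (cases "a + b = k") (auto simp: bdl_def)
qed

text \<open>U_i and V_i are the variables i and n + i; the variables 2 n and 2 n + 1 stay free for
  the parameters of the pencil.\<close>

definition psi :: "nat \<Rightarrow> nat \<Rightarrow> 'a::comm_ring_1 mpoly \<Rightarrow> 'a mpoly poly poly" where
  "psi n j = mev (\<lambda>c. cc (mconst c)) (\<lambda>i. if i = j then vy else [:[:mvar i, mvar (n + i):]:])"

lemma psi_hom: "comm_ring_hom (psi n j :: 'a::comm_ring_1 mpoly \<Rightarrow> _)"
  unfolding psi_def by (rule mev_hom[OF comm_ring_hom_comp[OF cc_hom mconst_hom]])

lemma psi_mconst [simp]: "psi n j (mconst c) = cc (mconst c)"
  unfolding psi_def by (rule mev_mconst[OF comm_ring_hom_comp[OF cc_hom mconst_hom]])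

lemma psi_mvar: "psi n j (mvar i) = (if i = j then vy else [:[:mvar i, mvar (n + i):]:])"
  unfolding psi_def by (rule mev_mvar[OF comm_ring_hom_comp[OF cc_hom mconst_hom]])

context leaf_setup
begin

definition conv0 :: "'k mpoly poly \<Rightarrow> 'k mpoly" where
  "conv0 p = poly (map_poly xs p) (mvar s)"

text \<open>Translates to the layout of the curve: x becomes s, y becomes Z_j, and a coefficient
  variable v becomes 2 v, which sends U_i to X_i and V_i to the direction variable.\<close>

definition conv :: "'k mpoly poly poly \<Rightarrow> 'k mpoly" where
  "conv q = poly (map_poly conv0 q) (mvar zj)"

lemma conv0_hom: "comm_ring_hom conv0"
  unfolding conv0_def by (rule comm_ring_hom_comp[OF poly_eval_hom map_poly_hom[OF xs_hom]])

lemma conv_hom: "comm_ring_hom conv"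
  unfolding conv_def by (rule comm_ring_hom_comp[OF poly_eval_hom map_poly_hom[OF conv0_hom]])

sublocale conv0: comm_ring_hom conv0 by (rule conv0_hom)
sublocale conv: comm_ring_hom conv by (rule conv_hom)

lemma conv0_pCons: "conv0 (pCons c p) = xs c + mvar s * conv0 p"
  by (simp add: conv0_def map_poly_pCons_0 xs.hom_zero)

lemma conv_pCons: "conv (pCons p q) = conv0 p + mvar zj * conv q"
  by (simp add: conv_def map_poly_pCons_0 conv0.hom_zero)

lemma xs_even: "xs a \<in> MP {v. even v}"
  unfolding xs_def by (rule MP_mev[OF MP_UNIV]) auto

lemma conv0_MP: "conv0 p \<in> MP ({v. even v} \<union> {s})"
proof (induction p)
  case (pCons c p)
  have "xs c \<in> MP ({v. even v} \<union> {s})" using xs_even by (rule MP_mono) auto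
  with pCons show ?case by (simp add: conv0_pCons)
qed (simp add: conv0.hom_zero)

lemma conv_MP: "conv q \<in> MP Cv"
proof (induction q)
  case (pCons c p)
  have "conv0 c \<in> MP Cv" using conv0_MP by (rule MP_mono) (auto simp: Cv_def)
  moreover have "mvar zj \<in> (MP Cv :: 'k mpoly set)" by (simp add: Cv_def)
  ultimately show ?case using pCons by (simp add: conv_pCons)
qed (simp add: conv.hom_zero)

lemma pd_s_conv0: "pd s (conv0 p) = conv0 (pderiv p)"
proof (induction p)
  case (pCons c p)
  have "pd s (xs c) = 0" by (rule pd_free[OF xs_even]) simp
  then show ?case using pCons by (simp add: conv0_pCons pderiv_pCons conv0.hom_add pd_add pd_mult pd_mvar xs.hom_zero)
qed (simp add: conv0.hom_zero)

lemma pd_s_conv: "pd s (conv q) = conv (dx q)"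
proof (induction q)
  case (pCons c q)
  have "dx (pCons c q) = pCons (pderiv c) (dx q)"
    by (rule poly_eqI) (simp add: coeff_dx coeff_pCons split: nat.splits)
  then show ?case using pCons by (simp add: conv_pCons pd_add pd_mult pd_mvar pd_s_conv0)
qed (simp add: conv.hom_zero dx_def)

lemma pd_zj_conv: "pd zj (conv q) = conv (dy q)"
proof (induction q)
  case (pCons c q)
  have "pd zj (conv0 c) = 0" by (rule pd_free[OF conv0_MP]) simp
  then show ?case using pCons
    by (simp add: conv_pCons pderiv_pCons conv.hom_add pd_add pd_mult pd_mvar conv0.hom_zero)
qed (simp add: conv.hom_zero)

lemma conv_eq_0: "conv q = 0 \<Longrightarrow> q = 0"
proof -
  interpret sz: comm_ring_hom "slice zj :: 'k mpoly \<Rightarrow> _" by (rule slice_hom)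
  interpret ss: comm_ring_hom "slice s :: 'k mpoly \<Rightarrow> _" by (rule slice_hom)
  have c0: "slice s (conv0 p) = map_poly xs p" for p
  proof (induction p)
    case (pCons c p)
    have "slice s (xs c) = [:xs c:]" by (rule slice_free[OF xs_even]) simp
    then show ?case using pCons by (simp add: conv0_pCons ss.hom_add ss.hom_mult slice_mvar map_poly_pCons_0 xs.hom_zero)
  qed (simp add: conv0.hom_zero ss.hom_zero)
  have c: "slice zj (conv q) = map_poly conv0 q"
  proof (induction q)
    case (pCons c p)
    have "slice zj (conv0 c) = [:conv0 c:]" by (rule slice_free[OF conv0_MP]) simp
    then show ?case using pCons by (simp add: conv_pCons sz.hom_add sz.hom_mult slice_mvar map_poly_pCons_0 conv0.hom_zero)
  qed (simp add: conv.hom_zero sz.hom_zero)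
  assume "conv q = 0"
  then have "map_poly conv0 q = 0" using c by (simp add: sz.hom_zero)
  then have "conv0 (coeff q b) = 0" for b using conv0.hom_zero by (metis coeff_0 coeff_map_poly)
  then have "map_poly xs (coeff q b) = 0" for b using c0[of "coeff q b"] by (simp add: ss.hom_zero)
  then have "xs (cf q a b) = 0" for a b using xs.hom_zero by (metis coeff_0 coeff_map_poly)
  then show "q = 0" by (intro cf_eqI) simp
qed

lemma sdeg_conv:
  assumes q: "bdl d q" and d: "0 < d"
  shows "sdeg {s, zj} (conv q) < d"
proof -
  interpret t: comm_ring_hom "tpol {s, zj} :: 'k mpoly \<Rightarrow> _" by (rule tpol_hom)
  have e: "conv q = (\<Sum>b\<le>degree q. \<Sum>a\<le>degree (coeff q b). xs (cf q a b) * mvar s ^ a * mvar zj ^ b)"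
  proof -
    have "q = (\<Sum>b\<le>degree q. [:coeff q b:] * vy ^ b)"
      using poly_as_sum_of_monoms[of q] by (simp add: monom_altdef)
    then have "conv q = conv (\<Sum>b\<le>degree q. [:coeff q b:] * vy ^ b)" by (rule arg_cong)
    also have "\<dots> = (\<Sum>b\<le>degree q. conv0 (coeff q b) * mvar zj ^ b)"
      unfolding conv.hom_sum conv.hom_mult conv.hom_power conv_pCons
      by (simp add: conv.hom_zero conv0.hom_zero conv.hom_one conv0.hom_one)
    finally have "conv q = (\<Sum>b\<le>degree q. conv0 (coeff q b) * mvar zj ^ b)" .
    moreover have "conv0 p = (\<Sum>a\<le>degree p. xs (coeff p a) * mvar s ^ a)" for p
    proof -
      have "p = (\<Sum>a\<le>degree p. [:coeff p a:] * [:0, 1:] ^ a)"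
        using poly_as_sum_of_monoms[of p] by (simp add: monom_altdef)
      then have "conv0 p = conv0 (\<Sum>a\<le>degree p. [:coeff p a:] * [:0, 1:] ^ a)" by (rule arg_cong)
      also have "\<dots> = (\<Sum>a\<le>degree p. xs (coeff p a) * mvar s ^ a)"
        unfolding conv0.hom_sum conv0.hom_mult conv0.hom_power conv0_pCons
        by (simp add: conv0.hom_zero xs.hom_zero conv0.hom_one xs.hom_one)
      finally show ?thesis .
    qed
    ultimately show ?thesis by (simp add: sum_distrib_right)
  qed
  have "degree (tpol {s, zj} (xs (cf q a b) * mvar s ^ a * mvar zj ^ b)) < d" for a b
  proof (cases "d \<le> a + b")
    case True
    then show ?thesis using q d by (simp add: bdl_def xs.hom_zero)
  next
    case False
    have "tpol {s, zj} (xs (cf q a b)) = [:xs (cf q a b):]"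
      by (rule tpol_free, rule MP_mono[OF xs_even]) auto
    moreover have "[:0, c:] ^ k = monom (c ^ k) k" for c :: "'k mpoly" and k
      by (induction k) (simp_all add: monom_Suc smult_monom)
    ultimately have "tpol {s, zj} (xs (cf q a b) * mvar s ^ a * mvar zj ^ b) =
        monom (xs (cf q a b) * mvar s ^ a * mvar zj ^ b) (a + b)"
      by (simp add: t.hom_mult t.hom_power tpol_mvar mult_monom smult_monom)
    then show ?thesis using False degree_monom_le[of "xs (cf q a b) * mvar s ^ a * mvar zj ^ b" "a + b"] by simp
  qed
  then show ?thesis unfolding e sdeg_def t.hom_sum by (intro degree_sum_less d)
qed

lemma conv_psi: "conv (psi n j a) = eta (zs a)" if "a \<in> MP {..<n}"
proof (rule hom_eq_on_MP[OF that comm_ring_hom_comp[OF conv_hom psi_hom] comm_ring_hom_comp[OF eta_hom zs_hom]])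
  fix i assume "i \<in> {..<n}"
  then show "conv (psi n j (mvar i)) = eta (zs (mvar i))"
    by (auto simp: psi_mvar conv_pCons conv0_pCons conv.hom_zero conv.hom_one conv0.hom_zero conv0.hom_one xs.hom_zero eta_mvar zj_def mult.commute)
qed (simp add: conv_pCons conv0_pCons conv.hom_zero conv0.hom_zero)

theorem closedf_zero:
  assumes m: "minimal_pair f g" and d: "d = pdeg f g" "0 < d"
    and A: "bdl d A" and B: "bdl d B" and AB: "bdl d (vx * A + vy * B)"
    and cl: "closedf (cc g * psi n j f - cc f * psi n j g) A B"
  shows "A = 0 \<and> B = 0"
proof -
  have cvx: "conv vx = mvar s" and cvy: "conv vy = mvar zj" and ccc: "conv (cc a) = xs a" for a
    by (simp_all add: conv_pCons conv0_pCons conv.hom_zero conv.hom_one conv0.hom_zero conv0.hom_one xs.hom_zero xs.hom_one)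
  have eta_even: "eta (xs a) = xs a" for a
    by (rule eta_id, rule MP_mono[OF xs_even]) (auto simp: Cv_def)
  have F: "conv (cc g * psi n j f - cc f * psi n j g) = F"
    unfolding F_def Phi_def conv.hom_minus conv.hom_mult ccc conv_psi[OF f] conv_psi[OF g]
      eta.hom_minus eta.hom_mult eta_even by (simp add: mult.commute)
  have "conv A = 0 \<and> conv B = 0"
  proof (rule closed_form_zero[OF m conv_MP conv_MP])
    show "sdeg {s, zj} (conv A) < pdeg f g" "sdeg {s, zj} (conv B) < pdeg f g"
      using sdeg_conv A B d by auto
    show "sdeg {s, zj} (mvar s * conv A + mvar zj * conv B) < pdeg f g"
      using sdeg_conv[OF AB d(2)] unfolding conv.hom_add conv.hom_mult cvx cvy d(1) .
    show "F * (pd zj (conv A) - pd s (conv B)) = pd zj F * conv A - pd s F * conv B"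
      using arg_cong[OF cl[unfolded closedf_def], of conv]
      unfolding pd_s_conv pd_zj_conv F[symmetric] conv.hom_mult conv.hom_minus
      by (simp only: pd_s_conv pd_zj_conv flip: conv.hom_minus conv.hom_mult)
  qed
  then show ?thesis using conv_eq_0 by blast
qed

end

section \<open>Derivatives of restricted polynomials\<close>

lemma dx_dy_commute: "dx (dy q) = dy (dx q)"
proof (rule cf_eqI)
  fix a b
  show "cf (dx (dy q)) a b = cf (dy (dx q)) a b"
    unfolding cf_dx cf_dy by (rule mult.left_commute)
qed

lemma dy_psi: "dy (psi n j a) = psi n j (pd j a)" if "a \<in> MP {..<n}" "j < n" for a :: "'a::idom mpoly"
proof -
  have "dy (psi n j a) = (\<Sum>i<n. psi n j (pd i a) * dy (psi n j (mvar i)))"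
    by (rule chain_rule[OF psi_hom that(1)]) (simp_all add: pderiv_add dy_mult)
  also have "\<dots> = (\<Sum>i<n. if i = j then psi n j (pd j a) else 0)"
    by (intro sum.cong refl) (auto simp: psi_mvar pderiv_pCons)
  finally show ?thesis using that(2) by simp
qed

lemma dx_psi: "dx (psi n j a) = (\<Sum>i\<in>{..<n} - {j}. psi n j (pd i a) * cc (mvar (n + i)))"
  if "a \<in> MP {..<n}" "j < n" for a :: "'a::idom mpoly"
proof -
  have l: "dx [:[:u, v:]:] = cc v" for u v :: "'a mpoly"
    by (rule poly_eqI) (simp add: coeff_dx coeff_pCons pderiv_pCons split: nat.splits)
  have "dx (psi n j a) = (\<Sum>i<n. psi n j (pd i a) * dx (psi n j (mvar i)))"
    by (rule chain_rule[OF psi_hom that(1)]) (simp_all add: dx_add dx_mult)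
  also have "\<dots> = (\<Sum>i\<in>{..<n} - {j}. psi n j (pd i a) * cc (mvar (n + i)))"
    by (rule sum.mono_neutral_cong_right) (auto simp: psi_mvar l simp del: mult_pCons_left mult_pCons_right)
  finally show ?thesis .
qed

text \<open>A retraction of \<open>psi\<close>: it sets \<open>x = 0\<close>, \<open>y = X\<^sub>j\<close>, makes \<open>V\<close> the \<open>k\<close>-th unit vector and
  gives the values \<open>u\<close> and \<open>w\<close> to the two parameters of the pencil.\<close>

definition retr :: "nat \<Rightarrow> nat \<Rightarrow> nat \<Rightarrow> 'a::comm_ring_1 mpoly \<Rightarrow> 'a mpoly \<Rightarrow> 'a mpoly poly poly \<Rightarrow> 'a mpoly" where
  "retr n j k u w q = poly (map_poly (\<lambda>p. poly (map_poly (mev mconst (\<lambda>v. if v < n then mvar v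
      else if v = n + k then 1 else if v = 2 * n then u else if v = 2 * n + 1 then w else 0)) p) 0) q) (mvar j)"

lemma retr_hom: "comm_ring_hom (retr n j k u w)"
  unfolding retr_def
  by (rule comm_ring_hom_comp[OF poly_eval_hom map_poly_hom[OF comm_ring_hom_comp[OF poly_eval_hom
      map_poly_hom[OF mev_hom[OF mconst_hom]]]]])

lemma retr_pCons: "retr n j k u w [:p:] = poly (map_poly (mev mconst (\<lambda>v. if v < n then mvar v
      else if v = n + k then 1 else if v = 2 * n then u else if v = 2 * n + 1 then w else 0)) p) 0"
  by (simp add: retr_def map_poly_pCons_0)

lemma retr_cc_mvar: "retr n j k u w (cc (mvar v)) = (if v < n then mvar v
      else if v = n + k then 1 else if v = 2 * n then u else if v = 2 * n + 1 then w else 0)"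
  by (simp add: retr_pCons map_poly_pCons_0 mev_mvar[OF mconst_hom])

lemma retr_psi: "retr n j k u w (psi n j a) = a" if "a \<in> MP {..<n}"
proof -
  have "retr n j k u w (psi n j a) = (\<lambda>x. x) a"
  proof (rule hom_eq_on_MP[OF that comm_ring_hom_comp[OF retr_hom psi_hom] comm_ring_hom_id])
    fix i assume "i \<in> {..<n}"
    have "retr n j k u w vy = mvar j"
    proof -
      interpret m: comm_ring_hom "mev mconst (\<lambda>v. if v < n then mvar v
      else if v = n + k then 1 else if v = 2 * n then u else if v = 2 * n + 1 then w else 0) :: 'a mpoly \<Rightarrow> 'a mpoly"
        by (rule mev_hom[OF mconst_hom])
      show ?thesis by (simp add: retr_def map_poly_pCons_0 m.hom_one)
    qed
    then show "retr n j k u w (psi n j (mvar i)) = mvar i"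
      using \<open>i \<in> {..<n}\<close> by (auto simp: psi_mvar retr_pCons map_poly_pCons_0 mev_mvar[OF mconst_hom])
  qed (simp add: retr_pCons map_poly_pCons_0 mev_mconst[OF mconst_hom])
  then show ?thesis .
qed

lemma retr_dx_psi: "retr n j k u w (dx (psi n j a)) = pd k a"
  if "a \<in> MP {..<n}" "j < n" "k < n" "k \<noteq> j" for a :: "'a::idom mpoly"
proof -
  interpret comm_ring_hom "retr n j k u w" by (rule retr_hom)
  have "retr n j k u w (dx (psi n j a)) = (\<Sum>i\<in>{..<n} - {j}. pd i a * retr n j k u w (cc (mvar (n + i))))"
    unfolding dx_psi[OF that(1,2)] hom_sum hom_mult retr_psi[OF pd_MP[OF that(1)]] ..
  also have "\<dots> = (\<Sum>i\<in>{..<n} - {j}. if i = k then pd k a else 0)"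
    by (intro sum.cong refl) (auto simp: retr_cc_mvar)
  finally show ?thesis using that by simp
qed

lemma retr_dy_psi: "retr n j k u w (dy (psi n j a)) = pd j a"
  if "a \<in> MP {..<n}" "j < n" for a :: "'a::idom mpoly"
  unfolding dy_psi[OF that] by (rule retr_psi[OF pd_MP[OF that(1)]])

lemma bdl_mon:
  fixes \<rho> :: "nat \<Rightarrow> 'c::comm_ring_1 poly poly"
  assumes "\<And>i. bdl 2 (\<rho> i)"
  shows "bdl (Suc (mdeg UNIV m)) (mon \<rho> m)"
proof -
  have "bdl (Suc (\<Sum>i\<in>I. Poly_Mapping.lookup m i)) (\<Prod>i\<in>I. \<rho> i ^ Poly_Mapping.lookup m i)" if "finite I" for I
    using that
  proof (induction I)
    case empty
    then show ?case by (auto simp: bdl_def one_pCons coeff_pCons split: nat.splits)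
  next
    case (insert i I)
    have "bdl (Suc (Poly_Mapping.lookup m i * 1)) (\<rho> i ^ Poly_Mapping.lookup m i)"
      by (rule bdl_power) (use assms in \<open>simp add: numeral_2_eq_2\<close>)
    then have "bdl (Poly_Mapping.lookup m i + Suc (\<Sum>i\<in>I. Poly_Mapping.lookup m i))
        (\<rho> i ^ Poly_Mapping.lookup m i * (\<Prod>i\<in>I. \<rho> i ^ Poly_Mapping.lookup m i))"
      using insert.IH by (intro bdl_mult) simp_all
    then show ?case using insert.hyps by simp
  qed
  then show ?thesis by (simp add: mon_def mdeg_def)
qed

lemma bdl_psi: "bdl (Suc (tdeg a)) (psi n j a)"
proof -
  have "bdl 2 (if i = j then vy else [:[:mvar i, mvar (n + i):]:] :: 'a mpoly poly poly)" for i
    by (auto simp: bdl_def coeff_pCons one_pCons split: nat.splits)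
  then have "bdl (Suc (mdeg UNIV m)) (mon (\<lambda>i. if i = j then vy else [:[:mvar i, mvar (n + i):]:] :: 'a mpoly poly poly) m)" for m
    by (rule bdl_mon)
  then have "bdl (0 + Suc (mdeg UNIV m)) (cc c * mon (\<lambda>i. if i = j then vy else [:[:mvar i, mvar (n + i):]:] :: 'a mpoly poly poly) m)" for c m
    using bdl_cc[of c] by (intro bdl_mult) simp_all
  moreover have "mdeg UNIV m \<le> tdeg a" if "m \<in> Poly_Mapping.keys a" for m
    using sdeg_le_iff[of UNIV a "tdeg a"] that by blast
  ultimately show ?thesis
    unfolding psi_def mev_def by (intro bdl_sum) (metis (no_types, lifting) add_0 bdl_mono Suc_le_mono)
qed

lemma degree_slice_le_tdeg: "degree (slice k h) \<le> tdeg h"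
  by (rule hom_degree_le[OF slice_hom MP_UNIV]) (auto simp: slice_mvar)

lemma pds_zero_imp_const:
  fixes h :: "'a::idom mpoly"
  assumes "h \<in> MP {..<n}" "\<And>k. k < n \<Longrightarrow> pd k h = 0"
    and ch: "\<And>k. 0 < k \<Longrightarrow> k \<le> tdeg h \<Longrightarrow> (of_nat k :: 'a) \<noteq> 0"
  shows "h \<in> range mconst"
proof -
  have "h \<in> MP (- {k})" for k
  proof (cases "k < n")
    case True
    show ?thesis
      by (rule pd_eq_0_imp_free[OF assms(2)[OF True]]) (use ch degree_slice_le_tdeg[of k h] in auto)
  next
    case False
    then show ?thesis using MP_mono[OF assms(1)] by auto
  qed
  then show ?thesis unfolding MP_empty[symmetric] MP_iff_free[of h "{}"] by blast
qed

text \<open>By coprimality h1 divides its own derivatives, which have smaller degree, so they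
  vanish; the condition on the characteristic then makes h1 constant. The same holds for h2.\<close>

lemma coprime_dependent_imp_const:
  fixes h1 h2 :: "'a::field mpoly"
  assumes h: "h1 \<in> MP {..<n}" "h2 \<in> MP {..<n}" and cop: "mpoly_coprime h1 h2"
    and dep: "\<And>k. k < n \<Longrightarrow> h1 * pd k h2 = h2 * pd k h1"
    and ch: "\<And>k. 0 < k \<Longrightarrow> k \<le> max (tdeg h1) (tdeg h2) \<Longrightarrow> (of_nat k :: 'a) \<noteq> 0"
  shows "h1 \<in> range mconst \<and> h2 \<in> range mconst"
proof -
  have main: "h1 \<in> range mconst" if h: "h1 \<in> MP {..<n}" "h2 \<in> MP {..<n}" and cop: "mpoly_coprime h1 h2"
    and dep: "\<And>k. k < n \<Longrightarrow> h1 * pd k h2 = h2 * pd k h1"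
    and ch: "\<And>k. 0 < k \<Longrightarrow> k \<le> tdeg h1 \<Longrightarrow> (of_nat k :: 'a) \<noteq> 0" for h1 h2 :: "'a mpoly"
  proof (cases "h1 = 0")
    case True
    then show ?thesis by (metis rangeI single_zero)
  next
    case False
    show ?thesis
    proof (rule pds_zero_imp_const[OF h(1) _ ch])
      fix k assume k: "k < n"
      show "pd k h1 = 0"
      proof (rule ccontr)
        assume nz: "pd k h1 \<noteq> 0"
        have "h1 dvd h2 * pd k h1" unfolding dep[OF k, symmetric] by simp
        then have "h1 dvd pd k h1" by (rule coprime_dvd_mult_mpoly[OF cop _ False])
        then obtain c where c: "pd k h1 = h1 * c" by (auto elim: dvdE)
        then have "tdeg h1 \<le> tdeg (pd k h1)" using nz by (auto simp: sdeg_mult)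
        moreover have "tdeg h1 \<noteq> 0"
        proof
          assume "tdeg h1 = 0"
          then have "pd k h1 = 0" unfolding tdeg_0_iff by auto
          with nz show False by simp
        qed
        ultimately show False using sdeg_pd_less[of k UNIV h1 "tdeg h1"] by simp
      qed
    qed auto
  qed
  have "mpoly_coprime h2 h1" using cop by (auto simp: mpoly_coprime_def)
  then show ?thesis using main[OF h cop dep] main[OF h(2,1) _ dep[symmetric]] ch by simp
qed

text \<open>A common divisor of largest degree leaves coprime cofactors, since nonzero divisors of
  degree 0 are units.\<close>

lemma extract_common_factor:
  fixes f g :: "'a::field mpoly"
  assumes "g \<noteq> 0"
  shows "\<exists>q f1 g1. f = q * f1 \<and> g = q * g1 \<and> mpoly_coprime f1 g1"
proof -
  let ?P = "\<lambda>q. q dvd f \<and> q dvd g"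
  have b: "tdeg q \<le> tdeg g" if "?P q" for q
  proof -
    from that obtain g1 where "g = q * g1" by (auto elim: dvdE)
    then show ?thesis using assms by (auto simp: sdeg_mult)
  qed
  have "\<forall>q'. ?P q' \<longrightarrow> tdeg q' < Suc (tdeg g)" using b by (simp add: less_Suc_eq_le)
  then have "\<exists>q. ?P q \<and> (\<forall>q'. ?P q' \<longrightarrow> tdeg q' \<le> tdeg q)"
    by (intro ex_has_greatest_nat[of ?P 1 tdeg "Suc (tdeg g)"]) simp_all
  then obtain q where q: "?P q" "\<And>q'. ?P q' \<Longrightarrow> tdeg q' \<le> tdeg q" by blast
  obtain f1 g1 where fg: "f = q * f1" "g = q * g1" using q(1) unfolding dvd_def by blast
  have "mpoly_coprime f1 g1"
    unfolding mpoly_coprime_def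
  proof (intro allI impI)
    fix c assume c: "c dvd f1" "c dvd g1"
    then have "q * c dvd q * f1" "q * c dvd q * g1" by (simp_all add: mult_dvd_mono)
    then have "tdeg (q * c) \<le> tdeg q" using q(2)[of "q * c"] unfolding fg by blast
    moreover have "q \<noteq> 0" "c \<noteq> 0" using assms c(2) fg(2) by auto
    ultimately show "c dvd 1" by (simp add: sdeg_mult dvd_1_iff_tdeg)
  qed
  then show ?thesis using fg by blast
qed

text \<open>Divided by Q P the form is a dQ / Q - b dP / P, a combination of logarithmic
  differentials with constant coefficients.\<close>

lemma closedf_product:
  fixes Q P :: "'c::idom poly poly"
  assumes "dx a = 0" "dy a = 0" "dx b = 0" "dy b = 0"
  shows "closedf (Q * P) (a * P * dx Q - b * Q * dx P) (a * P * dy Q - b * Q * dy P)"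
proof -
  define Qx Qy Px Py Qxy Pxy where "Qx = dx Q" and "Qy = dy Q" and "Px = dx P" and "Py = dy P"
    and "Qxy = dy (dx Q)" and "Pxy = dy (dx P)"
  have m1: "dy (a * P * Qx - b * Q * Px) = a * (Py * Qx + P * Qxy) - b * (Qy * Px + Q * Pxy)"
    unfolding pderiv_diff dy_mult assms Qx_def Qy_def Px_def Py_def Qxy_def Pxy_def by (simp add: algebra_simps)
  have m2: "dx (a * P * Qy - b * Q * Py) = a * (Px * Qy + P * Qxy) - b * (Qx * Py + Q * Pxy)"
    unfolding dx_diff dx_mult assms Qx_def Qy_def Px_def Py_def Qxy_def Pxy_def dx_dy_commute by (simp add: algebra_simps)
  show ?thesis
    unfolding closedf_def dy_mult[of Q P] dx_mult[of Q P] Qx_def[symmetric] Qy_def[symmetric] Px_def[symmetric] Py_def[symmetric] m1 m2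
    by (simp add: algebra_simps)
qed

text \<open>With t = H2 / H1 the form divided by H1^i H2^m is t^(i - 2) dt, because i + m = k.
  Multiplication by H1 H2 keeps the computation polynomial.\<close>

lemma closedf_form:
  fixes H1 H2 :: "'c::idom poly poly"
  assumes H: "H1 \<noteq> 0" "H2 \<noteq> 0" and k: "2 \<le> k" "i + m = k"
  shows "closedf (H1 ^ i * H2 ^ m) (H2 ^ (k - 2) * (H1 * dx H2 - H2 * dx H1)) (H2 ^ (k - 2) * (H1 * dy H2 - H2 * dy H1))"
proof -
  define W P a b where "W = H1 ^ i * H2 ^ m" and "P = H2 ^ (k - 2)" and "a = H1 * dx H2 - H2 * dx H1" and "b = H1 * dy H2 - H2 * dy H1"
  define H1x H1y H2x H2y where "H1x = dx H1" and "H1y = dy H1" and "H2x = dx H2" and "H2y = dy H2"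
  have py: "H * dy (H ^ l) = of_nat l * H ^ l * dy H" and px: "H * dx (H ^ l) = of_nat l * H ^ l * dx H" for H :: "'c poly poly" and l
  proof (induction l)
    case (Suc l)
    { case 1 show ?case using Suc(1) by (simp add: dy_mult algebra_simps) }
    { case 2 show ?case using Suc(2) by (simp add: dx_mult algebra_simps) }
  next
    case 0
    { case 1 show ?case by simp }
    { case 2 show ?case using dx_cc[of 1] by (simp add: one_pCons) }
  qed
  have Wy: "H1 * H2 * dy W = W * (of_nat i * H2 * H1y + of_nat m * H1 * H2y)"
  proof -
    have e: "H1 * H2 * dy W = H2 * H2 ^ m * (H1 * dy (H1 ^ i)) + H1 * H1 ^ i * (H2 * dy (H2 ^ m))"
      unfolding W_def dy_mult by (simp add: algebra_simps)
    show ?thesis unfolding e py unfolding W_def H1y_def H2y_def by (simp add: algebra_simps)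
  qed
  have Wx: "H1 * H2 * dx W = W * (of_nat i * H2 * H1x + of_nat m * H1 * H2x)"
  proof -
    have e: "H1 * H2 * dx W = H2 * H2 ^ m * (H1 * dx (H1 ^ i)) + H1 * H1 ^ i * (H2 * dx (H2 ^ m))"
      unfolding W_def dx_mult by (simp add: algebra_simps)
    show ?thesis unfolding e px unfolding W_def H1x_def H2x_def by (simp add: algebra_simps)
  qed
  define J where "J = H1y * H2x - H1x * H2y"
  define r where "r = (of_nat (k - 2) :: 'c poly poly)"
  have Py: "H2 * dy P = r * P * H2y" and Px: "H2 * dx P = r * P * H2x"
    unfolding P_def py px r_def H2x_def H2y_def by simp_all
  have ab: "dy a - dx b = 2 * J"
    unfolding a_def b_def dx_diff pderiv_diff dx_mult dy_mult dx_dy_commute J_def H1x_def H1y_def H2x_def H2y_def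
    by (simp add: algebra_simps)
  have L: "H2 * (dy (P * a) - dx (P * b)) = r * P * (H2y * a - H2x * b) + H2 * P * (2 * J)"
  proof -
    have e: "H2 * (dy (P * a) - dx (P * b)) = (H2 * dy P) * a - (H2 * dx P) * b + H2 * P * (dy a - dx b)"
      unfolding dy_mult dx_mult by (simp add: algebra_simps)
    show ?thesis unfolding e Py Px ab by (simp add: algebra_simps)
  qed
  have e1: "H2y * a - H2x * b = H2 * J" and e2: "H1y * a - H1x * b = H1 * J"
    unfolding a_def b_def J_def H1x_def H1y_def H2x_def H2y_def by (simp_all add: algebra_simps)
  have kk: "r + 2 = (of_nat k :: 'c poly poly)" unfolding r_def using k(1) by (metis of_nat_add of_nat_numeral le_add_diff_inverse2)
  have im: "of_nat i + of_nat m = (of_nat k :: 'c poly poly)" using k(2) by (metis of_nat_add)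
  have "H1 * H2 * (W * (dy (P * a) - dx (P * b))) = W * H1 * (H2 * (dy (P * a) - dx (P * b)))" by (simp only: mult_ac)
  also have "\<dots> = W * H1 * P * H2 * J * (r + 2)" unfolding L e1 by (simp add: algebra_simps)
  also have "\<dots> = W * P * (of_nat i * H2 * (H1 * J) + of_nat m * H1 * (H2 * J))"
    unfolding kk im[symmetric] by (simp add: algebra_simps)
  also have "\<dots> = (H1 * H2 * dy W) * (P * a) - (H1 * H2 * dx W) * (P * b)"
    unfolding Wy Wx e1[symmetric] e2[symmetric] by (simp add: algebra_simps)
  also have "\<dots> = H1 * H2 * (dy W * (P * a) - dx W * (P * b))" by (simp add: algebra_simps)
  finally have "W * (dy (P * a) - dx (P * b)) = dy W * (P * a) - dx W * (P * b)" using H by simp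
  then show ?thesis unfolding closedf_def W_def P_def a_def b_def .
qed

text \<open>For a fixed pair (A, B) closedness is linear in F, so a binary form in H1, H2 can be
  treated term by term.\<close>

lemma closedf_add: "closedf F A B \<Longrightarrow> closedf F' A B \<Longrightarrow> closedf (F + F') A B"
  by (simp add: closedf_def dx_add pderiv_add algebra_simps)

lemma closedf_cc: "closedf F A B \<Longrightarrow> closedf (cc c * F) A B"
  unfolding closedf_def dx_mult dy_mult dx_cc dy_cc
proof -
  assume a: "F * (dy A - dx B) = dy F * A - dx F * B"
  have "cc c * F * (dy A - dx B) = cc c * (F * (dy A - dx B))" by (simp only: mult.assoc)
  then show "cc c * F * (dy A - dx B) = (cc c * dy F + 0 * F) * A - (cc c * dx F + 0 * F) * B"
    unfolding a by (simp only: mult_zero_left add_0_right right_diff_distrib mult.assoc)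
qed

lemma closedf_cc_cancel: "closedf (cc c * F) A B \<Longrightarrow> c \<noteq> 0 \<Longrightarrow> closedf F A B"
  unfolding closedf_def dx_mult dy_mult dx_cc dy_cc
proof -
  assume a: "cc c * F * (dy A - dx B) = (cc c * dy F + 0 * F) * A - (cc c * dx F + 0 * F) * B" and c: "c \<noteq> 0"
  have "cc c * (F * (dy A - dx B)) = cc c * (dy F * A - dx F * B)"
    using a by (simp only: mult_zero_left add_0_right right_diff_distrib mult.assoc)
  moreover have "cc c \<noteq> 0" using c by simp
  ultimately show "F * (dy A - dx B) = dy F * A - dx F * B" by (metis mult_left_cancel)
qed

lemma closedf_0: "closedf 0 A B"
  by (simp add: closedf_def dx_def)

lemma closedf_sum: "(\<And>i. i \<in> I \<Longrightarrow> closedf (F i) A B) \<Longrightarrow> closedf (sum F I) A B"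
  by (induction I rule: infinite_finite_induct) (auto intro: closedf_add closedf_0)

subsection \<open>Nonzero closed forms of decomposable pencils\<close>

text \<open>The binary form y^k A(x / y). Numerator and denominator of a fraction use the same k,
  which may exceed the degree of one of them.\<close>

definition homog :: "nat \<Rightarrow> 'a::field poly \<Rightarrow> 'a mpoly \<Rightarrow> 'a mpoly \<Rightarrow> 'a mpoly" where
  "homog k A x y = (\<Sum>i\<le>k. mconst (coeff A i) * x ^ i * y ^ (k - i))"

lemma subst_ratfun_sum: "degree A \<le> k \<Longrightarrow> subst_ratfun A h = (\<Sum>i\<le>k. const_ratfun (coeff A i) * h ^ i)"
proof -
  interpret comm_ring_hom "const_ratfun :: 'a \<Rightarrow> _" by (rule const_ratfun_hom)
  assume "degree A \<le> k"
  then have "degree (map_poly const_ratfun A) \<le> k" by (rule order.trans[OF degree_map_poly_le])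
  then show ?thesis
    unfolding subst_ratfun_def poly_altdef
    by (intro sum.mono_neutral_cong_left) (auto simp: coeff_map_poly hom_zero intro!: le_degree)
qed

lemma homog_fract:
  assumes "degree A \<le> k" "y \<noteq> 0"
  shows "to_fract (homog k A x y) = to_fract y ^ k * subst_ratfun A (to_fract x / to_fract y)"
proof -
  interpret comm_ring_hom "to_fract :: 'a mpoly \<Rightarrow> _" by (rule to_fract_ring_hom)
  have y: "to_fract y \<noteq> 0" using assms(2) by simp
  have "to_fract y ^ (k - i) = to_fract y ^ k / to_fract y ^ i" if "i \<le> k" for i
    using y that by (simp add: power_diff)
  then show ?thesis
    unfolding homog_def subst_ratfun_sum[OF assms(1)] sum_distrib_left hom_sum
    by (intro sum.cong refl) (simp add: hom_mult hom_power const_ratfun_altdef power_divide)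
qed

text \<open>Homogenizes an identity U A + V B = 1; the power of y clears its denominators.\<close>

lemma homog_bezout:
  fixes A B :: "'a::field_gcd poly"
  assumes cop: "coprime A B" and deg: "degree A \<le> k" "degree B \<le> k" and y: "y \<noteq> 0"
  shows "\<exists>N u v. y ^ N = u * homog k A x y + v * homog k B x y"
proof -
  define U V where "U = fst (bezout_coefficients A B)" and "V = snd (bezout_coefficients A B)"
  have UV: "U * A + V * B = 1" using cop unfolding U_def V_def bezout_coefficients_fst_snd by simp
  define l where "l = max (degree U) (degree V)"
  interpret comm_ring_hom "to_fract :: 'a mpoly \<Rightarrow> _" by (rule to_fract_ring_hom)
  interpret s: comm_ring_hom "\<lambda>a. subst_ratfun a (to_fract x / to_fract y)" by (rule subst_ratfun_hom)
  let ?s = "\<lambda>a. subst_ratfun a (to_fract x / to_fract y)"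
  have "to_fract (homog l U x y * homog k A x y + homog l V x y * homog k B x y)
      = to_fract y ^ (l + k) * ?s (U * A + V * B)"
    unfolding hom_add hom_mult s.hom_add s.hom_mult
    by (simp add: homog_fract deg y l_def power_add algebra_simps)
  also have "\<dots> = to_fract (y ^ (l + k))" unfolding UV s.hom_one by (simp add: hom_power)
  finally have "homog l U x y * homog k A x y + homog l V x y * homog k B x y = y ^ (l + k)"
    unfolding to_fract_eq_iff .
  then show ?thesis by metis
qed

lemma homog_split_top: "homog k A x y = mconst (coeff A k) * x ^ k + y * (\<Sum>i<k. mconst (coeff A i) * x ^ i * y ^ (k - i - 1))"
proof -
  have "homog k A x y = mconst (coeff A k) * x ^ k + (\<Sum>i<k. mconst (coeff A i) * x ^ i * y ^ (k - i))"
    unfolding homog_def lessThan_Suc_atMost[symmetric] by (simp add: add.commute)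
  also have "(\<Sum>i<k. mconst (coeff A i) * x ^ i * y ^ (k - i)) = y * (\<Sum>i<k. mconst (coeff A i) * x ^ i * y ^ (k - i - 1))"
    unfolding sum_distrib_left
  proof (intro sum.cong refl)
    fix i assume "i \<in> {..<k}"
    then have e: "k - i = Suc (k - i - 1)" by simp
    show "mconst (coeff A i) * x ^ i * y ^ (k - i) = y * (mconst (coeff A i) * x ^ i * y ^ (k - i - 1))"
      by (subst e) (simp only: power_Suc mult_ac)
  qed
  finally show ?thesis .
qed

text \<open>By the Bezout identity q divides a power of y, hence y. Modulo y, the form whose
  polynomial has degree exactly k is a nonzero constant times x^k.\<close>

lemma homog_prime:
  fixes A B :: "'a::field_gcd poly"
  assumes cop: "coprime A B" and k: "k = max (degree A) (degree B)" "0 < k"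
    and q: "prime_elem q" "q dvd homog k A x y" "q dvd homog k B x y"
  shows "q dvd x \<and> q dvd y"
proof -
  have y: "q dvd y"
  proof (cases "y = 0")
    case False
    obtain N u v where "y ^ N = u * homog k A x y + v * homog k B x y"
      using homog_bezout[OF cop _ _ False, of k x] k(1) by auto
    then have "q dvd y ^ N" using q(2,3) by (simp add: dvd_add dvd_mult)
    then show ?thesis by (rule prime_elem_dvd_power[OF q(1)])
  qed simp
  have "\<exists>C. coeff C k \<noteq> 0 \<and> q dvd homog k C x y"
  proof (cases "degree A = k")
    case True
    then have "coeff A k \<noteq> 0" using k(2) leading_coeff_0_iff[of A] by auto
    then show ?thesis using q(2) by blast
  next
    case False
    then have "degree B = k" using k(1) by (auto simp: max_def split: if_splits)
    then have "coeff B k \<noteq> 0" using k(2) leading_coeff_0_iff[of B] by auto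
    then show ?thesis using q(3) by blast
  qed
  then obtain C where C: "coeff C k \<noteq> 0" "q dvd homog k C x y" by blast
  let ?r = "\<Sum>i<k. mconst (coeff C i) * x ^ i * y ^ (k - i - 1)"
  have e: "mconst (coeff C k) * x ^ k = homog k C x y - y * ?r" unfolding homog_split_top by simp
  have "q dvd mconst (coeff C k) * x ^ k" unfolding e by (rule dvd_diff[OF C(2) dvd_mult2[OF y]])
  moreover have "\<not> q dvd mconst (coeff C k)"
  proof
    assume "q dvd mconst (coeff C k)"
    then have "q dvd 1" using mconst_dvd_1[OF C(1)] by (rule dvd_trans)
    then show False using q(1) by (simp add: prime_elem_def)
  qed
  ultimately have "q dvd x ^ k" using q(1) by (simp add: prime_elem_dvd_mult_iff)
  then show ?thesis using y prime_elem_dvd_power[OF q(1)] by blast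
qed

text \<open>Zero is divisible by every prime, in particular by a variable that occurs in neither x
  nor y.\<close>

lemma homog_zero:
  fixes A B :: "'a::field_gcd poly"
  assumes "coprime A B" "k = max (degree A) (degree B)" "0 < k"
    and "homog k A x y = 0" "homog k B x y = 0"
  shows "x = 0 \<and> y = 0"
proof -
  obtain q where q: "prime_elem q" "\<not> q dvd x \<or> \<not> q dvd y" if "x \<noteq> 0 \<or> y \<noteq> 0"
  proof -
    obtain S where S: "finite S" "x \<in> MP S" using MP_finite by blast
    obtain T where T: "finite T" "y \<in> MP T" using MP_finite by blast
    obtain i where i: "i \<notin> S \<union> T" using ex_new_if_finite[of "S \<union> T"] S T by auto
    have nd: "z = 0" if z: "z \<in> MP (S \<union> T)" "mvar i dvd z" for z :: "'a mpoly"
    proof (rule ccontr)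
      assume z0: "z \<noteq> 0"
      obtain c where c: "z = mvar i * c" using z(2) unfolding dvd_def by blast
      have "mvar i \<in> (MP (S \<union> T) :: 'a mpoly set)" by (rule MP_factor[of _ c]) (use z z0 c in auto)
      then have "(mvar i :: 'a mpoly) \<in> MP (- {i})" by (rule MP_mono) (use i in auto)
      then have "degree (slice i (mvar i :: 'a mpoly)) = 0" by (simp add: degree_slice_0_iff)
      then show False by (simp add: slice_mvar)
    qed
    have "x \<in> MP (S \<union> T)" "y \<in> MP (S \<union> T)" using MP_mono[OF S(2), of "S \<union> T"] MP_mono[OF T(2), of "S \<union> T"] by auto
    then show ?thesis using that[of "mvar i"] prime_elem_mvar[of i] nd by metis
  qed
  show ?thesis
  proof (rule ccontr)
    assume "\<not> (x = 0 \<and> y = 0)"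
    then have "prime_elem q" "\<not> q dvd x \<or> \<not> q dvd y" using q by blast+
    then show False using homog_prime[OF assms(1-3), of q x y] assms(4,5) by simp
  qed
qed

lemma coeff_power_bound:
  fixes p :: "'c::comm_ring_1 poly"
  assumes "degree p \<le> e"
  shows "degree (p ^ i) \<le> i * e \<and> coeff (p ^ i) (i * e) = coeff p e ^ i"
proof (induction i)
  case (Suc i)
  have "degree (p * p ^ i) \<le> e + i * e" using degree_mult_le[of p "p ^ i"] assms Suc by linarith
  then show ?case using coeff_mult_sum_bound[OF assms, of "p ^ i" "i * e"] Suc by simp
qed simp

lemma homog_top:
  assumes "tdeg x \<le> e" "tdeg y \<le> e"
  shows "coeff (tpol UNIV (homog k A x y)) (k * e) = homog k A (coeff (tpol UNIV x) e) (coeff (tpol UNIV y) e)"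
proof -
  interpret t: comm_ring_hom "tpol UNIV :: 'a mpoly \<Rightarrow> _" by (rule tpol_hom)
  have dx: "degree (tpol UNIV x) \<le> e" and dy: "degree (tpol UNIV y) \<le> e" using assms by (simp_all add: sdeg_def)
  show ?thesis
    unfolding homog_def t.hom_sum coeff_sum
  proof (intro sum.cong refl)
    fix i assume "i \<in> {..k}"
    then have ke: "k * e = i * e + (k - i) * e" by (simp add: add_mult_distrib[symmetric])
    have "coeff (tpol UNIV x ^ i * tpol UNIV y ^ (k - i)) (i * e + (k - i) * e)
        = coeff (tpol UNIV x) e ^ i * coeff (tpol UNIV y) e ^ (k - i)"
      using coeff_power_bound[OF dx, of i] coeff_power_bound[OF dy, of "k - i"]
      by (subst coeff_mult_sum_bound) auto
    then show "coeff (tpol UNIV (mconst (coeff A i) * x ^ i * y ^ (k - i))) (k * e)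
       = mconst (coeff A i) * coeff (tpol UNIV x) e ^ i * coeff (tpol UNIV y) e ^ (k - i)"
      by (simp add: ke t.hom_mult t.hom_power mult.assoc)
  qed
qed

text \<open>If k e exceeded d, with e the larger degree, the components of x and y of degree e would
  be a common zero of the two forms, hence both zero.\<close>

lemma homog_tdeg:
  fixes A B :: "'a::field_gcd poly"
  assumes "coprime A B" "k = max (degree A) (degree B)" "0 < k"
    and d: "tdeg (homog k A x y) \<le> d" "tdeg (homog k B x y) \<le> d"
  shows "k * max (tdeg x) (tdeg y) \<le> d"
proof (rule ccontr)
  let ?e = "max (tdeg x) (tdeg y)"
  assume "\<not> k * ?e \<le> d"
  then have kd: "d < k * ?e" by simp
  have "coeff (tpol UNIV (homog k A x y)) (k * ?e) = 0" "coeff (tpol UNIV (homog k B x y)) (k * ?e) = 0"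
    using kd d by (auto intro!: coeff_eq_0 simp: sdeg_def)
  then have z: "coeff (tpol UNIV x) ?e = 0 \<and> coeff (tpol UNIV y) ?e = 0"
    using homog_top[of x ?e y k] by (intro homog_zero[OF assms(1-3)]) auto
  have e: "0 < ?e" using kd by (cases ?e) auto
  have nz: "coeff (tpol UNIV u) ?e \<noteq> 0" if "?e = tdeg u" for u :: "'a mpoly"
    using that e unfolding sdeg_def by (metis degree_0 leading_coeff_0_iff less_numeral_extra(3))
  show False using nz[of x] nz[of y] z by (auto simp: max_def split: if_splits)
qed

lemma mconst_neq_0: "c \<noteq> 0 \<Longrightarrow> mconst c \<noteq> 0"
  by (metis mconst_eq_iff single_zero)

lemma homog_MP: "x \<in> MP S \<Longrightarrow> y \<in> MP S \<Longrightarrow> homog k A x y \<in> MP S"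
  unfolding homog_def by (intro MP_sum MP_mult MP_power MP_mconst)

lemma psi_inj: "psi n j a = 0 \<Longrightarrow> a \<in> MP {..<n} \<Longrightarrow> j < n \<Longrightarrow> a = 0"
proof -
  assume a: "psi n j a = 0" "a \<in> MP {..<n}" "j < n"
  interpret comm_ring_hom "retr n j j 0 0 :: 'a mpoly poly poly \<Rightarrow> _" by (rule retr_hom)
  show "a = 0" using retr_psi[OF a(2), of j j 0 0] a(1) by (simp add: hom_zero)
qed

lemma wedge_identity:
  fixes a b :: "'c::comm_ring_1"
  assumes "a * l = b * k"
  shows "x * (a * P * Qx - b * Q * Px) + y * (a * P * Qy - b * Q * Py)
    = a * (P * (x * Qx + y * Qy - l * Q)) - b * (Q * (x * Px + y * Py - k * P))"
proof -
  have "a * (P * (l * Q)) = (a * l) * (P * Q)" "b * (Q * (k * P)) = (b * k) * (P * Q)" by (simp_all only: mult_ac)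
  then have "a * (P * (l * Q)) = b * (Q * (k * P))" using assms by simp
  then show ?thesis by (simp add: algebra_simps)
qed

text \<open>The weights a, b are chosen so that the contributions of degree k + l to x A + y B,
  which Euler's relation gives, cancel.\<close>

lemma bdl_wedge:
  assumes P: "bdl (Suc k) P" and Q: "bdl (Suc l) Q" and ab: "a * of_nat l = b * of_nat k"
  shows "bdl (k + l) (cc a * P * dx Q - cc b * Q * dx P)"
    and "bdl (k + l) (cc a * P * dy Q - cc b * Q * dy P)"
    and "bdl (k + l) (vx * (cc a * P * dx Q - cc b * Q * dx P) + vy * (cc a * P * dy Q - cc b * Q * dy P))"
proof -
  have c: "bdl m (cc u * X)" if "bdl m X" for m u and X :: "'a poly poly"
    using bdl_mult[of 0 "cc u" m X] bdl_cc[of u] that by simp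
  have p: "bdl (k + l) (P * X)" if "bdl l X" for X by (rule bdl_mult[OF P that])
  have q: "bdl (k + l) (Q * X)" if "bdl k X" for X using bdl_mult[OF Q that] by (simp add: add.commute)
  show "bdl (k + l) (cc a * P * dx Q - cc b * Q * dx P)" unfolding mult.assoc
    by (intro bdl_diff c p q bdl_dx P Q)
  show "bdl (k + l) (cc a * P * dy Q - cc b * Q * dy P)" unfolding mult.assoc
    by (intro bdl_diff c p q bdl_dy P Q)
  interpret h: comm_ring_hom "cc :: 'a \<Rightarrow> _" by (rule cc_hom)
  have "cc a * cc (of_nat l) = cc b * cc (of_nat k)" unfolding h.hom_mult[symmetric] ab ..
  then show "bdl (k + l) (vx * (cc a * P * dx Q - cc b * Q * dx P) + vy * (cc a * P * dy Q - cc b * Q * dy P))"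
    by (subst wedge_identity[of "cc a" "cc (of_nat l)" "cc b" "cc (of_nat k)"]) (assumption, intro bdl_diff c p q bdl_euler P Q)
qed

abbreviation pencil :: "nat \<Rightarrow> nat \<Rightarrow> 'a::comm_ring_1 mpoly \<Rightarrow> 'a mpoly \<Rightarrow> 'a mpoly poly poly" where
  "pencil n j f g \<equiv> cc (mvar (2 * n)) * psi n j f - cc (mvar (2 * n + 1)) * psi n j g"

definition in_kernel :: "nat \<Rightarrow> 'c::idom poly poly \<Rightarrow> 'c poly poly \<Rightarrow> 'c poly poly \<Rightarrow> bool" where
  "in_kernel d F A B \<longleftrightarrow> bdl d A \<and> bdl d B \<and> bdl d (vx * A + vy * B) \<and> closedf F A B"

text \<open>The form is e1 dq / q - e dP / P, with P the pencil of the cofactors and e the degree of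
  q. If it vanished, the pencil parameters (1, 0) and (0, -1) would give f1 and g1 proportional
  gradients, and being coprime they would be constant.\<close>

lemma kernel_common_factor:
  fixes f1 g1 q :: "'a::field mpoly"
  assumes j: "j < n" and MP: "f1 \<in> MP {..<n}" "g1 \<in> MP {..<n}" "q \<in> MP {..<n}"
    and cop: "mpoly_coprime f1 g1" and q: "q \<noteq> 0" "0 < tdeg q"
    and e1: "tdeg f1 \<le> e1" "tdeg g1 \<le> e1" and ch: "\<And>k. 0 < k \<Longrightarrow> k \<le> e1 + tdeg q \<Longrightarrow> (of_nat k :: 'a) \<noteq> 0"
    and np: "\<not> (f1 \<in> range mconst \<and> g1 \<in> range mconst)"
  shows "\<exists>A B. (A \<noteq> 0 \<or> B \<noteq> 0) \<and> in_kernel (e1 + tdeg q) (pencil n j (q * f1) (q * g1)) A B"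
proof -
  define e where "e = tdeg q"
  define Q P where "Q = psi n j q" and "P = pencil n j f1 g1"
  define A B where "A = cc (of_nat e1) * P * dx Q - cc (of_nat e) * Q * dx P"
    and "B = cc (of_nat e1) * P * dy Q - cc (of_nat e) * Q * dy P"
  interpret psi: comm_ring_hom "psi n j :: 'a mpoly \<Rightarrow> _" by (rule psi_hom)
  interpret h: comm_ring_hom "cc :: 'a mpoly \<Rightarrow> _" by (rule cc_hom)
  have c: "bdl m (cc u * X)" if "bdl m X" for m u and X :: "'a mpoly poly poly"
    using bdl_mult[of 0 "cc u" m X] bdl_cc[of u] that by simp
  have bQ: "bdl (Suc e) Q" unfolding Q_def e_def by (rule bdl_psi)
  have bP: "bdl (Suc e1) P" unfolding P_def
    using e1 by (intro bdl_diff c) (auto intro: bdl_mono[OF bdl_psi])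
  have b: "bdl (e1 + e) A" "bdl (e1 + e) B" "bdl (e1 + e) (vx * A + vy * B)"
    unfolding A_def B_def by (rule bdl_wedge[OF bP bQ], simp)+
  have "closedf (Q * P) A B" unfolding A_def B_def by (rule closedf_product) simp_all
  moreover have "Q * P = pencil n j (q * f1) (q * g1)"
    unfolding P_def Q_def psi.hom_mult right_diff_distrib by (simp only: mult.left_commute)
  ultimately have cl: "closedf (pencil n j (q * f1) (q * g1)) A B" by simp
  have "A \<noteq> 0 \<or> B \<noteq> 0"
  proof (rule ccontr)
    assume "\<not> (A \<noteq> 0 \<or> B \<noteq> 0)"
    then have AB: "A = 0" "B = 0" by auto
    \<comment> \<open>\<open>retr\<close> turns dx of a restricted polynomial into its derivative in
      X_k and dy into that in X_j; u and w are the values of the pencil parameters.\<close>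
    have key: "of_nat e1 * (u * f1 - w * g1) * pd k q = of_nat e * q * (u * pd k f1 - w * pd k g1)"
      if k: "k < n" for k u w
    proof -
      interpret r: comm_ring_hom "retr n j k u w :: 'a mpoly poly poly \<Rightarrow> _" by (rule retr_hom)
      have S: "retr n j k u w (cc (mvar (2 * n))) = u" "retr n j k u w (cc (mvar (2 * n + 1))) = w"
        using k by (simp_all add: retr_cc_mvar)
      have P: "retr n j k u w P = u * f1 - w * g1"
        unfolding P_def r.hom_minus r.hom_mult S retr_psi[OF MP(1)] retr_psi[OF MP(2)] ..
      have Q: "retr n j k u w Q = q" unfolding Q_def by (rule retr_psi[OF MP(3)])
      show ?thesis
      proof (cases "k = j")
        case True
        have p1: "retr n j k u w (dy P) = u * pd j f1 - w * pd j g1"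
          unfolding P_def pderiv_diff dy_mult dy_cc r.hom_minus r.hom_mult r.hom_add S retr_dy_psi[OF MP(1) j] retr_dy_psi[OF MP(2) j]
          by (simp add: r.hom_zero)
        have p2: "retr n j k u w (dy Q) = pd j q" unfolding Q_def by (rule retr_dy_psi[OF MP(3) j])
        have p3: "retr n j k u w (cc (of_nat e1) * P * dy Q) = retr n j k u w (cc (of_nat e) * Q * dy P)"
          using AB(2) unfolding B_def by simp
        from p3[unfolded r.hom_mult P Q h.hom_of_nat r.hom_of_nat p1 p2] show ?thesis unfolding True .
      next
        case False
        have p1: "retr n j k u w (dx P) = u * pd k f1 - w * pd k g1"
          unfolding P_def dx_diff dx_mult dx_cc r.hom_minus r.hom_mult r.hom_add S retr_dx_psi[OF MP(1) j k False] retr_dx_psi[OF MP(2) j k False]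
          by (simp add: r.hom_zero)
        have p2: "retr n j k u w (dx Q) = pd k q" unfolding Q_def by (rule retr_dx_psi[OF MP(3) j k False])
        have p3: "retr n j k u w (cc (of_nat e1) * P * dx Q) = retr n j k u w (cc (of_nat e) * Q * dx P)"
          using AB(1) unfolding A_def by simp
        from p3[unfolded r.hom_mult P Q h.hom_of_nat r.hom_of_nat p1 p2] show ?thesis .
      qed
    qed
    have ne: "(of_nat e :: 'a) \<noteq> 0" using ch[of e] q(2) by (simp add: e_def)
    have mc: "(of_nat e :: 'a mpoly) = mconst (of_nat e)"
    proof -
      interpret m: comm_ring_hom "mconst :: 'a \<Rightarrow> _" by (rule mconst_hom)
      show ?thesis by (simp add: m.hom_of_nat)
    qed
    have e0: "(of_nat e :: 'a mpoly) * q \<noteq> 0"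
      using ne mc q(1) by (metis mult_eq_0_iff mconst_eq_iff single_zero)
    have "f1 * pd k g1 = g1 * pd k f1" if "k < n" for k
    proof -
      have a: "of_nat e1 * f1 * pd k q = of_nat e * q * pd k f1" using key[OF that, of 1 0] by (simp only: mult_1 mult_zero_left diff_zero)
      have b: "of_nat e1 * g1 * pd k q = of_nat e * q * pd k g1" using key[OF that, of 0 "-1"]
        by (simp only: mult_minus1 mult_zero_left diff_minus_eq_add add_0)
      have "(of_nat e * q) * (f1 * pd k g1) = f1 * (of_nat e1 * g1 * pd k q)" unfolding b by (simp only: mult_ac)
      also have "\<dots> = g1 * (of_nat e1 * f1 * pd k q)" by (simp only: mult_ac)
      also have "\<dots> = (of_nat e * q) * (g1 * pd k f1)" unfolding a by (simp only: mult_ac)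
      finally show ?thesis using e0 by simp
    qed
    then have "f1 \<in> range mconst \<and> g1 \<in> range mconst"
      by (rule coprime_dependent_imp_const[OF MP(1,2) cop]) (assumption, rule ch, use e1 in simp_all)
    then show False using np by simp
  qed
  then show ?thesis using b cl unfolding in_kernel_def e_def by blast
qed

text \<open>One form serves all parameters of the pencil, since every member is a combination of the
  H1^i H2^(k - i). Degree (k - 2) e from the power and less than 2 e from the wedge stay below k e
  <= d.\<close>

lemma kernel_composite:
  fixes h1 h2 :: "'a::field mpoly"
  assumes j: "j < n" and MP: "h1 \<in> MP {..<n}" "h2 \<in> MP {..<n}"
    and cop: "mpoly_coprime h1 h2" and k: "2 \<le> k" and h0: "h1 \<noteq> 0" "h2 \<noteq> 0"
    and np: "\<not> (h1 \<in> range mconst \<and> h2 \<in> range mconst)"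
    and d: "k * max (tdeg h1) (tdeg h2) \<le> d" and ch: "\<And>k. 0 < k \<Longrightarrow> k \<le> d \<Longrightarrow> (of_nat k :: 'a) \<noteq> 0"
    and c: "c \<noteq> 0" "mconst c * f = homog k a h1 h2" "mconst c * g = homog k b h1 h2"
  shows "\<exists>A B. (A \<noteq> 0 \<or> B \<noteq> 0) \<and> in_kernel d (pencil n j f g) A B"
proof -
  define e where "e = max (tdeg h1) (tdeg h2)"
  define H1 H2 where "H1 = psi n j h1" and "H2 = psi n j h2"
  define A1 B1 where "A1 = H1 * dx H2 - H2 * dx H1" and "B1 = H1 * dy H2 - H2 * dy H1"
  define A B where "A = H2 ^ (k - 2) * A1" and "B = H2 ^ (k - 2) * B1"
  interpret psi: comm_ring_hom "psi n j :: 'a mpoly \<Rightarrow> _" by (rule psi_hom)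
  interpret h: comm_ring_hom "cc :: 'a mpoly \<Rightarrow> _" by (rule cc_hom)
  have H0: "H1 \<noteq> 0" "H2 \<noteq> 0" using psi_inj[OF _ MP(1) j] psi_inj[OF _ MP(2) j] h0 by (auto simp: H1_def H2_def)
  have bH: "bdl (Suc e) H1" "bdl (Suc e) H2" unfolding H1_def H2_def e_def
    by (rule bdl_mono[OF bdl_psi], simp)+
  have w: "bdl (e + e) A1" "bdl (e + e) B1" "bdl (e + e) (vx * A1 + vy * B1)"
    using bdl_wedge[OF bH(1) bH(2), of 1 1] unfolding A1_def B1_def by (simp_all add: h.hom_one)
  have dd: "(k - 2) * e + (e + e) \<le> d"
  proof -
    have "(k - 2) * e + (e + e) = (k - 2 + 2) * e" by (simp add: algebra_simps)
    also have "\<dots> = k * e" unfolding le_add_diff_inverse2[OF k] ..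
    finally show ?thesis using d by (simp add: e_def)
  qed
  have pw: "bdl d (H2 ^ (k - 2) * X)" if "bdl (e + e) X" for X
    by (rule bdl_mono[OF bdl_mult[OF bdl_power[OF bH(2)] that] dd])
  have "vx * A + vy * B = H2 ^ (k - 2) * (vx * A1 + vy * B1)" unfolding A_def B_def by (simp only: distrib_left mult.left_commute)
  then have bs: "bdl d A" "bdl d B" "bdl d (vx * A + vy * B)"
    using pw[OF w(1)] pw[OF w(2)] pw[OF w(3)] by (simp_all only: A_def B_def)
  have "cc (mconst c) * pencil n j f g
      = cc (mvar (2 * n)) * psi n j (mconst c * f) - cc (mvar (2 * n + 1)) * psi n j (mconst c * g)"
    unfolding psi.hom_mult psi_mconst right_diff_distrib by (simp only: mult.left_commute)
  also have "\<dots> = (\<Sum>i\<le>k. cc (mvar (2 * n) * mconst (coeff a i) - mvar (2 * n + 1) * mconst (coeff b i)) * (H1 ^ i * H2 ^ (k - i)))"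
    unfolding c homog_def psi.hom_sum psi.hom_mult psi.hom_power psi_mconst H1_def[symmetric] H2_def[symmetric]
      sum_distrib_left sum_subtractf[symmetric] h.hom_minus h.hom_mult
    by (simp only: left_diff_distrib mult.assoc)
  finally have e: "cc (mconst c) * pencil n j f g = \<dots>" .
  have "closedf (cc (mconst c) * pencil n j f g) A B"
    unfolding e
  proof (intro closedf_sum closedf_cc)
    fix i assume "i \<in> {..k}"
    then have "i + (k - i) = k" by simp
    from closedf_form[OF H0 k this] show "closedf (H1 ^ i * H2 ^ (k - i)) A B"
      unfolding A_def B_def A1_def B1_def .
  qed
  then have cl: "closedf (pencil n j f g) A B" by (rule closedf_cc_cancel[OF _ mconst_neq_0[OF c(1)]])
  have "A \<noteq> 0 \<or> B \<noteq> 0"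
  proof (rule ccontr)
    assume "\<not> (A \<noteq> 0 \<or> B \<noteq> 0)"
    then have z: "H1 * dx H2 = H2 * dx H1" "H1 * dy H2 = H2 * dy H1"
      using H0(2) unfolding A_def B_def A1_def B1_def by auto
    have dep: "h1 * pd i h2 = h2 * pd i h1" if i: "i < n" for i
    proof -
      interpret r: comm_ring_hom "retr n j i 0 0 :: 'a mpoly poly poly \<Rightarrow> _" by (rule retr_hom)
      show ?thesis
      proof (cases "i = j")
        case True
        have p: "retr n j i 0 0 (H1 * dy H2) = retr n j i 0 0 (H2 * dy H1)" unfolding z ..
        from p[unfolded r.hom_mult H1_def H2_def retr_psi[OF MP(1)] retr_psi[OF MP(2)]
            retr_dy_psi[OF MP(1) j] retr_dy_psi[OF MP(2) j]] show ?thesis unfolding True .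
      next
        case False
        have p: "retr n j i 0 0 (H1 * dx H2) = retr n j i 0 0 (H2 * dx H1)" unfolding z ..
        from p[unfolded r.hom_mult H1_def H2_def retr_psi[OF MP(1)] retr_psi[OF MP(2)]
            retr_dx_psi[OF MP(1) j i False] retr_dx_psi[OF MP(2) j i False]] show ?thesis .
      qed
    qed
    have md: "max (tdeg h1) (tdeg h2) \<le> d"
      using d mult_le_mono1[of 1 k "max (tdeg h1) (tdeg h2)"] k by linarith
    have "h1 \<in> range mconst \<and> h2 \<in> range mconst"
      by (rule coprime_dependent_imp_const[OF MP cop dep]) (assumption, rule ch, assumption, erule order.trans[OF _ md])
    then show False using np by simp
  qed
  then show ?thesis using bs cl unfolding in_kernel_def by blast
qed

text \<open>The two binary forms are f and g times a common factor w. A prime factor of w would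
  divide both forms, hence the coprime h1 and h2, so w is constant.\<close>

lemma composite_imp_homog:
  fixes f g :: "'a::field_gcd mpoly"
  assumes fg: "f \<in> MP {..<n}" "g \<in> MP {..<n}" "g \<noteq> 0" "mpoly_coprime f g" "f \<noteq> 0"
    and comp: "composite n (to_fract f / to_fract g)"
  shows "\<exists>h1 h2 a b k c. h1 \<in> MP {..<n} \<and> h2 \<in> MP {..<n} \<and> h2 \<noteq> 0 \<and> mpoly_coprime h1 h2 \<and>
    coprime a b \<and> k = max (degree a) (degree b) \<and> 2 \<le> k \<and> c \<noteq> 0 \<and>
    mconst c * f = homog k a h1 h2 \<and> mconst c * g = homog k b h1 h2"
proof -
  obtain h a b where h: "h \<in> ratfuns n" and ab: "coprime a b" "2 \<le> max (degree a) (degree b)"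
    and s: "subst_ratfun b h \<noteq> 0" "to_fract f / to_fract g = subst_ratfun a h / subst_ratfun b h"
    using comp unfolding composite_def by blast
  obtain u v where uv: "h = Fract u v" "u \<in> MP {..<n}" "v \<in> MP {..<n}" "v \<noteq> 0"
    using h unfolding ratfuns_def mpolys_eq_MP by blast
  obtain q h1 h2 where q: "u = q * h1" "v = q * h2" "mpoly_coprime h1 h2"
    using extract_common_factor[OF uv(4), of u] by blast
  have q0: "q \<noteq> 0" "h2 \<noteq> 0" using uv(4) q(2) by auto
  have h2: "h2 \<in> MP {..<n}" using MP_factor[of h2 q "{..<n}"] uv(3,4) q(2) by (metis mult.commute)
  have h1: "h1 \<in> MP {..<n}"
  proof (cases "h1 = 0")
    case False
    then have "u \<noteq> 0" using q(1) q0(1) by simp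
    then show ?thesis using MP_factor[of h1 q "{..<n}"] uv(2) q(1) by (metis mult.commute)
  qed simp
  have hh: "h = to_fract h1 / to_fract h2" unfolding uv(1) q(1,2) using q0 by (simp add: to_fract_def eq_fract)
  define k where "k = max (degree a) (degree b)"
  have y: "to_fract h2 \<noteq> 0" "to_fract g \<noteq> 0" using q0 fg(3) by simp_all
  have A: "to_fract (homog k a h1 h2) = to_fract h2 ^ k * subst_ratfun a h"
    and B: "to_fract (homog k b h1 h2) = to_fract h2 ^ k * subst_ratfun b h"
    unfolding hh by (rule homog_fract, simp_all add: k_def q0)+
  have b0: "homog k b h1 h2 \<noteq> 0" using B s(1) y by auto
  have "to_fract (f * homog k b h1 h2) = to_fract (g * homog k a h1 h2)"
    using s y unfolding to_fract_mult A B by (simp add: field_simps)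
  then have E: "f * homog k b h1 h2 = g * homog k a h1 h2" unfolding to_fract_eq_iff .
  then have "f dvd g * homog k a h1 h2" by (metis dvd_triv_left)
  then have "f dvd homog k a h1 h2" by (rule coprime_dvd_mult_mpoly[OF fg(4) _ fg(5)])
  then obtain w where w: "homog k a h1 h2 = f * w" unfolding dvd_def by blast
  have "f * homog k b h1 h2 = f * (g * w)" using E unfolding w by (simp only: mult.left_commute)
  then have w': "homog k b h1 h2 = g * w" using fg(5) by simp
  have "w dvd 1"
  proof (rule ccontr)
    assume nw: "\<not> w dvd 1"
    have "w \<noteq> 0" using b0 w' by auto
    then obtain \<pi> where p: "prime_elem \<pi>" "\<pi> dvd w" using prime_factor_exists_mpoly nw by blast
    have "\<pi> dvd h1 \<and> \<pi> dvd h2"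
    proof (rule homog_prime[OF ab(1) k_def _ p(1)])
      show "0 < k" using ab(2) by (simp add: k_def)
      show "\<pi> dvd homog k a h1 h2" "\<pi> dvd homog k b h1 h2" unfolding w w' using p(2) by (rule dvd_mult)+
    qed
    then have "\<pi> dvd 1" using q(3)[unfolded mpoly_coprime_def, rule_format, of \<pi>] by simp
    then show False using p(1) by (simp add: prime_elem_def)
  qed
  then have w0: "w \<noteq> 0" "w \<in> range mconst" unfolding tdeg_0_iff[symmetric] using dvd_1_iff_tdeg[of w] by simp_all
  from w0(2) obtain c where c: "w = mconst c" by (rule imageE)
  have mc: "mconst c * f = homog k a h1 h2" "mconst c * g = homog k b h1 h2" unfolding w w' c by (rule mult.commute)+
  have c0: "c \<noteq> 0" using w0(1) c by auto
  have k2: "2 \<le> k" using ab(2) k_def by simp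
  show ?thesis
    by (rule exI[of _ h1], rule exI[of _ h2], rule exI[of _ a], rule exI[of _ b], rule exI[of _ k], rule exI[of _ c])
      (intro conjI h1 h2 q0(2) q(3) ab(1) k_def k2 c0 mc)
qed

lemma kernel_exists:
  fixes f g :: "'a::field_gcd mpoly"
  assumes j: "j < n" and fg: "f \<in> MP {..<n}" "g \<in> MP {..<n}" "g \<noteq> 0" and np: "\<And>c. f \<noteq> mconst c * g"
    and d: "tdeg f \<le> d" "tdeg g \<le> d" and ch: "\<And>k. 0 < k \<Longrightarrow> k \<le> d \<Longrightarrow> (of_nat k :: 'a) \<noteq> 0"
    and bad: "\<not> (mpoly_coprime f g \<and> \<not> composite n (to_fract f / to_fract g))"
  shows "\<exists>A B. (A \<noteq> 0 \<or> B \<noteq> 0) \<and> in_kernel d (pencil n j f g) A B"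
proof -
  have f0: "f \<noteq> 0" using np[of 0] by simp
  have cp: False if "mconst w * f = mconst u" "mconst w * g = mconst v" "w \<noteq> 0" for u v w
  proof -
    have v: "v \<noteq> 0" using that(2) fg(3) mconst_neq_0[OF that(3)] by (metis mult_eq_0_iff single_zero)
    have "mconst w * f = mconst w * (mconst (u / v) * g)"
    proof -
      interpret m: comm_ring_hom "mconst :: 'a \<Rightarrow> _" by (rule mconst_hom)
      have "mconst w * (mconst (u / v) * g) = mconst (u / v) * mconst v" unfolding that(2)[symmetric] by (simp only: mult_ac)
      also have "\<dots> = mconst u" unfolding m.hom_mult[symmetric] using v by simp
      finally show ?thesis using that(1) by simp
    qed
    then show False using mconst_neq_0[OF that(3)] np[of "u / v"] by (metis mult_left_cancel)
  qed
  show ?thesis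
  proof (cases "mpoly_coprime f g")
    case False
    obtain q f1 g1 where q: "f = q * f1" "g = q * g1" "mpoly_coprime f1 g1"
      using extract_common_factor[OF fg(3), of f] by blast
    have nz: "q \<noteq> 0" "f1 \<noteq> 0" "g1 \<noteq> 0" using q f0 fg(3) by auto
    have e: "f1 * q = f" "g1 * q = g" unfolding q by (rule mult.commute)+
    have MPs: "f1 \<in> MP {..<n}" "g1 \<in> MP {..<n}" "q \<in> MP {..<n}"
      by (rule MP_factor[of f1 q], unfold e, rule fg, rule f0, rule MP_factor[of g1 q], unfold e, rule fg, rule fg,
          rule MP_factor[of q f1], unfold q(1)[symmetric], rule fg, rule f0)
    have q1: "tdeg q \<noteq> 0"
    proof
      assume "tdeg q = 0"
      then obtain c where c: "q = mconst c" unfolding tdeg_0_iff by blast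
      then have "c \<noteq> 0" using nz by auto
      then have qu: "q dvd 1" unfolding c by (rule mconst_dvd_1)
      have "mpoly_coprime f g" unfolding mpoly_coprime_def
      proof (intro allI impI)
        fix e assume e: "e dvd f" "e dvd g"
        have un: "e dvd h" if "e dvd q * h" for h
        proof -
          obtain q' where "1 = q * q'" using qu unfolding dvd_def by blast
          then have "q * h * q' = h" by (metis mult.assoc mult.commute mult_1)
          then show ?thesis using dvd_mult2[OF that, of q'] by metis
        qed
        show "e dvd 1" using q(3) un[of f1] un[of g1] e unfolding q(1,2) mpoly_coprime_def by blast
      qed
      then show False using False by simp
    qed
    have td: "tdeg f = tdeg q + tdeg f1" "tdeg g = tdeg q + tdeg g1" unfolding q using nz by (simp_all add: sdeg_mult)
    have de: "d - tdeg q + tdeg q = d" using td d by simp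
    \<comment> \<open>With e1 = d - tdeg q the bound is exactly d, also when both f and g have
      smaller degree.\<close>
    have "\<exists>A B. (A \<noteq> 0 \<or> B \<noteq> 0) \<and> in_kernel (d - tdeg q + tdeg q) (pencil n j (q * f1) (q * g1)) A B"
    proof (rule kernel_common_factor[OF j MPs q(3) nz(1)])
      show "\<not> (f1 \<in> range mconst \<and> g1 \<in> range mconst)"
      proof
        assume "f1 \<in> range mconst \<and> g1 \<in> range mconst"
        then obtain u v where uv: "f1 = mconst u" "g1 = mconst v" by blast
        have v: "v \<noteq> 0" using nz uv by auto
        interpret m: comm_ring_hom "mconst :: 'a \<Rightarrow> _" by (rule mconst_hom)
        have "f = mconst (u / v) * mconst v * q" unfolding q(1) uv m.hom_mult[symmetric] using v by (simp add: mult.commute)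
        also have "\<dots> = mconst (u / v) * g" unfolding q(2) uv by (simp only: mult_ac)
        finally show False using np by blast
      qed
    qed (use td d q1 ch de in auto)
    then show ?thesis unfolding de q(1,2)[symmetric] .
  next
    case True
    then have "composite n (to_fract f / to_fract g)" using bad by blast
    from composite_imp_homog[OF fg True f0 this] obtain h1 h2 a b k c where
      h: "h1 \<in> MP {..<n}" "h2 \<in> MP {..<n}" "h2 \<noteq> 0" "mpoly_coprime h1 h2"
      and ab: "coprime a b" "k = max (degree a) (degree b)" "2 \<le> k"
      and c: "c \<noteq> 0" "mconst c * f = homog k a h1 h2" "mconst c * g = homog k b h1 h2" by blast
    have nc: "\<not> (h1 \<in> range mconst \<and> h2 \<in> range mconst)"
    proof
      assume "h1 \<in> range mconst \<and> h2 \<in> range mconst"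
      then have "h1 \<in> MP {}" "h2 \<in> MP {}" unfolding MP_empty by simp_all
      then have "homog k a h1 h2 \<in> MP {}" "homog k b h1 h2 \<in> MP {}" by (rule homog_MP)+
      then obtain u v where "homog k a h1 h2 = mconst u" "homog k b h1 h2 = mconst v" unfolding MP_empty by blast
      then show False using cp[of c u v] c by simp
    qed
    have h10: "h1 \<noteq> 0"
    proof
      assume z: "h1 = 0"
      then have "h2 dvd 1" using h(4) unfolding mpoly_coprime_def by (metis dvd_0_right dvd_refl)
      then have "h2 \<in> range mconst" unfolding dvd_1_iff_tdeg tdeg_0_iff by blast
      moreover have "h1 \<in> range mconst" unfolding z by (metis rangeI single_zero)
      ultimately show False using nc by blast
    qed
    have t: "tdeg (mconst c * u) \<le> d" if "tdeg u \<le> d" for u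
    proof (cases "u = 0")
      case False
      have "tdeg (mconst c :: 'a mpoly) = 0" unfolding tdeg_0_iff by blast
      then show ?thesis unfolding sdeg_mult[OF mconst_neq_0[OF c(1)] False] using that by simp
    next
      case True
      then show ?thesis using that by simp
    qed
    have "k * max (tdeg h1) (tdeg h2) \<le> d"
      by (rule homog_tdeg[OF ab(1,2)]) (use ab(3) t[OF d(1)] t[OF d(2)] c in auto)
    then show ?thesis by (intro kernel_composite[OF j h(1,2,4) ab(3) h10 h(3) nc _ ch c]) auto
  qed
qed

subsection \<open>Norms and minors\<close>

text \<open>Modelled on the sum of the absolute values of all coefficients; \<open>pnorm\<close>
  passes from a coefficient ring to its polynomials and is used twice for bivariate ones.\<close>

locale ring_norm =
  fixes N :: "'r::comm_ring_1 \<Rightarrow> nat"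
  assumes N_0: "N 0 = 0" and N_1: "N 1 \<le> 1" and N_neg: "N (- x) \<le> N x"
    and N_add: "N (x + y) \<le> N x + N y" and N_mult: "N (x * y) \<le> N x * N y"
begin

lemma N_diff: "N (x - y) \<le> N x + N y"
  using N_add[of x "- y"] N_neg[of y] by simp

lemma N_sum: "N (sum F I) \<le> (\<Sum>i\<in>I. N (F i))"
proof (induction I rule: infinite_finite_induct)
  case (insert i I)
  then show ?case using N_add[of "F i" "sum F I"] by simp
qed (simp_all add: N_0)

lemma N_prod: "N (prod F I) \<le> (\<Prod>i\<in>I. N (F i))"
proof (induction I rule: infinite_finite_induct)
  case (insert i I)
  have "N (F i * prod F I) \<le> N (F i) * (\<Prod>i\<in>I. N (F i))"
    using N_mult insert.IH by (rule order.trans[OF _ mult_le_mono2])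
  then show ?case using insert.hyps by simp
qed (use N_1 in simp_all)

lemma N_of_nat: "N (of_nat k) \<le> k"
proof (induction k)
  case (Suc k)
  then show ?case using N_add[of 1 "of_nat k"] N_1 by simp
qed (simp add: N_0)

lemma N_of_int: "N (of_int c) \<le> nat \<bar>c\<bar>"
proof (cases "0 \<le> c")
  case True
  then show ?thesis using N_of_nat[of "nat c"] by simp
next
  case False
  then show ?thesis using N_of_nat[of "nat (- c)"] N_neg[of "- of_int c"] by simp
qed

lemma N_power: "N (x ^ k) \<le> N x ^ k"
  using N_prod[of "\<lambda>_. x" "{..<k}"] by simp

text \<open>In the Leibniz formula the sum over permutations is enlarged to all maps from rows to
  columns, and that sum factors into the product of the row sums.\<close>

lemma N_det:
  assumes M: "M \<in> carrier_mat D D"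
  shows "N (det M) \<le> (\<Prod>i\<in>{0..<D}. \<Sum>j\<in>{0..<D}. N (M $$ (i, j)))"
proof -
  let ?I = "{0..<D}"
  let ?P = "{p. p permutes ?I}"
  have fP: "finite ?P" by (rule finite_permutations) simp
  have s: "N (signof p * x) \<le> N x" for p and x :: 'r
    using N_neg[of x] by (cases "sign p = (1::int)") (auto simp: sign_def)
  have "N (det M) \<le> (\<Sum>p\<in>?P. N (signof p * (\<Prod>i\<in>?I. M $$ (i, p i))))"
    unfolding det_def'[OF M] by (rule N_sum)
  also have "\<dots> \<le> (\<Sum>p\<in>?P. \<Prod>i\<in>?I. N (M $$ (i, p i)))"
  proof (rule sum_mono)
    fix p
    show "N (signof p * (\<Prod>i\<in>?I. M $$ (i, p i))) \<le> (\<Prod>i\<in>?I. N (M $$ (i, p i)))"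
      by (rule order.trans[OF s N_prod])
  qed
  also have "\<dots> = (\<Sum>p\<in>?P. \<Prod>i\<in>?I. N (M $$ (i, restrict p ?I i)))"
    by (intro sum.cong prod.cong refl) simp
  also have "\<dots> = (\<Sum>h\<in>(\<lambda>p. restrict p ?I) ` ?P. \<Prod>i\<in>?I. N (M $$ (i, h i)))"
  proof (rule sum.reindex_cong[symmetric, of "\<lambda>p. restrict p ?I"])
    show "inj_on (\<lambda>p. restrict p ?I) ?P"
    proof (rule inj_onI)
      fix p q assume pq: "p \<in> ?P" "q \<in> ?P" "restrict p ?I = restrict q ?I"
      show "p = q"
      proof
        fix x show "p x = q x"
        proof (cases "x \<in> ?I")
          case True
          then show ?thesis using fun_cong[OF pq(3), of x] by simp
        next
          case False
          then show ?thesis using pq(1,2) by (simp add: permutes_def)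
        qed
      qed
    qed
  qed simp_all
  also have "\<dots> \<le> (\<Sum>h\<in>?I \<rightarrow>\<^sub>E ?I. \<Prod>i\<in>?I. N (M $$ (i, h i)))"
  proof (rule sum_mono2)
    show "(\<lambda>p. restrict p ?I) ` ?P \<subseteq> ?I \<rightarrow>\<^sub>E ?I"
      by (auto simp: permutes_in_image)
  qed (auto intro: finite_PiE)
  also have "\<dots> = (\<Prod>i\<in>?I. \<Sum>j\<in>?I. N (M $$ (i, j)))"
    by (rule prod_sum_PiE[symmetric]) simp_all
  finally show ?thesis .
qed

end

definition pnorm :: "('r::zero \<Rightarrow> nat) \<Rightarrow> 'r poly \<Rightarrow> nat" where
  "pnorm N p = (\<Sum>i\<le>degree p. N (coeff p i))"

context ring_norm
begin

lemma pnorm_eq: "pnorm N p = poly (map_poly N p) 1"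
proof -
  have "poly (map_poly N p) 1 = (\<Sum>i\<le>degree (map_poly N p). N (coeff p i))"
    by (simp add: poly_altdef coeff_map_poly N_0)
  also have "\<dots> = (\<Sum>i\<le>degree p. N (coeff p i))"
  proof (rule sum.mono_neutral_left)
    show "{..degree (map_poly N p)} \<subseteq> {..degree p}" using degree_map_poly_le[of N p] by auto
    show "\<forall>i\<in>{..degree p} - {..degree (map_poly N p)}. N (coeff p i) = 0"
    proof
      fix i assume "i \<in> {..degree p} - {..degree (map_poly N p)}"
      then have "coeff (map_poly N p) i = 0" by (intro coeff_eq_0) auto
      then show "N (coeff p i) = 0" by (simp add: coeff_map_poly N_0)
    qed
  qed simp
  finally show ?thesis by (simp add: pnorm_def)
qed

lemma sum_le_pnorm: "(\<Sum>i\<le>k. N (coeff p i)) \<le> pnorm N p"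
proof -
  have "(\<Sum>i\<le>k. N (coeff p i)) = (\<Sum>i\<in>{..k} \<inter> {..degree p}. N (coeff p i))"
  proof (rule sum.mono_neutral_right)
    show "\<forall>i\<in>{..k} - {..k} \<inter> {..degree p}. N (coeff p i) = 0"
    proof
      fix i assume "i \<in> {..k} - {..k} \<inter> {..degree p}"
      then have "coeff p i = 0" by (intro coeff_eq_0) auto
      then show "N (coeff p i) = 0" by (simp add: N_0)
    qed
  qed auto
  also have "\<dots> \<le> pnorm N p" unfolding pnorm_def by (rule sum_mono2) auto
  finally show ?thesis .
qed

lemma pnorm_pCons: "pnorm N (pCons a p) = N a + pnorm N p"
proof (cases "a = 0 \<and> p = 0")
  case True
  then show ?thesis by (simp add: pnorm_def N_0)
next
  case False
  have "map_poly N (pCons a p) = pCons (N a) (map_poly N p)"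
    by (rule poly_eqI) (simp add: coeff_map_poly N_0 coeff_pCons split: nat.splits)
  then show ?thesis by (simp add: pnorm_eq)
qed

lemma pnorm_le:
  assumes "\<And>i. N (coeff p i) \<le> coeff Q i"
  shows "pnorm N p \<le> poly Q 1"
proof -
  let ?k = "max (degree p) (degree Q)"
  have "pnorm N p \<le> (\<Sum>i\<le>?k. N (coeff p i))" unfolding pnorm_def by (rule sum_mono2) auto
  also have "\<dots> \<le> (\<Sum>i\<le>?k. coeff Q i)" by (intro sum_mono assms)
  also have "\<dots> = (\<Sum>i\<le>degree Q. coeff Q i)" by (rule sum.mono_neutral_right) (auto simp: coeff_eq_0)
  finally show ?thesis by (simp add: poly_altdef)
qed

lemma ring_norm_poly: "ring_norm (pnorm N)"
proof
  show "pnorm N 0 = 0" by (simp add: pnorm_def N_0)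
  show "pnorm N 1 \<le> 1" using N_1 by (simp add: pnorm_def)
  fix x y :: "'r poly"
  have c: "coeff (map_poly N p) i = N (coeff p i)" for p i by (simp add: coeff_map_poly N_0)
  show "pnorm N (- x) \<le> pnorm N x" unfolding pnorm_eq[of x] by (rule pnorm_le) (simp add: c N_neg)
  show "pnorm N (x + y) \<le> pnorm N x + pnorm N y"
    unfolding pnorm_eq[of x] pnorm_eq[of y] poly_add[symmetric]
    by (rule pnorm_le) (simp add: c N_add)
  show "pnorm N (x * y) \<le> pnorm N x * pnorm N y"
    unfolding pnorm_eq[of x] pnorm_eq[of y] poly_mult[symmetric]
  proof (rule pnorm_le)
    fix i
    have "N (coeff (x * y) i) \<le> (\<Sum>j\<le>i. N (coeff x j * coeff y (i - j)))" unfolding coeff_mult by (rule N_sum)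
    also have "\<dots> \<le> (\<Sum>j\<le>i. N (coeff x j) * N (coeff y (i - j)))" by (intro sum_mono N_mult)
    finally show "N (coeff (x * y) i) \<le> coeff (map_poly N x * map_poly N y) i" by (simp add: coeff_mult c)
  qed
qed

end

definition mnorm :: "int mpoly \<Rightarrow> nat" where
  "mnorm f = (\<Sum>m\<in>Poly_Mapping.keys f. nat \<bar>Poly_Mapping.lookup f m\<bar>)"

lemma mnorm_superset: "finite S \<Longrightarrow> Poly_Mapping.keys f \<subseteq> S \<Longrightarrow> mnorm f = (\<Sum>m\<in>S. nat \<bar>Poly_Mapping.lookup f m\<bar>)"
  unfolding mnorm_def by (rule sum.mono_neutral_left) (auto simp: in_keys_iff)

lemma mnorm_add: "mnorm (f + g) \<le> mnorm f + mnorm g"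
proof -
  let ?S = "Poly_Mapping.keys f \<union> Poly_Mapping.keys g"
  have "mnorm (f + g) = (\<Sum>m\<in>?S. nat \<bar>Poly_Mapping.lookup (f + g) m\<bar>)"
    by (rule mnorm_superset) (use keys_add[of f g] in auto)
  also have "\<dots> \<le> (\<Sum>m\<in>?S. nat \<bar>Poly_Mapping.lookup f m\<bar> + nat \<bar>Poly_Mapping.lookup g m\<bar>)"
    by (rule sum_mono) (simp add: lookup_add)
  also have "\<dots> = mnorm f + mnorm g" by (simp add: sum.distrib mnorm_superset[of ?S])
  finally show ?thesis .
qed

lemma mnorm_single: "mnorm (Poly_Mapping.single m c) = nat \<bar>c\<bar>"
  by (simp add: mnorm_superset[of "{m}"])

lemma mnorm_sum: "mnorm (sum F I) \<le> (\<Sum>i\<in>I. mnorm (F i))"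
proof (induction I rule: infinite_finite_induct)
  case (insert i I)
  then show ?case using mnorm_add[of "F i" "sum F I"] by simp
qed (simp_all add: mnorm_def)

lemma mnorm_lookup: "nat \<bar>Poly_Mapping.lookup f m\<bar> \<le> mnorm f"
proof (cases "m \<in> Poly_Mapping.keys f")
  case True
  then show ?thesis unfolding mnorm_def by (intro member_le_sum) auto
qed (simp add: in_keys_iff)

lemma ring_norm_mpoly: "ring_norm mnorm"
proof
  show "mnorm 0 = 0" by (simp add: mnorm_def)
  show "mnorm 1 \<le> 1" by (simp add: mnorm_def)
  fix f g :: "int mpoly"
  show "mnorm (- f) \<le> mnorm f" by (simp add: mnorm_def)
  show "mnorm (f + g) \<le> mnorm f + mnorm g" by (rule mnorm_add)
  have "mnorm (f * g) \<le> (\<Sum>m\<in>Poly_Mapping.keys f. \<Sum>m'\<in>Poly_Mapping.keys g.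
      mnorm (Poly_Mapping.single (m + m') (Poly_Mapping.lookup f m * Poly_Mapping.lookup g m')))"
    unfolding mpoly_mult_monomials[of f g] by (intro order.trans[OF mnorm_sum] sum_mono mnorm_sum)
  also have "\<dots> = mnorm f * mnorm g"
    unfolding mnorm_single abs_mult mnorm_def[of f] mnorm_def[of g] sum_product by (simp add: nat_mult_distrib)
  finally show "mnorm (f * g) \<le> mnorm f * mnorm g" .
qed

text \<open>A minor is a choice \<rho> of D rows from an arbitrary index type. If all minors of the
  first D columns vanish, a kernel vector for them is extended by 0; otherwise the signed minors of
  one nonvanishing choice form a kernel vector, with no division.\<close>

lemma minors_zero_imp_kernel:
  fixes M :: "'r \<Rightarrow> nat \<Rightarrow> 'a::idom"
  assumes "\<And>\<rho> :: nat \<Rightarrow> 'r. det (mat D D (\<lambda>(i, j). M (\<rho> i) j)) = 0"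
  shows "\<exists>v. (\<exists>l<D. v l \<noteq> 0) \<and> (\<forall>r. (\<Sum>l<D. M r l * v l) = 0)"
  using assms
proof (induction D)
  case 0
  have "det (mat 0 0 (\<lambda>(i, j). M (\<rho> i) j)) = 1" for \<rho> :: "nat \<Rightarrow> 'r" by (rule det_dim_zero) simp
  then show ?case using 0 by simp
next
  case (Suc D)
  show ?case
  proof (cases "\<forall>\<rho> :: nat \<Rightarrow> 'r. det (mat D D (\<lambda>(i, j). M (\<rho> i) j)) = 0")
    case True
    then obtain v where v: "\<exists>l<D. v l \<noteq> 0" "\<forall>r. (\<Sum>l<D. M r l * v l) = 0" using Suc.IH by blast
    have "(\<Sum>l<Suc D. M r l * (v(D := 0)) l) = 0" for r
    proof -
      have "(\<Sum>l<Suc D. M r l * (v(D := 0)) l) = (\<Sum>l<D. M r l * v l)" by (simp cong: sum.cong_simp)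
      then show ?thesis using v(2) by simp
    qed
    moreover have "\<exists>l<Suc D. (v(D := 0)) l \<noteq> 0" using v(1) by (metis fun_upd_other less_Suc_eq nat_neq_iff)
    ultimately show ?thesis by blast
  next
    case False
    then obtain \<rho> :: "nat \<Rightarrow> 'r" where nz: "det (mat D D (\<lambda>(i, j). M (\<rho> i) j)) \<noteq> 0" by blast
    \<comment> \<open>The cofactors of the last row when \<rho> is bordered by any row r; Laplace
      expansion along r gives a minor, which vanishes.\<close>
    define v where "v l = (-1) ^ (D + l) * det (mat D D (\<lambda>(i, j). M (\<rho> i) (if j < l then j else Suc j)))" for l
    have "mat D D (\<lambda>(i, j). M (\<rho> i) (if j < D then j else Suc j)) = mat D D (\<lambda>(i, j). M (\<rho> i) j)"
      by (rule eq_matI) auto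
    then have "v D \<noteq> 0" using nz by (simp add: v_def)
    moreover have "(\<Sum>l<Suc D. M r l * v l) = 0" for r
    proof -
      let ?A = "mat (Suc D) (Suc D) (\<lambda>(i, j). M ((\<rho>(D := r)) i) j)"
      have "0 = det ?A" using Suc.prems by simp
      also have "\<dots> = (\<Sum>l<Suc D. ?A $$ (D, l) * cofactor ?A D l)"
        by (rule laplace_expansion_row) auto
      also have "\<dots> = (\<Sum>l<Suc D. M r l * v l)"
      proof (rule sum.cong[OF refl])
        fix l assume l: "l \<in> {..<Suc D}"
        have "mat_delete ?A D l = mat D D (\<lambda>(i, j). M (\<rho> i) (if j < l then j else Suc j))"
          unfolding mat_delete_def by (rule eq_matI) (use l in auto)
        then show "?A $$ (D, l) * cofactor ?A D l = M r l * v l" using l by (simp add: cofactor_def v_def)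
      qed
      finally show ?thesis by simp
    qed
    ultimately show ?thesis by blast
  qed
qed

lemma kernel_imp_minor_zero:
  fixes M :: "'r \<Rightarrow> nat \<Rightarrow> 'a::idom"
  assumes v: "l < D" "v l \<noteq> 0" and k: "\<And>r. (\<Sum>l<D. M r l * v l) = 0"
  shows "det (mat D D (\<lambda>(i, j). M (\<rho> i) j)) = 0"
proof -
  let ?A = "mat D D (\<lambda>(i, j). M (\<rho> i) j)"
  have "vec D v \<noteq> 0\<^sub>v D" using v by (metis index_vec index_zero_vec(1))
  moreover have "?A *\<^sub>v vec D v = 0\<^sub>v D"
  proof (rule eq_vecI)
    fix i assume "i < dim_vec (0\<^sub>v D)"
    then have i: "i < D" by simp
    have "(?A *\<^sub>v vec D v) $ i = (\<Sum>l<D. M (\<rho> i) l * v l)"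
      using i by (simp add: scalar_prod_def atLeast0LessThan)
    then show "(?A *\<^sub>v vec D v) $ i = 0\<^sub>v D $ i" using k i by simp
  qed simp
  ultimately show ?thesis using det_0_iff_vec_prod_zero[of ?A D] by (metis mat_carrier vec_carrier)
qed

text \<open>Stars and bars: the slack d - deg m as a last entry makes every list of exponents sum to
  exactly d.\<close>

lemma card_monomials_le:
  assumes "\<And>m. m \<in> K \<Longrightarrow> Poly_Mapping.keys m \<subseteq> {..<n} \<and> mdeg UNIV m \<le> d"
  shows "card K \<le> (n + d) choose n"
proof -
  define L where "L = {l :: nat list. length l = Suc n \<and> sum_list l = d}"
  define \<phi> where "\<phi> m = map (Poly_Mapping.lookup m) [0..<n] @ [d - mdeg UNIV m]" for m :: "nat \<Rightarrow>\<^sub>0 nat"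
  have cL: "card L = (n + d) choose n"
    unfolding L_def card_length_sum_list using binomial_symmetric[of n "n + d"] by (simp add: add.commute)
  then have fin: "finite L" by (intro card_ge_0_finite) (simp add: zero_less_binomial)
  have img: "\<phi> m \<in> L" if "m \<in> K" for m
  proof -
    have m: "Poly_Mapping.keys m \<subseteq> {..<n}" "mdeg UNIV m \<le> d" using assms that by auto
    have "mdeg UNIV m = (\<Sum>i<n. Poly_Mapping.lookup m i)"
      unfolding mdeg_def by (rule sum.mono_neutral_left) (use m(1) in \<open>auto simp: in_keys_iff\<close>)
    then show ?thesis using m(2) by (simp add: L_def \<phi>_def interv_sum_list_conv_sum_set_nat atLeast0LessThan)
  qed
  have inj: "inj_on \<phi> K"
  proof (rule inj_onI)
    fix a b assume ab: "a \<in> K" "b \<in> K" "\<phi> a = \<phi> b"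
    have lt: "Poly_Mapping.lookup a i = Poly_Mapping.lookup b i" if "i < n" for i
      using ab(3) that by (auto simp: \<phi>_def)
    show "a = b"
    proof (rule poly_mapping_eqI)
      fix i show "Poly_Mapping.lookup a i = Poly_Mapping.lookup b i"
      proof (cases "i < n")
        case False
        then have "i \<notin> Poly_Mapping.keys a" "i \<notin> Poly_Mapping.keys b" using assms[OF ab(1)] assms[OF ab(2)] by auto
        then show ?thesis by (simp add: in_keys_iff)
      qed (rule lt)
    qed
  qed
  have "\<phi> ` K \<subseteq> L" using img by blast
  from card_inj_on_le[OF inj this fin] show ?thesis unfolding cL .
qed

subsection \<open>The linear system\<close>

abbreviation mono :: "'c::comm_ring_1 \<Rightarrow> nat \<Rightarrow> nat \<Rightarrow> 'c poly poly" where
  "mono c i j \<equiv> monom (monom c i) j"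

lemma cf_mono: "cf (mono c i j) a b = (if a = i \<and> b = j then c else 0)"
  by simp

lemma cf_mult_mono: "cf (q * mono c i j) a b = (if i \<le> a \<and> j \<le> b then c * cf q (a - i) (b - j) else 0)"
  unfolding mult.commute[of q] by (simp add: coeff_monom_mult)

lemma dy_mono: "dy (mono c i j) = mono (of_nat j * c) i (j - 1)" for c :: "'c::idom"
  by (simp add: pderiv_monom of_nat_poly smult_monom)

lemma dx_mono: "dx (mono c i j) = mono (of_nat i * c) (i - 1) j" for c :: "'c::idom"
  by (simp add: dx_def map_poly_monom pderiv_monom)

lemma cf_mult_dy_mono:
  "cf (F * dy (mono c i j)) a b = (if i \<le> a \<and> j \<le> b + 1 then of_nat j * c * cf F (a - i) (b + 1 - j) else 0)"
  for c :: "'c::idom"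
  unfolding dy_mono cf_mult_mono by (cases j) auto

lemma cf_mult_dx_mono:
  "cf (F * dx (mono c i j)) a b = (if i \<le> a + 1 \<and> j \<le> b then of_nat i * c * cf F (a + 1 - i) (b - j) else 0)"
  for c :: "'c::idom"
  unfolding dx_mono cf_mult_mono by (cases i) auto

text \<open>At j = b + 1 the factor b + 1 - j is zero, which allows the same case condition as in
  \<open>cf_mult_dy_mono\<close>.\<close>

lemma cf_dy_mult_mono:
  "cf (dy F * mono c i j) a b = (if i \<le> a \<and> j \<le> b + 1 then of_nat (b + 1 - j) * c * cf F (a - i) (b + 1 - j) else 0)"
  for c :: "'c::idom"
proof (cases "j = b + 1")
  case False
  then have "j \<le> b + 1 \<longleftrightarrow> j \<le> b" "j \<le> b \<Longrightarrow> b + 1 - j = Suc (b - j)" by auto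
  then show ?thesis unfolding cf_mult_mono cf_dy by (simp del: of_nat_Suc)
qed (simp add: cf_mult_mono)

lemma cf_dx_mult_mono:
  "cf (dx F * mono c i j) a b = (if i \<le> a + 1 \<and> j \<le> b then of_nat (a + 1 - i) * c * cf F (a + 1 - i) (b - j) else 0)"
  for c :: "'c::idom"
proof (cases "i = a + 1")
  case False
  then have "i \<le> a + 1 \<longleftrightarrow> i \<le> a" "i \<le> a \<Longrightarrow> a + 1 - i = Suc (a - i)" by auto
  then show ?thesis unfolding cf_mult_mono cf_dx by (simp del: of_nat_Suc)
qed (simp add: cf_mult_mono)

definition closed_op :: "'c::idom poly poly \<Rightarrow> 'c poly poly \<Rightarrow> 'c poly poly \<Rightarrow> 'c poly poly" where
  "closed_op F A B = F * dy A - F * dx B - dy F * A + dx F * B"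

lemma closedf_iff: "closedf F A B \<longleftrightarrow> closed_op F A B = 0"
proof -
  have "closed_op F A B = F * (dy A - dx B) - (dy F * A - dx F * B)"
    by (simp add: closed_op_def right_diff_distrib)
  then show ?thesis by (simp add: closedf_def)
qed

text \<open>A basis of the pairs \<open>(A, B)\<close> with \<open>A\<close>, \<open>B\<close> and \<open>x A + y B\<close> of total degree less than \<open>d\<close>:
  the pairs \<open>(m, 0)\<close> and \<open>(0, m)\<close> for the monomials \<open>m\<close> of degree at most \<open>d - 2\<close>, and the pairs
  \<open>(y m, - x m)\<close> for the monomials of degree \<open>d - 2\<close>.\<close>

datatype label = LA nat nat | LB nat nat | LC nat nat

primrec bA :: "label \<Rightarrow> 'c::comm_ring_1 poly poly" where
  "bA (LA i j) = mono 1 i j" | "bA (LB i j) = 0" | "bA (LC i j) = mono 1 i (Suc j)"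

primrec bB :: "label \<Rightarrow> 'c::comm_ring_1 poly poly" where
  "bB (LA i j) = 0" | "bB (LB i j) = mono 1 i j" | "bB (LC i j) = mono (- 1) (Suc i) j"

definition tri :: "nat \<Rightarrow> (nat \<times> nat) set" where "tri d = {(i, j). i + j \<le> d}"

definition labels :: "nat \<Rightarrow> label set" where
  "labels d = (\<lambda>(i, j). LA i j) ` tri (d - 2) \<union> (\<lambda>(i, j). LB i j) ` tri (d - 2) \<union> (\<lambda>i. LC i (d - 2 - i)) ` {..d - 2}"

lemma finite_tri [simp]: "finite (tri d)"
  by (rule finite_subset[of _ "{..d} \<times> {..d}"]) (auto simp: tri_def)

lemma sum_labels:
  "sum h (labels d) = (\<Sum>(i, j)\<in>tri (d - 2). h (LA i j)) + (\<Sum>(i, j)\<in>tri (d - 2). h (LB i j)) + (\<Sum>i\<le>d - 2. h (LC i (d - 2 - i)))"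
proof -
  have i: "inj_on (\<lambda>(i, j). LA i j) X" "inj_on (\<lambda>(i, j). LB i j) X" "inj_on (\<lambda>i. LC i (d - 2 - i)) Y" for X Y
    by (auto simp: inj_on_def)
  show ?thesis
    unfolding labels_def
    by (subst sum.union_disjoint, simp, simp, force, subst sum.union_disjoint, simp, simp, force)
      (simp only: sum.reindex[OF i(1)] sum.reindex[OF i(2)] sum.reindex[OF i(3)] o_def, simp add: case_prod_unfold)
qed

lemma finite_labels: "finite (labels d)"
  by (simp add: labels_def)

lemma card_tri: "2 * card (tri k) = (k + 1) * (k + 2)"
proof (induction k)
  case 0
  have "tri 0 = {(0, 0)}" by (auto simp: tri_def)
  then show ?case by simp
next
  case (Suc k)
  have e: "tri (Suc k) = tri k \<union> (\<lambda>i. (i, Suc k - i)) ` {..Suc k}"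
  proof
    show "tri (Suc k) \<subseteq> tri k \<union> (\<lambda>i. (i, Suc k - i)) ` {..Suc k}"
    proof
      fix x assume "x \<in> tri (Suc k)"
      then obtain i j where x: "x = (i, j)" "i + j \<le> Suc k" by (auto simp: tri_def)
      show "x \<in> tri k \<union> (\<lambda>i. (i, Suc k - i)) ` {..Suc k}"
      proof (cases "i + j \<le> k")
        case False
        then have "j = Suc k - i" "i \<le> Suc k" using x by auto
        then show ?thesis using x by blast
      qed (simp add: tri_def x)
    qed
  qed (auto simp: tri_def)
  have c: "card ((\<lambda>i. (i, Suc k - i)) ` {..Suc k}) = k + 2" by (subst card_image) (auto simp: inj_on_def)
  have "card (tri (Suc k)) = card (tri k) + (k + 2)"
    unfolding e by (subst card_Un_disjoint) (simp_all add: c, auto simp: tri_def)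
  then show ?case using Suc by (simp add: algebra_simps)
qed

text \<open>Two triangles of d (d - 1) / 2 monomials each and a diagonal of d - 1.\<close>

lemma card_labels: "2 \<le> d \<Longrightarrow> card (labels d) = d\<^sup>2 - 1"
proof -
  assume d: "2 \<le> d"
  then obtain k where k: "d = k + 2" by (metis le_iff_add add.commute)
  have "card (labels d) = (\<Sum>l\<in>labels d. 1)" by simp
  also have "\<dots> = 2 * card (tri k) + (k + 1)" unfolding sum_labels k by (simp add: case_prod_unfold)
  also have "\<dots> = d\<^sup>2 - 1" unfolding card_tri k by (simp add: power2_eq_square algebra_simps)
  finally show ?thesis .
qed

text \<open>A row (a, b) is the coefficient of x^a y^b in the closedness equation, a column an
  element of the basis.\<close>

definition entry :: "'c::idom poly poly \<Rightarrow> nat \<times> nat \<Rightarrow> label \<Rightarrow> 'c" where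
  "entry F r l = cf (closed_op F (bA l) (bB l)) (fst r) (snd r)"

text \<open>Differentiating F and differentiating the monomial meet the same coefficient of F with
  multipliers of opposite sign, so an entry is one coefficient of F times a small integer. This
  keeps the row sums small.\<close>

lemma entry_LA: "entry F (a, b) (LA i j) =
    (if i \<le> a \<and> j \<le> b + 1 then of_int (int j - int (b + 1 - j)) * cf F (a - i) (b + 1 - j) else 0)"
proof -
  have "entry F (a, b) (LA i j) = cf (F * dy (mono 1 i j)) a b - cf (dy F * mono 1 i j) a b"
    by (simp add: entry_def closed_op_def dx_def)
  then show ?thesis unfolding cf_mult_dy_mono cf_dy_mult_mono
    by (cases "i \<le> a \<and> j \<le> b + 1")
      (simp_all only: if_True if_False simp_thms mult_1_right of_int_diff of_int_of_nat_eq left_diff_distrib diff_self)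
qed

lemma entry_LB: "entry F (a, b) (LB i j) =
    (if i \<le> a + 1 \<and> j \<le> b then of_int (int (a + 1 - i) - int i) * cf F (a + 1 - i) (b - j) else 0)"
proof -
  have "entry F (a, b) (LB i j) = cf (dx F * mono 1 i j) a b - cf (F * dx (mono 1 i j)) a b"
    by (simp add: entry_def closed_op_def)
  then show ?thesis unfolding cf_mult_dx_mono cf_dx_mult_mono
    by (cases "i \<le> a + 1 \<and> j \<le> b")
      (simp_all only: if_True if_False simp_thms mult_1_right of_int_diff of_int_of_nat_eq left_diff_distrib diff_self)
qed

text \<open>Here A_y - B_x is (i + j + 2) x^i y^j, and the other two terms form the Euler operator
  of F; so the multiplier is i + j + 2 minus the degree of the coefficient that is met.\<close>

lemma entry_LC: "entry F (a, b) (LC i j) =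
    (if i \<le> a \<and> j \<le> b then of_int (int (i + j + 2) - int (a - i) - int (b - j)) * cf F (a - i) (b - j) else 0)"
proof -
  have "entry F (a, b) (LC i j) = cf (F * dy (mono 1 i (Suc j))) a b - cf (F * dx (mono (- 1) (Suc i) j)) a b
     - cf (dy F * mono 1 i (Suc j)) a b + cf (dx F * mono (- 1) (Suc i) j) a b"
    by (simp add: entry_def closed_op_def)
  moreover define u w where "u = a - i" and "w = b - j"
  moreover have "a + 1 - Suc i = u" "b + 1 - Suc j = w" "Suc i \<le> a + 1 \<longleftrightarrow> i \<le> a" "Suc j \<le> b + 1 \<longleftrightarrow> j \<le> b"
    by (simp_all add: u_def w_def)
  ultimately show ?thesis
    unfolding cf_mult_dx_mono cf_dx_mult_mono cf_mult_dy_mono cf_dy_mult_mono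
    by (cases "i \<le> a \<and> j \<le> b") (auto simp: algebra_simps)
qed

lemma sum_le_reindex:
  fixes f :: "'i \<Rightarrow> nat" and h :: "'j \<Rightarrow> nat"
  assumes "finite I" "finite T" and le: "\<And>x. x \<in> I \<Longrightarrow> f x \<noteq> 0 \<Longrightarrow> \<phi> x \<in> T \<and> f x \<le> h (\<phi> x)"
    and inj: "\<And>x y. x \<in> I \<Longrightarrow> y \<in> I \<Longrightarrow> f x \<noteq> 0 \<Longrightarrow> f y \<noteq> 0 \<Longrightarrow> \<phi> x = \<phi> y \<Longrightarrow> x = y"
  shows "sum f I \<le> sum h T"
proof -
  let ?J = "{x \<in> I. f x \<noteq> 0}"
  have "sum f I = sum f ?J" by (rule sum.mono_neutral_right) (use assms(1) in auto)
  also have "\<dots> \<le> (\<Sum>x\<in>?J. h (\<phi> x))" by (rule sum_mono) (use le in auto)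
  also have "\<dots> = sum h (\<phi> ` ?J)"
    by (subst sum.reindex) (auto intro!: inj_onI inj)
  also have "\<dots> \<le> sum h T" by (rule sum_mono2) (use assms(2) le in auto)
  finally show ?thesis .
qed

text \<open>In one row each of the three kinds of labels meets a coefficient of F, at x^s y^t, at
  most once, with multipliers up to max t (d - 2 - t), max s (d - 2 - s) and d - s - t. Their sum is
  at most 3 d - 4, the value at s = t = 0.\<close>

lemma (in ring_norm) row_norm_le:
  fixes F :: "'r poly poly"
  assumes d: "2 \<le> d"
    and A: "\<And>i j. E (LA i j) = (if i \<le> a \<and> j \<le> b + 1 then of_int (int j - int (b + 1 - j)) * cf F (a - i) (b + 1 - j) else 0)"
    and B: "\<And>i j. E (LB i j) = (if i \<le> a + 1 \<and> j \<le> b then of_int (int (a + 1 - i) - int i) * cf F (a + 1 - i) (b - j) else 0)"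
    and C: "\<And>i j. E (LC i j) = (if i \<le> a \<and> j \<le> b then of_int (int (i + j + 2) - int (a - i) - int (b - j)) * cf F (a - i) (b - j) else 0)"
    and F: "bdl (Suc d) F"
  shows "(\<Sum>l\<in>labels d. N (E l)) \<le> (3 * d - 4) * (\<Sum>(s, t)\<in>tri d. N (cf F s t))"
proof -
  have tri: "s + t \<le> d" if "N (of_int k * cf F s t) \<noteq> 0" for k s t
  proof (rule ccontr)
    assume "\<not> s + t \<le> d"
    then have "cf F s t = 0" using F by (simp add: bdl_def)
    then show False using that by (simp add: N_0)
  qed
  have m: "N (of_int k * x) \<le> w * N x" if "nat \<bar>k\<bar> \<le> w" for k x w
  proof -
    have "N (of_int k * x) \<le> N (of_int k) * N x" by (rule N_mult)
    also have "\<dots> \<le> w * N x" using N_of_int[of k] that by (intro mult_le_mono1) linarith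
    finally show ?thesis .
  qed
  have sA: "(\<Sum>(i, j)\<in>tri (d - 2). N (E (LA i j))) \<le> (\<Sum>(s, t)\<in>tri d. max t (d - 2 - t) * N (cf F s t))"
  proof (rule sum_le_reindex[where \<phi> = "\<lambda>(i, j). (a - i, b + 1 - j)"])
    fix x assume x: "x \<in> tri (d - 2)" "(case x of (i, j) \<Rightarrow> N (E (LA i j))) \<noteq> 0"
    obtain i j where ij: "x = (i, j)" by force
    have c: "i \<le> a \<and> j \<le> b + 1" using x(2) by (auto simp: ij A N_0 split: if_splits)
    have n: "N (of_int (int j - int (b + 1 - j)) * cf F (a - i) (b + 1 - j)) \<noteq> 0" using x(2) c by (simp add: ij A)
    have "i + j \<le> d - 2" using x(1) by (simp add: ij tri_def)
    then have w: "nat \<bar>int j - int (b + 1 - j)\<bar> \<le> max (b + 1 - j) (d - 2 - (b + 1 - j))"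
      using tri[OF n] by linarith
    show "(case x of (i, j) \<Rightarrow> (a - i, b + 1 - j)) \<in> tri d \<and>
       (case x of (i, j) \<Rightarrow> N (E (LA i j))) \<le> (case case x of (i, j) \<Rightarrow> (a - i, b + 1 - j) of (s, t) \<Rightarrow> max t (d - 2 - t) * N (cf F s t))"
      using tri[OF n] m[OF w] c by (simp add: ij tri_def A del: of_int_diff)
  next
    fix x y assume "x \<in> tri (d - 2)" "y \<in> tri (d - 2)" "(case x of (i, j) \<Rightarrow> N (E (LA i j))) \<noteq> 0"
       "(case y of (i, j) \<Rightarrow> N (E (LA i j))) \<noteq> 0" "(case x of (i, j) \<Rightarrow> (a - i, b + 1 - j)) = (case y of (i, j) \<Rightarrow> (a - i, b + 1 - j))"
    then show "x = y" by (auto simp: A N_0 split: prod.splits if_splits)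
  qed simp_all
  have sB: "(\<Sum>(i, j)\<in>tri (d - 2). N (E (LB i j))) \<le> (\<Sum>(s, t)\<in>tri d. max s (d - 2 - s) * N (cf F s t))"
  proof (rule sum_le_reindex[where \<phi> = "\<lambda>(i, j). (a + 1 - i, b - j)"])
    fix x assume x: "x \<in> tri (d - 2)" "(case x of (i, j) \<Rightarrow> N (E (LB i j))) \<noteq> 0"
    obtain i j where ij: "x = (i, j)" by force
    have c: "i \<le> a + 1 \<and> j \<le> b" using x(2) by (auto simp: ij B N_0 split: if_splits)
    have n: "N (of_int (int (a + 1 - i) - int i) * cf F (a + 1 - i) (b - j)) \<noteq> 0" using x(2) c by (simp add: ij B)
    have "i + j \<le> d - 2" using x(1) by (simp add: ij tri_def)
    then have w: "nat \<bar>int (a + 1 - i) - int i\<bar> \<le> max (a + 1 - i) (d - 2 - (a + 1 - i))"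
      using tri[OF n] by linarith
    show "(case x of (i, j) \<Rightarrow> (a + 1 - i, b - j)) \<in> tri d \<and>
       (case x of (i, j) \<Rightarrow> N (E (LB i j))) \<le> (case case x of (i, j) \<Rightarrow> (a + 1 - i, b - j) of (s, t) \<Rightarrow> max s (d - 2 - s) * N (cf F s t))"
      using tri[OF n] m[OF w] c by (simp add: ij tri_def B del: of_int_diff)
  next
    fix x y assume "x \<in> tri (d - 2)" "y \<in> tri (d - 2)" "(case x of (i, j) \<Rightarrow> N (E (LB i j))) \<noteq> 0"
       "(case y of (i, j) \<Rightarrow> N (E (LB i j))) \<noteq> 0" "(case x of (i, j) \<Rightarrow> (a + 1 - i, b - j)) = (case y of (i, j) \<Rightarrow> (a + 1 - i, b - j))"
    then show "x = y" by (auto simp: B N_0 split: prod.splits if_splits)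
  qed simp_all
  have sC: "(\<Sum>i\<le>d - 2. N (E (LC i (d - 2 - i)))) \<le> (\<Sum>(s, t)\<in>tri d. (d - s - t) * N (cf F s t))"
  proof (rule sum_le_reindex[where \<phi> = "\<lambda>i. (a - i, b - (d - 2 - i))"])
    fix i assume x: "i \<in> {..d - 2}" "N (E (LC i (d - 2 - i))) \<noteq> 0"
    define j where "j = d - 2 - i"
    have ij: "i + j + 2 = d" using x(1) d by (simp add: j_def)
    have c: "i \<le> a \<and> j \<le> b" using x(2) by (auto simp: C N_0 j_def split: if_splits)
    have n: "N (of_int (int (i + j + 2) - int (a - i) - int (b - j)) * cf F (a - i) (b - j)) \<noteq> 0"
      using x(2) c by (simp add: C j_def)
    have w: "nat \<bar>int (i + j + 2) - int (a - i) - int (b - j)\<bar> \<le> d - (a - i) - (b - j)"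
      using tri[OF n] ij by linarith
    show "(a - i, b - (d - 2 - i)) \<in> tri d \<and>
       N (E (LC i (d - 2 - i))) \<le> (case (a - i, b - (d - 2 - i)) of (s, t) \<Rightarrow> (d - s - t) * N (cf F s t))"
      using tri[OF n] m[OF w] c unfolding j_def[symmetric] by (simp add: tri_def C del: of_int_diff of_int_add of_nat_add)
  next
    fix i i' assume nz: "N (E (LC i (d - 2 - i))) \<noteq> 0" "N (E (LC i' (d - 2 - i'))) \<noteq> 0"
      and eq: "(a - i, b - (d - 2 - i)) = (a - i', b - (d - 2 - i'))"
    have "i \<le> a" "i' \<le> a" using nz by (auto simp: C N_0 split: if_splits)
    moreover have "a - i = a - i'" using eq by simp
    ultimately show "i = i'" by arith
  qed simp_all
  have "(\<Sum>l\<in>labels d. N (E l)) \<le> (\<Sum>(s, t)\<in>tri d. max t (d - 2 - t) * N (cf F s t))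
     + (\<Sum>(s, t)\<in>tri d. max s (d - 2 - s) * N (cf F s t)) + (\<Sum>(s, t)\<in>tri d. (d - s - t) * N (cf F s t))"
    unfolding sum_labels by (intro add_mono sA sB sC)
  also have "\<dots> = (\<Sum>(s, t)\<in>tri d. (max t (d - 2 - t) + max s (d - 2 - s) + (d - s - t)) * N (cf F s t))"
    by (simp add: sum.distrib[symmetric] case_prod_unfold add_mult_distrib)
  also have "\<dots> \<le> (\<Sum>(s, t)\<in>tri d. (3 * d - 4) * N (cf F s t))"
  proof (rule sum_mono)
    fix x assume x: "x \<in> tri d"
    obtain s t where st: "x = (s, t)" by force
    have "max t (d - 2 - t) + max s (d - 2 - s) + (d - s - t) \<le> 3 * d - 4"
    proof -
      have "s + t \<le> d" using x by (simp add: st tri_def)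
      then obtain u where "d = s + t + u" by (metis le_iff_add)
      then show ?thesis using d by (cases "t \<le> d - 2 - t"; cases "s \<le> d - 2 - s") (simp_all add: max_def)
    qed
    then show "(case x of (s, t) \<Rightarrow> (max t (d - 2 - t) + max s (d - 2 - s) + (d - s - t)) * N (cf F s t))
       \<le> (case x of (s, t) \<Rightarrow> (3 * d - 4) * N (cf F s t))" unfolding st by (simp only: prod.case mult_le_mono1)
  qed
  finally show ?thesis by (simp add: sum_distrib_left case_prod_unfold)
qed

lemma cf_sum_bA:
  assumes "2 \<le> d"
  shows "cf (\<Sum>l\<in>labels d. cc (w l) * bA l) a b =
    (if a + b \<le> d - 2 then w (LA a b) else if a + b = d - 1 \<and> b \<noteq> 0 then w (LC a (b - 1)) else 0)"
proof -
  have "cf (\<Sum>l\<in>labels d. cc (w l) * bA l) a b = (\<Sum>l\<in>labels d. w l * cf (bA l) a b)"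
    by (simp add: coeff_sum)
  also have "\<dots> = (\<Sum>x\<in>tri (d - 2). if x = (a, b) then w (LA a b) else 0)
     + (\<Sum>i\<le>d - 2. if i = a then if b = Suc (d - 2 - a) then w (LC a (d - 2 - a)) else 0 else 0)"
    unfolding sum_labels
  proof -
    have "(\<Sum>(i, j)\<in>tri (d - 2). w (LA i j) * cf (bA (LA i j)) a b) = (\<Sum>x\<in>tri (d - 2). if x = (a, b) then w (LA a b) else 0)"
      by (intro sum.cong refl) (auto simp: cf_mono simp del: coeff_monom split: if_splits)
    moreover have "(\<Sum>(i, j)\<in>tri (d - 2). w (LB i j) * cf (bA (LB i j)) a b) = 0" by (simp add: case_prod_unfold)
    moreover have "(\<Sum>i\<le>d - 2. w (LC i (d - 2 - i)) * cf (bA (LC i (d - 2 - i))) a b) = (\<Sum>i\<le>d - 2. if i = a then if b = Suc (d - 2 - a) then w (LC a (d - 2 - a)) else 0 else 0)"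
      by (intro sum.cong refl) (auto simp: cf_mono simp del: coeff_monom split: if_splits)
    ultimately show "(\<Sum>(i, j)\<in>tri (d - 2). w (LA i j) * cf (bA (LA i j)) a b) + (\<Sum>(i, j)\<in>tri (d - 2). w (LB i j) * cf (bA (LB i j)) a b)
      + (\<Sum>i\<le>d - 2. w (LC i (d - 2 - i)) * cf (bA (LC i (d - 2 - i))) a b) = (\<Sum>x\<in>tri (d - 2). if x = (a, b) then w (LA a b) else 0) + (\<Sum>i\<le>d - 2. if i = a then if b = Suc (d - 2 - a) then w (LC a (d - 2 - a)) else 0 else 0)"
      by simp
  qed
  also have "\<dots> = (if a + b \<le> d - 2 then w (LA a b) else if a + b = d - 1 \<and> b \<noteq> 0 then w (LC a (b - 1)) else 0)"
  proof -
    have e: "a \<le> d - 2 \<and> b = Suc (d - 2 - a) \<longleftrightarrow> a + b = d - 1 \<and> b \<noteq> 0" using assms by auto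
    have s1: "(\<Sum>x\<in>tri (d - 2). if x = (a, b) then w (LA a b) else 0) = (if a + b \<le> d - 2 then w (LA a b) else 0)"
      unfolding sum.delta[OF finite_tri] by (simp add: tri_def)
    have s2: "(\<Sum>i\<le>d - 2. if i = a then if b = Suc (d - 2 - a) then w (LC a (d - 2 - a)) else 0 else 0)
       = (if a \<le> d - 2 \<and> b = Suc (d - 2 - a) then w (LC a (d - 2 - a)) else 0)"
      unfolding sum.delta[OF finite_atMost] by simp
    have "d - 2 - a = b - 1" if "a + b = d - 1 \<and> b \<noteq> 0" using that by linarith
    moreover have "\<not> (a + b = d - 1 \<and> b \<noteq> 0)" if "a + b \<le> d - 2" using that assms by linarith
    ultimately show ?thesis unfolding s1 s2 e using assms by auto
  qed
  finally show ?thesis .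
qed

lemma cf_sum_bB:
  assumes "2 \<le> d"
  shows "cf (\<Sum>l\<in>labels d. cc (w l) * bB l) a b =
    (if a + b \<le> d - 2 then w (LB a b) else if a + b = d - 1 \<and> a \<noteq> 0 then - w (LC (a - 1) b) else 0)"
proof -
  have "cf (\<Sum>l\<in>labels d. cc (w l) * bB l) a b = (\<Sum>l\<in>labels d. w l * cf (bB l) a b)"
    by (simp add: coeff_sum)
  also have "\<dots> = (\<Sum>x\<in>tri (d - 2). if x = (a, b) then w (LB a b) else 0)
     + (\<Sum>i\<le>d - 2. if i = a - 1 then if a \<noteq> 0 \<and> b = d - 2 - i then - w (LC i b) else 0 else 0)"
    unfolding sum_labels
  proof -
    have "(\<Sum>(i, j)\<in>tri (d - 2). w (LB i j) * cf (bB (LB i j)) a b) = (\<Sum>x\<in>tri (d - 2). if x = (a, b) then w (LB a b) else 0)"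
      by (intro sum.cong refl) (auto simp: cf_mono simp del: coeff_monom split: if_splits)
    moreover have "(\<Sum>(i, j)\<in>tri (d - 2). w (LA i j) * cf (bB (LA i j)) a b) = 0" by (simp add: case_prod_unfold)
    moreover have "(\<Sum>i\<le>d - 2. w (LC i (d - 2 - i)) * cf (bB (LC i (d - 2 - i))) a b) = (\<Sum>i\<le>d - 2. if i = a - 1 then if a \<noteq> 0 \<and> b = d - 2 - i then - w (LC i b) else 0 else 0)"
      by (intro sum.cong refl) (auto simp: cf_mono simp del: coeff_monom split: if_splits)
    ultimately show "(\<Sum>(i, j)\<in>tri (d - 2). w (LA i j) * cf (bB (LA i j)) a b) + (\<Sum>(i, j)\<in>tri (d - 2). w (LB i j) * cf (bB (LB i j)) a b)
      + (\<Sum>i\<le>d - 2. w (LC i (d - 2 - i)) * cf (bB (LC i (d - 2 - i))) a b) = (\<Sum>x\<in>tri (d - 2). if x = (a, b) then w (LB a b) else 0) + (\<Sum>i\<le>d - 2. if i = a - 1 then if a \<noteq> 0 \<and> b = d - 2 - i then - w (LC i b) else 0 else 0)"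
      by simp
  qed
  also have "\<dots> = (if a + b \<le> d - 2 then w (LB a b) else if a + b = d - 1 \<and> a \<noteq> 0 then - w (LC (a - 1) b) else 0)"
  proof -
    have e: "a - 1 \<le> d - 2 \<and> a \<noteq> 0 \<and> b = d - 2 - (a - 1) \<longleftrightarrow> a + b = d - 1 \<and> a \<noteq> 0" using assms by auto
    have s1: "(\<Sum>x\<in>tri (d - 2). if x = (a, b) then w (LB a b) else 0) = (if a + b \<le> d - 2 then w (LB a b) else 0)"
      unfolding sum.delta[OF finite_tri] by (simp add: tri_def)
    have s2: "(\<Sum>i\<le>d - 2. if i = a - 1 then if a \<noteq> 0 \<and> b = d - 2 - i then - w (LC i b) else 0 else 0)
       = (if a - 1 \<le> d - 2 \<and> a \<noteq> 0 \<and> b = d - 2 - (a - 1) then - w (LC (a - 1) b) else 0)"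
      unfolding sum.delta[OF finite_atMost] by simp
    have "\<not> (a + b = d - 1 \<and> a \<noteq> 0)" if "a + b \<le> d - 2" using that assms by linarith
    then show ?thesis unfolding s1 s2 e using assms by auto
  qed
  finally show ?thesis .
qed

lemma closed_op_sum:
  "closed_op F (\<Sum>l\<in>L. cc (w l) * bA l) (\<Sum>l\<in>L. cc (w l) * bB l) = (\<Sum>l\<in>L. cc (w l) * closed_op F (bA l) (bB l))"
proof (induction L rule: infinite_finite_induct)
  case (insert l L)
  have c: "closed_op F (cc k * A) (cc k * B) = cc k * closed_op F A B" for k A B
    unfolding closed_op_def dx_mult dy_mult dx_cc dy_cc mult_zero_left add_0_right distrib_left right_diff_distrib
    by (simp only: mult.left_commute)
  have a: "closed_op F (A + A') (B + B') = closed_op F A B + closed_op F A' B'" for A A' B B'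
    unfolding closed_op_def dx_add pderiv_add distrib_left by (simp only: diff_conv_add_uminus minus_add_distrib add_ac)
  show ?case unfolding sum.insert[OF insert.hyps] a c insert.IH ..
qed (simp_all add: closed_op_def dx_def)

lemma cf_closed_op_sum:
  "cf (closed_op F (\<Sum>l\<in>L. cc (w l) * bA l) (\<Sum>l\<in>L. cc (w l) * bB l)) a b = (\<Sum>l\<in>L. entry F (a, b) l * w l)"
  unfolding closed_op_sum by (simp add: coeff_sum entry_def mult.commute)

text \<open>The condition on x A + y B pairs each coefficient of A in degree d - 1 with the negative
  of one of B and excludes x^(d - 1) from A and y^(d - 1) from B; so the basis spans.\<close>

lemma in_kernel_imp_vector:
  assumes d: "2 \<le> d" and k: "in_kernel d F A B" "A \<noteq> 0 \<or> B \<noteq> 0"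
  shows "\<exists>w. (\<exists>l\<in>labels d. w l \<noteq> 0) \<and> (\<forall>r. (\<Sum>l\<in>labels d. entry F r l * w l) = 0)"
proof -
  define w where "w l = (case l of LA i j \<Rightarrow> cf A i j | LB i j \<Rightarrow> cf B i j | LC i j \<Rightarrow> cf A i (Suc j))" for l
  have b: "bdl d A" "bdl d B" "bdl d (vx * A + vy * B)" "closed_op F A B = 0"
    using k(1) by (simp_all add: in_kernel_def closedf_iff)
  have z: "cf A a b = 0" "cf B a b = 0" if "d \<le> a + b" for a b using b(1,2) that by (simp_all add: bdl_def)
  have xy: "(if a = 0 then 0 else cf A (a - 1) b) + (if b = 0 then 0 else cf B a (b - 1)) = 0" if "a + b = d" for a b
  proof -
    have "cf (vx * A + vy * B) a b = 0" using b(3) that by (simp add: bdl_def)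
    then show ?thesis by (simp add: coeff_pCons split: nat.splits)
  qed
  have tr: "a + b \<le> d - 2 \<or> a + b = d - 1 \<or> d \<le> a + b" for a b using d by linarith
  have A: "A = (\<Sum>l\<in>labels d. cc (w l) * bA l)"
  proof (rule cf_eqI)
    fix a b
    have "cf A a b = 0" if "a + b = d - 1" "b = 0" using xy[of "Suc a" b] that d by simp
    then show "cf A a b = cf (\<Sum>l\<in>labels d. cc (w l) * bA l) a b"
      unfolding cf_sum_bA[OF d] using z(1)[of a b] tr[of a b] d by (cases "b = 0") (auto simp: w_def)
  qed
  have B: "B = (\<Sum>l\<in>labels d. cc (w l) * bB l)"
  proof (rule cf_eqI)
    fix a b
    show "cf B a b = cf (\<Sum>l\<in>labels d. cc (w l) * bB l) a b"
    proof (cases "a + b = d - 1")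
      case True
      then have nd: "\<not> a + b \<le> d - 2" using d by linarith
      have "a + Suc b = d" using True d by linarith
      then have e: "(if a = 0 then 0 else cf A (a - 1) (Suc b)) + cf B a b = 0" using xy[of a "Suc b"] by simp
      show ?thesis
      proof (cases "a = 0")
        case False
        then have "cf B a b = - cf A (a - 1) (Suc b)" using e by (simp add: eq_neg_iff_add_eq_0 add.commute)
        then show ?thesis unfolding cf_sum_bB[OF d] using True nd False by (simp add: w_def)
      next
        case True
        then show ?thesis unfolding cf_sum_bB[OF d] using e nd by simp
      qed
    next
      case False
      then show ?thesis unfolding cf_sum_bB[OF d] using z(2)[of a b] tr[of a b] by (simp add: w_def)
    qed
  qed
  have "(\<Sum>l\<in>labels d. entry F r l * w l) = 0" for r
    using cf_closed_op_sum[of F w "labels d" "snd r" "fst r"] b(4) unfolding A[symmetric] B[symmetric] by simp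
  moreover have "\<exists>l\<in>labels d. w l \<noteq> 0"
  proof (rule ccontr)
    assume "\<not> (\<exists>l\<in>labels d. w l \<noteq> 0)"
    then have "A = 0 \<and> B = 0" by (subst A, subst B) simp
    with k(2) show False by simp
  qed
  ultimately show ?thesis by blast
qed

lemma vector_imp_in_kernel:
  assumes d: "2 \<le> d" and w: "l \<in> labels d" "w l \<noteq> 0" "\<And>r. (\<Sum>l\<in>labels d. entry F r l * w l) = 0"
  shows "\<exists>A B. (A \<noteq> 0 \<or> B \<noteq> 0) \<and> in_kernel d F A B"
proof -
  define A B where "A = (\<Sum>l\<in>labels d. cc (w l) * bA l)" and "B = (\<Sum>l\<in>labels d. cc (w l) * bB l)"
  note cA = cf_sum_bA[OF d, of w, folded A_def] and cB = cf_sum_bB[OF d, of w, folded B_def]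
  have "closed_op F A B = 0"
    by (rule cf_eqI) (unfold A_def B_def cf_closed_op_sum w(3), simp)
  moreover have "bdl d A" "bdl d B" using d by (auto simp: bdl_def cA cB)
  moreover have "bdl d (vx * A + vy * B)"
    unfolding bdl_def
  proof (intro allI impI)
    fix a b assume ab: "d \<le> a + b"
    have "cf (vx * A + vy * B) a b = (if a = 0 then 0 else cf A (a - 1) b) + (if b = 0 then 0 else cf B a (b - 1))"
      by (simp add: coeff_pCons split: nat.splits)
    also have "\<dots> = 0" unfolding cA cB using ab d by auto
    finally show "cf (vx * A + vy * B) a b = 0" .
  qed
  moreover have "A \<noteq> 0 \<or> B \<noteq> 0"
  proof (rule ccontr)
    assume "\<not> (A \<noteq> 0 \<or> B \<noteq> 0)"
    then have zA: "cf A a b = 0" and zB: "cf B a b = 0" for a b by auto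
    have "w l = 0"
    proof (cases l)
      case (LA i j)
      then show ?thesis using w(1) zA[of j i] by (auto simp: labels_def tri_def cA)
    next
      case (LB i j)
      then show ?thesis using w(1) zB[of j i] by (auto simp: labels_def tri_def cB)
    next
      case (LC i j)
      then have e: "i + Suc j = d - 1" using w(1) d by (auto simp: labels_def)
      then have "\<not> i + Suc j \<le> d - 2" using d by linarith
      then show ?thesis using zA[of "Suc j" i] e unfolding cA LC by simp
    qed
    with w(2) show False ..
  qed
  ultimately show ?thesis unfolding in_kernel_def closedf_iff by blast
qed

text \<open>Integer multiples of coefficients commute with ring homomorphisms; this serves reduction
  modulo p and specialization of the pencil alike.\<close>

lemma entry_hom:
  fixes \<phi> :: "'c::idom \<Rightarrow> 'e::idom"
  assumes "comm_ring_hom \<phi>"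
  shows "entry (map_poly (map_poly \<phi>) F) r l = \<phi> (entry F r l)"
proof -
  interpret comm_ring_hom \<phi> by fact
  have c: "cf (map_poly (map_poly \<phi>) F) a b = \<phi> (cf F a b)" for a b by (simp add: coeff_map_poly)
  obtain a b where r: "r = (a, b)" by force
  show ?thesis unfolding r
    by (cases l) (simp_all only: entry_LA entry_LB entry_LC c if_distrib[of \<phi>] hom_mult hom_of_int hom_zero)
qed

subsection \<open>Integer polynomials and reduction\<close>

lemma lookup_of_int_mpoly: "Poly_Mapping.lookup (of_int_mpoly f) m = of_int (Poly_Mapping.lookup f m)"
  by (simp add: of_int_mpoly_def Poly_Mapping.map.rep_eq when_def)

lemma of_int_ring_hom: "comm_ring_hom (of_int :: int \<Rightarrow> 'a::comm_ring_1)"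
  by unfold_locales simp_all

lemma of_int_mpoly_altdef: "(of_int_mpoly f :: 'a::comm_ring_1 mpoly) = mev (\<lambda>c. mconst (of_int c)) mvar f"
proof (rule poly_mapping_eqI)
  fix m
  have "mev (\<lambda>c. mconst (of_int c)) mvar f =
      (\<Sum>m\<in>Poly_Mapping.keys f. Poly_Mapping.single m (of_int (Poly_Mapping.lookup f m) :: 'a))"
    unfolding mev_def by (simp add: mon_mvar mult_single del: single_of_int)
  then show "Poly_Mapping.lookup (of_int_mpoly f :: 'a mpoly) m
      = Poly_Mapping.lookup (mev (\<lambda>c. mconst (of_int c)) mvar f) m"
    by (auto simp: lookup_of_int_mpoly lookup_sum lookup_single when_def in_keys_iff if_distrib cong: if_cong)
qed

lemma of_int_mpoly_hom: "comm_ring_hom (of_int_mpoly :: int mpoly \<Rightarrow> 'a::comm_ring_1 mpoly)"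
  unfolding of_int_mpoly_altdef[abs_def] by (rule mev_hom[OF comm_ring_hom_comp[OF mconst_hom of_int_ring_hom]])

lemma of_int_mpoly_mconst: "of_int_mpoly (mconst c) = mconst (of_int c)"
  unfolding of_int_mpoly_altdef by (rule mev_mconst[OF comm_ring_hom_comp[OF mconst_hom of_int_ring_hom]])

lemma of_int_mpoly_mvar: "of_int_mpoly (mvar i) = (mvar i :: 'a::comm_ring_1 mpoly)"
  unfolding of_int_mpoly_altdef by (rule mev_mvar[OF comm_ring_hom_comp[OF mconst_hom of_int_ring_hom]])

lemma keys_of_int_mpoly: "Poly_Mapping.keys (of_int_mpoly f) \<subseteq> Poly_Mapping.keys f"
  by (auto simp: in_keys_iff lookup_of_int_mpoly)

lemma MP_of_int_mpoly: "f \<in> MP S \<Longrightarrow> of_int_mpoly f \<in> MP S"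
  using keys_of_int_mpoly[of f] unfolding MP_def by blast

lemma keys_of_int_mpoly_char_0: "Poly_Mapping.keys (of_int_mpoly f :: 'a::{comm_ring_1,ring_char_0} mpoly) = Poly_Mapping.keys f"
  by (auto simp: in_keys_iff lookup_of_int_mpoly)

lemma of_int_mpoly_inj: "of_int_mpoly f = (of_int_mpoly g :: 'a::{comm_ring_1,ring_char_0} mpoly) \<Longrightarrow> f = g"
  by (rule poly_mapping_eqI) (metis lookup_of_int_mpoly of_int_eq_iff)

lemma tdeg_eq_total_degree: "tdeg f = total_degree f"
proof -
  have "tdeg f \<le> k \<longleftrightarrow> total_degree f \<le> k" for k
    unfolding sdeg_le_iff total_degree_def mdeg_def by (auto simp: Max_le_iff)
  then show ?thesis by (metis order_antisym order_refl)
qed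

lemma total_degree_cong: "Poly_Mapping.keys f \<subseteq> Poly_Mapping.keys g \<Longrightarrow> total_degree f \<le> total_degree g"
  unfolding total_degree_def by (rule Max_mono) auto

lemma lookup_mconst_mult: "Poly_Mapping.lookup (mconst c * f) m = c * Poly_Mapping.lookup f m"
  by (simp add: mult_map_scale_conv_mult[symmetric] Poly_Mapping.map.rep_eq when_def)

lemma mconst_dvd_iff: "mconst c dvd f \<longleftrightarrow> (\<forall>m. c dvd Poly_Mapping.lookup f m)" for c :: int
proof
  assume "mconst c dvd f"
  then obtain h where "f = mconst c * h" unfolding dvd_def by blast
  then show "\<forall>m. c dvd Poly_Mapping.lookup f m" by (simp add: lookup_mconst_mult)
next
  assume d: "\<forall>m. c dvd Poly_Mapping.lookup f m"
  have "f = mconst c * Poly_Mapping.map (\<lambda>x. x div c) f"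
    by (rule poly_mapping_eqI) (use d in \<open>auto simp: lookup_mconst_mult Poly_Mapping.map.rep_eq when_def\<close>)
  then show "mconst c dvd f" unfolding dvd_def by blast
qed

text \<open>The coefficient of \<open>f g\<close> at the sum of the least monomials of \<open>f\<close> and \<open>g\<close> whose
  coefficients \<open>c\<close> does not divide is not divisible by \<open>c\<close>.\<close>

lemma mconst_prime:
  fixes c :: int
  assumes c: "prime c" and dvd: "mconst c dvd f * g"
  shows "mconst c dvd f \<or> mconst c dvd g"
proof (rule ccontr)
  define K where "K f = {m \<in> Poly_Mapping.keys f. \<not> c dvd Poly_Mapping.lookup f m}" for f :: "int mpoly"
  have K: "finite (K f)" for f by (simp add: K_def)
  have dv: "c dvd Poly_Mapping.lookup f m" if "m \<notin> K f" for f m using that by (auto simp: K_def in_keys_iff)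
  assume n: "\<not> (mconst c dvd f \<or> mconst c dvd g)"
  then have ne: "K f \<noteq> {}" "K g \<noteq> {}" unfolding mconst_dvd_iff using dv by blast+
  define a b where "a = Min (K f)" and "b = Min (K g)"
  have ab: "a \<in> K f" "b \<in> K g" unfolding a_def b_def using Min_in K ne by blast+
  let ?X = "Poly_Mapping.keys f \<times> Poly_Mapping.keys g"
  define h where "h x = (if fst x + snd x = a + b then Poly_Mapping.lookup f (fst x) * Poly_Mapping.lookup g (snd x) else 0)" for x
  have "Poly_Mapping.lookup (f * g) (a + b) = (\<Sum>x\<in>?X. h x)"
    unfolding mpoly_mult_monomials[of f g] lookup_sum lookup_single when_def h_def
    by (simp add: sum.cartesian_product case_prod_unfold)
  also have "\<dots> = h (a, b) + (\<Sum>x\<in>?X - {(a, b)}. h x)"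
    by (rule sum.remove) (use ab in \<open>auto simp: K_def\<close>)
  finally have E: "Poly_Mapping.lookup (f * g) (a + b) = h (a, b) + (\<Sum>x\<in>?X - {(a, b)}. h x)" .
  have "c dvd (\<Sum>x\<in>?X - {(a, b)}. h x)"
  proof (rule dvd_sum)
    fix x assume x: "x \<in> ?X - {(a, b)}"
    obtain u v where uv: "x = (u, v)" by force
    show "c dvd h x"
    proof (cases "u + v = a + b")
      case True
      have "u \<notin> K f \<or> v \<notin> K g"
      proof (rule ccontr)
        assume "\<not> (u \<notin> K f \<or> v \<notin> K g)"
        then have le: "a \<le> u" "b \<le> v" unfolding a_def b_def using K Min_le by blast+
        have "\<not> a < u" using add_less_le_mono[of a u b v] le(2) True by auto
        then have "a = u" using le(1) by simp
        then have "(u, v) = (a, b)" using True by simp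
        then show False using x uv by simp
      qed
      then show ?thesis using dv[of u f] dv[of v g] by (auto simp: h_def uv)
    qed (simp add: h_def uv)
  qed
  moreover have "c dvd Poly_Mapping.lookup (f * g) (a + b)" using dvd unfolding mconst_dvd_iff by blast
  ultimately have "c dvd h (a, b)" unfolding E by (simp add: dvd_add_left_iff)
  then have "c dvd Poly_Mapping.lookup f a * Poly_Mapping.lookup g b" by (simp add: h_def)
  then show False using ab c by (auto simp: K_def prime_dvd_mult_iff)
qed

lemma clear_denominators: "\<exists>M u0. 0 < M \<and> mconst (of_int M) * u = (of_int_mpoly u0 :: rat mpoly)"
  using MP_UNIV[of u]
proof (induction rule: MP_induct)
  case (const c)
  obtain a b where ab: "quotient_of c = (a, b)" by force
  then have "0 < b" "c = of_int a / of_int b" using quotient_of_denom_pos quotient_of_div by blast+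
  then have "mconst (of_int b) * mconst c = (of_int_mpoly (mconst a) :: rat mpoly)"
    by (simp add: of_int_mpoly_mconst mult_single del: single_of_int)
  then show ?case using \<open>0 < b\<close> by blast
next
  case (var i)
  have "mconst (of_int 1) * mvar i = (of_int_mpoly (mvar i) :: rat mpoly)" by (simp add: of_int_mpoly_mvar)
  moreover have "(0 :: int) < 1" by simp
  ultimately show ?case by blast
next
  interpret h: comm_ring_hom "of_int_mpoly :: int mpoly \<Rightarrow> rat mpoly" by (rule of_int_mpoly_hom)
  { case (add u v)
    then obtain M a N b where M: "0 < M" "mconst (of_int M) * u = (of_int_mpoly a :: rat mpoly)"
      and N: "0 < N" "mconst (of_int N) * v = (of_int_mpoly b :: rat mpoly)" by blast
    have e: "mconst (of_int (M * N)) = (mconst (of_int M) * mconst (of_int N) :: rat mpoly)"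
      by (simp add: mult_single del: single_of_int)
    have "mconst (of_int (M * N)) * (u + v) = mconst (of_int N) * (mconst (of_int M) * u) + mconst (of_int M) * (mconst (of_int N) * v)"
      unfolding e by (simp only: distrib_left distrib_right mult_ac)
    also have "\<dots> = of_int_mpoly (mconst N * a + mconst M * b)"
      unfolding M N by (simp only: h.hom_add h.hom_mult of_int_mpoly_mconst)
    finally have "mconst (of_int (M * N)) * (u + v) = of_int_mpoly (mconst N * a + mconst M * b)" .
    moreover have "0 < M * N" using M N by simp
    ultimately show ?case by blast }
  { case (mult u v)
    then obtain M a N b where M: "0 < M" "mconst (of_int M) * u = (of_int_mpoly a :: rat mpoly)"
      and N: "0 < N" "mconst (of_int N) * v = (of_int_mpoly b :: rat mpoly)" by blast
    have e: "mconst (of_int (M * N)) = (mconst (of_int M) * mconst (of_int N) :: rat mpoly)"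
      by (simp add: mult_single del: single_of_int)
    have "mconst (of_int (M * N)) * (u * v) = (mconst (of_int M) * u) * (mconst (of_int N) * v)"
      unfolding e by (simp only: mult_ac)
    also have "\<dots> = of_int_mpoly (a * b)" unfolding M N h.hom_mult ..
    finally have "mconst (of_int (M * N)) * (u * v) = of_int_mpoly (a * b)" .
    moreover have "0 < M * N" using M N by simp
    ultimately show ?case by blast }
qed

text \<open>Gauss's lemma: a common divisor over the rationals is scaled to a primitive integer
  polynomial c0, which divides f and g over the integers and so is a unit.\<close>

lemma mpoly_coprime_of_int:
  fixes f g :: "int mpoly"
  assumes cop: "mpoly_coprime f g" and g: "g \<noteq> 0"
  shows "mpoly_coprime (of_int_mpoly f) (of_int_mpoly g :: rat mpoly)"
  unfolding mpoly_coprime_def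
proof (intro allI impI)
  interpret h: comm_ring_hom "of_int_mpoly :: int mpoly \<Rightarrow> rat mpoly" by (rule of_int_mpoly_hom)
  interpret m: comm_ring_hom "mconst :: int \<Rightarrow> int mpoly" by (rule mconst_hom)
  fix c :: "rat mpoly" assume c: "c dvd of_int_mpoly f" "c dvd of_int_mpoly g"
  have "c \<noteq> 0"
  proof
    assume "c = 0"
    then have "of_int_mpoly g = (of_int_mpoly 0 :: rat mpoly)" using c(2) by (simp add: h.hom_zero)
    then show False using of_int_mpoly_inj g by blast
  qed
  let ?P = "\<lambda>c0. \<exists>q. q \<noteq> 0 \<and> mconst q * c = of_int_mpoly c0"
  obtain M c1 where "0 < M" "mconst (of_int M) * c = of_int_mpoly c1" using clear_denominators by blast
  then have "?P c1" by (intro exI[of _ "of_int M"]) simp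
  \<comment> \<open>Least norm makes c0 primitive: removing a prime from its content would give a
    smaller norm.\<close>
  from ex_has_least_nat[of ?P, OF this, of mnorm] obtain c0 where c0: "?P c0" and
    least: "\<And>c'. ?P c' \<Longrightarrow> mnorm c0 \<le> mnorm c'" by blast
  obtain q where q: "q \<noteq> 0" "mconst q * c = of_int_mpoly c0" using c0 by blast
  have c00: "c0 \<noteq> 0"
  proof
    assume "c0 = 0"
    then have "mconst q * c = 0" unfolding q(2) by (simp add: h.hom_zero)
    then show False using \<open>c \<noteq> 0\<close> mconst_neq_0[OF q(1)] by simp
  qed
  have prim: "\<not> mconst \<pi> dvd c0" if "prime \<pi>" for \<pi>
  proof
    assume "mconst \<pi> dvd c0"
    then obtain c' where c': "c0 = mconst \<pi> * c'" unfolding dvd_def by blast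
    have p: "1 < \<pi>" using that by (simp add: prime_gt_1_int)
    have "mconst (q / of_int \<pi>) * c = of_int_mpoly c'"
    proof (rule poly_mapping_eqI)
      fix m
      have "q * Poly_Mapping.lookup c m = of_int (\<pi> * Poly_Mapping.lookup c' m)"
        using arg_cong[OF q(2), of "\<lambda>x. Poly_Mapping.lookup x m"] unfolding c' by (simp add: lookup_mconst_mult lookup_of_int_mpoly)
      then show "Poly_Mapping.lookup (mconst (q / of_int \<pi>) * c) m = Poly_Mapping.lookup (of_int_mpoly c') m"
        unfolding lookup_mconst_mult lookup_of_int_mpoly using p by (simp add: field_simps)
    qed
    moreover have "q / of_int \<pi> \<noteq> 0" using q(1) p by simp
    ultimately have le: "mnorm c0 \<le> mnorm c'" by (intro least exI[of _ "q / of_int \<pi>"] conjI)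
    have eq: "mnorm c0 = nat \<pi> * mnorm c'"
    proof -
      have lk: "Poly_Mapping.lookup c0 m = \<pi> * Poly_Mapping.lookup c' m" for m unfolding c' by (rule lookup_mconst_mult)
      have "Poly_Mapping.keys c0 \<subseteq> Poly_Mapping.keys c'" by (rule subsetI) (simp add: in_keys_iff lk)
      then have "mnorm c0 = (\<Sum>m\<in>Poly_Mapping.keys c'. nat \<bar>Poly_Mapping.lookup c0 m\<bar>)"
        by (rule mnorm_superset[OF finite_keys])
      also have "\<dots> = (\<Sum>m\<in>Poly_Mapping.keys c'. nat \<pi> * nat \<bar>Poly_Mapping.lookup c' m\<bar>)"
        by (intro sum.cong refl) (use p in \<open>simp add: lk abs_mult nat_mult_distrib\<close>)
      finally show ?thesis by (simp add: mnorm_def sum_distrib_left)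
    qed
    have pos: "0 < mnorm c0"
    proof -
      obtain m where "Poly_Mapping.lookup c0 m \<noteq> 0" using c00 by (metis lookup_zero poly_mapping_eqI)
      then show ?thesis using mnorm_lookup[of c0 m] by linarith
    qed
    have "2 \<le> nat \<pi>" using p by simp
    then have "2 * mnorm c' \<le> mnorm c0" unfolding eq by (rule mult_le_mono1)
    then show False using le pos by linarith
  qed
  \<comment> \<open>The primes of M are stripped one at a time; none divides c0, so each divides
    u.\<close>
  have cancel: "c0 dvd w" if "c0 * u = mconst (int M) * w" "0 < M" for M u w
    using that
  proof (induction M arbitrary: u rule: less_induct)
    case (less M)
    show ?case
    proof (cases "M = 1")
      case True
      then have "w = c0 * u" using less.prems(1) by simp
      then show ?thesis by simp
    next
      case False
      then obtain \<pi> where p: "prime \<pi>" "\<pi> dvd M" using prime_factor_nat by blast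
      from p(2) obtain M' where M': "M = \<pi> * M'" by (rule dvdE)
      have mm: "mconst (int M) = mconst (int \<pi>) * (mconst (int M') :: int mpoly)" unfolding M' of_nat_mult m.hom_mult ..
      have p': "prime (int \<pi>)" unfolding prime_int_nat_transfer by (simp only: nat_int p(1) of_nat_0_le_iff simp_thms)
      have "mconst (int \<pi>) dvd c0 * u" unfolding less.prems(1) mm mult.assoc by (rule dvd_triv_left)
      with mconst_prime[OF p', of c0 u] prim[OF p'] have "mconst (int \<pi>) dvd u" by iprover
      then obtain u' where u': "u = mconst (int \<pi>) * u'" by (rule dvdE)
      have "int \<pi> \<noteq> 0" using prime_gt_1_nat[OF p(1)] by simp
      then have nz: "mconst (int \<pi>) \<noteq> (0 :: int mpoly)" by (rule mconst_neq_0)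
      have "mconst (int \<pi>) * (c0 * u') = c0 * u" unfolding u' by (rule mult.left_commute)
      also have "\<dots> = mconst (int \<pi>) * (mconst (int M') * w)" unfolding less.prems(1) mm by (rule mult.assoc)
      finally have "c0 * u' = mconst (int M') * w" unfolding mult_left_cancel[OF nz] .
      moreover have "0 < M'" using less.prems(2) unfolding M' by simp
      moreover from this have "M' < M" unfolding M' using prime_gt_1_nat[OF p(1)] by simp
      ultimately show ?thesis using less.IH by blast
    qed
  qed
  have main: "c0 dvd w" if "c dvd of_int_mpoly w" for w
  proof -
    obtain u where u: "of_int_mpoly w = c * u" using \<open>c dvd of_int_mpoly w\<close> unfolding dvd_def by blast
    obtain M u0 where M: "0 < M" "mconst (of_int M) * u = of_int_mpoly u0" using clear_denominators by blast
    obtain N w0 where N: "0 < N" "mconst (of_int N) * mconst q = (of_int_mpoly w0 :: rat mpoly)" using clear_denominators by blast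
    obtain M' w' where M': "0 < M'" "mconst (of_int M') * mconst (inverse q) = (of_int_mpoly w' :: rat mpoly)" using clear_denominators by blast
    have qq: "mconst (inverse q) * mconst q = (1 :: rat mpoly)" using q(1) by (simp add: mult_single)
    have "of_int_mpoly (c0 * (w' * u0)) = (mconst q * c) * ((mconst (of_int M') * mconst (inverse q)) * (mconst (of_int M) * u))"
      unfolding h.hom_mult q(2) M M' ..
    also have "\<dots> = (mconst (inverse q) * mconst q) * (mconst (of_int M') * mconst (of_int M)) * (c * u)" by (simp only: mult_ac)
    also have "\<dots> = of_int_mpoly (mconst (M' * M) * w)"
      unfolding qq u[symmetric] h.hom_mult of_int_mpoly_mconst by (simp add: mult_single del: single_of_int)
    finally have "c0 * (w' * u0) = mconst (M' * M) * w" by (rule of_int_mpoly_inj)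
    then have "c0 * (w' * u0) = mconst (int (nat (M' * M))) * w" using M(1) M'(1) by simp
    then show ?thesis by (rule cancel) (use M(1) M'(1) in simp)
  qed
  have "c0 dvd 1" using main[OF c(1)] main[OF c(2)] cop unfolding mpoly_coprime_def by blast
  then obtain e where e: "1 = c0 * e" unfolding dvd_def by blast
  have "1 = of_int_mpoly c0 * (of_int_mpoly e :: rat mpoly)" unfolding h.hom_mult[symmetric] e[symmetric] by (simp add: h.hom_one)
  also have "\<dots> = c * (mconst q * of_int_mpoly e)" unfolding q(2)[symmetric] by (simp only: mult_ac)
  finally show "c dvd 1" by (rule dvdI)
qed

section \<open>Norm bounds and coefficient homomorphisms for the pencil\<close>

lemma mnorm_le:
  assumes f: "f \<in> MP {..<n}" and d: "total_degree f \<le> d"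
  shows "mnorm f \<le> ((n + d) choose n) * height f"
proof -
  have "nat \<bar>Poly_Mapping.lookup f m\<bar> \<le> height f" if "m \<in> Poly_Mapping.keys f" for m
    unfolding height_def using that by (intro Max_ge) auto
  then have "mnorm f \<le> card (Poly_Mapping.keys f) * height f"
    unfolding mnorm_def using sum_bounded_above[of "Poly_Mapping.keys f" "\<lambda>m. nat \<bar>Poly_Mapping.lookup f m\<bar>" "height f"] by simp
  also have "card (Poly_Mapping.keys f) \<le> (n + d) choose n"
  proof (rule card_monomials_le)
    fix m assume m: "m \<in> Poly_Mapping.keys f"
    have "mdeg UNIV m \<le> d" using sdeg_le_iff[of UNIV f d] m d unfolding tdeg_eq_total_degree by blast
    then show "Poly_Mapping.keys m \<subseteq> {..<n} \<and> mdeg UNIV m \<le> d" using f m unfolding MP_def by blast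
  qed
  then have "card (Poly_Mapping.keys f) * height f \<le> ((n + d) choose n) * height f" by (rule mult_le_mono1)
  finally show ?thesis .
qed

abbreviation pnorm2 :: "int mpoly poly poly \<Rightarrow> nat" where
  "pnorm2 \<equiv> pnorm (pnorm mnorm)"

text \<open>Each variable is replaced by U_i + V_i x or by y, of norm at most 2, so a monomial of
  degree at most d has norm at most 2^d.\<close>

lemma pnorm2_cc: "pnorm2 (cc u) = mnorm u"
  and pnorm2_psi: "total_degree f \<le> d \<Longrightarrow> pnorm2 (psi n j f) \<le> 2 ^ d * mnorm f"
proof -
  interpret N0: ring_norm mnorm by (rule ring_norm_mpoly)
  interpret N1: ring_norm "pnorm mnorm" by (rule N0.ring_norm_poly)
  interpret N2: ring_norm pnorm2 by (rule N1.ring_norm_poly)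
  show cc: "pnorm2 (cc u) = mnorm u" for u by (simp add: N1.pnorm_pCons N0.pnorm_pCons N1.N_0 N2.N_0)
  assume d: "total_degree f \<le> d"
  let ?\<rho> = "\<lambda>i. if i = j then vy else [:[:mvar i, mvar (n + i):]:] :: int mpoly poly poly"
  have mv: "mnorm (mvar i) = 1" for i by (simp add: mvar_def mnorm_single)
  have rho: "pnorm2 (?\<rho> i) \<le> 2" for i
  proof (cases "i = j")
    case True
    have "pnorm2 vy = pnorm mnorm 1" by (simp add: N1.pnorm_pCons N1.N_0 N2.N_0)
    then show ?thesis using True N1.N_1 by simp
  next
    case False
    then show ?thesis by (simp add: N1.pnorm_pCons N0.pnorm_pCons N1.N_0 N2.N_0 mv)
  qed
  have mon: "pnorm2 (mon ?\<rho> m) \<le> 2 ^ d" if "m \<in> Poly_Mapping.keys f" for m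
  proof -
    have "pnorm2 (mon ?\<rho> m) \<le> (\<Prod>i\<in>Poly_Mapping.keys m. pnorm2 (?\<rho> i ^ Poly_Mapping.lookup m i))"
      unfolding mon_def by (rule N2.N_prod)
    also have "\<dots> \<le> (\<Prod>i\<in>Poly_Mapping.keys m. 2 ^ Poly_Mapping.lookup m i)"
      by (rule prod_mono, intro conjI, simp, rule order.trans[OF N2.N_power power_mono[OF rho]], simp)
    also have "\<dots> = 2 ^ mdeg UNIV m" by (simp add: power_sum mdeg_def)
    also have "\<dots> \<le> 2 ^ d" using sdeg_le_iff[of UNIV f d] that d unfolding tdeg_eq_total_degree by (intro power_increasing) auto
    finally show ?thesis .
  qed
  have "pnorm2 (psi n j f) \<le> (\<Sum>m\<in>Poly_Mapping.keys f. pnorm2 (cc (mconst (Poly_Mapping.lookup f m)) * mon ?\<rho> m))"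
    unfolding psi_def mev_def by (rule N2.N_sum)
  also have "\<dots> \<le> (\<Sum>m\<in>Poly_Mapping.keys f. nat \<bar>Poly_Mapping.lookup f m\<bar> * 2 ^ d)"
  proof (rule sum_mono)
    fix m assume m: "m \<in> Poly_Mapping.keys f"
    have "pnorm2 (cc (mconst (Poly_Mapping.lookup f m)) * mon ?\<rho> m) \<le> pnorm2 (cc (mconst (Poly_Mapping.lookup f m))) * pnorm2 (mon ?\<rho> m)"
      by (rule N2.N_mult)
    also have "\<dots> \<le> nat \<bar>Poly_Mapping.lookup f m\<bar> * 2 ^ d" unfolding cc mnorm_single by (rule mult_le_mono2[OF mon[OF m]])
    finally show "pnorm2 (cc (mconst (Poly_Mapping.lookup f m)) * mon ?\<rho> m) \<le> nat \<bar>Poly_Mapping.lookup f m\<bar> * 2 ^ d" .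
  qed
  finally show "pnorm2 (psi n j f) \<le> 2 ^ d * mnorm f" by (simp add: mnorm_def sum_distrib_left mult.commute)
qed

text \<open>Constants are integers, on which a ring homomorphism is forced, so only the images of
  the U_i and V_i matter.\<close>

lemma map_psi:
  fixes \<phi> :: "int mpoly \<Rightarrow> 'a::comm_ring_1 mpoly"
  assumes \<phi>: "comm_ring_hom \<phi>" "\<And>v. v < 2 * n \<Longrightarrow> \<phi> (mvar v) = mvar v" and f: "f \<in> MP {..<n}"
  shows "map_poly (map_poly \<phi>) (psi n j f) = psi n j (of_int_mpoly f)"
proof -
  interpret \<phi>: comm_ring_hom \<phi> by fact
  interpret m: comm_ring_hom "mconst :: int \<Rightarrow> int mpoly" by (rule mconst_hom)
  interpret m': comm_ring_hom "mconst :: 'a \<Rightarrow> 'a mpoly" by (rule mconst_hom)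
  show ?thesis
  proof (rule hom_eq_on_MP[OF f comm_ring_hom_comp[OF map_poly_hom[OF map_poly_hom[OF \<phi>(1)]] psi_hom]
      comm_ring_hom_comp[OF psi_hom of_int_mpoly_hom]])
    fix c :: int
    have "mconst c = (of_int c :: int mpoly)" by (rule m.hom_of_int[of c, unfolded of_int_eq_id id_apply])
    then have "\<phi> (mconst c) = mconst (of_int c)" using \<phi>.hom_of_int[of c] m'.hom_of_int[of c] by simp
    then show "map_poly (map_poly \<phi>) (psi n j (mconst c)) = psi n j (of_int_mpoly (mconst c))"
      unfolding of_int_mpoly_mconst psi_mconst by (simp add: map_poly_pCons_0 \<phi>.hom_zero)
  next
    fix i assume "i \<in> {..<n}"
    then show "map_poly (map_poly \<phi>) (psi n j (mvar i)) = psi n j (of_int_mpoly (mvar i))"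
      by (simp add: psi_mvar map_poly_pCons_0 \<phi>.hom_zero \<phi>.hom_one \<phi>(2) of_int_mpoly_mvar)
  qed
qed

lemma map_pencil:
  fixes \<phi> :: "int mpoly \<Rightarrow> 'a::comm_ring_1 mpoly"
  assumes \<phi>: "comm_ring_hom \<phi>" "\<And>v. v < 2 * n \<Longrightarrow> \<phi> (mvar v) = mvar v" and fg: "f \<in> MP {..<n}" "g \<in> MP {..<n}"
  shows "map_poly (map_poly \<phi>) (pencil n j f g)
    = cc (\<phi> (mvar (2 * n))) * psi n j (of_int_mpoly f) - cc (\<phi> (mvar (2 * n + 1))) * psi n j (of_int_mpoly g)"
proof -
  interpret \<phi>: comm_ring_hom \<phi> by fact
  interpret h: comm_ring_hom "map_poly (map_poly \<phi>)" by (rule map_poly_hom[OF map_poly_hom[OF \<phi>(1)]])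
  have c: "map_poly (map_poly \<phi>) (cc u) = cc (\<phi> u)" for u by (simp add: map_poly_pCons_0 \<phi>.hom_zero)
  have m: "map_poly (map_poly \<phi>) (psi n j h) = psi n j (of_int_mpoly h)" if "h \<in> MP {..<n}" for h
    by (rule map_psi) (rule \<phi>(1), erule \<phi>(2), rule that)
  show ?thesis unfolding h.hom_minus h.hom_mult c m[OF fg(1)] m[OF fg(2)] ..
qed

lemma of_int_mod_ring_eq_0:
  assumes p: "CARD('p::prime_card) = p" and c: "nat \<bar>c\<bar> < p" "(of_int c :: 'p mod_ring) = 0"
  shows "c = 0"
proof -
  have "of_int \<bar>c\<bar> = (0 :: 'p mod_ring)" using c(2) by (cases "0 \<le> c") simp_all
  moreover have "(of_nat (nat \<bar>c\<bar>) :: 'p mod_ring) = of_int \<bar>c\<bar>" by (rule of_nat_nat) simp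
  ultimately have "p dvd nat \<bar>c\<bar>" using of_nat_0_mod_ring_dvd[where 'a = 'p, of "nat \<bar>c\<bar>"] p by simp
  then have "nat \<bar>c\<bar> = 0" using c(1) by (meson nat_dvd_not_less not_gr_zero)
  then show ?thesis by simp
qed

lemma of_int_mpoly_mod_ring_eq_0:
  assumes p: "CARD('p::prime_card) = p" and x: "mnorm x < p" "of_int_mpoly x = (0 :: 'p mod_ring mpoly)"
  shows "x = 0"
proof (rule poly_mapping_eqI)
  fix m
  have "(of_int (Poly_Mapping.lookup x m) :: 'p mod_ring) = 0"
    using arg_cong[OF x(2), of "\<lambda>f. Poly_Mapping.lookup f m"] by (simp add: lookup_of_int_mpoly)
  then show "Poly_Mapping.lookup x m = Poly_Mapping.lookup 0 m"
    using of_int_mod_ring_eq_0[OF p, of "Poly_Mapping.lookup x m"] mnorm_lookup[of x m] x(1) by simp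
qed

text \<open>The factor 2 counts the two members of the pencil, whose parameters have norm 1. The
  triangle of coefficients is enlarged to a square so that it is summed by the bivariate
  norm.\<close>

lemma row_mnorm_le:
  fixes f g :: "int mpoly"
  assumes MP: "f \<in> MP {..<n}" "g \<in> MP {..<n}" and td: "total_degree f \<le> d" "total_degree g \<le> d" and d: "2 \<le> d"
    and H: "height f \<le> H" "height g \<le> H"
  shows "(\<Sum>l\<in>labels d. mnorm (entry (pencil n j f g) r l)) \<le> (3 * d - 4) * (2 * (2 ^ d * (((n + d) choose n) * H)))"
proof -
  let ?F = "pencil n j f g"
  interpret N0: ring_norm mnorm by (rule ring_norm_mpoly)
  interpret N1: ring_norm "pnorm mnorm" by (rule N0.ring_norm_poly)
  interpret N2: ring_norm pnorm2 by (rule N1.ring_norm_poly)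
  obtain a b where r: "r = (a, b)" by force
  have c: "bdl m (cc u * X)" if "bdl m X" for m u and X :: "int mpoly poly poly"
    using bdl_mult[of 0 "cc u" m X] bdl_cc[of u] that by simp
  have "bdl (Suc d) ?F"
    using td by (intro bdl_diff c) (auto intro!: bdl_mono[OF bdl_psi] simp: tdeg_eq_total_degree)
  from N0.row_norm_le[where E = "entry ?F r", OF d _ _ _ this, unfolded r, OF entry_LA entry_LB entry_LC]
  have "(\<Sum>l\<in>labels d. mnorm (entry ?F r l)) \<le> (3 * d - 4) * (\<Sum>(s, t)\<in>tri d. mnorm (cf ?F s t))" unfolding r .
  also have "(\<Sum>(s, t)\<in>tri d. mnorm (cf ?F s t)) \<le> (\<Sum>(s, t)\<in>{..d} \<times> {..d}. mnorm (cf ?F s t))"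
    by (rule sum_mono2) (auto simp: tri_def)
  also have "\<dots> = (\<Sum>t\<le>d. \<Sum>s\<le>d. mnorm (cf ?F s t))"
    unfolding sum.cartesian_product[symmetric] by (rule sum.swap)
  also have "\<dots> \<le> (\<Sum>t\<le>d. pnorm mnorm (coeff ?F t))" by (intro sum_mono N0.sum_le_pnorm)
  also have "\<dots> \<le> pnorm2 ?F" by (rule N1.sum_le_pnorm)
  also have "pnorm2 ?F \<le> 2 * (2 ^ d * (((n + d) choose n) * H))"
  proof -
    have one: "pnorm2 (cc (mvar v) * psi n j h) \<le> 2 ^ d * (((n + d) choose n) * H)"
      if "h \<in> MP {..<n}" "total_degree h \<le> d" "height h \<le> H" for v h
    proof -
      have "pnorm2 (cc (mvar v) * psi n j h) \<le> pnorm2 (cc (mvar v)) * pnorm2 (psi n j h)" by (rule N2.N_mult)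
      also have "\<dots> = pnorm2 (psi n j h)" unfolding pnorm2_cc by (simp add: mvar_def mnorm_single)
      also have "\<dots> \<le> 2 ^ d * mnorm h" by (rule pnorm2_psi[OF that(2)])
      also have "\<dots> \<le> 2 ^ d * (((n + d) choose n) * H)"
        using mnorm_le[OF that(1,2)] that(3) by (intro mult_le_mono2) (metis le_trans mult_le_mono2)
      finally show ?thesis .
    qed
    show ?thesis
      using N2.N_diff[of "cc (mvar (2 * n)) * psi n j f" "cc (mvar (2 * n + 1)) * psi n j g"]
        one[OF MP(1) td(1) H(1), of "2 * n"] one[OF MP(2) td(2) H(2), of "2 * n + 1"] by linarith
  qed
  finally show ?thesis by simp
qed

text \<open>The minors of the linear system have norm less than \<open>p\<close>, so those vanishing modulo \<open>p\<close>
  vanish; setting the pencil parameters to \<open>g\<close> and \<open>f\<close> then yields a kernel in characteristic 0.\<close>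

lemma kernel_lift:
  fixes f g :: "int mpoly" and A B :: "'p::prime_card mod_ring mpoly poly poly"
  assumes MP: "f \<in> MP {..<n}" "g \<in> MP {..<n}" and td: "total_degree f \<le> d" "total_degree g \<le> d" and d: "2 \<le> d"
    and H: "height f \<le> H" "height g \<le> H" and p: "CARD('p) = p"
    and bound: "((3 * d - 4) * (2 * (2 ^ d * (((n + d) choose n) * H)))) ^ (d\<^sup>2 - 1) < p"
    and AB: "A \<noteq> 0 \<or> B \<noteq> 0" "in_kernel d (pencil n j (of_int_mpoly f) (of_int_mpoly g)) A B"
  shows "\<exists>A B :: rat mpoly poly poly. (A \<noteq> 0 \<or> B \<noteq> 0) \<and>
    in_kernel d (cc (of_int_mpoly g) * psi n j (of_int_mpoly f) - cc (of_int_mpoly f) * psi n j (of_int_mpoly g)) A B"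
proof -
  define D where "D = d\<^sup>2 - 1"
  define R where "R = (3 * d - 4) * (2 * (2 ^ d * (((n + d) choose n) * H)))"
  let ?F = "pencil n j f g"
  let ?red = "of_int_mpoly :: int mpoly \<Rightarrow> 'p mod_ring mpoly"
  interpret red: comm_ring_hom ?red by (rule of_int_mpoly_hom)
  interpret N0: ring_norm mnorm by (rule ring_norm_mpoly)
  obtain e where e: "bij_betw e {..<D} (labels d)"
    using ex_bij_betw_nat_finite[OF finite_labels, of d] unfolding card_labels[OF d] D_def[symmetric] atLeast0LessThan by blast
  have re: "(\<Sum>k<D. h (e k)) = sum h (labels d)" for h :: "label \<Rightarrow> 'z::comm_monoid_add"
    by (rule sum.reindex_bij_betw[OF e])
  have map_det: "\<phi> (det (mat D D (\<lambda>(i, k). entry ?F (\<rho> i) (e k)))) = det (mat D D (\<lambda>(i, k). entry (map_poly (map_poly \<phi>) ?F) (\<rho> i) (e k)))"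
    if "comm_ring_hom \<phi>" for \<phi> :: "int mpoly \<Rightarrow> 'y::idom mpoly" and \<rho>
  proof -
    interpret \<phi>: comm_ring_hom \<phi> by fact
    have "mat D D (\<lambda>(i, k). entry (map_poly (map_poly \<phi>) ?F) (\<rho> i) (e k)) = map_mat \<phi> (mat D D (\<lambda>(i, k). entry ?F (\<rho> i) (e k)))"
      by (rule eq_matI) (simp_all add: entry_hom[OF that])
    then show ?thesis by (simp only: \<phi>.hom_det)
  qed
  have minor: "det (mat D D (\<lambda>(i, k). entry ?F (\<rho> i) (e k))) = 0" for \<rho>
  proof (rule of_int_mpoly_mod_ring_eq_0[OF p])
    let ?M = "mat D D (\<lambda>(i, k). entry ?F (\<rho> i) (e k))"
    have "mnorm (det ?M) \<le> (\<Prod>i\<in>{0..<D}. \<Sum>k\<in>{0..<D}. mnorm (?M $$ (i, k)))" by (rule N0.N_det) simp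
    also have "\<dots> = (\<Prod>i\<in>{0..<D}. \<Sum>k\<in>{0..<D}. mnorm (entry ?F (\<rho> i) (e k)))" by (intro prod.cong sum.cong refl) simp
    also have "\<dots> \<le> (\<Prod>i\<in>{0..<D}. R)"
    proof (rule prod_mono, intro conjI)
      fix i
      show "(\<Sum>k\<in>{0..<D}. mnorm (entry ?F (\<rho> i) (e k))) \<le> R"
        unfolding atLeast0LessThan R_def by (subst re[of "\<lambda>l. mnorm (entry ?F (\<rho> i) l)"]) (rule row_mnorm_le[OF MP td d H])
    qed simp
    also have "\<dots> = R ^ D" by simp
    also have "\<dots> < p" using bound by (simp add: R_def D_def)
    finally show "mnorm (det ?M) < p" .
    obtain w where w: "\<exists>l\<in>labels d. w l \<noteq> 0" "\<forall>r. (\<Sum>l\<in>labels d. entry (pencil n j (?red f) (?red g)) r l * w l) = 0"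
      using in_kernel_imp_vector[OF d AB(2,1)] by blast
    obtain l where l: "l \<in> labels d" "w l \<noteq> 0" using w(1) by blast
    then have "l \<in> e ` {..<D}" unfolding bij_betw_imp_surj_on[OF e] by blast
    then obtain k where k: "k < D" "w (e k) \<noteq> 0" using l(2) by auto
    have F: "map_poly (map_poly ?red) ?F = pencil n j (?red f) (?red g)"
      using map_pencil[OF of_int_mpoly_hom _ MP, where 'a = "'p mod_ring", of j] by (simp only: of_int_mpoly_mvar)
    show "?red (det ?M) = 0"
      unfolding map_det[OF of_int_mpoly_hom] F
    proof (rule kernel_imp_minor_zero[of k D "\<lambda>k. w (e k)", OF k])
      fix r show "(\<Sum>k<D. entry (pencil n j (?red f) (?red g)) r (e k) * w (e k)) = 0"
        unfolding re[of "\<lambda>l. entry (pencil n j (?red f) (?red g)) r l * w l"] using w(2) by blast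
    qed
  qed
  \<comment> \<open>Vanishing minors are preserved by every homomorphism; this one produces the
    denominator of \<open>closedf_zero\<close>.\<close>
  define \<sigma> where "\<sigma> = mev (\<lambda>c. mconst (of_int c)) (\<lambda>v. if v < 2 * n then mvar v
     else if v = 2 * n then of_int_mpoly g else (of_int_mpoly f :: rat mpoly))"
  have \<sigma>: "comm_ring_hom \<sigma>" unfolding \<sigma>_def by (rule mev_hom[OF comm_ring_hom_comp[OF mconst_hom of_int_ring_hom]])
  interpret \<sigma>: comm_ring_hom \<sigma> by (rule \<sigma>)
  have \<sigma>v: "\<sigma> (mvar v) = (if v < 2 * n then mvar v else if v = 2 * n then of_int_mpoly g else of_int_mpoly f)" for v
    unfolding \<sigma>_def by (rule mev_mvar[OF comm_ring_hom_comp[OF mconst_hom of_int_ring_hom]])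
  let ?G = "cc (of_int_mpoly g) * psi n j (of_int_mpoly f) - cc (of_int_mpoly f) * psi n j (of_int_mpoly g) :: rat mpoly poly poly"
  have G: "map_poly (map_poly \<sigma>) ?F = ?G"
  proof -
    have "\<sigma> (mvar (2 * n)) = of_int_mpoly g" "\<sigma> (mvar (2 * n + 1)) = of_int_mpoly f" unfolding \<sigma>v by simp_all
    moreover have "\<sigma> (mvar v) = mvar v" if "v < 2 * n" for v unfolding \<sigma>v using that by simp
    ultimately show ?thesis using map_pencil[OF \<sigma> _ MP, of j] by (simp only: simp_thms)
  qed
  have dz: "det (mat D D (\<lambda>(i, k). entry ?G (\<rho> i) (e k))) = 0" for \<rho>
    unfolding G[symmetric] map_det[OF \<sigma>, symmetric] minor by (rule \<sigma>.hom_zero)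
  from minors_zero_imp_kernel[of D "\<lambda>r k. entry ?G r (e k)", OF dz] obtain v where
    v: "\<exists>l<D. v l \<noteq> 0" "\<forall>r. (\<Sum>l<D. entry ?G r (e l) * v l) = 0" by blast
  obtain k where k: "k < D" "v k \<noteq> 0" using v(1) by blast
  define w where "w l = v (inv_into {..<D} e l)" for l
  have we: "w (e l) = v l" if "l < D" for l
    unfolding w_def using e that by (simp add: bij_betw_def)
  have "e k \<in> labels d" using e k(1) unfolding bij_betw_def by blast
  moreover have "w (e k) \<noteq> 0" using k we by simp
  moreover have "(\<Sum>l\<in>labels d. entry ?G r l * w l) = 0" for r
  proof -
    have "(\<Sum>l\<in>labels d. entry ?G r l * w l) = (\<Sum>l<D. entry ?G r (e l) * w (e l))"
      by (rule sum.reindex_bij_betw[OF e, symmetric])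
    also have "\<dots> = (\<Sum>l<D. entry ?G r (e l) * v l)" by (intro sum.cong refl) (simp add: we)
    also have "\<dots> = 0" using v(2) by blast
    finally show ?thesis .
  qed
  ultimately show ?thesis by (rule vector_imp_in_kernel[OF d])
qed

theorem theorem3p6:
  fixes n d p :: nat
    and f g :: "int mpoly"
    and r :: "rat mpoly fract"
    and f\<^sub>p g\<^sub>p :: "'p::prime_card mod_ring mpoly"
  assumes "n \<ge> 2"
    and "f \<in> mpolys n" and "g \<in> mpolys n" and "g \<noteq> 0"
    and "mpoly_coprime f g"
    and "r = Fract (of_int_mpoly f) (of_int_mpoly g)"
    and "r \<notin> range const_ratfun"
    and "\<not> composite n r"
    and "d = max (total_degree f) (total_degree g)" and "d \<ge> 2"
    and "prime p" and "CARD('p) = p"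
    and "p > d ^ (3 * d\<^sup>2 - 3) * (((n + d) choose n) * 2 ^ d) ^ (d\<^sup>2 - 1)
             * ((d\<^sup>2 - 1) choose ((d\<^sup>2 - 1) div 2))
             * max (height f) (height g) ^ (d\<^sup>2 - 1)"
    and "f\<^sub>p = of_int_mpoly f" and "g\<^sub>p = of_int_mpoly g"
  shows "mpoly_coprime f\<^sub>p g\<^sub>p \<and> g\<^sub>p \<noteq> 0 \<and> \<not> composite n (Fract f\<^sub>p g\<^sub>p)"
proof -
  let ?f = "of_int_mpoly f :: rat mpoly" and ?g = "of_int_mpoly g :: rat mpoly"
  have MP: "f \<in> MP {..<n}" "g \<in> MP {..<n}" using assms(2,3) by (simp_all add: mpolys_eq_MP)
  have td: "total_degree f \<le> d" "total_degree g \<le> d" using assms(9) by simp_all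
  note d = assms(10) and p = assms(12)
  define H where "H = max (height f) (height g)"
  have H: "height f \<le> H" "height g \<le> H" by (simp_all add: H_def)
  have hl: "nat \<bar>Poly_Mapping.lookup h m\<bar> \<le> height h" for h m
    unfolding height_def by (cases "m \<in> Poly_Mapping.keys h") (auto simp: in_keys_iff intro!: Max_ge)
  obtain m0 where m0: "Poly_Mapping.lookup g m0 \<noteq> 0" using assms(4) by (metis lookup_zero poly_mapping_eqI)
  have H1: "1 \<le> H" using hl[of g m0] m0 H(2) by linarith
  \<comment> \<open>D is the number of unknowns, and X bounds the row sums of the linear
    system.\<close>
  define D X where "D = d\<^sup>2 - 1" and "X = d ^ 3 * (((n + d) choose n) * 2 ^ d) * H"
  have D3: "3 \<le> D"
    using power_mono[OF d, of 2] by (simp add: D_def)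
  have C1: "1 \<le> ((n + d) choose n) * 2 ^ d" by (simp add: Suc_le_eq)
  have "X ^ D \<le> d ^ (3 * d\<^sup>2 - 3) * (((n + d) choose n) * 2 ^ d) ^ (d\<^sup>2 - 1)
             * ((d\<^sup>2 - 1) choose ((d\<^sup>2 - 1) div 2)) * max (height f) (height g) ^ (d\<^sup>2 - 1)"
  proof -
    have "3 * d\<^sup>2 - 3 = 3 * D" by (simp add: D_def diff_mult_distrib2)
    moreover have "1 \<le> D choose (D div 2)" by (simp add: Suc_le_eq)
    moreover have "X ^ D = d ^ (3 * D) * (((n + d) choose n) * 2 ^ d) ^ D * 1 * H ^ D"
      unfolding X_def power_mult_distrib power_mult by simp
    ultimately show ?thesis unfolding D_def[symmetric] H_def[symmetric] by (simp only: mult_le_mono order_refl)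
  qed
  then have Xp: "X ^ D < p" using assms(13) by simp
  \<comment> \<open>d^3 absorbs the factor 2 (3 d - 4) of the row sums.\<close>
  have d3: "2 * (3 * d - 4) \<le> d ^ 3" "d \<le> d ^ 3" "2 \<le> d ^ 3"
  proof -
    obtain k where "d = k + 2" using d by (metis le_iff_add add.commute)
    then show "2 * (3 * d - 4) \<le> d ^ 3" "d \<le> d ^ 3" "2 \<le> d ^ 3" by (simp_all add: power3_eq_cube algebra_simps)
  qed
  have X: "d ^ 3 * H \<le> X"
    using mult_le_mono2[OF C1, of "d ^ 3 * H"] by (simp add: X_def mult_ac)
  have X1: "1 \<le> X" using X d3(3) H1 mult_le_mono[of 1 "d ^ 3" 1 H] by linarith
  have "((3 * d - 4) * (2 * (2 ^ d * (((n + d) choose n) * H)))) \<le> X"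
    using mult_le_mono1[OF d3(1), of "(((n + d) choose n) * 2 ^ d) * H"] by (simp add: X_def mult_ac)
  then have bound: "((3 * d - 4) * (2 * (2 ^ d * (((n + d) choose n) * H)))) ^ (d\<^sup>2 - 1) < p"
    using Xp unfolding D_def by (meson le_less_trans power_mono zero_le)
  \<comment> \<open>As D is at least 3, there is room for quadratic expressions in the coefficients
    of f and g, which \<open>npp\<close> needs.\<close>
  have XX: "X * X < p"
  proof -
    have "X ^ 2 \<le> X ^ D" using X1 D3 by (intro power_increasing) simp_all
    then show ?thesis using Xp by (simp add: power2_eq_square)
  qed
  \<comment> \<open>The characteristic exceeds d, as the derivative arguments modulo p
    require.\<close>
  have dp: "d < p"
  proof -
    have "d \<le> X" using X d3(2) H1 mult_le_mono2[of 1 H "d ^ 3"] by linarith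
    also have "X \<le> X * X" using X1 by simp
    finally show ?thesis using XX by simp
  qed
  have HX: "2 * H \<le> X" using X mult_le_mono1[OF d3(3), of H] by linarith
  have HH: "2 * (H * H) < p"
  proof -
    have "2 * (H * H) \<le> (2 * H) * (2 * H)" by simp
    also have "\<dots> \<le> X * X" using HX HX by (rule mult_le_mono)
    finally show ?thesis using XX by simp
  qed
  have Hp: "H < p"
  proof -
    have "H \<le> H * H" using H1 by simp
    then show ?thesis using HH by linarith
  qed
  have g0: "?g \<noteq> 0"
    using m0 lookup_of_int_mpoly[of g m0, where 'a = rat] by auto
  have np: "?f \<noteq> mconst c * ?g" for c
  proof
    assume "?f = mconst c * ?g"
    then have "r = const_ratfun c" unfolding assms(6) const_ratfun_def using g0 by (simp add: eq_fract)
    then show False using assms(7) by blast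
  qed
  have cop: "mpoly_coprime ?f ?g" by (rule mpoly_coprime_of_int[OF assms(5,4)])
  have MPq: "?f \<in> MP {..<n}" "?g \<in> MP {..<n}" using MP by (simp_all add: MP_of_int_mpoly)
  \<comment> \<open>If all derivatives of f / g vanished, the coprime f and g would be
    constant.\<close>
  have "\<exists>j<n. ?g * pd j ?f - ?f * pd j ?g \<noteq> 0"
  proof (rule ccontr)
    assume "\<not> ?thesis"
    then have dep: "\<And>k. k < n \<Longrightarrow> ?f * pd k ?g = ?g * pd k ?f" by simp
    have "?f \<in> range mconst \<and> ?g \<in> range mconst"
      by (rule coprime_dependent_imp_const[OF MPq cop dep]) simp_all
    then obtain u v where uv: "?f = mconst u" "?g = mconst v" by blast
    have "v \<noteq> 0" using g0 uv(2) by auto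
    then have "?f = mconst (u / v) * ?g" unfolding uv by (simp add: mult_single)
    then show False using np by blast
  qed
  then obtain j where j: "j < n" "?g * pd j ?f - ?f * pd j ?g \<noteq> 0" by blast
  interpret L: leaf_setup n j ?f ?g by unfold_locales (fact j(1), fact MPq(1), fact MPq(2), fact j(2))
  have "\<not> composite n (to_fract ?f / to_fract ?g)" using assms(8) unfolding assms(6) Fract_conv_to_fract .
  then have mp: "L.minimal_pair ?f ?g" by (rule L.noncomposite_minimal[OF cop])
  have pd: "d = L.pdeg ?f ?g"
  proof -
    have "total_degree (of_int_mpoly h :: rat mpoly) = total_degree h" for h
      unfolding total_degree_def keys_of_int_mpoly_char_0 ..
    then show ?thesis unfolding L.pdeg_def tdeg_eq_total_degree assms(9) by simp
  qed
  have gp: "g\<^sub>p \<noteq> 0"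
  proof
    assume "g\<^sub>p = 0"
    then have z: "(of_int (Poly_Mapping.lookup g m0) :: 'p mod_ring) = 0"
      using lookup_of_int_mpoly[of g m0, where 'a = "'p mod_ring"] unfolding assms(15) by simp
    have "nat \<bar>Poly_Mapping.lookup g m0\<bar> < p" using hl[of g m0] H(2) Hp by linarith
    from m0 of_int_mod_ring_eq_0[OF p this z] show False by (rule notE)
  qed
  \<comment> \<open>Proportionality modulo p makes the 2 x 2 minors of the coefficients vanish
    modulo p. They are at most 2 H^2 < p in absolute value, so they vanish and f / g is
    constant.\<close>
  have npp: "f\<^sub>p \<noteq> mconst c * g\<^sub>p" for c
  proof
    assume e: "f\<^sub>p = mconst c * g\<^sub>p"
    have l: "of_int (Poly_Mapping.lookup f m) = c * of_int (Poly_Mapping.lookup g m)" for m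
    proof -
      have "Poly_Mapping.lookup f\<^sub>p m = Poly_Mapping.lookup (mconst c * g\<^sub>p) m" by (rule arg_cong[OF e])
      then show ?thesis unfolding lookup_mconst_mult assms(14) assms(15) lookup_of_int_mpoly .
    qed
    have z: "Poly_Mapping.lookup f m * Poly_Mapping.lookup g m0 - Poly_Mapping.lookup f m0 * Poly_Mapping.lookup g m = 0" for m
    proof (rule of_int_mod_ring_eq_0[OF p])
      have b: "nat \<bar>x * y\<bar> \<le> H * H" if "nat \<bar>x\<bar> \<le> H" "nat \<bar>y\<bar> \<le> H" for x y :: int
        using mult_le_mono[OF that] by (simp add: abs_mult nat_mult_distrib)
      have t: "nat \<bar>x - y\<bar> \<le> nat \<bar>x\<bar> + nat \<bar>y\<bar>" for x y :: int by linarith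
      have "nat \<bar>Poly_Mapping.lookup f m * Poly_Mapping.lookup g m0 - Poly_Mapping.lookup f m0 * Poly_Mapping.lookup g m\<bar> \<le> H * H + H * H"
        by (rule order.trans[OF t add_mono[OF b b]]) (rule order.trans[OF hl H(1)] order.trans[OF hl H(2)])+
      also have "\<dots> < p" using HH by (simp only: mult_2)
      finally show "nat \<bar>Poly_Mapping.lookup f m * Poly_Mapping.lookup g m0 - Poly_Mapping.lookup f m0 * Poly_Mapping.lookup g m\<bar> < p" .
      show "(of_int (Poly_Mapping.lookup f m * Poly_Mapping.lookup g m0 - Poly_Mapping.lookup f m0 * Poly_Mapping.lookup g m) :: 'p mod_ring) = 0"
        unfolding of_int_diff of_int_mult l by (simp only: mult_ac diff_self)
    qed
    define q where "q = rat_of_int (Poly_Mapping.lookup f m0) / rat_of_int (Poly_Mapping.lookup g m0)"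
    have "?f = mconst q * ?g"
    proof (rule poly_mapping_eqI)
      fix m
      have "Poly_Mapping.lookup f m * Poly_Mapping.lookup g m0 = Poly_Mapping.lookup f m0 * Poly_Mapping.lookup g m"
        using z[of m] by (simp only: right_minus_eq)
      then have "rat_of_int (Poly_Mapping.lookup f m) * rat_of_int (Poly_Mapping.lookup g m0)
          = rat_of_int (Poly_Mapping.lookup f m0) * rat_of_int (Poly_Mapping.lookup g m)"
        unfolding of_int_mult[symmetric] by (rule arg_cong)
      then show "Poly_Mapping.lookup ?f m = Poly_Mapping.lookup (mconst q * ?g) m"
        unfolding lookup_mconst_mult lookup_of_int_mpoly q_def using m0 by (simp add: field_simps)
    qed
    then show False using np by blast
  qed
  have "mpoly_coprime f\<^sub>p g\<^sub>p \<and> \<not> composite n (to_fract f\<^sub>p / to_fract g\<^sub>p)"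
  proof (rule ccontr)
    assume bad: "\<not> ?thesis"
    have ch: "(of_nat k :: 'p mod_ring) \<noteq> 0" if "0 < k" "k \<le> d" for k
    proof
      assume "(of_nat k :: 'p mod_ring) = 0"
      then have "p dvd k" using of_nat_0_mod_ring_dvd[where 'a = 'p, of k] unfolding p by simp
      then have "p \<le> k" using that(1) by (rule dvd_imp_le)
      then show False using that(2) dp by linarith
    qed
    have tp: "tdeg f\<^sub>p \<le> d" "tdeg g\<^sub>p \<le> d"
      unfolding tdeg_eq_total_degree assms(14,15)
      using total_degree_cong[OF keys_of_int_mpoly[of f, where 'a = "'p mod_ring"]]
        total_degree_cong[OF keys_of_int_mpoly[of g, where 'a = "'p mod_ring"]] td by linarith+
    have MPp: "f\<^sub>p \<in> MP {..<n}" "g\<^sub>p \<in> MP {..<n}" unfolding assms(14,15) using MP by (simp_all add: MP_of_int_mpoly)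
    obtain A B where AB: "A \<noteq> 0 \<or> B \<noteq> 0" "in_kernel d (pencil n j f\<^sub>p g\<^sub>p) A B"
      using kernel_exists[OF j(1) MPp gp npp tp ch bad] by blast
    obtain A B :: "rat mpoly poly poly" where AB: "A \<noteq> 0 \<or> B \<noteq> 0"
      "in_kernel d (cc ?g * psi n j ?f - cc ?f * psi n j ?g) A B"
      using kernel_lift[OF MP td d H p bound AB[unfolded assms(14,15)]] by blast
    have "A = 0 \<and> B = 0"
      using AB(2) L.closedf_zero[OF mp pd] d unfolding in_kernel_def by auto
    then show False using AB(1) by blast
  qed
  then show ?thesis using gp by (simp add: Fract_conv_to_fract)
qed

end
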